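(* Let $A=(A_1,\dots,A_k)\in \mathrm{GL}_2(\mathbb{R})^k$ be a cocycle with $L^+(A)>L^-(A)$. (i) If $A$ is diagonalizable, then $A$ satisfies a uniform sub-exponential LDT estimate: there are $\delta>0$, $\bar n\in\mathbb{N}$ and $a,b>0$ such that for every cocycle $B\in\mathrm{GL}_2(\mathbb{R})^k$ with $d(B,A)<\delta$ and every $n\ge \bar n$, $$\mathbb{P}\Big[\,\Big|\tfrac1n\log\|B^{(n)}\|-L^+(B)\Big|>n^{-a}\Big]<e^{-n^{b}}.$$ (ii) If $A$ is not diagonalizable, then $A$ satisfies a uniform exponential LDT estimate: there are constants $\delta>0$, $c>0$ and, for every small enough $\varepsilon>0$, an integer $\bar n=\bar n(A,\varepsilon)$ such that for every cocycle $B\in\mathrm{GL}_2(\mathbb{R})^k$ with $d(B,A)<\delta$ and every $n\ge\bar n$, $$\mathbb{P}\Big[\,\Big|\tfrac1n\log\|B^{(n)}\|-L^+(B)\Big|>\varepsilon\Big]<e^{-c\varepsilon^2 n}.$$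
   Context: Let $\Sigma=\{1,\dots,k\}$ and $p=(p_1,\dots,p_k)$ a probability vector with $p_i>0$ for all $i$. Let $X=\Sigma^{\mathbb{Z}}$ with product probability $\mathbb{P}=p^{\mathbb{Z}}$ and shift $T(\{x_n\})=\{x_{n+1}\}$. A cocycle is a $k$-tuple $A=(A_1,\dots,A_k)\in\mathrm{GL}_2(\mathbb{R})^k$, identified with the function $A:X\to\mathrm{GL}_2(\mathbb{R})$, $A(x)=A_{x_0}$; its iterates are $A^{(n)}(x)=A_{x_{n-1}}\cdots A_{x_1}A_{x_0}$. The distance between cocycles is $d(A,B)=\max_{1\le j\le k}\|A_j-B_j\|$ (operator norm). The Lyapunov exponents are the $\mathbb{P}$-a.s. limits $L^+(A)=\lim_n\frac1n\log\|A^{(n)}(x)\|$ and $L^-(A)=\lim_n\frac1n\log\|A^{(n)}(x)^{-1}\|^{-1}$. A cocycle is diagonalizable if the matrices $A_1,\dots,A_k$ are simultaneously diagonalizable over $\mathbb{R}$. *)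

theory Defs
  imports "HOL-Probability.Probability"
begin

type_synonym mat2 = "real^2^2"

definition opnorm :: "mat2 \<Rightarrow> real" where
  "opnorm M = onorm (\<lambda>v::real^2. M *v v)"

definition bshift :: "'a pmf \<Rightarrow> (int \<Rightarrow> 'a) measure" where
  "bshift p = PiM UNIV (\<lambda>_::int. measure_pmf p)"

fun cociter :: "('a \<Rightarrow> mat2) \<Rightarrow> nat \<Rightarrow> (int \<Rightarrow> 'a) \<Rightarrow> mat2" where
  "cociter A 0 x = mat 1"
| "cociter A (Suc n) x = A (x (int n)) ** cociter A n x"

definition GL2_cocycle :: "('a \<Rightarrow> mat2) \<Rightarrow> bool" where
  "GL2_cocycle A \<longleftrightarrow> (\<forall>j. invertible (A j))"

definition cdist :: "('a::finite \<Rightarrow> mat2) \<Rightarrow> ('a \<Rightarrow> mat2) \<Rightarrow> real" where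
  "cdist A B = Max (range (\<lambda>j. opnorm (A j - B j)))"

definition Lplus :: "'a pmf \<Rightarrow> ('a \<Rightarrow> mat2) \<Rightarrow> real" where
  "Lplus p A = (THE L. AE x in bshift p.
      (\<lambda>n. ln (opnorm (cociter A n x)) / real n) \<longlonglongrightarrow> L)"

definition Lminus :: "'a pmf \<Rightarrow> ('a \<Rightarrow> mat2) \<Rightarrow> real" where
  "Lminus p A = (THE L. AE x in bshift p.
      (\<lambda>n. ln (inverse (opnorm (matrix_inv (cociter A n x)))) / real n) \<longlonglongrightarrow> L)"

definition diagonalizable_cocycle :: "('a \<Rightarrow> mat2) \<Rightarrow> bool" where
  "diagonalizable_cocycle A \<longleftrightarrow> (\<exists>Q::mat2. invertible Q \<and>
     (\<forall>j i1 i2. i1 \<noteq> i2 \<longrightarrow> (matrix_inv Q ** A j ** Q) $ i1 $ i2 = 0))"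

definition dev_prob :: "'a pmf \<Rightarrow> ('a \<Rightarrow> mat2) \<Rightarrow> nat \<Rightarrow> real \<Rightarrow> real" where
  "dev_prob p B n t = measure (bshift p)
     {x \<in> space (bshift p). \<bar>ln (opnorm (cociter B n x)) / real n - Lplus p B\<bar> > t}"

end

theory Submission
  imports Defs "HOL-Real_Asymp.Real_Asymp"
begin

text \<open>
  Letters are drawn independently, so everything is a finite expectation over words; a word acts
  with its first letter first. If the mean growth \<open>E ln (norm (B w x) / norm x)\<close> depends on the
  starting direction \<open>x\<close> only up to a constant \<open>D\<close>, then it is almost additive in the length of the
  word and its martingale increments are bounded by \<open>D\<close>, so Azuma's inequality gives a deviation estimate
  uniform in \<open>B\<close>. Such a \<open>D\<close> exists of order \<open>N\<close> as soon as all directions expand on average within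
  \<open>N\<close> letters, because then words contract the projective line on average.

  To obtain this expansion, observe that once a direction is not contracted relative to the norm of
  the product it keeps growing with the norm. A direction contracted with probability
  close to one must be almost fixed by every letter, since two directions contracted by the
  same product are close. If there is no common eigenvector this is impossible for large \<open>N\<close>.

  Near a diagonal cocycle with dominant first axis, let \<open>\<rho>\<close> be the least displacement of a
  direction near the second axis. The previous argument works with \<open>N\<close> of order \<open>ln (1 / \<rho>)\<close>, while for
  lengths below a power of \<open>ln (1 / \<rho>)\<close> the product is almost triangular and its norm is a sum of independent
  variables up to small errors. The two regimes overlap, which gives the diagonalizable case.
  A triangular cocycle that is not diagonalizable (after transposition if the invariant line carries the smaller
  exponent) is conjugate to such a perturbation with \<open>\<rho>\<close> bounded below.
\<close>

section \<open>Expectations over random words\<close>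

text \<open>The obstacle is uniformity in \<open>B\<close>. Near a diagonalizable cocycle the second
  axis may be displaced by an arbitrarily small amount \<rho>; escaping it takes about ln (1 /
  \<rho>) letters, so no single oscillation bound covers the neighbourhood. What rescues the
  estimate is that this bound is linear in the escape time. With l = 1 - ln \<rho>, Azuma's
  inequality is effective once n exceeds a power of l, whereas the triangular description only asks
  that \<rho> times a stretched exponential of n be small, and so lasts beyond that power. Linearity
  comes from contracting a fractional power of the angle whose exponent is inversely proportional to
  the number of letters. The same \<rho> separates the two statements: near a triangular
  \<open>A\<close> it stays away from 0 when there is no second common eigenvector.
  \<open>vgrow\<close> and \<open>ngrow\<close> subtract half of ln |det|, so that products behave
  like area-preserving maps and the growth of two directions determines how their angle shrinks. The
  limit L is produced together with its deviation estimate, from almost additivity, and is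
  identified with \<open>Lplus\<close> afterwards through summable tails.\<close>

fun ew :: "'a::finite pmf \<Rightarrow> nat \<Rightarrow> ('a list \<Rightarrow> real) \<Rightarrow> real" where
  "ew p 0 f = f []"
| "ew p (Suc n) f = (\<Sum>j\<in>UNIV. pmf p j * ew p n (\<lambda>w. f (j # w)))"

definition pw :: "'a::finite pmf \<Rightarrow> nat \<Rightarrow> ('a list \<Rightarrow> bool) \<Rightarrow> real" where
  "pw p n P = ew p n (\<lambda>w. of_bool (P w))"

lemma sum_pmf_UNIV [simp]: "(\<Sum>j\<in>UNIV. pmf (p :: 'a::finite pmf) j) = 1"
  by (rule sum_pmf_eq_1) auto

lemma sum_pmf_const [simp]: "(\<Sum>j\<in>UNIV. pmf (p :: 'a::finite pmf) j * c) = c"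
  by (simp flip: sum_distrib_right)

lemma ew_mono:
  assumes "\<And>w. length w = n \<Longrightarrow> f w \<le> g w"
  shows "ew p n f \<le> ew p n g"
  using assms
proof (induction n arbitrary: f g)
  case (Suc n)
  have "ew p n (\<lambda>w. f (j # w)) \<le> ew p n (\<lambda>w. g (j # w))" for j
    by (rule Suc.IH) (use Suc.prems in auto)
  then show ?case
    by (auto intro!: sum_mono mult_left_mono)
qed auto

lemma ew_cong:
  assumes "\<And>w. length w = n \<Longrightarrow> f w = g w"
  shows "ew p n f = ew p n g"
  by (intro antisym ew_mono) (simp_all add: assms)

lemma ew_const [simp]: "ew p n (\<lambda>_. c) = c"
  by (induction n) auto

lemma ew_add: "ew p n (\<lambda>w. f w + g w) = ew p n f + ew p n g"
  by (induction n arbitrary: f g) (auto simp: sum.distrib algebra_simps)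

lemma ew_cmult: "ew p n (\<lambda>w. c * f w) = c * ew p n f"
  by (induction n arbitrary: f) (auto simp: sum_distrib_left algebra_simps)

lemma ew_mult_right: "ew p n (\<lambda>w. f w * c) = ew p n f * c"
  using ew_cmult[of p n c f] by (simp add: mult.commute)

lemma ew_uminus: "ew p n (\<lambda>w. - f w) = - ew p n f"
  using ew_cmult[of p n "-1" f] by simp

lemma ew_diff: "ew p n (\<lambda>w. f w - g w) = ew p n f - ew p n g"
  using ew_add[of p n f "\<lambda>w. - g w"] by (simp add: ew_uminus)

lemma ew_add_const: "ew p n (\<lambda>w. f w + c) = ew p n f + c"
  by (simp add: ew_add)

lemma ew_sum: "ew p n (\<lambda>w. \<Sum>i\<in>I. f i w) = (\<Sum>i\<in>I. ew p n (f i))"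
  by (induction I rule: infinite_finite_induct) (auto simp: ew_add)

lemma ew_append: "ew p (m + n) f = ew p m (\<lambda>u. ew p n (\<lambda>v. f (u @ v)))"
  by (induction m arbitrary: f) auto

lemma ew_snoc: "ew p (Suc n) f = ew p n (\<lambda>u. \<Sum>j\<in>UNIV. pmf p j * f (u @ [j]))"
  using ew_append[of p n 1 f] by simp

text \<open>Independent identically distributed letters are exchangeable. Transposing a cocycle
  reverses the order of its products, so this lets estimates pass between a cocycle and its
  transpose.\<close>

lemma ew_rev: "ew p n (\<lambda>w. f (rev w)) = ew p n f"
proof (induction n arbitrary: f)
  case (Suc n)
  have "ew p (Suc n) (\<lambda>w. f (rev w)) = (\<Sum>j\<in>UNIV. pmf p j * ew p n (\<lambda>w. f (w @ [j])))"
    by (simp add: Suc.IH[of "\<lambda>w. f (w @ [_])"])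
  also have "\<dots> = ew p (Suc n) f"
    unfolding ew_snoc ew_sum ew_cmult ..
  finally show ?case .
qed auto

lemma ew_nonneg:
  assumes "\<And>w. length w = n \<Longrightarrow> 0 \<le> f w"
  shows "0 \<le> ew p n f"
  using ew_mono[of n "\<lambda>_. 0" f p] assms by simp

lemma ew_abs_le: "\<bar>ew p n f\<bar> \<le> ew p n (\<lambda>w. \<bar>f w\<bar>)"
proof -
  have "ew p n f \<le> ew p n (\<lambda>w. \<bar>f w\<bar>)" "ew p n (\<lambda>w. - f w) \<le> ew p n (\<lambda>w. \<bar>f w\<bar>)"
    by (rule ew_mono; simp)+
  then show ?thesis
    by (simp add: ew_uminus)
qed

lemma pw_nonneg [simp]: "0 \<le> pw p n P"
  unfolding pw_def by (rule ew_nonneg) auto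

lemma pw_mono:
  assumes "\<And>w. length w = n \<Longrightarrow> P w \<Longrightarrow> Q w"
  shows "pw p n P \<le> pw p n Q"
  unfolding pw_def by (rule ew_mono) (use assms in auto)

lemma pw_cong:
  assumes "\<And>w. length w = n \<Longrightarrow> P w \<longleftrightarrow> Q w"
  shows "pw p n P = pw p n Q"
  unfolding pw_def by (rule ew_cong) (use assms in auto)

lemma pw_le_1 [simp]: "pw p n P \<le> 1"
  using ew_mono[of n "\<lambda>w. of_bool (P w)" "\<lambda>_. 1" p] by (simp add: pw_def)

lemma pw_disj: "pw p n (\<lambda>w. P w \<or> Q w) \<le> pw p n P + pw p n Q"
  unfolding pw_def ew_add[symmetric] by (rule ew_mono) auto

lemma pw_Bex:
  assumes "finite I"
  shows "pw p n (\<lambda>w. \<exists>i\<in>I. P i w) \<le> (\<Sum>i\<in>I. pw p n (P i))"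
  using assms
proof (induction I)
  case empty
  then show ?case by (simp add: pw_def)
next
  case (insert i I)
  have "pw p n (\<lambda>w. \<exists>i\<in>insert i I. P i w) \<le> pw p n (P i) + pw p n (\<lambda>w. \<exists>i\<in>I. P i w)"
    using pw_disj[of p n "P i" "\<lambda>w. \<exists>i\<in>I. P i w"] by simp
  with insert show ?case by simp
qed

lemma pw_not: "pw p n (\<lambda>w. \<not> P w) = 1 - pw p n P"
proof -
  have "pw p n (\<lambda>w. \<not> P w) + pw p n P = ew p n (\<lambda>_. 1)"
    unfolding pw_def ew_add[symmetric] by (rule ew_cong) auto
  then show ?thesis by simp
qed

lemma pw_pos_imp_ex:
  assumes "0 < pw p n P"
  obtains w where "length w = n" "P w"
proof (rule ccontr)
  assume "\<not> thesis"
  then have "pw p n P = pw p n (\<lambda>_. False)"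
    by (intro pw_cong) (use that in blast)
  with assms show False by (simp add: pw_def)
qed

lemma pw_prefix: "pw p (m + n) (\<lambda>w. P (take m w)) = pw p m P"
  unfolding pw_def ew_append by (rule ew_cong) simp

lemma pw_prefix': "m \<le> n \<Longrightarrow> pw p n (\<lambda>w. P (take m w)) = pw p m P"
  using pw_prefix[of p m "n - m" P] by simp

lemma pw_Markov:
  assumes "\<And>w. length w = n \<Longrightarrow> 0 \<le> f w" "0 < t"
  shows "pw p n (\<lambda>w. t \<le> f w) \<le> ew p n f / t"
proof -
  have "pw p n (\<lambda>w. t \<le> f w) \<le> ew p n (\<lambda>w. f w * (1 / t))"
    unfolding pw_def by (rule ew_mono) (use assms in \<open>auto simp: field_simps\<close>)
  then show ?thesis unfolding ew_mult_right by simp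
qed

section \<open>Exponential moments and Azuma's inequality\<close>

text \<open>The common source of all exponential moment bounds below: once the mean of the exponent
  is known, only a second-order error remains. For u = -v < 0 the claim is equivalent to a lower
  bound for exp v, obtained by multiplying its quadratic Taylor minorant with 1 - v + v^2.\<close>

lemma exp_le_quadratic:
  fixes u :: real
  assumes "\<bar>u\<bar> \<le> 1"
  shows "exp u \<le> 1 + u + u\<^sup>2"
  using exp_bound[of u] exp_lower_Taylor_quadratic
proof (cases "u \<ge> 0")
  case True
  then show ?thesis using exp_bound[of u] assms by simp
next
  case False
  define v where "v = -u"
  have v: "0 \<le> v" "v \<le> 1" using False assms by (auto simp: v_def)
  have "exp v \<ge> 1 + v + v\<^sup>2/2" by (rule exp_lower_Taylor_quadratic[OF v(1)])
  moreover have "1 \<le> (1 - v + v\<^sup>2) * (1 + v + v\<^sup>2/2)"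
  proof -
    have "(1 - v + v\<^sup>2) * (1 + v + v\<^sup>2/2) - 1 = v\<^sup>2/2 + v^3/2 + v^4/2"
      by (simp add: field_simps power2_eq_square power3_eq_cube power4_eq_xxxx)
    also have "\<dots> \<ge> 0" using v by simp
    finally show ?thesis by simp
  qed
  moreover have "0 \<le> 1 - v + v\<^sup>2" using v by simp
  ultimately have "1 \<le> (1 - v + v\<^sup>2) * exp v"
    by (meson mult_left_mono order_trans)
  then have "exp (-v) \<le> 1 - v + v\<^sup>2"
    by (simp add: exp_minus field_simps)
  then show ?thesis by (simp add: v_def)
qed

text \<open>An additive functional along the orbit driven by the letters: \<open>f j x\<close> is
  collected at state \<open>x\<close> and \<open>F j\<close> moves the state. With vectors as states
  it yields the logarithm of a norm; with a one-point state space it is a sum of independent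
  variables.\<close>

fun addf :: "('a \<Rightarrow> 's \<Rightarrow> real) \<Rightarrow> ('a \<Rightarrow> 's \<Rightarrow> 's) \<Rightarrow> 'a list \<Rightarrow> 's \<Rightarrow> real" where
  "addf f F [] x = 0"
| "addf f F (j # w) x = f j x + addf f F w (F j x)"

text \<open>Revealing the first letter changes the conditional mean by \<open>Y j\<close>, which
  averages to 0 by the recursion for \<open>h\<close>. The quadratic bound for exp then costs a
  factor of at most 1 + (l D)^2 per letter, and the remaining letters are treated by induction from
  the new state.\<close>

lemma ew_exp_addf_le:
  fixes p :: "'a::finite pmf"
  defines "h \<equiv> \<lambda>f F n x. ew p n (\<lambda>w. addf f F w x)"
  assumes S: "\<And>j x. x \<in> S \<Longrightarrow> F j x \<in> S"
    and D: "\<And>n j x. x \<in> S \<Longrightarrow> \<bar>f j x + h f F n (F j x) - h f F (Suc n) x\<bar> \<le> D"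
    and l: "\<bar>l\<bar> * D \<le> 1" and x: "x \<in> S"
  shows "ew p n (\<lambda>w. exp (l * (addf f F w x - h f F n x))) \<le> exp (real n * (l * D)\<^sup>2)"
  using x
proof (induction n arbitrary: x)
  case 0
  then show ?case by (simp add: h_def)
next
  case (Suc n)
  define Y where "Y j = f j x + h f F n (F j x) - h f F (Suc n) x" for j
  have Y: "\<bar>l * Y j\<bar> \<le> 1" "(l * Y j)\<^sup>2 \<le> (l * D)\<^sup>2" for j
  proof -
    have *: "\<bar>l * Y j\<bar> \<le> \<bar>l\<bar> * D"
      using D[OF Suc.prems, of j n] by (auto simp: abs_mult Y_def intro: mult_left_mono)
    then show "\<bar>l * Y j\<bar> \<le> 1" using l by linarith
    have "0 \<le> D" using D[OF Suc.prems, of j n] by linarith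
    then show "(l * Y j)\<^sup>2 \<le> (l * D)\<^sup>2" using *
      by (metis abs_le_square_iff abs_mult abs_of_nonneg)
  qed
  have mean: "(\<Sum>j\<in>UNIV. pmf p j * Y j) = 0"
  proof -
    have "h f F (Suc n) x = (\<Sum>j\<in>UNIV. pmf p j * (f j x + h f F n (F j x)))"
      by (simp add: h_def ew_add)
    then show ?thesis
      by (simp add: Y_def right_diff_distrib sum_subtractf)
  qed
  have "ew p (Suc n) (\<lambda>w. exp (l * (addf f F w x - h f F (Suc n) x)))
      = (\<Sum>j\<in>UNIV. pmf p j * ew p n (\<lambda>w. exp (l * Y j) * exp (l * (addf f F w (F j x) - h f F n (F j x)))))"
    by (simp add: Y_def algebra_simps flip: exp_add)
  also have "\<dots> \<le> (\<Sum>j\<in>UNIV. pmf p j * (exp (l * Y j) * exp (real n * (l * D)\<^sup>2)))"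
    using Suc.IH[OF S[OF Suc.prems]]
    by (auto simp: ew_cmult intro!: sum_mono mult_left_mono)
  also have "\<dots> = exp (real n * (l * D)\<^sup>2) * (\<Sum>j\<in>UNIV. pmf p j * exp (l * Y j))"
    unfolding sum_distrib_left by (rule sum.cong) (auto simp: mult_ac)
  also have "(\<Sum>j\<in>UNIV. pmf p j * exp (l * Y j)) \<le> (\<Sum>j\<in>UNIV. pmf p j * (1 + l * Y j + (l * D)\<^sup>2))"
    by (intro sum_mono mult_left_mono order_trans[OF exp_le_quadratic[OF Y(1)]] add_left_mono Y(2)) auto
  also have "\<dots> = 1 + (l * D)\<^sup>2"
  proof -
    have "(\<Sum>j\<in>UNIV. pmf p j * (1 + l * Y j + (l * D)\<^sup>2))
      = (\<Sum>j\<in>UNIV. pmf p j * (1 + (l * D)\<^sup>2)) + l * (\<Sum>j\<in>UNIV. pmf p j * Y j)"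
      unfolding sum_distrib_left sum.distrib[symmetric] by (rule sum.cong) (auto simp: algebra_simps)
    then show ?thesis by (simp add: mean)
  qed
  also have "\<dots> \<le> exp ((l * D)\<^sup>2)" by (rule exp_ge_add_one_self)
  finally show ?case
    by (simp add: algebra_simps flip: exp_add)
qed

text \<open>Exponential Markov inequality for both signs of \<open>l\<close>. The state space is
  restricted to an invariant set \<open>S\<close> because the logarithm of a norm is controlled only
  for nonzero vectors.\<close>

lemma azuma_addf:
  fixes p :: "'a::finite pmf"
  defines "h \<equiv> \<lambda>f F n x. ew p n (\<lambda>w. addf f F w x)"
  assumes S: "\<And>j x. x \<in> S \<Longrightarrow> F j x \<in> S"
    and D: "\<And>n j x. x \<in> S \<Longrightarrow> \<bar>f j x + h f F n (F j x) - h f F (Suc n) x\<bar> \<le> D"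
    and D0: "0 < D" and x: "x \<in> S" and s: "0 \<le> s"
  shows "pw p n (\<lambda>w. \<bar>addf f F w x - h f F n x\<bar> > s) \<le> 2 * exp (- s\<^sup>2 / (4 * real n * D\<^sup>2))"
proof -
  have bnd: "\<bar>addf f F w x - h f F n x\<bar> \<le> real n * D" if "length w = n" "x \<in> S" for w n x
    using that
  proof (induction w arbitrary: n x)
    case (Cons j w)
    obtain m where n: "n = Suc m" using Cons.prems by (cases n) auto
    have "\<bar>addf f F w (F j x) - h f F m (F j x)\<bar> \<le> real m * D"
      by (rule Cons.IH) (use Cons.prems n S in auto)
    then show ?case using D[OF Cons.prems(2), of j m] unfolding n
      by (simp add: algebra_simps)
  qed (simp add: h_def)
  consider "n = 0" | "s > real n * D" | "n > 0" "s \<le> real n * D" by linarith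
  then show ?thesis
  proof cases
    case 1
    have "pw p n (\<lambda>w. \<bar>addf f F w x - h f F n x\<bar> > s) \<le> 1" by simp
    \<comment> \<open>For \<open>n = 0\<close> the quotient in the exponent is 0 by the convention
      for division by zero, so the right-hand side is 2.\<close>
    also have "1 \<le> 2 * exp (- s\<^sup>2 / (4 * real n * D\<^sup>2))" using 1 by simp
    finally show ?thesis .
  next
    case 2
    have "pw p n (\<lambda>w. \<bar>addf f F w x - h f F n x\<bar> > s) = pw p n (\<lambda>_. False)"
    proof (rule pw_cong)
      fix w :: "'a list" assume "length w = n"
      from bnd[OF this x] 2 show "(s < \<bar>addf f F w x - h f F n x\<bar>) \<longleftrightarrow> False" by auto
    qed
    then show ?thesis by (simp add: pw_def)
  next
    case 3
    \<comment> \<open>The minimiser of n (l D)^2 - l s. It is admissible, that is l D is at most 1,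
      because s is at most n D here; for larger s the event is empty by \<open>bnd\<close>.\<close>
    define l where "l = s / (2 * real n * D\<^sup>2)"
    have l0: "0 \<le> l" using s by (simp add: l_def)
    have "s \<le> 2 * (real n * D)" using 3 s by linarith
    then have l1: "l * D \<le> 1" using 3 D0 by (simp add: l_def field_simps power2_eq_square)
    have eq: "real n * (l * D)\<^sup>2 - l * s = - s\<^sup>2 / (4 * real n * D\<^sup>2)"
      using 3 D0 by (simp add: l_def field_simps power2_eq_square)
    have one: "pw p n (\<lambda>w. exp (l * s) \<le> exp (l' * (addf f F w x - h f F n x))) \<le> exp (- s\<^sup>2 / (4 * real n * D\<^sup>2))"
      if "\<bar>l'\<bar> = l" for l'
    proof -
      have "pw p n (\<lambda>w. exp (l * s) \<le> exp (l' * (addf f F w x - h f F n x)))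
          \<le> ew p n (\<lambda>w. exp (l' * (addf f F w x - h f F n x))) / exp (l * s)"
        by (rule pw_Markov) auto
      also have "\<dots> \<le> exp (real n * (l' * D)\<^sup>2) / exp (l * s)"
        unfolding h_def
        by (intro divide_right_mono ew_exp_addf_le[where S = S])
           (use S D[unfolded h_def] l1 that x in auto)
      also have "\<dots> = exp (real n * (l * D)\<^sup>2 - l * s)"
        using that by (auto simp: exp_diff power_mult_distrib)
      finally show ?thesis unfolding eq .
    qed
    have "pw p n (\<lambda>w. \<bar>addf f F w x - h f F n x\<bar> > s) \<le>
        pw p n (\<lambda>w. exp (l * s) \<le> exp (l * (addf f F w x - h f F n x))
           \<or> exp (l * s) \<le> exp ((-l) * (addf f F w x - h f F n x)))"
    proof (rule pw_mono)
      fix w assume "s < \<bar>addf f F w x - h f F n x\<bar>"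
      then have "s \<le> addf f F w x - h f F n x \<or> s \<le> - (addf f F w x - h f F n x)" by linarith
      then show "exp (l * s) \<le> exp (l * (addf f F w x - h f F n x))
           \<or> exp (l * s) \<le> exp ((-l) * (addf f F w x - h f F n x))"
        using l0 by (metis exp_le_cancel_iff mult_left_mono mult_minus_left mult_minus_right)
    qed
    also have "\<dots> \<le> exp (- s\<^sup>2 / (4 * real n * D\<^sup>2)) + exp (- s\<^sup>2 / (4 * real n * D\<^sup>2))"
      by (rule order_trans[OF pw_disj]) (intro add_mono one, use l0 in auto)
    finally show ?thesis by simp
  qed
qed

section \<open>Products of planar matrices\<close>

fun wprod :: "('a \<Rightarrow> mat2) \<Rightarrow> 'a list \<Rightarrow> mat2" where
  "wprod B [] = mat 1"
| "wprod B (j # w) = wprod B w ** B j"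

abbreviation lognorm :: "('a \<Rightarrow> mat2) \<Rightarrow> 'a list \<Rightarrow> real" where
  "lognorm B w \<equiv> ln (opnorm (wprod B w))"

text \<open>Signed area of the parallelogram spanned by \<open>x\<close> and \<open>y\<close>. A
  matrix multiplies it by its determinant, and divided by the two norms it is the sine of the angle,
  so it measures distances on the projective line.\<close>

definition wedge :: "real^2 \<Rightarrow> real^2 \<Rightarrow> real" where
  "wedge x y = x$1 * y$2 - x$2 * y$1"

lemma wprod_append: "wprod B (u @ v) = wprod B v ** wprod B u"
  by (induction u) (auto simp: matrix_mul_assoc)

lemma wprod_Cons_vec: "wprod B (j # w) *v x = wprod B w *v (B j *v x)"
  by (simp add: matrix_vector_mul_assoc)

lemma wprod_append_vec: "wprod B (u @ v) *v x = wprod B v *v (wprod B u *v x)"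
  by (simp add: wprod_append matrix_vector_mul_assoc)

lemma matvec2: "(M *v x) $ i = M $ i $ 1 * x $ 1 + M $ i $ 2 * x $ (2::2)" for M :: mat2
  by (simp add: matrix_vector_mult_def sum_2)

lemma norm2_sq: "(norm x)\<^sup>2 = (x$1)\<^sup>2 + (x$2)\<^sup>2" for x :: "real^2"
  by (simp add: norm_vec_def L2_set_def sum_2)

lemma wedge_matrix: "wedge (M *v x) (M *v y) = det M * wedge x y"
  by (simp add: wedge_def matvec2 det_2 algebra_simps)

lemma wedge_self [simp]: "wedge x x = 0"
  by (simp add: wedge_def)

lemma wedge_scaleR [simp]: "wedge (a *\<^sub>R x) y = a * wedge x y" "wedge x (a *\<^sub>R y) = a * wedge x y"
  by (simp_all add: wedge_def algebra_simps)

lemma wedge_commute: "wedge x y = - wedge y x"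
  by (simp add: wedge_def)

lemma wedge_inner: "(wedge x y)\<^sup>2 + (x \<bullet> y)\<^sup>2 = (norm x)\<^sup>2 * (norm y)\<^sup>2"
  unfolding norm2_sq by (simp add: wedge_def inner_vec_def sum_2 power2_eq_square algebra_simps)

lemma wedge_le: "\<bar>wedge x y\<bar> \<le> norm x * norm y"
proof -
  have "\<bar>wedge x y\<bar>\<^sup>2 \<le> (norm x * norm y)\<^sup>2"
    using wedge_inner[of x y] by (simp add: power_mult_distrib) (smt (verit) zero_le_power2)
  then show ?thesis by (rule power2_le_imp_le) simp
qed

lemma wedge_exists:
  fixes x :: "real^2"
  obtains y :: "real^2" where "norm y = norm x" "wedge x y = (norm x)\<^sup>2"
proof
  let ?y = "vector [- x$2, x$1] :: real^2"
  show w: "wedge x ?y = (norm x)\<^sup>2" unfolding norm2_sq by (simp add: wedge_def power2_eq_square)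
  have "(norm ?y)\<^sup>2 = (norm x)\<^sup>2" unfolding norm2_sq by simp
  then show "norm ?y = norm x" by simp
qed

lemma wedge_Cramer: "wedge x y *\<^sub>R u = wedge u y *\<^sub>R x + wedge x u *\<^sub>R y"
  by (simp add: vec_eq_iff wedge_def forall_2 algebra_simps)

lemma bl_mv: "bounded_linear ((*v) (M :: mat2))"
  by (rule matrix_vector_mul_bounded_linear)

lemma opnorm_ge: "norm (M *v x) \<le> opnorm M * norm x"
  unfolding opnorm_def by (rule onorm[OF bl_mv])

lemma opnorm_le: "(\<And>x. norm (M *v x) \<le> K * norm x) \<Longrightarrow> opnorm M \<le> K"
  unfolding opnorm_def by (rule onorm_le)

lemma opnorm_nonneg [simp]: "0 \<le> opnorm M"
  unfolding opnorm_def by (rule onorm_pos_le[OF bl_mv])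

lemma opnorm_mult: "opnorm (M ** N) \<le> opnorm M * opnorm N"
proof (rule opnorm_le)
  fix x
  have "norm ((M ** N) *v x) \<le> opnorm M * norm (N *v x)"
    by (metis matrix_vector_mul_assoc opnorm_ge)
  also have "\<dots> \<le> opnorm M * (opnorm N * norm x)"
    by (intro mult_left_mono opnorm_ge) auto
  finally show "norm ((M ** N) *v x) \<le> opnorm M * opnorm N * norm x" by (simp add: mult_ac)
qed

lemma opnorm_mat1 [simp]: "opnorm (mat 1) = 1"
  by (simp add: opnorm_def onorm_id)

text \<open>Any vector is a combination of \<open>x\<close> and \<open>y\<close> by Cramer's rule,
  with coefficients bounded through areas. Read conversely: two directions strongly contracted
  relative to the norm of \<open>M\<close> must be close to each other.\<close>

lemma opnorm_two_points: "opnorm M * \<bar>wedge x y\<bar> \<le> norm (M *v x) * norm y + norm (M *v y) * norm x"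
proof (cases "wedge x y = 0")
  case False
  have "opnorm M \<le> (norm (M *v x) * norm y + norm (M *v y) * norm x) / \<bar>wedge x y\<bar>"
  proof (rule opnorm_le)
    fix u
    have "M *v (wedge x y *\<^sub>R u) = wedge u y *\<^sub>R (M *v x) + wedge x u *\<^sub>R (M *v y)"
      unfolding wedge_Cramer[of x y u] by (simp add: matrix_vector_right_distrib matrix_vector_mult_scaleR)
    then have "\<bar>wedge x y\<bar> * norm (M *v u) \<le> \<bar>wedge u y\<bar> * norm (M *v x) + \<bar>wedge x u\<bar> * norm (M *v y)"
      by (metis matrix_vector_mult_scaleR norm_scaleR norm_triangle_ineq)
    also have "\<dots> \<le> (norm u * norm y) * norm (M *v x) + (norm x * norm u) * norm (M *v y)"
      by (intro add_mono mult_right_mono wedge_le) auto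
    finally show "norm (M *v u) \<le> (norm (M *v x) * norm y + norm (M *v y) * norm x) / \<bar>wedge x y\<bar> * norm u"
      using False by (simp add: field_simps)
  qed
  then show ?thesis using False by (simp add: field_simps)
qed (simp add: add_nonneg_nonneg)

lemma abs_det_le_opnorm: "\<bar>det M\<bar> \<le> (opnorm M)\<^sup>2" for M :: mat2
proof -
  let ?x = "axis 1 1 :: real^2" and ?y = "axis 2 1 :: real^2"
  have "\<bar>det M\<bar> = \<bar>wedge (M *v ?x) (M *v ?y)\<bar>"
    unfolding wedge_matrix by (simp add: wedge_def axis_def)
  also have "\<dots> \<le> norm (M *v ?x) * norm (M *v ?y)" by (rule wedge_le)
  also have "\<dots> \<le> opnorm M * opnorm M"
    using opnorm_ge[of M ?x] opnorm_ge[of M ?y] by (intro mult_mono) auto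
  finally show ?thesis by (simp add: power2_eq_square)
qed

lemma opnorm_pos: "det M \<noteq> 0 \<Longrightarrow> 0 < opnorm M" for M :: mat2
  using abs_det_le_opnorm[of M] opnorm_nonneg[of M] by (cases "opnorm M = 0") (auto simp: order_less_le)

lemma entry_le_opnorm: "\<bar>M $ i $ k\<bar> \<le> opnorm M" for M :: mat2
proof -
  have "\<bar>M $ i $ k\<bar> = \<bar>(M *v axis k 1) $ i\<bar>"
    by (simp add: matvec2 axis_def) (use exhaust_2[of k] in auto)
  also have "\<dots> \<le> norm (M *v axis k 1)" by (rule component_le_norm_cart)
  also have "\<dots> \<le> opnorm M" using opnorm_ge[of M "axis k 1"] by simp
  finally show ?thesis .
qed

lemma opnorm_le_entries:
  fixes M :: mat2
  assumes "\<And>i k. \<bar>M $ i $ k\<bar> \<le> d"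
  shows "opnorm M \<le> 4 * d"
proof (rule opnorm_le)
  fix x :: "real^2"
  have c: "\<bar>(M *v x) $ i\<bar> \<le> 2 * d * norm x" for i
  proof -
    have "\<bar>(M *v x) $ i\<bar> \<le> \<bar>M $ i $ 1\<bar> * \<bar>x $ 1\<bar> + \<bar>M $ i $ 2\<bar> * \<bar>x $ 2\<bar>"
      unfolding matvec2 by (metis abs_mult abs_triangle_ineq)
    also have "\<dots> \<le> d * norm x + d * norm x"
      by (intro add_mono mult_mono assms component_le_norm_cart) (use assms[of 1 1] in auto)
    finally show ?thesis by simp
  qed
  have "norm (M *v x) \<le> \<bar>(M *v x) $ 1\<bar> + \<bar>(M *v x) $ 2\<bar>"
    using norm_le_l1_cart[of "M *v x"] by (simp add: sum_2)
  then show "norm (M *v x) \<le> 4 * d * norm x" using c[of 1] c[of 2] by linarith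
qed

lemma opnorm_transpose: "opnorm (transpose M) = opnorm M" for M :: mat2
proof -
  have *: "opnorm (transpose M) \<le> opnorm M" for M :: mat2
  proof (rule opnorm_le)
    fix x :: "real^2"
    let ?y = "transpose M *v x"
    have "(norm ?y)\<^sup>2 = x \<bullet> (M *v ?y)"
      by (metis dot_lmul_matrix dot_square_norm inner_commute transpose_matrix_vector transpose_transpose)
    also have "\<dots> \<le> norm x * (opnorm M * norm ?y)"
      by (rule order_trans[OF norm_cauchy_schwarz]) (intro mult_left_mono opnorm_ge, auto)
    finally have "norm ?y * norm ?y \<le> (opnorm M * norm x) * norm ?y"
      by (simp add: power2_eq_square mult_ac)
    then show "norm ?y \<le> opnorm M * norm x"
      by (cases "norm ?y = 0") (auto simp: )
  qed
  from *[of M] *[of "transpose M"] show ?thesis by simp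
qed

section \<open>Words read along the Bernoulli shift\<close>

definition bword :: "(int \<Rightarrow> 'a) \<Rightarrow> nat \<Rightarrow> 'a list" where
  "bword x n = map (\<lambda>i. x (int i)) [0..<n]"

lemma length_bword [simp]: "length (bword x n) = n"
  by (simp add: bword_def)

lemma cociter_eq_wprod: "cociter A n x = wprod A (bword x n)"
  by (induction n) (auto simp: bword_def wprod_append)

lemma prob_space_bshift: "prob_space (bshift p)"
  unfolding bshift_def by (intro prob_space_PiM measure_pmf.prob_space_axioms)

lemma space_bshift [simp]: "space (bshift p) = UNIV"
  by (simp add: bshift_def space_PiM)

text \<open>Fixing the first letters is a cylinder condition on nonnegative integer coordinates;
  \<open>nat\<close> only translates these back into list positions. In this form both measurability
  and the product formula are available.\<close>

lemma bword_eq_emb: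
  "{x. bword x (length w) = w} = prod_emb UNIV (\<lambda>_::int. measure_pmf p) (int ` {..<length w})
     (Pi\<^sub>E (int ` {..<length w}) (\<lambda>k. {w ! nat k}))"
proof -
  have emb: "x \<in> prod_emb UNIV (\<lambda>_::int. measure_pmf p) J (Pi\<^sub>E J X) \<longleftrightarrow> (\<forall>k\<in>J. x k \<in> X k)" for x J X
    by (auto simp: prod_emb_def PiE_iff space_PiM)
  have word: "bword x (length w) = w \<longleftrightarrow> (\<forall>i<length w. x (int i) = w ! i)" for x
    unfolding list_eq_iff_nth_eq[of "bword x (length w)" w] by (simp add: bword_def)
  show ?thesis
    unfolding set_eq_iff emb mem_Collect_eq word by auto
qed

lemma bword_eq_sets: "{x. bword x (length w) = w} \<in> sets (bshift p)"
  unfolding bword_eq_emb[of w p] bshift_def by (rule sets_PiM_I) auto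

lemma measure_bword_eq: "measure (bshift p) {x. bword x (length w) = w} = (\<Prod>i<length w. pmf p (w ! i))"
proof -
  interpret product_prob_space "\<lambda>_::int. measure_pmf p" UNIV
    by (rule product_prob_spaceI) (rule measure_pmf.prob_space_axioms)
  have "measure (bshift p) {x. bword x (length w) = w}
      = (\<Prod>k\<in>int ` {..<length w}. measure (measure_pmf p) {w ! nat k})"
    unfolding bword_eq_emb[of w p] bshift_def by (rule measure_PiM_emb) auto
  then show ?thesis
    by (simp add: prod.reindex measure_pmf_single)
qed

lemma finite_lists_length: "finite {w :: 'a::finite list. length w = n}"
  using finite_lists_length_eq[of "UNIV :: 'a set" n] by simp

text \<open>Turns the letter-by-letter recursion into a sum over words weighted by products, the
  form in which the product measure presents itself on cylinders.\<close>

lemma ew_eq_sum: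
  "ew p n f = (\<Sum>w | length w = n. (\<Prod>i<n. pmf p (w ! i)) * f w)" for p :: "'a::finite pmf"
proof (induction n arbitrary: f)
  case (Suc n)
  have set: "{w :: 'a list. length w = Suc n} = case_prod (#) ` (UNIV \<times> {w. length w = n})"
    by (auto simp: length_Suc_conv)
  have "(\<Sum>w | length w = Suc n. (\<Prod>i<Suc n. pmf p (w ! i)) * f w)
      = (\<Sum>(j, w)\<in>UNIV \<times> {w. length w = n}. (\<Prod>i<Suc n. pmf p ((j # w) ! i)) * f (j # w))"
    unfolding set by (subst sum.reindex) (auto simp: inj_on_def intro!: sum.cong)
  also have "\<dots> = (\<Sum>j\<in>UNIV. \<Sum>w | length w = n. pmf p j * ((\<Prod>i<n. pmf p (w ! i)) * f (j # w)))"
    unfolding sum.cartesian_product prod.lessThan_Suc_shift by (intro sum.cong) (auto simp: mult.assoc)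
  also have "\<dots> = ew p (Suc n) f"
    by (simp add: Suc.IH sum_distrib_left)
  finally show ?case ..
qed auto

text \<open>An event that depends on the first \<open>n\<close> letters is a finite disjoint union
  of cylinders. This is the bridge from the shift space to finite words.\<close>

lemma bword_pred_sets: "{x. P (bword x n)} \<in> sets (bshift (p :: 'a::finite pmf))"
  and measure_bword: "measure (bshift p) {x. P (bword x n)} = pw p n P"
proof -
  interpret prob_space "bshift p" by (rule prob_space_bshift)
  let ?W = "{w :: 'a list. length w = n \<and> P w}"
  have fin: "finite ?W"
    by (rule finite_subset[OF _ finite_lists_length[of n]]) auto
  have eq: "{x. P (bword x n)} = (\<Union>w\<in>?W. {x. bword x n = w})" by auto
  have s: "{x. bword x n = w} \<in> sets (bshift p)" if "w \<in> ?W" for w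
    using bword_eq_sets[of w p] that by simp
  show "{x. P (bword x n)} \<in> sets (bshift p)"
    unfolding eq by (intro sets.finite_UN fin s)
  have "measure (bshift p) {x. P (bword x n)} = (\<Sum>w\<in>?W. measure (bshift p) {x. bword x n = w})"
    unfolding eq by (rule finite_measure_finite_Union) (use fin s in \<open>auto simp: disjoint_family_on_def\<close>)
  also have "\<dots> = (\<Sum>w\<in>?W. \<Prod>i<n. pmf p (w ! i))"
    using measure_bword_eq[where p=p] by (intro sum.cong) auto
  also have "\<dots> = (\<Sum>w | length w = n. (\<Prod>i<n. pmf p (w ! i)) * of_bool (P w))"
    by (rule sum.mono_neutral_cong_left[OF finite_lists_length]) auto
  finally show "measure (bshift p) {x. P (bword x n)} = pw p n P"
    by (simp add: pw_def ew_eq_sum)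
qed

lemma dev_prob_eq_pw:
  "dev_prob p B n t = pw p n (\<lambda>w. \<bar>lognorm B w / real n - Lplus p B\<bar> > t)"
  unfolding dev_prob_def measure_bword[symmetric] by (simp add: cociter_eq_wprod)

text \<open>The Borel-Cantelli lemma for each of the thresholds 1 / (k + 1), followed by
  intersecting countably many sets of full measure.\<close>

lemma AE_bword_limit:
  fixes p :: "'a::finite pmf" and X :: "'a list \<Rightarrow> real"
  assumes "\<And>\<epsilon>. 0 < \<epsilon> \<Longrightarrow> summable (\<lambda>n. pw p n (\<lambda>w. \<bar>X w - real n * L\<bar> > \<epsilon> * real n))"
  shows "AE x in bshift p. (\<lambda>n. X (bword x n) / real n) \<longlonglongrightarrow> L"
proof -
  interpret prob_space "bshift p" by (rule prob_space_bshift)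
  have ev: "AE x in bshift p. eventually (\<lambda>n. \<not> \<bar>X (bword x n) - real n * L\<bar> > (1 / real (Suc k)) * real n) sequentially" for k
  proof -
    have "AE x in bshift p. eventually (\<lambda>n. x \<in> space (bshift p) - {x. \<bar>X (bword x n) - real n * L\<bar> > (1 / real (Suc k)) * real n}) sequentially"
      by (rule borel_cantelli_AE1)
         (use assms[of "1 / real (Suc k)"] in
           \<open>auto simp: bword_pred_sets[where P = "\<lambda>w. _ < \<bar>X w - _\<bar>"] measure_bword[where P = "\<lambda>w. _ < \<bar>X w - _\<bar>"] emeasure_eq_measure less_top\<close>)
    then show ?thesis by simp
  qed
  have "AE x in bshift p. \<forall>k. eventually (\<lambda>n. \<not> \<bar>X (bword x n) - real n * L\<bar> > (1 / real (Suc k)) * real n) sequentially"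
    using ev by (simp add: AE_all_countable)
  then show ?thesis
  proof eventually_elim
    case (elim x)
    show ?case
    proof (rule tendstoI)
      fix e :: real assume e: "0 < e"
      then obtain k where k: "1 / real (Suc k) < e" using nat_approx_posE by metis
      show "\<forall>\<^sub>F n in sequentially. dist (X (bword x n) / real n) L < e"
        using elim[rule_format, of k] eventually_gt_at_top[of 0]
      proof eventually_elim
        case (elim n)
        have "\<bar>X (bword x n) / real n - L\<bar> = \<bar>X (bword x n) - real n * L\<bar> / real n"
          using elim by (simp add: field_simps abs_divide[symmetric])
        also have "\<dots> \<le> 1 / real (Suc k)" using elim by (simp add: field_simps)
        finally show ?case using k by (simp add: dist_real_def)
      qed
    qed
  qed
qed

lemma AE_limit_unique:
  assumes "AE x in bshift p. f x \<longlonglongrightarrow> L"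
  shows "(THE L. AE x in bshift p. f x \<longlonglongrightarrow> (L :: real)) = L"
proof (rule the_equality)
  show "AE x in bshift p. f x \<longlonglongrightarrow> L" by (rule assms)
next
  fix L' assume "AE x in bshift p. f x \<longlonglongrightarrow> L'"
  with assms have "AE x in bshift p. L' = L"
    by eventually_elim (rule LIMSEQ_unique)
  then show "L' = L"
    using prob_space.AE_const[OF prob_space_bshift] by metis
qed

text \<open>\<open>Lplus\<close> is a definite description, so it acquires a value only once almost
  sure convergence to some number is known. Summable deviations around a candidate \<open>L\<close>
  provide both the convergence and the value.\<close>

lemma Lplus_eqI:
  fixes p :: "'a::finite pmf"
  assumes "\<And>\<epsilon>. 0 < \<epsilon> \<Longrightarrow> summable (\<lambda>n. pw p n (\<lambda>w. \<bar>lognorm B w - real n * L\<bar> > \<epsilon> * real n))"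
  shows "Lplus p B = L"
  unfolding Lplus_def cociter_eq_wprod by (intro AE_limit_unique AE_bword_limit assms)

lemma Lminus_eqI:
  fixes p :: "'a::finite pmf"
  assumes "\<And>\<epsilon>. 0 < \<epsilon> \<Longrightarrow> summable (\<lambda>n. pw p n (\<lambda>w. \<bar>ln (inverse (opnorm (matrix_inv (wprod B w)))) - real n * L\<bar> > \<epsilon> * real n))"
  shows "Lminus p B = L"
  unfolding Lminus_def cociter_eq_wprod by (intro AE_limit_unique AE_bword_limit assms)

section \<open>Growth of vectors and norms\<close>

text \<open>One constant controls the matrices and their inverses. Stating the second bound on
  vectors lets it pass to products and to perturbations, and it forces invertibility.\<close>

definition bounded_by :: "('a \<Rightarrow> mat2) \<Rightarrow> real \<Rightarrow> bool" where
  "bounded_by B C \<longleftrightarrow> 0 \<le> C \<and> (\<forall>j x. norm (B j *v x) \<le> exp C * norm x \<and> norm x \<le> exp C * norm (B j *v x))"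

text \<open>Logarithmic growth of \<open>x\<close> under the product normalised to determinant of
  modulus 1. A positive mean says that the direction expands, which by \<open>pdist_image\<close> is
  the same as contraction of angles near it.\<close>

definition vgrow :: "('a \<Rightarrow> mat2) \<Rightarrow> 'a list \<Rightarrow> real^2 \<Rightarrow> real" where
  "vgrow B w x = ln (norm (wprod B w *v x)) - ln (norm x) - ln \<bar>det (wprod B w)\<bar> / 2"

text \<open>Half the logarithm of the ratio of the two singular values of the product; hence
  nonnegative and subadditive.\<close>

definition ngrow :: "('a \<Rightarrow> mat2) \<Rightarrow> 'a list \<Rightarrow> real" where
  "ngrow B w = lognorm B w - ln \<bar>det (wprod B w)\<bar> / 2"

lemma ln_le_of_le_exp: "0 < x \<Longrightarrow> x \<le> exp y \<Longrightarrow> ln x \<le> (y :: real)"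
  by (metis exp_gt_zero ln_exp ln_le_cancel_iff)

text \<open>In the plane the modulus of the determinant is at most the square of the operator norm;
  this is applied to \<open>M\<close> and to its inverse.\<close>

lemma mat_vec_bounds_det:
  fixes M :: mat2
  assumes "\<And>x. norm (M *v x) \<le> exp C * norm x" "\<And>x. norm x \<le> exp C * norm (M *v x)"
  shows "det M \<noteq> 0" "\<bar>ln \<bar>det M\<bar>\<bar> \<le> 2 * C"
proof -
  have inj: "inj ((*v) M)"
  proof (rule injI)
    fix x y assume "M *v x = M *v y"
    then have "M *v (x - y) = 0" by (simp add: matrix_vector_mult_diff_distrib)
    then show "x = y" using assms(2)[of "x - y"] by simp
  qed
  then obtain N where N: "N ** M = mat 1"
    using matrix_left_invertible_injective[of M] by (auto simp: inj_def)
  then have N': "M ** N = mat 1" using matrix_left_right_inverse by blast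
  have d: "det N * det M = 1" using N by (metis det_I det_mul)
  then show nz: "det M \<noteq> 0" by auto
  have E2: "exp C * exp C = exp (2 * C)" by (metis exp_add mult_2)
  have "opnorm M \<le> exp C" by (rule opnorm_le) (rule assms)
  then have "\<bar>det M\<bar> \<le> exp (2 * C)"
    using abs_det_le_opnorm[of M] mult_mono[of "opnorm M" "exp C" "opnorm M" "exp C"] by (simp add: power2_eq_square E2)
  then have 1: "ln \<bar>det M\<bar> \<le> 2 * C"
    using nz by (intro ln_le_of_le_exp) auto
  have "opnorm N \<le> exp C"
    by (rule opnorm_le) (metis N' assms(2) matrix_vector_mul_assoc matrix_vector_mul_lid)
  then have "\<bar>det N\<bar> \<le> exp (2 * C)"
    using abs_det_le_opnorm[of N] mult_mono[of "opnorm N" "exp C" "opnorm N" "exp C"] by (simp add: power2_eq_square E2)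
  moreover have "\<bar>det N\<bar> = 1 / \<bar>det M\<bar>" using d nz by (simp add: field_simps abs_mult[symmetric])
  ultimately have "1 / \<bar>det M\<bar> \<le> exp (2 * C)" by simp
  then have "ln (1 / \<bar>det M\<bar>) \<le> 2 * C"
    using nz by (intro ln_le_of_le_exp) auto
  then have "- ln \<bar>det M\<bar> \<le> 2 * C" using nz by (simp add: ln_div)
  with 1 show "\<bar>ln \<bar>det M\<bar>\<bar> \<le> 2 * C" by linarith
qed

context
  fixes B :: "'a \<Rightarrow> mat2" and C :: real
  assumes bounded_by: "bounded_by B C"
begin

lemma bdd_nonneg: "0 \<le> C" using bounded_by by (simp add: bounded_by_def)

lemma bdd_upper: "norm (B j *v x) \<le> exp C * norm x" using bounded_by by (simp add: bounded_by_def)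

lemma bdd_lower: "norm x \<le> exp C * norm (B j *v x)" using bounded_by by (simp add: bounded_by_def)

lemma bdd_word: "norm (wprod B w *v x) \<le> exp (C * length w) * norm x"
  "norm x \<le> exp (C * length w) * norm (wprod B w *v x)"
proof (induction w arbitrary: x)
  case (Cons j w)
  { case 1
    have "norm (wprod B (j # w) *v x) \<le> exp (C * length w) * norm (B j *v x)"
      unfolding wprod_Cons_vec by (rule Cons.IH)
    also have "\<dots> \<le> exp (C * length w) * (exp C * norm x)"
      by (intro mult_left_mono bdd_upper) auto
    finally show ?case by (simp add: algebra_simps exp_add)
  next
    case 2
    have "norm x \<le> exp C * norm (B j *v x)" by (rule bdd_lower)
    also have "\<dots> \<le> exp C * (exp (C * length w) * norm (wprod B (j # w) *v x))"
      unfolding wprod_Cons_vec by (intro mult_left_mono Cons.IH) auto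
    finally show ?case by (simp add: algebra_simps exp_add)
  }
qed auto

lemma bdd_nz: "x \<noteq> 0 \<Longrightarrow> wprod B w *v x \<noteq> 0"
  using bdd_word(2)[of x w] by auto

lemma bdd_nz1: "x \<noteq> 0 \<Longrightarrow> B j *v x \<noteq> 0"
  using bdd_lower[of x j] by auto

lemma bdd_det: "det (wprod B w) \<noteq> 0" "\<bar>ln \<bar>det (wprod B w)\<bar>\<bar> \<le> 2 * (C * length w)"
  using mat_vec_bounds_det[OF bdd_word] by auto

lemma bdd_ln_norm:
  assumes "x \<noteq> 0"
  shows "\<bar>ln (norm (wprod B w *v x)) - ln (norm x)\<bar> \<le> C * length w"
proof -
  have "ln (norm (wprod B w *v x)) \<le> C * length w + ln (norm x)"
    using bdd_word(1)[of w x] bdd_nz[OF assms, of w] assms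
    by (subst (asm) ln_le_cancel_iff[symmetric]) (auto simp: ln_mult)
  moreover have "ln (norm x) \<le> C * length w + ln (norm (wprod B w *v x))"
    using bdd_word(2)[of x w] bdd_nz[OF assms, of w] assms
    by (subst (asm) ln_le_cancel_iff[symmetric]) (auto simp: ln_mult)
  ultimately show ?thesis by linarith
qed

lemma vgrow_abs_le:
  assumes "x \<noteq> 0"
  shows "\<bar>vgrow B w x\<bar> \<le> 2 * C * length w"
  using bdd_ln_norm[OF assms, of w] bdd_det(2)[of w] unfolding vgrow_def by linarith

lemma vgrow_append:
  assumes "x \<noteq> 0"
  shows "vgrow B (u @ v) x = vgrow B u x + vgrow B v (wprod B u *v x)"
  using bdd_det(1)[of u] bdd_det(1)[of v]
  by (simp add: vgrow_def wprod_append_vec) (simp add: wprod_append det_mul abs_mult ln_mult field_simps)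

lemma ngrow_nonneg: "0 \<le> ngrow B w"
proof -
  have "ln \<bar>det (wprod B w)\<bar> \<le> ln ((opnorm (wprod B w))\<^sup>2)"
    using abs_det_le_opnorm[of "wprod B w"] bdd_det(1)[of w] by (subst ln_le_cancel_iff) (auto simp: opnorm_pos)
  also have "\<dots> = 2 * lognorm B w"
    using opnorm_pos[OF bdd_det(1)[of w]] by (simp add: ln_realpow)
  finally show ?thesis by (simp add: ngrow_def)
qed

lemma ngrow_append: "ngrow B (u @ v) \<le> ngrow B u + ngrow B v"
proof -
  have p: "0 < opnorm (wprod B w)" for w using opnorm_pos[OF bdd_det(1)] .
  have "ln (opnorm (wprod B (u @ v))) \<le> ln (opnorm (wprod B v) * opnorm (wprod B u))"
    using opnorm_mult[of "wprod B v" "wprod B u"] p by (subst ln_le_cancel_iff) (auto simp: wprod_append p[of "u @ v", unfolded wprod_append])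
  also have "\<dots> = ln (opnorm (wprod B v)) + ln (opnorm (wprod B u))"
    using p[of u] p[of v] by (simp add: ln_mult)
  finally show ?thesis
    using bdd_det(1)[of u] bdd_det(1)[of v] by (simp add: ngrow_def wprod_append det_mul abs_mult ln_mult field_simps)
qed

lemma opnorm_wprod_le: "opnorm (wprod B w) \<le> exp (C * length w)"
  by (rule opnorm_le) (rule bdd_word)

lemma ngrow_le: "ngrow B w \<le> 2 * C * length w"
proof -
  have "lognorm B w \<le> C * length w"
    using opnorm_wprod_le[of w] opnorm_pos[OF bdd_det(1)[of w]] by (intro ln_le_of_le_exp)
  then show ?thesis using bdd_det(2)[of w] unfolding ngrow_def by linarith
qed

text \<open>The inverse of the appended product is bounded, so a few extra letters destroy only a
  controlled amount of growth. It serves to pass from a grid of times to all times.\<close>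

lemma ngrow_append_ge: "ngrow B u - 2 * C * length v \<le> ngrow B (u @ v)"
proof -
  have "opnorm (wprod B u) \<le> exp (C * length v) * opnorm (wprod B (u @ v))"
  proof (rule opnorm_le)
    fix x
    have "norm (wprod B u *v x) \<le> exp (C * length v) * norm (wprod B (u @ v) *v x)"
      unfolding wprod_append_vec by (rule bdd_word)
    also have "\<dots> \<le> exp (C * length v) * (opnorm (wprod B (u @ v)) * norm x)"
      by (intro mult_left_mono opnorm_ge) auto
    finally show "norm (wprod B u *v x) \<le> exp (C * length v) * opnorm (wprod B (u @ v)) * norm x"
      by (simp add: mult_ac)
  qed
  then have "ln (opnorm (wprod B u)) \<le> ln (exp (C * length v) * opnorm (wprod B (u @ v)))"
    using opnorm_pos[OF bdd_det(1)] by (subst ln_le_cancel_iff) auto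
  also have "\<dots> = C * length v + ln (opnorm (wprod B (u @ v)))"
    using opnorm_pos[OF bdd_det(1)[of "u @ v"]] by (simp add: ln_mult)
  finally show ?thesis
    using bdd_det(1)[of u] bdd_det(1)[of v] bdd_det(2)[of v]
    by (simp add: ngrow_def wprod_append det_mul abs_mult ln_mult field_simps)
qed

text \<open>Splitting \<open>v\<close> along \<open>u\<close> and its orthogonal complement, the distortion of the ratio of
  norms is governed by the area spanned by \<open>u\<close> and \<open>v\<close>.\<close>
lemma norm_ratio_step:
  assumes "u \<noteq> 0"
  shows "norm (B j *v v) / norm (B j *v u) \<le> norm v / norm u + exp (2 * C) * \<bar>wedge u v\<bar> / (norm u)\<^sup>2"
proof -
  define s where "s = (u \<bullet> v) / (norm u)\<^sup>2"
  define r where "r = v - s *\<^sub>R u"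
  have v: "v = s *\<^sub>R u + r" by (simp add: r_def)
  have "u \<bullet> r = 0" using assms by (simp add: r_def s_def inner_diff_right power2_norm_eq_inner)
  moreover have "wedge u r = wedge u v" by (simp add: r_def wedge_def algebra_simps)
  ultimately have "(wedge u v)\<^sup>2 = (norm u * norm r)\<^sup>2"
    using wedge_inner[of u r] by (simp add: power_mult_distrib)
  then have r: "\<bar>wedge u v\<bar> = norm u * norm r"
    using power2_eq_iff_nonneg[of "\<bar>wedge u v\<bar>" "norm u * norm r"] by simp
  have s: "\<bar>s\<bar> \<le> norm v / norm u"
    using Cauchy_Schwarz_ineq2[of u v] assms by (simp add: s_def field_simps power2_eq_square)
  have "norm (B j *v v) \<le> \<bar>s\<bar> * norm (B j *v u) + norm (B j *v r)"
    unfolding v by (metis matrix_vector_mult_scaleR matrix_vector_right_distrib norm_scaleR norm_triangle_ineq)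
  also have "\<dots> \<le> (norm v / norm u) * norm (B j *v u) + exp C * norm r"
    by (intro add_mono mult_right_mono s bdd_upper) auto
  also have "exp C * norm r \<le> exp C * (norm r * (exp C * norm (B j *v u) / norm u))"
    using bdd_lower[of u j] assms by (intro mult_left_mono) (auto simp: field_simps intro!: mult_left_mono)
  also have "\<dots> = (exp (2 * C) * \<bar>wedge u v\<bar> / (norm u)\<^sup>2) * norm (B j *v u)"
    using assms unfolding r mult_2 exp_add by (simp add: field_simps power2_eq_square)
  finally show ?thesis
    using bdd_nz1[OF assms, of j] by (simp add: field_simps)
qed

section \<open>Persistence of growth, and restarting after a contraction\<close>

text \<open>\<open>x\<close> is followed together with an orthogonal partner \<open>y\<close>;
  \<open>S m\<close> bounds the norm of the product relative to the growth of \<open>x\<close>. By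
  \<open>norm_ratio_step\<close> one letter increases \<open>S\<close> by at most a constant times
  the area divided by the square of |\<open>u m\<close>|. That area is exp (-2 ngrow) times the
  squared norm of the product, so linear growth of \<open>ngrow\<close> makes the increments tiny
  and their sum never exceeds the initial bound.\<close>

lemma persistence:
  fixes kap :: real
  assumes x: "x \<noteq> 0" and N: "N \<le> length w" and kap: "0 \<le> kap"
    and good: "opnorm (wprod B (take N w)) * norm x \<le> exp (kap * N) * norm (wprod B (take N w) *v x)"
    and H: "\<And>m. N \<le> m \<Longrightarrow> m \<le> length w \<Longrightarrow> 3 * kap * m \<le> ngrow B (take m w)"
    and small: "16 * exp (2 * C - 4 * kap * N) * length w \<le> 2 * exp (kap * N)"
  shows "3 * kap * length w - kap * N - ln 4 \<le> vgrow B w x"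
proof -
  obtain y where y: "norm y = norm x" "wedge x y = (norm x)\<^sup>2" by (rule wedge_exists)
  define u where "u m = wprod B (take m w) *v x" for m
  define v where "v m = wprod B (take m w) *v y" for m
  define S where "S m = 1 + norm (v m) / norm (u m)" for m
  \<comment> \<open>The largest increment of \<open>S\<close> per letter: exp (2 C) times exp (-6
    kap N), from hypothesis \<open>H\<close> at times at least N, times the square of the bound 4
    exp (kap N) for \<open>S\<close>.\<close>
  define e where "e = 16 * exp (2 * C - 4 * kap * N)"
  have u0: "u m \<noteq> 0" for m unfolding u_def by (rule bdd_nz[OF x])
  have op: "opnorm (wprod B (take m w)) * norm x \<le> norm (u m) * S m" for m
  proof -
    have "opnorm (wprod B (take m w)) * (norm x)\<^sup>2 \<le> norm (u m) * norm x + norm (v m) * norm x"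
      using opnorm_two_points[of "wprod B (take m w)" x y] y by (simp add: u_def v_def)
    also have "\<dots> = (norm (u m) * S m) * norm x" using u0 by (simp add: S_def field_simps)
    finally show ?thesis using x by (simp add: power2_eq_square)
  qed
  have S1: "1 \<le> S m" for m by (simp add: S_def)
  have "S m \<le> 2 * exp (kap * N) + real (m - N) * e" if "N \<le> m" "m \<le> length w" for m
    using that
  proof (induction m rule: dec_induct)
    case base
    have "norm (v N) \<le> opnorm (wprod B (take N w)) * norm x" unfolding v_def y(1)[symmetric] by (rule opnorm_ge)
    with good have "norm (v N) / norm (u N) \<le> exp (kap * N)" using u0[of N] by (simp add: u_def field_simps)
    moreover have "1 \<le> exp (kap * N)" using kap by simp
    ultimately have "S N \<le> 2 * exp (kap * N)" unfolding S_def by linarith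
    then show ?case by simp
  next
    case (step m)
    have IH: "S m \<le> 2 * exp (kap * N) + real (m - N) * e" using step by simp
    have "real (m - N) * e \<le> length w * e" unfolding e_def using step.prems by (intro mult_right_mono) auto
    also have "\<dots> \<le> 2 * exp (kap * N)" using small by (simp add: e_def mult_ac)
    finally have S4: "S m \<le> 4 * exp (kap * N)" using IH by simp
    have tk: "take (Suc m) w = take m w @ [w ! m]" using step.prems by (simp add: take_Suc_conv_app_nth)
    have uS: "u (Suc m) = B (w ! m) *v u m" "v (Suc m) = B (w ! m) *v v m"
      unfolding u_def v_def tk by (simp_all add: wprod_append_vec)
    let ?M = "wprod B (take m w)"
    have wuv: "\<bar>wedge (u m) (v m)\<bar> = \<bar>det ?M\<bar> * (norm x)\<^sup>2"
      unfolding u_def v_def wedge_matrix y by (simp add: abs_mult)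
    have det: "\<bar>det ?M\<bar> = exp (- 2 * ngrow B (take m w)) * (opnorm ?M)\<^sup>2"
    proof -
      have "exp (- 2 * ngrow B (take m w)) * (opnorm ?M)\<^sup>2 = exp (ln \<bar>det ?M\<bar> - 2 * ln (opnorm ?M)) * exp (ln ((opnorm ?M)\<^sup>2))"
        using opnorm_pos[OF bdd_det(1)[of "take m w"]] by (simp add: ngrow_def)
      also have "\<dots> = exp (ln \<bar>det ?M\<bar>)"
        using opnorm_pos[OF bdd_det(1)[of "take m w"]] by (simp add: ln_realpow flip: exp_add)
      finally show ?thesis using bdd_det(1)[of "take m w"] by simp
    qed
    have "exp (2 * C) * \<bar>wedge (u m) (v m)\<bar> / (norm (u m))\<^sup>2
        = exp (2 * C) * exp (- 2 * ngrow B (take m w)) * ((opnorm ?M * norm x)\<^sup>2 / (norm (u m))\<^sup>2)"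
      unfolding wuv det by (simp add: power_mult_distrib)
    also have "\<dots> \<le> exp (2 * C) * exp (- 6 * kap * N) * (S m)\<^sup>2"
    proof (intro mult_mono)
      have "kap * N \<le> kap * m" using step kap by (intro mult_left_mono) auto
      then show "exp (- 2 * ngrow B (take m w)) \<le> exp (- 6 * kap * N)"
        using H[of m] step by simp
      have "(opnorm ?M * norm x)\<^sup>2 \<le> (norm (u m) * S m)\<^sup>2"
        by (intro power_mono op) simp
      then show "(opnorm ?M * norm x)\<^sup>2 / (norm (u m))\<^sup>2 \<le> (S m)\<^sup>2"
        using u0[of m] by (simp add: field_simps power_mult_distrib)
    qed auto
    also have "\<dots> \<le> exp (2 * C) * exp (- 6 * kap * N) * (4 * exp (kap * N))\<^sup>2"
      using S4 S1[of m] by (intro mult_left_mono power_mono) auto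
    also have "\<dots> = e"
      by (simp add: e_def power2_eq_square flip: exp_add)
    finally have "S (Suc m) \<le> S m + e"
      using norm_ratio_step[OF u0[of m], of "w ! m" "v m"] by (simp add: S_def uS)
    moreover have "real (Suc m - N) = real (m - N) + 1" using step by (simp add: Suc_diff_le)
    ultimately show ?case using IH by (simp add: algebra_simps)
  qed
  from this[of "length w"] N have "S (length w) \<le> 2 * exp (kap * N) + real (length w - N) * e" by simp
  also have "real (length w - N) * e \<le> length w * e" unfolding e_def by (intro mult_right_mono) auto
  also have "length w * e \<le> 2 * exp (kap * N)" using small by (simp add: e_def mult_ac)
  finally have "S (length w) \<le> 4 * exp (kap * N)" by simp
  then have "ln (S (length w)) \<le> ln (4 * exp (kap * N))"
    using S1[of "length w"] by (subst ln_le_cancel_iff) auto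
  also have "\<dots> = ln 4 + kap * N" by (simp add: ln_mult)
  finally have lnS: "ln (S (length w)) \<le> ln 4 + kap * N" .
  have p: "0 < opnorm (wprod B w)" by (rule opnorm_pos[OF bdd_det(1)])
  have "ln (opnorm (wprod B w) * norm x) \<le> ln (norm (u (length w)) * S (length w))"
    using op[of "length w"] p x u0[of "length w"] S1[of "length w"] by (subst ln_le_cancel_iff) auto
  then have "lognorm B w + ln (norm x) \<le> ln (norm (wprod B w *v x)) + ln (S (length w))"
    using p x u0[of "length w"] S1[of "length w"] by (simp add: ln_mult u_def)
  then show ?thesis
    using lnS H[of "length w"] N by (simp add: vgrow_def ngrow_def)
qed

end

definition balanced :: "('a \<Rightarrow> mat2) \<Rightarrow> real \<Rightarrow> 'a list \<Rightarrow> real^2 \<Rightarrow> bool" where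
  "balanced B kap w x \<longleftrightarrow> opnorm (wprod B w) * norm x \<le> exp (kap * length w) * norm (wprod B w *v x)"

text \<open>The sine of the angle between the lines spanned by \<open>x\<close> and
  \<open>y\<close>; it is 0 when one of the vectors vanishes.\<close>

definition pdist :: "real^2 \<Rightarrow> real^2 \<Rightarrow> real" where
  "pdist x y = \<bar>wedge x y\<bar> / (norm x * norm y)"

lemma pdist_nonneg [simp]: "0 \<le> pdist x y"
  by (simp add: pdist_def)

lemma pdist_le_1: "pdist x y \<le> 1"
  using wedge_le[of x y] by (cases "x = 0 \<or> y = 0") (auto simp: pdist_def wedge_def field_simps)

lemma pdist_commute: "pdist x y = pdist y x"
  by (simp add: pdist_def wedge_commute[of x y] mult.commute)

context
  fixes B :: "'a::finite \<Rightarrow> mat2" and C :: real and p :: "'a pmf"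
  assumes bounded_by: "bounded_by B C"
begin

text \<open>Up to \<open>l\<close> attempts of \<open>N\<close> letters each. If the current
  direction is balanced over the attempt, \<open>persistence\<close> gives the growth for all the
  remaining letters, unless \<open>ngrow\<close> fails to grow, which has probability at most
  \<eta>. Otherwise, with probability at most \<open>q\<close>, the attempt costs at most 2 C N and
  the argument restarts from the image direction. The horizon \<open>T0\<close> is fixed so that one
  growth hypothesis serves all the shorter lengths met in the induction.\<close>

lemma growth_prob:
  fixes kap q \<eta> :: real and N T0 :: nat
  assumes kap: "0 \<le> kap" and q: "0 \<le> q" "q \<le> 1"
    and bad: "\<And>x. x \<noteq> 0 \<Longrightarrow> pw p N (\<lambda>u. \<not> balanced B kap u x) \<le> q"
    and H: "pw p T0 (\<lambda>w. \<exists>m\<in>{N..T0}. ngrow B (take m w) < 3 * kap * m) \<le> \<eta>"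
    and small: "16 * exp (2 * C - 4 * kap * N) * T0 \<le> 2 * exp (kap * N)"
    and x: "x \<noteq> 0" and T: "l * N \<le> T" "T \<le> T0"
  shows "pw p T (\<lambda>w. vgrow B w x < 2 * kap * (real T - l * N) - ln 4 - 2 * C * l * N) \<le> q ^ l + l * \<eta>"
  using x T
proof (induction l arbitrary: x T)
  case 0
  then show ?case by simp
next
  case (Suc l)
  have C0: "0 \<le> C" by (rule bdd_nonneg[OF bounded_by])
  have eta0: "0 \<le> \<eta>" using H pw_nonneg order_trans by blast
  define T' where "T' = T - N"
  have T': "T = N + T'" "l * N \<le> T'" "T' \<le> T0" using Suc.prems by (auto simp: T'_def)
  define thr where "thr = 2 * kap * (real T' - l * N) - ln 4 - 2 * C * l * N"
  have thr: "2 * kap * (real T - Suc l * N) - ln 4 - 2 * C * Suc l * N = thr - 2 * C * N"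
    by (simp add: thr_def T'(1) algebra_simps)
  have "pw p T (\<lambda>w. vgrow B w x < thr - 2 * C * N)
      \<le> pw p T (\<lambda>w. (\<exists>m\<in>{N..T}. ngrow B (take m w) < 3 * kap * m)
          \<or> (\<not> balanced B kap (take N w) x \<and> vgrow B (drop N w) (wprod B (take N w) *v x) < thr))"
  proof (rule pw_mono, rule ccontr)
    fix w :: "'a list"
    assume w: "length w = T" and low: "vgrow B w x < thr - 2 * C * N"
      and n: "\<not> ((\<exists>m\<in>{N..T}. ngrow B (take m w) < 3 * kap * m)
          \<or> (\<not> balanced B kap (take N w) x \<and> vgrow B (drop N w) (wprod B (take N w) *v x) < thr))"
    have app: "vgrow B w x = vgrow B (take N w) x + vgrow B (drop N w) (wprod B (take N w) *v x)"
      using vgrow_append[OF bounded_by Suc.prems(1), of "take N w" "drop N w"] by simp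
    have "- (2 * C * N) \<le> vgrow B (take N w) x"
      using vgrow_abs_le[OF bounded_by Suc.prems(1), of "take N w"] w T' by simp
    with low app have "vgrow B (drop N w) (wprod B (take N w) *v x) < thr" by linarith
    with n have bal: "balanced B kap (take N w) x" by blast
    have "3 * kap * length w - kap * N - ln 4 \<le> vgrow B w x"
    proof (rule persistence[OF bounded_by Suc.prems(1)])
      show "N \<le> length w" using w T' by simp
      show "opnorm (wprod B (take N w)) * norm x \<le> exp (kap * N) * norm (wprod B (take N w) *v x)"
        using bal w T' by (simp add: balanced_def)
      show "3 * kap * m \<le> ngrow B (take m w)" if "N \<le> m" "m \<le> length w" for m
        using n that w by (force simp: not_less)
      have "16 * exp (2 * C - 4 * kap * N) * length w \<le> 16 * exp (2 * C - 4 * kap * N) * T0"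
        using w Suc.prems by (intro mult_left_mono) auto
      then show "16 * exp (2 * C - 4 * kap * N) * length w \<le> 2 * exp (kap * N)"
        using small by linarith
    qed (rule kap)
    moreover have "thr - 2 * C * N \<le> 2 * kap * (real T' - l * N) - ln 4"
    proof -
      have "0 \<le> 2 * C * l * N" "0 \<le> 2 * C * N" using C0 by auto
      then show ?thesis unfolding thr_def by linarith
    qed
    moreover have "2 * kap * (real T' - l * N) \<le> 3 * kap * T - kap * N"
    proof -
      have "0 \<le> kap * (l * N)" "0 \<le> kap * N" "0 \<le> kap * T'" using kap by auto
      then show ?thesis unfolding T'(1) by (simp add: algebra_simps)
    qed
    ultimately show False using low unfolding w by linarith
  qed
  also have "\<dots> \<le> pw p T (\<lambda>w. \<exists>m\<in>{N..T}. ngrow B (take m w) < 3 * kap * m)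
     + pw p T (\<lambda>w. \<not> balanced B kap (take N w) x \<and> vgrow B (drop N w) (wprod B (take N w) *v x) < thr)"
    by (rule pw_disj)
  also have "pw p T (\<lambda>w. \<exists>m\<in>{N..T}. ngrow B (take m w) < 3 * kap * m) \<le> \<eta>"
  proof -
    have "pw p T (\<lambda>w. \<exists>m\<in>{N..T}. ngrow B (take m w) < 3 * kap * m)
        = pw p T0 (\<lambda>w. \<exists>m\<in>{N..T}. ngrow B (take m (take T w)) < 3 * kap * m)"
      using pw_prefix'[OF Suc.prems(3), of p "\<lambda>w. \<exists>m\<in>{N..T}. ngrow B (take m w) < 3 * kap * m"] by simp
    also have "\<dots> \<le> pw p T0 (\<lambda>w. \<exists>m\<in>{N..T0}. ngrow B (take m w) < 3 * kap * m)"
      using Suc.prems(3) by (intro pw_mono) (force simp: min_def)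
    finally show ?thesis using H by linarith
  qed
  \<comment> \<open>The first block and the rest of the word are independent, and the induction
    hypothesis is uniform in the starting direction.\<close>
  also have "pw p T (\<lambda>w. \<not> balanced B kap (take N w) x \<and> vgrow B (drop N w) (wprod B (take N w) *v x) < thr)
      = ew p N (\<lambda>u. of_bool (\<not> balanced B kap u x) * pw p T' (\<lambda>v. vgrow B v (wprod B u *v x) < thr))"
    unfolding pw_def T'(1) ew_append ew_cmult[symmetric] by (intro ew_cong) simp
  also have "\<dots> \<le> ew p N (\<lambda>u. of_bool (\<not> balanced B kap u x) * (q ^ l + l * \<eta>))"
    unfolding thr_def by (intro ew_mono mult_left_mono Suc.IH bdd_nz[OF bounded_by] Suc.prems T') auto
  also have "\<dots> = pw p N (\<lambda>u. \<not> balanced B kap u x) * (q ^ l + l * \<eta>)"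
    unfolding pw_def ew_mult_right ..
  also have "\<dots> \<le> q * (q ^ l + l * \<eta>)"
    using q eta0 by (intro mult_right_mono bad Suc.prems) auto
  also have "\<eta> + q * (q ^ l + l * \<eta>) \<le> q ^ Suc l + Suc l * \<eta>"
    using q eta0 mult_right_mono[of q 1 "l * \<eta>"] by (simp add: algebra_simps)
  finally show ?case unfolding thr by simp
qed

section \<open>Oscillation of the mean growth and concentration\<close>

text \<open>The determinant is kept, since the target is \<open>lognorm\<close>; in a difference
  between two directions its mean cancels, so oscillations agree with those of the mean of
  \<open>vgrow\<close>.\<close>

definition mean_grow :: "nat \<Rightarrow> real^2 \<Rightarrow> real" where
  "mean_grow n x = ew p n (\<lambda>w. ln (norm (wprod B w *v x)) - ln (norm x))"

lemma addf_eq: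
  "addf (\<lambda>j x. ln (norm (B j *v x)) - ln (norm x)) (\<lambda>j x. B j *v x) w x
     = ln (norm (wprod B w *v x)) - ln (norm x)"
  by (induction w arbitrary: x) (auto simp: matrix_vector_mul_assoc)

lemma mean_grow_Suc: "mean_grow (Suc n) x = (\<Sum>j\<in>UNIV. pmf p j * (ln (norm (B j *v x)) - ln (norm x) + mean_grow n (B j *v x)))"
  unfolding mean_grow_def addf_eq[symmetric] by (simp add: ew_add)

lemma mean_grow_add: "mean_grow (m + n) x = mean_grow m x + ew p m (\<lambda>u. mean_grow n (wprod B u *v x))"
  unfolding mean_grow_def ew_append ew_add[symmetric]
  by (intro ew_cong) (simp add: wprod_append_vec ew_diff)

text \<open>The area is multiplied by the determinant and each norm by its own growth; with the
  normalisation in \<open>vgrow\<close> the determinant drops out.\<close>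

lemma pdist_image:
  assumes "x \<noteq> 0" "y \<noteq> 0"
  shows "pdist (wprod B w *v x) (wprod B w *v y) = pdist x y * exp (- vgrow B w x - vgrow B w y)"
proof -
  have "exp (- vgrow B w x - vgrow B w y)
      = exp (ln \<bar>det (wprod B w)\<bar>) * exp (ln (norm x)) * exp (ln (norm y)) / (exp (ln (norm (wprod B w *v x))) * exp (ln (norm (wprod B w *v y))))"
    unfolding exp_add[symmetric] exp_diff[symmetric] by (simp add: vgrow_def algebra_simps)
  also have "\<dots> = \<bar>det (wprod B w)\<bar> * norm x * norm y / (norm (wprod B w *v x) * norm (wprod B w *v y))"
    using bdd_det(1)[OF bounded_by, of w] assms bdd_nz[OF bounded_by assms(1)] bdd_nz[OF bounded_by assms(2)] by simp
  finally show ?thesis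
    using assms by (simp add: pdist_def wedge_matrix abs_mult)
qed

text \<open>\<open>norm_ratio_step\<close> divided by the ratio of the norms bounds a quotient by 1
  plus a multiple of the angle; ln (1 + t) is at most t, and the roles of \<open>x\<close> and
  \<open>y\<close> are exchangeable.\<close>

lemma ln_norm_lipschitz:
  assumes "x \<noteq> 0" "y \<noteq> 0"
  shows "\<bar>(ln (norm (B j *v x)) - ln (norm x)) - (ln (norm (B j *v y)) - ln (norm y))\<bar> \<le> exp (2 * C) * pdist x y"
proof -
  have *: "(ln (norm (B j *v v)) - ln (norm v)) - (ln (norm (B j *v u)) - ln (norm u)) \<le> exp (2 * C) * pdist u v"
    if "u \<noteq> 0" "v \<noteq> 0" for u v
  proof -
    note nz = bdd_nz1[OF bounded_by that(1), of j] bdd_nz1[OF bounded_by that(2), of j]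
    have "norm (B j *v v) / norm (B j *v u) \<le> (norm v / norm u) * (1 + exp (2 * C) * pdist u v)"
    proof -
      have "exp (2 * C) * \<bar>wedge u v\<bar> / (norm u)\<^sup>2 = (norm v / norm u) * (exp (2 * C) * pdist u v)"
        using that by (simp add: pdist_def power2_eq_square)
      then show ?thesis using norm_ratio_step[OF bounded_by that(1), of j v] by (simp add: distrib_left)
    qed
    also have "\<dots> \<le> (norm v / norm u) * exp (exp (2 * C) * pdist u v)"
      by (intro mult_left_mono exp_ge_add_one_self) auto
    finally have "ln (norm (B j *v v) / norm (B j *v u)) \<le> ln ((norm v / norm u) * exp (exp (2 * C) * pdist u v))"
      using nz that by (subst ln_le_cancel_iff) auto
    then show ?thesis using nz that by (simp add: ln_div ln_mult)
  qed
  from *[OF assms] *[OF assms(2,1)] pdist_commute[of x y] show ?thesis by simp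
qed

text \<open>With exponent a = \<tau> / (2 N) the variable 2 a \<open>vgrow\<close> is bounded by 2 C
  \<tau> whatever \<open>N\<close> is, so the quadratic bound gives the mean 1 - k \<tau> + 4 C^2
  \<tau>^2, at most 1 - k \<tau> / 2. The two directions are separated by the inequality between
  geometric and arithmetic mean. Shrinking the exponent with \<open>N\<close> keeps the contraction
  factor independent of \<open>N\<close>.\<close>

lemma contraction_step:
  fixes k \<tau> :: real and N :: nat
  assumes N: "1 \<le> N" and k: "\<And>x. x \<noteq> 0 \<Longrightarrow> k * N \<le> ew p N (\<lambda>w. vgrow B w x)"
    and tau: "0 < \<tau>" "2 * C * \<tau> \<le> 1" "8 * C\<^sup>2 * \<tau> \<le> k"
    and x: "x \<noteq> 0" and y: "y \<noteq> 0"
  shows "ew p N (\<lambda>w. pdist (wprod B w *v x) (wprod B w *v y) powr (\<tau> / (2 * N))) \<le> (1 - k * \<tau> / 2) * pdist x y powr (\<tau> / (2 * N))"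
proof -
  define a where "a = \<tau> / (2 * N)"
  have a: "0 < a" "2 * a * N = \<tau>" using tau N by (auto simp: a_def)
  have one: "ew p N (\<lambda>w. exp (- 2 * a * vgrow B w x)) \<le> 1 - k * \<tau> / 2" if "x \<noteq> 0" for x
  proof -
    have "ew p N (\<lambda>w. exp (- 2 * a * vgrow B w x)) \<le> ew p N (\<lambda>w. (- 2 * a) * vgrow B w x + (1 + (2 * C * \<tau>)\<^sup>2))"
    proof (rule ew_mono)
      fix w :: "'a list" assume w: "length w = N"
      have "\<bar>- 2 * a * vgrow B w x\<bar> \<le> 2 * a * (2 * C * N)"
        using vgrow_abs_le[OF bounded_by that, of w] a w by (simp add: abs_mult)
      also have "\<dots> = 2 * C * \<tau>" using a by (simp add: algebra_simps)
      finally have *: "\<bar>- 2 * a * vgrow B w x\<bar> \<le> 2 * C * \<tau>" .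
      then have "(- 2 * a * vgrow B w x)\<^sup>2 \<le> (2 * C * \<tau>)\<^sup>2"
        by (metis abs_ge_zero power2_abs power_mono)
      then show "exp (- 2 * a * vgrow B w x) \<le> (- 2 * a) * vgrow B w x + (1 + (2 * C * \<tau>)\<^sup>2)"
        using exp_le_quadratic[of "- 2 * a * vgrow B w x"] * tau by linarith
    qed
    also have "\<dots> = (- 2 * a) * ew p N (\<lambda>w. vgrow B w x) + (1 + (2 * C * \<tau>)\<^sup>2)"
      by (simp only: ew_add ew_cmult ew_const)
    also have "\<dots> \<le> (- 2 * a) * (k * N) + (1 + (2 * C * \<tau>)\<^sup>2)"
      using k[OF that] a by simp
    also have "\<dots> = 1 - k * \<tau> + \<tau> * (8 * C\<^sup>2 * \<tau>) / 2"
      using a(2) by (simp add: power2_eq_square algebra_simps)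
    also have "\<dots> \<le> 1 - k * \<tau> + \<tau> * k / 2"
      using tau by (intro add_left_mono divide_right_mono mult_left_mono) auto
    finally show ?thesis by (simp add: algebra_simps)
  qed
  have "ew p N (\<lambda>w. pdist (wprod B w *v x) (wprod B w *v y) powr a)
      \<le> ew p N (\<lambda>w. pdist x y powr a * (1/2 * exp (- 2 * a * vgrow B w x) + 1/2 * exp (- 2 * a * vgrow B w y)))"
  proof (rule ew_mono)
    fix w :: "'a list"
    have am: "exp (u + v) \<le> 1/2 * exp (2 * u) + 1/2 * exp (2 * v)" for u v :: real
    proof -
      have "0 \<le> (exp u - exp v)\<^sup>2" by simp
      moreover have "exp (2 * u) = exp u * exp u" "exp (2 * v) = exp v * exp v" by (metis exp_add mult_2)+
      ultimately show ?thesis by (simp add: power2_eq_square algebra_simps exp_add)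
    qed
    have "pdist (wprod B w *v x) (wprod B w *v y) powr a = pdist x y powr a * exp (- a * vgrow B w x + - a * vgrow B w y)"
      unfolding pdist_image[OF x y]
      by (subst powr_mult) (auto simp: powr_def algebra_simps)
    also have "\<dots> \<le> pdist x y powr a * (1/2 * exp (- 2 * a * vgrow B w x) + 1/2 * exp (- 2 * a * vgrow B w y))"
      using am[of "- a * vgrow B w x" "- a * vgrow B w y"] by (intro mult_left_mono) (auto simp: mult.assoc)
    finally show "pdist (wprod B w *v x) (wprod B w *v y) powr a
      \<le> pdist x y powr a * (1/2 * exp (- 2 * a * vgrow B w x) + 1/2 * exp (- 2 * a * vgrow B w y))" .
  qed
  also have "\<dots> = pdist x y powr a * (1/2 * ew p N (\<lambda>w. exp (- 2 * a * vgrow B w x)) + 1/2 * ew p N (\<lambda>w. exp (- 2 * a * vgrow B w y)))"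
    by (simp only: ew_add ew_cmult)
  also have "\<dots> \<le> pdist x y powr a * (1 - k * \<tau> / 2)"
    using one[OF x] one[OF y] by (intro mult_left_mono) auto
  finally show ?thesis by (simp add: a_def mult.commute)
qed

text \<open>Reading one letter changes the difference of the mean growths by at most exp (2 C) times
  the angle, hence at most exp (2 C) times its power \<open>a\<close>. Exactly this amount is
  released by the drop of \<open>K * U\<close>, so \<open>K * U\<close> dominates the difference for
  every \<open>m\<close>. Each of the \<open>N\<close> terms of \<open>U\<close> is at most 1, which
  makes the bound linear in \<open>N\<close>.\<close>

lemma oscillation_bound:
  fixes k \<tau> :: real and N :: nat
  assumes N: "1 \<le> N" and k: "\<And>x. x \<noteq> 0 \<Longrightarrow> k * N \<le> ew p N (\<lambda>w. vgrow B w x)" and k0: "0 < k"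
    and tau: "0 < \<tau>" "\<tau> \<le> 1" "2 * C * \<tau> \<le> 1" "8 * C\<^sup>2 * \<tau> \<le> k"
    and x: "x \<noteq> 0" and y: "y \<noteq> 0"
  shows "\<bar>mean_grow m x - mean_grow m y\<bar> \<le> exp (2 * C) * 2 / (k * \<tau>) * N"
proof -
  define a where "a = \<tau> / (2 * N)"
  define c where "c = k * \<tau> / 2"
  define K where "K = exp (2 * C) / c"
  have a: "0 < a" "a \<le> 1" using tau N by (auto simp: a_def)
  have c: "0 < c" using k0 tau by (simp add: c_def)
  have K: "0 < K" "K * c = exp (2 * C)" using c by (auto simp: K_def)
  define dk where "dk i x y = ew p i (\<lambda>w. pdist (wprod B w *v x) (wprod B w *v y) powr a)" for i x y
  \<comment> \<open>\<open>U\<close> telescopes: averaging over one letter replaces the first summand by one that is smaller by a factor.\<close>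
  define U where "U x y = (\<Sum>i<N. dk i x y)" for x y
  have U_step: "(\<Sum>j\<in>UNIV. pmf p j * U (B j *v x) (B j *v y)) \<le> U x y - c * pdist x y powr a"
    if "x \<noteq> 0" "y \<noteq> 0" for x y
  proof -
    have "(\<Sum>j\<in>UNIV. pmf p j * U (B j *v x) (B j *v y)) = (\<Sum>i<N. dk (Suc i) x y)"
      unfolding U_def sum_distrib_left dk_def ew.simps wprod_Cons_vec by (rule sum.swap)
    also have "\<dots> = U x y - dk 0 x y + dk N x y"
      unfolding U_def by (induction N) auto
    also have "dk N x y \<le> (1 - c) * pdist x y powr a"
      unfolding dk_def a_def c_def by (rule contraction_step[OF N k tau(1,3,4) that])
    also have "dk 0 x y = pdist x y powr a" by (simp add: dk_def)
    finally show ?thesis by (simp add: algebra_simps)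
  qed
  have "\<bar>mean_grow m x - mean_grow m y\<bar> \<le> K * U x y"
    using x y
  proof (induction m arbitrary: x y)
    case 0
    have "0 \<le> U x y" unfolding U_def dk_def by (intro sum_nonneg ew_nonneg) auto
    then show ?case using K by (simp add: mean_grow_def)
  next
    case (Suc m)
    have "mean_grow (Suc m) x - mean_grow (Suc m) y = (\<Sum>j\<in>UNIV. pmf p j *
        (((ln (norm (B j *v x)) - ln (norm x)) - (ln (norm (B j *v y)) - ln (norm y))) + (mean_grow m (B j *v x) - mean_grow m (B j *v y))))"
      unfolding mean_grow_Suc sum_subtractf[symmetric] by (rule sum.cong) (auto simp: algebra_simps)
    also have "\<bar>\<dots>\<bar> \<le> (\<Sum>j\<in>UNIV. pmf p j * (exp (2 * C) * pdist x y + K * U (B j *v x) (B j *v y)))"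
    proof (rule order_trans[OF sum_abs], rule sum_mono)
      fix j
      have "\<bar>mean_grow m (B j *v x) - mean_grow m (B j *v y)\<bar> \<le> K * U (B j *v x) (B j *v y)"
        by (rule Suc.IH) (use bdd_nz1[OF bounded_by] Suc.prems in auto)
      then have "\<bar>((ln (norm (B j *v x)) - ln (norm x)) - (ln (norm (B j *v y)) - ln (norm y))) + (mean_grow m (B j *v x) - mean_grow m (B j *v y))\<bar>
          \<le> exp (2 * C) * pdist x y + K * U (B j *v x) (B j *v y)"
        using ln_norm_lipschitz[OF Suc.prems, of j] by linarith
      then show "\<bar>pmf p j * (((ln (norm (B j *v x)) - ln (norm x)) - (ln (norm (B j *v y)) - ln (norm y))) + (mean_grow m (B j *v x) - mean_grow m (B j *v y)))\<bar>
          \<le> pmf p j * (exp (2 * C) * pdist x y + K * U (B j *v x) (B j *v y))"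
        by (simp add: abs_mult mult_left_mono)
    qed
    also have "\<dots> = exp (2 * C) * pdist x y + K * (\<Sum>j\<in>UNIV. pmf p j * U (B j *v x) (B j *v y))"
      by (simp add: distrib_left sum.distrib sum_distrib_left mult_ac)
    also have "\<dots> \<le> exp (2 * C) * pdist x y powr a + K * (U x y - c * pdist x y powr a)"
    proof (intro add_mono mult_left_mono U_step Suc.prems)
      show "pdist x y \<le> pdist x y powr a"
        using powr_mono'[of a 1 "pdist x y"] pdist_le_1[of x y] a by simp
    qed (use K in auto)
    also have "\<dots> = K * U x y" using K(2) by (simp add: algebra_simps)
    finally show ?case .
  qed
  also have "K * U x y \<le> K * (\<Sum>i<N. 1)"
    unfolding U_def
  proof (intro mult_left_mono sum_mono)
    fix i
    have "dk i x y \<le> ew p i (\<lambda>_. 1)"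
      unfolding dk_def using pdist_le_1 a by (intro ew_mono powr_le1) auto
    then show "dk i x y \<le> 1" by simp
  qed (use K in simp)
  also have "K * (\<Sum>i<N. 1) = exp (2 * C) * 2 / (k * \<tau>) * N" by (simp add: K_def c_def)
  finally show ?thesis .
qed

text \<open>Starting a second block from a random direction instead of \<open>e1\<close> costs at
  most \<open>D\<close>, so the mean growth is additive up to \<open>D\<close> and stays within
  \<open>D\<close> of a linear function. Azuma's inequality is applied to the two basis vectors,
  whose images bound the operator norm from both sides up to a factor 2.\<close>

lemma ldt_of_oscillation:
  assumes D: "\<And>m x y. x \<noteq> 0 \<Longrightarrow> y \<noteq> 0 \<Longrightarrow> \<bar>mean_grow m x - mean_grow m y\<bar> \<le> D"
  shows "\<exists>L :: real. \<forall>n s. 0 \<le> s \<longrightarrow> pw p n (\<lambda>w. \<bar>lognorm B w - n * L\<bar> > s + 2 * D + 1)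
     \<le> 4 * exp (- s\<^sup>2 / (4 * real n * (D + 2 * C + 1)\<^sup>2))"
proof -
  have C0: "0 \<le> C" by (rule bdd_nonneg[OF bounded_by])
  define e1 :: "real^2" where "e1 = axis 1 1"
  define e2 :: "real^2" where "e2 = axis 2 1"
  have e: "e1 \<noteq> 0" "e2 \<noteq> 0" "norm e1 = 1" "norm e2 = 1" "wedge e1 e2 = 1"
    by (simp_all add: e1_def e2_def axis_eq_0_iff wedge_def) (simp_all add: axis_def)
  have D0: "0 \<le> D" using D[OF e(1,1), of 0] by simp
  have add: "\<bar>mean_grow (m + n) e1 - (mean_grow m e1 + mean_grow n e1)\<bar> \<le> D" for m n
  proof -
    have "\<bar>ew p m (\<lambda>u. mean_grow n (wprod B u *v e1) - mean_grow n e1)\<bar> \<le> ew p m (\<lambda>u. \<bar>mean_grow n (wprod B u *v e1) - mean_grow n e1\<bar>)"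
      by (rule ew_abs_le)
    also have "\<dots> \<le> ew p m (\<lambda>_. D)" by (intro ew_mono D e bdd_nz[OF bounded_by])
    finally show ?thesis by (simp add: mean_grow_add ew_diff)
  qed
  have mult: "\<bar>mean_grow (m * n) e1 - m * mean_grow n e1\<bar> \<le> m * D" for m n
  proof (induction m)
    case (Suc m)
    then show ?case using add[of n "m * n"] by (simp add: algebra_simps)
  qed (simp add: mean_grow_def)
  \<comment> \<open>Almost additivity puts every (g n - D) / n below every (g m + D) / m, where g is
    the mean growth of \<open>e1\<close>; the infimum of the latter separates the two
    families.\<close>
  define L where "L = (INF m\<in>{1..}. (mean_grow m e1 + D) / m)"
  have cross: "(mean_grow n e1 - D) / n \<le> (mean_grow m e1 + D) / m" if "1 \<le> n" "1 \<le> m" for m n :: nat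
  proof -
    have "m * mean_grow n e1 - m * D \<le> n * mean_grow m e1 + n * D"
      using mult[of m n] mult[of n m] by (simp add: mult.commute) 
    then show ?thesis using that by (simp add: field_simps)
  qed
  have bdd: "bdd_below ((\<lambda>m. (mean_grow m e1 + D) / real m) ` {1..})"
    by (rule bdd_belowI[of _ "mean_grow 1 e1 - D"]) (use cross[of 1] in auto)
  have L: "\<bar>mean_grow n e1 - n * L\<bar> \<le> D" for n
  proof (cases "n = 0")
    case False
    then have n: "1 \<le> n" by simp
    have "L \<le> (mean_grow n e1 + D) / n" unfolding L_def by (rule cINF_lower[OF bdd]) (use n in auto)
    moreover have "(mean_grow n e1 - D) / n \<le> L" unfolding L_def by (rule cINF_greatest) (use cross n in auto)
    ultimately show ?thesis using n by (simp add: field_simps abs_le_iff)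
  qed (use D0 in \<open>simp add: mean_grow_def\<close>)
  have dev: "pw p n (\<lambda>w. \<bar>ln (norm (wprod B w *v x)) - mean_grow n x\<bar> > s) \<le> 2 * exp (- s\<^sup>2 / (4 * real n * (D + 2 * C + 1)\<^sup>2))"
    if x: "x \<noteq> 0" "norm x = 1" and s: "0 \<le> s" for n s x
  proof -
    have "pw p n (\<lambda>w. \<bar>addf (\<lambda>j x. ln (norm (B j *v x)) - ln (norm x)) (\<lambda>j x. B j *v x) w x
        - ew p n (\<lambda>w. addf (\<lambda>j x. ln (norm (B j *v x)) - ln (norm x)) (\<lambda>j x. B j *v x) w x)\<bar> > s)
        \<le> 2 * exp (- s\<^sup>2 / (4 * real n * (D + 2 * C + 1)\<^sup>2))"
    proof (rule azuma_addf[where S = "- {0}"])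
      fix m j and x :: "real^2" assume "x \<in> - {0}"
      then have x: "x \<noteq> 0" by simp
      \<comment> \<open>Replacing the first letter changes its own contribution by at most 2 C and
        the mean of the rest by at most \<open>D\<close>. The additional 1 in the martingale bound
        makes it positive, as Azuma's inequality requires.\<close>
      define t where "t i = ln (norm (B i *v x)) - ln (norm x) + mean_grow m (B i *v x)" for i
      have t: "\<bar>t j - t i\<bar> \<le> D + 2 * C" for i
        using D[OF bdd_nz1[OF bounded_by x, of i] bdd_nz1[OF bounded_by x, of j], of m]
          bdd_ln_norm[OF bounded_by x, of "[i]"] bdd_ln_norm[OF bounded_by x, of "[j]"]
        unfolding t_def by simp
      have "t j - mean_grow (Suc m) x = (\<Sum>i\<in>UNIV. pmf p i * (t j - t i))"
        unfolding mean_grow_Suc t_def[symmetric] right_diff_distrib sum_subtractf sum_pmf_const ..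
      also have "\<bar>\<dots>\<bar> \<le> (\<Sum>i\<in>UNIV. pmf p i * (D + 2 * C))"
        by (rule order_trans[OF sum_abs]) (intro sum_mono, simp add: abs_mult mult_left_mono t)
      finally have "\<bar>t j - mean_grow (Suc m) x\<bar> \<le> D + 2 * C + 1" by simp
      then show "\<bar>ln (norm (B j *v x)) - ln (norm x)
         + ew p m (\<lambda>w. addf (\<lambda>j x. ln (norm (B j *v x)) - ln (norm x)) (\<lambda>j x. B j *v x) w (B j *v x))
         - ew p (Suc m) (\<lambda>w. addf (\<lambda>j x. ln (norm (B j *v x)) - ln (norm x)) (\<lambda>j x. B j *v x) w x)\<bar> \<le> D + 2 * C + 1"
        unfolding addf_eq t_def mean_grow_def .
    qed (use bdd_nz1[OF bounded_by] x s D0 C0 in auto)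
    then show ?thesis unfolding addf_eq mean_grow_def[symmetric] using x by simp
  qed
  show ?thesis
  proof (intro exI allI impI)
    fix n :: nat and s :: real assume s: "0 \<le> s"
    have "pw p n (\<lambda>w. \<bar>lognorm B w - n * L\<bar> > s + 2 * D + 1)
        \<le> pw p n (\<lambda>w. \<bar>ln (norm (wprod B w *v e1)) - mean_grow n e1\<bar> > s \<or> \<bar>ln (norm (wprod B w *v e2)) - mean_grow n e2\<bar> > s)"
    proof (rule pw_mono, rule ccontr)
      fix w :: "'a list"
      assume w: "s + 2 * D + 1 < \<bar>lognorm B w - n * L\<bar>"
        and n: "\<not> (\<bar>ln (norm (wprod B w *v e1)) - mean_grow n e1\<bar> > s \<or> \<bar>ln (norm (wprod B w *v e2)) - mean_grow n e2\<bar> > s)"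
      note nz = bdd_nz[OF bounded_by e(1), of w] bdd_nz[OF bounded_by e(2), of w]
      have op: "0 < opnorm (wprod B w)" by (rule opnorm_pos[OF bdd_det(1)[OF bounded_by]])
      define t where "t = n * L + s + 2 * D"
      have le: "ln (norm (wprod B w *v e1)) \<le> t" "ln (norm (wprod B w *v e2)) \<le> t" "n * L - s - D \<le> ln (norm (wprod B w *v e1))"
        using n L[of n] D[OF e(2,1), of n] D0 unfolding t_def by linarith+
      have "norm (wprod B w *v e1) \<le> opnorm (wprod B w)" using opnorm_ge[of "wprod B w" e1] e by simp
      then have "ln (norm (wprod B w *v e1)) \<le> lognorm B w" using nz op by (subst ln_le_cancel_iff) auto
      with le D0 have low: "n * L - s - 2 * D - 1 \<le> lognorm B w" by linarith
      have "norm (wprod B w *v e1) \<le> exp t" "norm (wprod B w *v e2) \<le> exp t"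
        using le nz by (metis exp_le_cancel_iff exp_ln zero_less_norm_iff)+
      then have "opnorm (wprod B w) \<le> 2 * exp t"
        using opnorm_two_points[of "wprod B w" e1 e2] e by simp
      also have "\<dots> \<le> exp (t + 1)"
        using exp_ge_add_one_self[of 1] by (simp add: exp_add mult.commute)
      finally have "lognorm B w \<le> t + 1" by (rule ln_le_of_le_exp[OF op])
      with low w show False unfolding t_def by linarith
    qed
    also have "\<dots> \<le> 2 * exp (- s\<^sup>2 / (4 * real n * (D + 2 * C + 1)\<^sup>2)) + 2 * exp (- s\<^sup>2 / (4 * real n * (D + 2 * C + 1)\<^sup>2))"
      by (rule order_trans[OF pw_disj add_mono[OF dev[OF e(1,3) s] dev[OF e(2,4) s]]])
    finally show "pw p n (\<lambda>w. \<bar>lognorm B w - n * L\<bar> > s + 2 * D + 1) \<le> 4 * exp (- s\<^sup>2 / (4 * real n * (D + 2 * C + 1)\<^sup>2))"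
      by simp
  qed
qed

end

text \<open>Converts the probability bound of \<open>growth_prob\<close> into a bound for the mean.
  The constants are fixed before \<open>p\<close>, \<open>B\<close> and \<open>N\<close>; in
  particular the final length is \<open>M * N\<close> with \<open>M\<close> independent of
  \<open>N\<close>, which preserves linear dependence on \<open>N\<close>.\<close>

lemma growth:
  fixes C kap q :: real
  assumes C: "0 \<le> C" and kap: "0 < kap" and q: "0 \<le> q" "q < 1"
  obtains M :: nat and \<eta> :: real and N0 :: nat where "1 \<le> M" "0 < \<eta>"
    "\<And>(p :: 'a::finite pmf) B N x. bounded_by B C \<Longrightarrow> N0 \<le> N \<Longrightarrow>
      (\<And>x. x \<noteq> 0 \<Longrightarrow> pw p N (\<lambda>u. \<not> balanced B kap u x) \<le> q) \<Longrightarrow>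
      pw p (M * N) (\<lambda>w. \<exists>m\<in>{N..M * N}. ngrow B (take m w) < 3 * kap * m) \<le> \<eta> \<Longrightarrow>
      x \<noteq> 0 \<Longrightarrow> kap / 2 * real (M * N) \<le> ew p (M * N) (\<lambda>w. vgrow B w x)"
proof -
  \<comment> \<open>The allowed failure probability. A failure replaces growth of at most 2 kap per
    letter by a loss of at most 2 C per letter, so it lowers the mean by at most (2 kap + 2 C) e =
    kap / 2 per letter.\<close>
  define e where "e = kap / (4 * (kap + C))"
  have e: "0 < e" using kap C by (simp add: e_def add_pos_nonneg)
  have e': "(2 * kap + 2 * C) * e = kap / 2"
  proof -
    have "kap + C \<noteq> 0" using kap C by simp
    then show ?thesis by (simp add: e_def field_simps)
  qed
  obtain l where l: "q ^ l < e / 2" using real_arch_pow_inv[of "e/2" q] e q by auto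
  define \<eta> where "\<eta> = e / (2 * (real l + 1))"
  have eta: "0 < \<eta>" "l * \<eta> \<le> e / 2" using e by (auto simp: \<eta>_def field_simps)
  \<comment> \<open>The \<open>l\<close> attempts waste 2 l (kap + C) N in total; the extra 1 leaves
    kap N to absorb ln 4.\<close>
  obtain M :: nat where M: "2 * l * (kap + C) / kap + 1 \<le> M" using real_arch_simple by blast
  have M1: "1 \<le> M"
  proof -
    have "0 \<le> 2 * l * (kap + C) / kap" using kap C by simp
    with M show ?thesis by linarith
  qed
  \<comment> \<open>The second summand gives ln 4 at most kap N; the third yields the smallness
    condition of \<open>persistence\<close>, through exp u at least u^2 / 2 at u = 5 kap N.\<close>
  obtain N0 :: nat where N0: "1 + ln 4 / kap + 16 * M * exp (2 * C) / (25 * kap\<^sup>2) \<le> N0" using real_arch_simple by blast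
  show thesis
  proof (rule that[OF M1 eta(1), of N0])
    fix p :: "'a pmf" and B N and x :: "real^2"
    assume bounded_by: "bounded_by B C" and N: "N0 \<le> N"
      and bad: "\<And>x. x \<noteq> 0 \<Longrightarrow> pw p N (\<lambda>u. \<not> balanced B kap u x) \<le> q"
      and H: "pw p (M * N) (\<lambda>w. \<exists>m\<in>{N..M * N}. ngrow B (take m w) < 3 * kap * m) \<le> \<eta>"
      and x: "x \<noteq> 0"
    have nn: "0 \<le> ln 4 / kap" "0 \<le> 16 * M * exp (2 * C) / (25 * kap\<^sup>2)" using kap by auto
    have Nr: "real N0 \<le> real N" using N by simp
    have "ln 4 / kap \<le> N" using N0 nn Nr by linarith
    then have N4: "ln 4 \<le> kap * N" using kap by (simp add: field_simps)
    have "16 * M * exp (2 * C) / (25 * kap\<^sup>2) \<le> N" using N0 nn Nr by linarith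
    then have N5: "16 * M * exp (2 * C) \<le> 25 * kap\<^sup>2 * N" using kap by (simp add: field_simps)
    define T where "T = M * N"
    define thr where "thr = 2 * kap * (real T - l * N) - ln 4 - 2 * C * l * N"
    have small: "16 * exp (2 * C - 4 * kap * N) * T \<le> 2 * exp (kap * N)"
    proof -
      have "16 * exp (2 * C) * T = (16 * M * exp (2 * C)) * N" by (simp add: T_def)
      also have "\<dots> \<le> (25 * kap\<^sup>2 * N) * N" by (intro mult_right_mono N5) auto
      also have "\<dots> = 2 * ((5 * kap * N)\<^sup>2 / 2)" by (simp add: power2_eq_square)
      also have "\<dots> \<le> 2 * exp (5 * kap * N)"
        using exp_lower_Taylor_quadratic[of "5 * kap * N"] kap mult_nonneg_nonneg[of "5 * kap" "real N"] by linarith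
      finally have *: "16 * exp (2 * C) * T \<le> 2 * exp (5 * kap * N)" .
      have "16 * exp (2 * C - 4 * kap * N) * T = (16 * exp (2 * C) * T) * exp (- (4 * kap * N))"
        by (simp add: exp_diff exp_minus field_simps)
      also have "\<dots> \<le> 2 * exp (5 * kap * N) * exp (- (4 * kap * N))"
        by (intro mult_right_mono *) auto
      also have "\<dots> = 2 * exp (kap * N)" by (simp flip: exp_add)
      finally show ?thesis .
    qed
    have lN: "l * N \<le> T"
    proof -
      have "2 * (real l * kap) \<le> 2 * l * (kap + C)" using C by (simp add: algebra_simps)
      then have "2 * real l \<le> 2 * l * (kap + C) / kap" using kap by (simp add: field_simps)
      with M have "real l \<le> M" by linarith
      then show ?thesis by (simp add: T_def)
    qed
    have P: "pw p T (\<lambda>w. vgrow B w x < thr) \<le> e"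
    proof -
      have "pw p T (\<lambda>w. vgrow B w x < thr) \<le> q ^ l + l * \<eta>"
        unfolding thr_def
        by (rule growth_prob[OF bounded_by, where T0 = T]) (use kap q bad H small x lN in \<open>auto simp: T_def\<close>)
      with l eta show ?thesis by linarith
    qed
    have thr: "kap * T \<le> thr"
    proof -
      have "2 * l * (kap + C) + kap \<le> kap * M" using M kap by (simp add: field_simps)
      then have "(2 * l * (kap + C) + kap) * N \<le> kap * M * N" by (intro mult_right_mono) auto
      with N4 show ?thesis by (simp add: thr_def T_def algebra_simps)
    qed
    have "thr - (2 * kap + 2 * C) * T * pw p T (\<lambda>w. vgrow B w x < thr)
        = ew p T (\<lambda>w. thr - (2 * kap + 2 * C) * T * of_bool (vgrow B w x < thr))"
      unfolding pw_def ew_cmult[symmetric] ew_diff by simp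
    also have "\<dots> \<le> ew p T (\<lambda>w. vgrow B w x)"
    proof (rule ew_mono)
      fix w :: "'a list" assume w: "length w = T"
      have "thr \<le> 2 * kap * T"
      proof -
        have "0 \<le> kap * (l * N)" "0 \<le> C * (l * N)" using kap C by auto
        then show ?thesis by (simp add: thr_def algebra_simps)
      qed
      then show "thr - (2 * kap + 2 * C) * T * of_bool (vgrow B w x < thr) \<le> vgrow B w x"
        using vgrow_abs_le[OF bounded_by x, of w] w by (auto simp: algebra_simps)
    qed
    finally have "thr - (2 * kap + 2 * C) * T * pw p T (\<lambda>w. vgrow B w x < thr) \<le> ew p T (\<lambda>w. vgrow B w x)" .
    moreover have "(2 * kap + 2 * C) * T * pw p T (\<lambda>w. vgrow B w x < thr) \<le> (2 * kap + 2 * C) * T * e"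
      using kap C by (intro mult_left_mono P) auto
    moreover have "(2 * kap + 2 * C) * T * e = kap / 2 * T"
      using e' by (metis (no_types, opaque_lifting) mult.assoc mult.commute)
    ultimately show "kap / 2 * real (M * N) \<le> ew p (M * N) (\<lambda>w. vgrow B w x)"
      using thr unfolding T_def by linarith
  qed
qed

text \<open>The exponent \<tau> depends on \<open>C\<close> and \<open>k\<close> alone, so one
  \<open>D\<close> serves all \<open>p\<close>, \<open>B\<close> and \<open>N\<close> and the
  oscillation is at most \<open>D * N\<close>.\<close>

lemma oscillation_of_growth:
  fixes C k :: real
  assumes C: "0 \<le> C" and k: "0 < k"
  obtains D where "0 < D"
    "\<And>(p :: 'a::finite pmf) B N m x y. bounded_by B C \<Longrightarrow> 1 \<le> N \<Longrightarrow>
      (\<And>x. x \<noteq> 0 \<Longrightarrow> k * N \<le> ew p N (\<lambda>w. vgrow B w x)) \<Longrightarrow> x \<noteq> 0 \<Longrightarrow> y \<noteq> 0 \<Longrightarrow>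
      \<bar>mean_grow B p m x - mean_grow B p m y\<bar> \<le> D * N"
proof -
  define \<tau> where "\<tau> = min 1 (min (1 / (2 * C + 1)) (k / (8 * C\<^sup>2 + 1)))"
  have pos: "0 < 2 * C + 1" "0 < 8 * C\<^sup>2 + 1" using C by (auto simp: add_nonneg_pos)
  have t: "\<tau> \<le> 1" "\<tau> \<le> 1 / (2 * C + 1)" "\<tau> \<le> k / (8 * C\<^sup>2 + 1)" "0 < \<tau>"
    using pos k by (auto simp: \<tau>_def)
  have "(2 * C + 1) * \<tau> \<le> 1" "(8 * C\<^sup>2 + 1) * \<tau> \<le> k" using t pos by (simp_all add: field_simps)
  with t(4) have t2: "2 * C * \<tau> \<le> 1" "8 * C\<^sup>2 * \<tau> \<le> k" by (simp_all add: distrib_right)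
  show thesis
  proof (rule that[of "exp (2 * C) * 2 / (k * \<tau>)"])
    show "0 < exp (2 * C) * 2 / (k * \<tau>)" using k t by simp
  qed (rule oscillation_bound; (assumption | rule k t t2))
qed

section \<open>Subadditive functionals and the Lyapunov gap\<close>

text \<open>For small \<open>l\<close> the negative linear term beats the quadratic remainder. The
  bound of \<open>l\<close> by 1 is recorded because \<open>l\<close> later becomes an exponent for
  which powers are subadditive.\<close>

lemma ew_exp_less_1:
  assumes "\<And>w. length w = m \<Longrightarrow> \<bar>Y w\<bar> \<le> K" "ew p m Y < 0"
  obtains l where "0 < l" "l \<le> 1" "ew p m (\<lambda>w. exp (l * Y w)) < 1"
proof -
  define b where "b = - ew p m Y"
  have b: "0 < b" using assms by (simp add: b_def)
  define K' where "K' = max K 1"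
  have K': "1 \<le> K'" "\<And>w. length w = m \<Longrightarrow> \<bar>Y w\<bar> \<le> K'" using assms(1) by (auto simp: K'_def intro: le_max_iff_disj[THEN iffD2])
  define l where "l = min (1 / K') (b / (2 * K'\<^sup>2))"
  have l: "0 < l" "l * K' \<le> 1" "2 * l * K'\<^sup>2 \<le> b" "l \<le> 1"
  proof -
    show "0 < l" using K'(1) b by (simp add: l_def)
    have "l \<le> 1 / K'" "l \<le> b / (2 * K'\<^sup>2)" by (simp_all add: l_def)
    then show "l * K' \<le> 1" "2 * l * K'\<^sup>2 \<le> b" using K'(1) by (simp_all add: field_simps)
    have "1 / K' \<le> 1" using K'(1) by simp
    with \<open>l \<le> 1 / K'\<close> show "l \<le> 1" by linarith
  qed
  have "ew p m (\<lambda>w. exp (l * Y w)) \<le> ew p m (\<lambda>w. l * Y w + (1 + (l * K')\<^sup>2))"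
  proof (rule ew_mono)
    fix w :: "'a list" assume "length w = m"
    then have *: "\<bar>l * Y w\<bar> \<le> l * K'" using K'(2) l(1) by (simp add: abs_mult)
    then have "(l * Y w)\<^sup>2 \<le> (l * K')\<^sup>2" by (metis abs_ge_zero power2_abs power_mono)
    then show "exp (l * Y w) \<le> l * Y w + (1 + (l * K')\<^sup>2)"
      using exp_le_quadratic[of "l * Y w"] * l(2) by linarith
  qed
  also have "\<dots> = l * (- b) + (1 + (l * K')\<^sup>2)"
    by (simp only: ew_add ew_cmult ew_const b_def minus_minus)
  also have "\<dots> = 1 - l * b + l * (2 * l * K'\<^sup>2) / 2" by (simp add: power2_eq_square algebra_simps)
  also have "\<dots> \<le> 1 - l * b + l * b / 2" using l by (intro add_left_mono divide_right_mono mult_left_mono) auto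
  also have "\<dots> < 1" using mult_pos_pos[OF l(1) b] by (simp add: mult.commute)
  finally show thesis using that l(1,4) by blast
qed

text \<open>Exponential upper tails by cutting a word into independent blocks of length \<open>m\<close>.\<close>
lemma subadditive_upper_tail:
  fixes p :: "'a::finite pmf" and X :: "'a list \<Rightarrow> real" and K c :: real
  assumes sub: "\<And>u v. X (u @ v) \<le> X u + X v" and bnd: "\<And>w. \<bar>X w\<bar> \<le> K * length w" and K: "0 \<le> K"
    and m: "1 \<le> m" "ew p m X < m * c"
  obtains K2 r where "0 < r" "\<And>n. pw p n (\<lambda>w. n * c \<le> X w) \<le> K2 * exp (- r * n)"
proof -
  obtain l where l: "0 < l" and th1: "ew p m (\<lambda>w. exp (l * (X w - m * c))) < 1"
  proof (rule ew_exp_less_1[of m "\<lambda>w. X w - m * c" "K * m + \<bar>m * c\<bar>" p])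
    show "\<bar>X w - m * c\<bar> \<le> K * m + \<bar>m * c\<bar>" if "length w = m" for w
      using bnd[of w] that abs_triangle_ineq4[of "X w" "m * c"] by simp
    show "ew p m (\<lambda>w. X w - m * c) < 0" using m by (simp add: ew_diff)
  qed
  define \<theta> where "\<theta> = ew p m (\<lambda>w. exp (l * (X w - m * c)))"
  define K1 where "K1 = exp (l * (K + \<bar>c\<bar>) * m)"
  have th0: "0 < \<theta>"
  proof -
    have "0 < exp (- l * (K * m + \<bar>m * c\<bar>))" by simp
    also have "\<dots> = ew p m (\<lambda>_. exp (- l * (K * m + \<bar>m * c\<bar>)))" by simp
    also have "\<dots> \<le> \<theta>"
      unfolding \<theta>_def
    proof (rule ew_mono)
      fix w :: "'a list" assume w: "length w = m"
      have "- (K * m + \<bar>m * c\<bar>) \<le> X w - m * c"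
        using bnd[of w] abs_ge_self[of "m * c"] unfolding w by linarith
      then show "exp (- l * (K * m + \<bar>m * c\<bar>)) \<le> exp (l * (X w - m * c))"
        using l by (metis exp_le_cancel_iff mult_le_cancel_left_pos mult_minus_left mult_minus_right)
    qed
    finally show ?thesis .
  qed
  have mgf: "ew p (q * m + s) (\<lambda>w. exp (l * (X w - real (q * m + s) * c))) \<le> \<theta> ^ q * exp (l * (K + \<bar>c\<bar>) * s)" for q s
  proof (induction q)
    case 0
    have "ew p s (\<lambda>w. exp (l * (X w - s * c))) \<le> ew p s (\<lambda>w. exp (l * (K + \<bar>c\<bar>) * s))"
    proof (rule ew_mono)
      fix w :: "'a list" assume w: "length w = s"
      have "s * (- c) \<le> s * \<bar>c\<bar>" by (intro mult_left_mono) auto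
      then have "X w - s * c \<le> (K + \<bar>c\<bar>) * s" using bnd[of w] w by (simp add: algebra_simps)
      then show "exp (l * (X w - s * c)) \<le> exp (l * (K + \<bar>c\<bar>) * s)" using l by simp
    qed
    then show ?case by simp
  next
    case (Suc q)
    let ?n = "q * m + s"
    have "ew p (m + ?n) (\<lambda>w. exp (l * (X w - real (m + ?n) * c)))
        \<le> ew p m (\<lambda>u. ew p ?n (\<lambda>v. exp (l * (X u - m * c)) * exp (l * (X v - real ?n * c))))"
      unfolding ew_append
    proof (intro ew_mono)
      fix u v :: "'a list"
      have "l * (X (u @ v) - real (m + ?n) * c) \<le> l * ((X u - m * c) + (X v - real ?n * c))"
        using sub[of u v] l by (intro mult_left_mono) (auto simp: algebra_simps)
      then show "exp (l * (X (u @ v) - real (m + ?n) * c)) \<le> exp (l * (X u - m * c)) * exp (l * (X v - real ?n * c))"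
        unfolding exp_add[symmetric] by (simp add: algebra_simps)
    qed
    also have "\<dots> = \<theta> * ew p ?n (\<lambda>v. exp (l * (X v - real ?n * c)))"
      by (simp only: ew_cmult ew_mult_right \<theta>_def)
    also have "\<dots> \<le> \<theta> * (\<theta> ^ q * exp (l * (K + \<bar>c\<bar>) * s))"
      using th0 Suc by (intro mult_left_mono) auto
    finally show ?case by (simp add: algebra_simps)
  qed
  show thesis
  proof (rule that[of "- ln \<theta> / m" "K1 / \<theta>"])
    show "0 < - ln \<theta> / m" using th0 th1 m by (simp add: \<theta>_def field_simps)
    fix n
    define q where "q = n div m"
    define s where "s = n mod m"
    have n: "n = q * m + s" by (simp add: q_def s_def)
    have s: "s \<le> m" using m by (simp add: s_def less_imp_le)
    have "pw p n (\<lambda>w. n * c \<le> X w) \<le> pw p n (\<lambda>w. 1 \<le> exp (l * (X w - n * c)))"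
      by (rule pw_mono) (use l in simp)
    also have "\<dots> \<le> ew p n (\<lambda>w. exp (l * (X w - n * c))) / 1"
      by (rule pw_Markov) auto
    also have "\<dots> \<le> \<theta> ^ q * exp (l * (K + \<bar>c\<bar>) * s)" using mgf[of q s] n by simp
    also have "\<dots> \<le> \<theta> ^ q * K1"
    proof -
      have "l * (K + \<bar>c\<bar>) * s \<le> l * (K + \<bar>c\<bar>) * m" using l K s by (intro mult_left_mono) auto
      then show ?thesis unfolding K1_def using th0 by (intro mult_left_mono) auto
    qed
    also have "\<theta> ^ q \<le> exp (- (- ln \<theta> / m) * n) / \<theta>"
    proof -
      have "real n \<le> (q + 1) * m" using n s by (simp add: algebra_simps flip: of_nat_mult of_nat_add)
      then have "real n / m - 1 \<le> q" using m by (simp add: field_simps)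
      then have "q * ln \<theta> \<le> (real n / m - 1) * ln \<theta>"
        using th0 th1 by (intro mult_right_mono_neg) (auto simp: \<theta>_def)
      then have "exp (q * ln \<theta>) \<le> exp ((real n / m - 1) * ln \<theta>)" by simp
      moreover have "exp (q * ln \<theta>) = \<theta> ^ q" using th0 by (simp add: exp_of_nat_mult)
      moreover have "exp ((real n / m - 1) * ln \<theta>) = exp (- (- ln \<theta> / m) * n) / \<theta>"
        using th0 by (simp add: left_diff_distrib exp_diff)
      ultimately show ?thesis by simp
    qed
    finally show "pw p n (\<lambda>w. n * c \<le> X w) \<le> K1 / \<theta> * exp (- (- ln \<theta> / m) * n)"
      by (simp add: K1_def mult_right_mono mult.commute)
  qed
qed

lemma summable_exp_decay: "0 < r \<Longrightarrow> summable (\<lambda>n. K * exp (- r * real n) :: real)"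
proof -
  assume r: "0 < r"
  have "summable (\<lambda>n. K * exp (- r) ^ n)" by (intro summable_mult summable_geometric) (use r in auto)
  then show ?thesis by (simp add: exp_of_nat_mult[symmetric] mult.commute)
qed

text \<open>The mean is at least n g, and the upper tail leaves almost no mass above n (g + d); a
  mass larger than \<eta> below n (g - \<epsilon>) would pull the mean under n g. With d =
  \<epsilon> \<eta> / 2 the two small errors add up to \<epsilon> \<eta>. Subadditivity gives
  smallness here but no rate, which shapes \<open>ngrow_grid\<close>.\<close>

lemma subadditive_lower_tail:
  fixes p :: "'a::finite pmf" and X :: "'a list \<Rightarrow> real" and g \<epsilon> \<eta> K :: real
  assumes sub: "\<And>u v. X (u @ v) \<le> X u + X v" and bnd: "\<And>w. \<bar>X w\<bar> \<le> K * length w" and K: "0 \<le> K"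
    and g: "\<And>n. n * g \<le> ew p n X" "\<And>\<epsilon>. 0 < \<epsilon> \<Longrightarrow> \<exists>m\<ge>1. ew p m X < real m * (g + \<epsilon>)"
    and e: "0 < \<epsilon>" "0 < \<eta>"
  obtains N0 where "\<And>n. N0 \<le> n \<Longrightarrow> pw p n (\<lambda>w. X w < n * (g - \<epsilon>)) \<le> \<eta>"
proof -
  define d where "d = \<epsilon> * \<eta> / 2"
  have d: "0 < d" using e by (simp add: d_def)
  obtain m where m: "1 \<le> m" "ew p m X < real m * (g + d)" using g(2)[OF d] by blast
  obtain K2 r where r: "0 < r" "\<And>n. pw p n (\<lambda>w. n * (g + d) \<le> X w) \<le> K2 * exp (- r * n)"
    by (rule subadditive_upper_tail[OF sub bnd K m]) blast
  have "(\<lambda>n. (K + \<bar>g\<bar>) * (K2 * exp (- r * real n))) \<longlonglongrightarrow> 0"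
    by (intro tendsto_mult_right_zero summable_LIMSEQ_zero[OF summable_exp_decay] r)
  then have "eventually (\<lambda>n. (K + \<bar>g\<bar>) * (K2 * exp (- r * real n)) < d) sequentially"
    using d by (rule order_tendstoD)
  then obtain N0 where N0: "\<And>n. N0 \<le> n \<Longrightarrow> (K + \<bar>g\<bar>) * (K2 * exp (- r * real n)) < d"
    by (auto simp: eventually_sequentially)
  show thesis
  proof (rule that[of "max N0 1"])
    fix n assume n: "max N0 1 \<le> n"
    let ?up = "pw p n (\<lambda>w. n * (g + d) \<le> X w)" and ?lo = "pw p n (\<lambda>w. X w < n * (g - \<epsilon>))"
    have "n * g \<le> ew p n X" by (rule g)
    also have "\<dots> \<le> ew p n (\<lambda>w. n * (g + d) + (n * (K + \<bar>g\<bar>)) * of_bool (n * (g + d) \<le> X w) - (n * \<epsilon>) * of_bool (X w < n * (g - \<epsilon>)))"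
    proof (rule ew_mono)
      fix w :: "'a list" assume w: "length w = n"
      have a: "X w \<le> n * K" using bnd[of w] w by (simp add: mult.commute)
      have b: "n * (g - \<epsilon>) \<le> n * (g + d)" using d e by (intro mult_left_mono) auto
      have c: "0 \<le> n * (g + d + \<bar>g\<bar>)" using d by (intro mult_nonneg_nonneg) auto
      have f: "0 \<le> n * d" using d by simp
      show "X w \<le> n * (g + d) + (n * (K + \<bar>g\<bar>)) * of_bool (n * (g + d) \<le> X w) - (n * \<epsilon>) * of_bool (X w < n * (g - \<epsilon>))"
        using a b c f by (cases "n * (g + d) \<le> X w"; cases "X w < n * (g - \<epsilon>)") (auto simp: algebra_simps)
    qed
    also have "\<dots> = n * ((g + d) + (K + \<bar>g\<bar>) * ?up - \<epsilon> * ?lo)"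
      by (simp only: ew_add ew_diff ew_cmult ew_const pw_def) (simp add: algebra_simps)
    finally have "g \<le> (g + d) + (K + \<bar>g\<bar>) * ?up - \<epsilon> * ?lo" using n by simp
    moreover have "(K + \<bar>g\<bar>) * ?up \<le> (K + \<bar>g\<bar>) * (K2 * exp (- r * real n))"
      using K r by (intro mult_left_mono) auto
    moreover have "(K + \<bar>g\<bar>) * (K2 * exp (- r * real n)) < d" using N0 n by simp
    ultimately have "\<epsilon> * ?lo \<le> \<epsilon> * \<eta>" by (simp add: d_def)
    then show "?lo \<le> \<eta>" using e by simp
  qed
qed

section \<open>The gap and the two Lyapunov exponents\<close>

lemma matrix_inv_mult:
  assumes "invertible M"
  shows "M ** matrix_inv M = mat 1" "matrix_inv M ** M = mat 1"
  using someI_ex[OF assms[unfolded invertible_def]] by (auto simp: matrix_inv_def)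

text \<open>The determinant is the product of the singular values. The bound compares the area
  spanned by \<open>x\<close> and an orthogonal vector with its image; applied to \<open>M\<close>
  and to its inverse it gives both inequalities.\<close>

lemma opnorm_matrix_inv:
  fixes M :: mat2
  assumes "det M \<noteq> 0"
  shows "opnorm (matrix_inv M) = opnorm M / \<bar>det M\<bar>"
proof -
  have *: "opnorm N \<le> opnorm M / \<bar>det M\<bar>" if "M ** N = mat 1" for M N :: mat2
  proof (rule opnorm_le)
    fix y
    define x where "x = N *v y"
    have y: "M *v x = y" using that by (simp add: x_def matrix_vector_mul_assoc)
    obtain z where z: "norm z = norm x" "wedge x z = (norm x)\<^sup>2" by (rule wedge_exists)
    have "det M * det N = 1" using that by (metis det_I det_mul)
    then have d: "det M \<noteq> 0" by auto
    have "\<bar>det M\<bar> * (norm x)\<^sup>2 = \<bar>wedge (M *v x) (M *v z)\<bar>"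
      unfolding wedge_matrix z by (simp add: abs_mult)
    also have "\<dots> \<le> norm y * (opnorm M * norm x)"
      unfolding y using order_trans[OF wedge_le mult_left_mono[OF opnorm_ge[of M z]]] z by simp
    finally have "\<bar>det M\<bar> * norm x \<le> norm y * opnorm M"
      by (cases "x = 0") (auto simp: power2_eq_square)
    then show "norm (N *v y) \<le> opnorm M / \<bar>det M\<bar> * norm y"
      using d by (simp add: x_def[symmetric] field_simps)
  qed
  have inv: "M ** matrix_inv M = mat 1" "matrix_inv M ** M = mat 1"
    using assms invertible_det_nz matrix_inv_mult by blast+
  have d: "det (matrix_inv M) = 1 / det M"
    using inv(1) assms by (metis det_I det_mul nonzero_mult_div_cancel_left)
  show ?thesis
    using *[OF inv(1)] *[OF inv(2)] assms by (simp add: d field_simps)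
qed

text \<open>Plays the role of half the difference of the exponents. As an infimum it bounds the mean
  of \<open>ngrow\<close> from below at every length; the link with the exponents is
  \<open>exponents_eq_of_gap_zero\<close>.\<close>

definition gap :: "'a::finite pmf \<Rightarrow> ('a \<Rightarrow> mat2) \<Rightarrow> real" where
  "gap p B = (INF n\<in>{1..}. ew p n (ngrow B) / n)"

context
  fixes B :: "'a::finite \<Rightarrow> mat2" and C :: real and p :: "'a pmf"
  assumes bounded_by: "bounded_by B C"
begin

lemma gap_bdd_below: "bdd_below ((\<lambda>n. ew p n (ngrow B) / real n) ` {1..})"
  by (rule bdd_belowI[of _ 0]) (auto intro!: divide_nonneg_nonneg ew_nonneg ngrow_nonneg[OF bounded_by])

lemma gap_nonneg: "0 \<le> gap p B"
  unfolding gap_def by (rule cINF_greatest) (auto intro!: divide_nonneg_nonneg ew_nonneg ngrow_nonneg[OF bounded_by])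

lemma gap_le: "n * gap p B \<le> ew p n (ngrow B)"
proof (cases "n = 0")
  case True
  then show ?thesis by (simp add: ngrow_nonneg[OF bounded_by])
next
  case False
  then have "gap p B \<le> ew p n (ngrow B) / n"
    unfolding gap_def by (intro cINF_lower gap_bdd_below) auto
  then show ?thesis using False by (simp add: field_simps)
qed

lemma gap_approx:
  assumes "0 < \<epsilon>"
  shows "\<exists>m\<ge>1. ew p m (ngrow B) < real m * (gap p B + \<epsilon>)"
proof -
  have "(INF n\<in>{1..}. ew p n (ngrow B) / n) < gap p B + \<epsilon>" using assms by (simp add: gap_def)
  then obtain m where "1 \<le> m" "ew p m (ngrow B) / m < gap p B + \<epsilon>"
    using gap_bdd_below by (auto simp: cINF_less_iff)
  then show ?thesis by (intro exI[of _ m]) (auto simp: field_simps)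
qed

lemma ngrow_abs_le: "\<bar>ngrow B w\<bar> \<le> 2 * C * length w"
  using ngrow_nonneg[OF bounded_by, of w] ngrow_le[OF bounded_by, of w] by simp

text \<open>ln |det| is exactly additive, so it and its negative are both subadditive, and blocks of
  length 1 already have the right mean.\<close>

lemma summable_det_tail:
  fixes \<mu> \<epsilon> :: real
  defines "\<mu> \<equiv> \<Sum>j\<in>UNIV. pmf p j * ln \<bar>det (B j)\<bar>"
  assumes e: "0 < \<epsilon>"
  shows "summable (\<lambda>n. pw p n (\<lambda>w. \<epsilon> * n \<le> \<bar>ln \<bar>det (wprod B w)\<bar> - n * \<mu>\<bar>))"
proof -
  let ?X = "\<lambda>s w. s * ln \<bar>det (wprod B w)\<bar>"
  have app: "?X s (u @ v) = ?X s u + ?X s v" for s u v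
    using bdd_det(1)[OF bounded_by, of u] bdd_det(1)[OF bounded_by, of v] by (simp add: wprod_append det_mul abs_mult ln_mult algebra_simps)
  have bnd: "\<bar>?X s w\<bar> \<le> 2 * C * length w" if "s = 1 \<or> s = -1" for s w
    using bdd_det(2)[OF bounded_by, of w] that by auto
  have C0: "0 \<le> 2 * C" using bdd_nonneg[OF bounded_by] by simp
  have mean: "ew p 1 (?X s) = s * \<mu>" for s by (simp add: \<mu>_def sum_distrib_left mult_ac)
  obtain K1 r1 where 1: "0 < r1" "\<And>n. pw p n (\<lambda>w. n * (\<mu> + \<epsilon>) \<le> ?X 1 w) \<le> K1 * exp (- r1 * n)"
    by (rule subadditive_upper_tail[of "?X 1" "2 * C" 1 p "\<mu> + \<epsilon>"])
       (use app[of 1] bnd[of 1] C0 mean[of 1] e in auto)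
  obtain K2 r2 where 2: "0 < r2" "\<And>n. pw p n (\<lambda>w. n * (- \<mu> + \<epsilon>) \<le> ?X (-1) w) \<le> K2 * exp (- r2 * n)"
    by (rule subadditive_upper_tail[of "?X (-1)" "2 * C" 1 p "- \<mu> + \<epsilon>"])
       (use app[of "-1"] bnd[of "-1"] C0 mean[of "-1"] e in auto)
  show ?thesis
  proof (rule summable_comparison_test')
    show "summable (\<lambda>n. K1 * exp (- r1 * real n) + K2 * exp (- r2 * real n))"
      by (intro summable_add summable_exp_decay 1 2)
    fix n :: nat
    have "pw p n (\<lambda>w. \<epsilon> * n \<le> \<bar>ln \<bar>det (wprod B w)\<bar> - n * \<mu>\<bar>)
        \<le> pw p n (\<lambda>w. n * (\<mu> + \<epsilon>) \<le> ?X 1 w \<or> n * (- \<mu> + \<epsilon>) \<le> ?X (-1) w)"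
      by (rule pw_mono) (auto simp: algebra_simps abs_real_def split: if_splits)
    also have "\<dots> \<le> K1 * exp (- r1 * real n) + K2 * exp (- r2 * real n)"
      by (intro order_trans[OF pw_disj] add_mono 1 2)
    finally show "norm (pw p n (\<lambda>w. \<epsilon> * n \<le> \<bar>ln \<bar>det (wprod B w)\<bar> - n * \<mu>\<bar>)) \<le> K1 * exp (- r1 * real n) + K2 * exp (- r2 * real n)"
      by simp
  qed
qed

text \<open>The two quantities that define the exponents are half of ln |det| plus and minus
  \<open>ngrow\<close>; the sign \<open>s\<close> covers both. If the gap vanishes,
  \<open>ngrow\<close> exceeds \<epsilon> n / 2 with exponentially small probability, so both limits
  equal half the mean of ln |det|.\<close>

lemma exponents_eq_of_gap_zero:
  assumes "gap p B = 0"
  shows "Lplus p B = Lminus p B"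
proof -
  define \<mu> where "\<mu> = (\<Sum>j\<in>UNIV. pmf p j * ln \<bar>det (B j)\<bar>)"
  have C0: "0 \<le> 2 * C" using bdd_nonneg[OF bounded_by] by simp
  have inv: "ln (inverse (opnorm (matrix_inv (wprod B w)))) = ln \<bar>det (wprod B w)\<bar> / 2 - ngrow B w" for w
    using bdd_det(1)[OF bounded_by, of w] opnorm_pos[OF bdd_det(1)[OF bounded_by, of w]]
    by (simp add: opnorm_matrix_inv ngrow_def ln_div)
  have sum: "summable (\<lambda>n. pw p n (\<lambda>w. \<bar>ln \<bar>det (wprod B w)\<bar> / 2 + s * ngrow B w - n * (\<mu> / 2)\<bar> > \<epsilon> * n))"
    if e: "0 < \<epsilon>" and s: "\<bar>s\<bar> = 1" for \<epsilon> s :: real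
  proof -
    obtain m where m: "1 \<le> m" "ew p m (ngrow B) < real m * (\<epsilon> / 2)"
      using gap_approx[of "\<epsilon> / 2"] assms e by auto
    obtain K r where r: "0 < r" "\<And>n. pw p n (\<lambda>w. n * (\<epsilon> / 2) \<le> ngrow B w) \<le> K * exp (- r * n)"
      by (rule subadditive_upper_tail[OF ngrow_append[OF bounded_by] ngrow_abs_le C0 m]) blast
    show ?thesis
    proof (rule summable_comparison_test')
      show "summable (\<lambda>n. K * exp (- r * real n) + pw p n (\<lambda>w. \<epsilon> * n \<le> \<bar>ln \<bar>det (wprod B w)\<bar> - n * \<mu>\<bar>))"
        unfolding \<mu>_def by (intro summable_add summable_exp_decay summable_det_tail r e)
      fix n :: nat
      have "pw p n (\<lambda>w. \<bar>ln \<bar>det (wprod B w)\<bar> / 2 + s * ngrow B w - n * (\<mu> / 2)\<bar> > \<epsilon> * n)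
          \<le> pw p n (\<lambda>w. n * (\<epsilon> / 2) \<le> ngrow B w \<or> \<epsilon> * n \<le> \<bar>ln \<bar>det (wprod B w)\<bar> - n * \<mu>\<bar>)"
      proof (rule pw_mono)
        fix w assume *: "\<bar>ln \<bar>det (wprod B w)\<bar> / 2 + s * ngrow B w - n * (\<mu> / 2)\<bar> > \<epsilon> * n"
        have "\<bar>s * ngrow B w\<bar> = ngrow B w" using s ngrow_nonneg[OF bounded_by, of w] by (simp add: abs_mult)
        moreover have "n * (\<mu> / 2) = n * \<mu> / 2" "n * (\<epsilon> / 2) = \<epsilon> * n / 2" by simp_all
        ultimately show "n * (\<epsilon> / 2) \<le> ngrow B w \<or> \<epsilon> * n \<le> \<bar>ln \<bar>det (wprod B w)\<bar> - n * \<mu>\<bar>"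
          using * by linarith
      qed
      also have "\<dots> \<le> K * exp (- r * real n) + pw p n (\<lambda>w. \<epsilon> * n \<le> \<bar>ln \<bar>det (wprod B w)\<bar> - n * \<mu>\<bar>)"
        by (intro order_trans[OF pw_disj] add_mono r order_refl)
      finally show "norm (pw p n (\<lambda>w. \<bar>ln \<bar>det (wprod B w)\<bar> / 2 + s * ngrow B w - n * (\<mu> / 2)\<bar> > \<epsilon> * n))
          \<le> K * exp (- r * real n) + pw p n (\<lambda>w. \<epsilon> * n \<le> \<bar>ln \<bar>det (wprod B w)\<bar> - n * \<mu>\<bar>)"
        by simp
    qed
  qed
  have "Lplus p B = \<mu> / 2"
    by (rule Lplus_eqI) (use sum[of _ 1] in \<open>simp add: ngrow_def\<close>)
  moreover have "Lminus p B = \<mu> / 2"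
    by (rule Lminus_eqI) (use sum[of _ "-1"] in \<open>simp add: inv\<close>)
  ultimately show ?thesis by simp
qed

end

section \<open>Bounds for a cocycle and its neighbours\<close>

lemma opnorm_diff_le_cdist: "opnorm (A j - B j) \<le> cdist A B"
  unfolding cdist_def by (rule Max_ge) auto

lemma bdd_exists:
  assumes "GL2_cocycle (A :: 'a::finite \<Rightarrow> mat2)"
  obtains C where "bounded_by A C"
proof -
  define C where "C = (\<Sum>j\<in>UNIV. \<bar>ln (opnorm (A j))\<bar> + \<bar>ln (opnorm (matrix_inv (A j)))\<bar>)"
  have le: "\<bar>ln (opnorm (A j))\<bar> + \<bar>ln (opnorm (matrix_inv (A j)))\<bar> \<le> C" for j
    unfolding C_def by (rule member_le_sum) auto
  have inv: "invertible (A j)" for j using assms by (simp add: GL2_cocycle_def)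
  have inv': "A j ** matrix_inv (A j) = mat 1" "matrix_inv (A j) ** A j = mat 1" for j
    using matrix_inv_mult[OF inv] by auto
  have d: "det (A j) \<noteq> 0" "det (matrix_inv (A j)) \<noteq> 0" for j
    using inv' inv by (metis det_I det_mul mult_eq_0_iff zero_neq_one)+
  have e: "opnorm (A j) \<le> exp C" "opnorm (matrix_inv (A j)) \<le> exp C" for j
  proof -
    have "ln (opnorm (A j)) \<le> C" "ln (opnorm (matrix_inv (A j))) \<le> C" using le[of j] by linarith+
    then show "opnorm (A j) \<le> exp C" "opnorm (matrix_inv (A j)) \<le> exp C"
      using opnorm_pos[OF d(1)[of j]] opnorm_pos[OF d(2)[of j]] by (metis exp_le_cancel_iff exp_ln)+
  qed
  have "bounded_by A C"
    unfolding bounded_by_def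
  proof (intro conjI allI)
    show "0 \<le> C" unfolding C_def by (intro sum_nonneg) auto
    fix j x
    show "norm (A j *v x) \<le> exp C * norm x"
      by (rule order_trans[OF opnorm_ge mult_right_mono[OF e(1)]]) auto
    have "norm x = norm (matrix_inv (A j) *v (A j *v x))"
      using inv'(2)[of j] by (simp add: matrix_vector_mul_assoc)
    also have "\<dots> \<le> exp C * norm (A j *v x)"
      by (rule order_trans[OF opnorm_ge mult_right_mono[OF e(2)]]) auto
    finally show "norm x \<le> exp C * norm (A j *v x)" .
  qed
  then show thesis by (rule that)
qed

text \<open>The allowed distance is half of the lower bound exp (-C), so the lower bound is at most
  halved, and 2 is at most exp 1.\<close>

lemma bdd_perturb:
  fixes A B :: "'a::finite \<Rightarrow> mat2"
  assumes A: "bounded_by A C" and d: "\<And>j. opnorm (A j - B j) \<le> exp (- C) / 2"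
  shows "bounded_by B (C + 1)"
  unfolding bounded_by_def
proof (intro conjI allI)
  have C0: "0 \<le> C" by (rule bdd_nonneg[OF A])
  then show "0 \<le> C + 1" by simp
  have e1: "2 \<le> exp (1 :: real)" using exp_ge_add_one_self[of 1] by simp
  fix j x
  have diff: "norm (A j *v x - B j *v x) \<le> exp (- C) / 2 * norm x"
    unfolding matrix_vector_mult_diff_rdistrib[symmetric]
    by (rule order_trans[OF opnorm_ge mult_right_mono[OF d]]) simp
  have "norm (B j *v x) \<le> norm (A j *v x) + norm (A j *v x - B j *v x)"
    by (metis norm_minus_commute norm_triangle_sub)
  also have "\<dots> \<le> exp C * norm x + exp (- C) / 2 * norm x"
    by (intro add_mono diff bdd_upper[OF A])
  also have "\<dots> = (exp C + exp (- C) / 2) * norm x" by (simp add: distrib_right)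
  also have "\<dots> \<le> (exp C * exp 1) * norm x"
  proof (intro mult_right_mono)
    have "exp (- C) \<le> exp C" using C0 by simp
    then show "exp C + exp (- C) / 2 \<le> exp C * exp 1"
      using mult_left_mono[OF e1, of "exp C"] exp_gt_zero[of C] by linarith
  qed simp
  finally show "norm (B j *v x) \<le> exp (C + 1) * norm x" by (simp add: exp_add)
  have "exp (- C) * norm x \<le> norm (A j *v x)"
    using bdd_lower[OF A, of x j] by (simp add: exp_minus field_simps)
  also have "\<dots> \<le> norm (B j *v x) + exp (- C) / 2 * norm x"
    using diff norm_triangle_sub[of "A j *v x" "B j *v x"] by linarith
  finally have "norm x \<le> 2 * exp C * norm (B j *v x)" by (simp add: exp_minus field_simps)
  also have "\<dots> \<le> exp 1 * exp C * norm (B j *v x)"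
    using e1 by (intro mult_right_mono) auto
  finally show "norm x \<le> exp (C + 1) * norm (B j *v x)" by (simp add: exp_add mult_ac)
qed

section \<open>Irreducible cocycles\<close>

lemma pw_Suc: "pw p (Suc n) P = (\<Sum>j\<in>UNIV. pmf p j * pw p n (\<lambda>w. P (j # w)))"
  by (simp add: pw_def)

context
  fixes B :: "'a::finite \<Rightarrow> mat2" and C :: real and p :: "'a pmf"
  assumes bounded_by: "bounded_by B C"
begin

text \<open>Two directions contracted by the same matrix are close to each other. If \<open>x\<close> is contracted
  with probability almost one, then so are \<open>x\<close> and \<open>B j *v x\<close> simultaneously.\<close>
lemma unbalanced_almost_fixed:
  assumes x: "x \<noteq> 0" and N: "1 \<le> N"
    and bad: "1 - pmf p j / 4 < pw p N (\<lambda>u. \<not> balanced B kap u x)"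
  shows "pdist x (B j *v x) \<le> 2 * exp (2 * C - kap * N)"
proof -
  obtain n where n: "N = Suc n" using N by (cases N) auto
  define e where "e = exp (2 * C - kap * N)"
  define small where "small w y \<longleftrightarrow> norm (wprod B w *v y) < e * (opnorm (wprod B w) * norm y)" for w y
  have e: "exp C * exp C * (1 / exp (kap * N)) = e" by (simp add: e_def exp_diff mult_exp_exp)
  \<comment> \<open>One contracted word loses its last letter, the other its first, so both
    statements concern the same random word of length N - 1, acting on \<open>x\<close> and on
    \<open>B j *v x\<close>.\<close>
  have 1: "small u x" if "\<not> balanced B kap (u @ [i]) x" "length (u @ [i]) = N" for u i
  proof -
    let ?M = "wprod B u"
    have "exp (kap * N) * norm (B i *v (?M *v x)) < opnorm (B i ** ?M) * norm x"
      using that(1) unfolding balanced_def that(2) by (simp add: wprod_append matrix_vector_mul_assoc not_le)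
    also have "\<dots> \<le> (exp C * opnorm ?M) * norm x"
      by (intro mult_right_mono order_trans[OF opnorm_mult] opnorm_le bdd_upper[OF bounded_by]) auto
    finally have "norm (B i *v (?M *v x)) < exp C * opnorm ?M * norm x * (1 / exp (kap * N))"
      by (simp add: field_simps)
    then have "exp C * norm (B i *v (?M *v x)) < exp C * (exp C * opnorm ?M * norm x * (1 / exp (kap * N)))"
      by (intro mult_strict_left_mono) auto
    also have "\<dots> = e * (opnorm ?M * norm x)" unfolding e[symmetric] by simp
    finally show ?thesis
      unfolding small_def using bdd_lower[OF bounded_by, of "?M *v x" i] by linarith
  qed
  have 2: "small w (B j *v x)" if "\<not> balanced B kap (j # w) x" "length (j # w) = N" for w
  proof -
    let ?M = "wprod B w"
    have "exp (kap * N) * norm (?M *v (B j *v x)) < opnorm (?M ** B j) * norm x"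
      using that(1) unfolding balanced_def that(2) by (simp add: matrix_vector_mul_assoc not_le)
    also have "\<dots> \<le> (opnorm ?M * exp C) * (exp C * norm (B j *v x))"
      by (intro mult_mono order_trans[OF opnorm_mult] mult_left_mono opnorm_le bdd_upper[OF bounded_by] bdd_lower[OF bounded_by]) auto
    finally have "norm (?M *v (B j *v x)) < (opnorm ?M * exp C) * (exp C * norm (B j *v x)) * (1 / exp (kap * N))"
      by (simp add: field_simps)
    also have "\<dots> = e * (opnorm ?M * norm (B j *v x))" unfolding e[symmetric] by simp
    finally show ?thesis unfolding small_def .
  qed
  have pj: "0 < pmf p j"
  proof (rule ccontr)
    assume "\<not> 0 < pmf p j"
    then have "pmf p j = 0" by (simp add: order_less_le)
    with bad pw_le_1[of p N "\<lambda>u. \<not> balanced B kap u x"] show False by simp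
  qed
  \<comment> \<open>Conditioning on the first letter being \<open>j\<close>: if the continuation
    failed to contract with probability 1/4 or more, the total would drop to 1 -
    \<open>pmf p j\<close> / 4 or less.\<close>
  have "pw p N (\<lambda>u. \<not> balanced B kap u x) \<le> 1 - pmf p j * (1 - pw p n (\<lambda>w. \<not> balanced B kap (j # w) x))"
  proof -
    have "pw p N (\<lambda>u. \<not> balanced B kap u x)
        \<le> (\<Sum>i\<in>UNIV. pmf p i - of_bool (i = j) * (pmf p j * (1 - pw p n (\<lambda>w. \<not> balanced B kap (j # w) x))))"
      unfolding n pw_Suc
    proof (rule sum_mono)
      fix i
      show "pmf p i * pw p n (\<lambda>w. \<not> balanced B kap (i # w) x)
        \<le> pmf p i - of_bool (i = j) * (pmf p j * (1 - pw p n (\<lambda>w. \<not> balanced B kap (j # w) x)))"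
        using mult_left_mono[OF pw_le_1[of p n "\<lambda>w. \<not> balanced B kap (i # w) x"], of "pmf p i"]
        by (auto simp: algebra_simps)
    qed
    also have "\<dots> = 1 - pmf p j * (1 - pw p n (\<lambda>w. \<not> balanced B kap (j # w) x))"
      by (simp add: sum_subtractf of_bool_def if_distrib[of "\<lambda>t. t * _"] cong: if_cong)
    finally show ?thesis .
  qed
  with bad have "pmf p j * (1 - pw p n (\<lambda>w. \<not> balanced B kap (j # w) x)) < pmf p j * (1 / 4)" by simp
  then have "3 / 4 < pw p n (\<lambda>w. \<not> balanced B kap (j # w) x)" using pj by simp
  also have "\<dots> \<le> pw p n (\<lambda>w. small w (B j *v x))"
    by (rule pw_mono, rule 2) (auto simp: n)
  finally have P2: "3 / 4 < pw p n (\<lambda>w. small w (B j *v x))" .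
  have "3 / 4 < pw p N (\<lambda>u. \<not> balanced B kap u x)" using bad pmf_le_1[of p j] by linarith
  also have "\<dots> \<le> pw p N (\<lambda>w. small (take n w) x)"
  proof (rule pw_mono)
    fix w assume w: "length w = N" "\<not> balanced B kap w x"
    then have "w = take n w @ [w ! n]" unfolding n by (metis lessI take_Suc_conv_app_nth take_all le_refl)
    then show "small (take n w) x" using 1[of "take n w" "w ! n"] w by simp
  qed
  also have "\<dots> = pw p n (\<lambda>w. small w x)" unfolding n by (rule pw_prefix') simp
  finally have P1: "3 / 4 < pw p n (\<lambda>w. small w x)" .
  \<comment> \<open>Two events of probability above 3/4 meet, so a single word contracts both
    directions and \<open>opnorm_two_points\<close> applies to it.\<close>
  have "0 < pw p n (\<lambda>w. small w x \<and> small w (B j *v x))"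
  proof -
    have "pw p n (\<lambda>w. \<not> (small w x \<and> small w (B j *v x))) \<le> pw p n (\<lambda>w. \<not> small w x) + pw p n (\<lambda>w. \<not> small w (B j *v x))"
      using pw_disj[of p n "\<lambda>w. \<not> small w x" "\<lambda>w. \<not> small w (B j *v x)"] by simp
    then show ?thesis using P1 P2 unfolding pw_not by linarith
  qed
  then obtain w where w: "small w x" "small w (B j *v x)" by (rule pw_pos_imp_ex) blast
  have "opnorm (wprod B w) * \<bar>wedge x (B j *v x)\<bar> \<le> norm (wprod B w *v x) * norm (B j *v x) + norm (wprod B w *v (B j *v x)) * norm x"
    by (rule opnorm_two_points)
  also have "\<dots> \<le> (e * (opnorm (wprod B w) * norm x)) * norm (B j *v x) + (e * (opnorm (wprod B w) * norm (B j *v x))) * norm x"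
    using w unfolding small_def by (intro add_mono mult_right_mono) auto
  also have "\<dots> = opnorm (wprod B w) * (2 * e * (norm x * norm (B j *v x)))" by simp
  finally have "\<bar>wedge x (B j *v x)\<bar> \<le> 2 * e * (norm x * norm (B j *v x))"
    using opnorm_pos[OF bdd_det(1)[OF bounded_by]] by (metis mult_le_cancel_left_pos)
  then show ?thesis using x bdd_nz1[OF bounded_by x, of j] by (simp add: pdist_def e_def field_simps)
qed

text \<open>The union bound runs over multiples of \<open>n\<close> only: their number does not grow
  with \<open>n\<close>, as it must not, since the available lower tail has no rate. Between
  neighbouring grid times at most (3 kap + 2 C) n is lost, which the step from 4 kap to 3 kap
  absorbs once the multiple is at least \<open>K\<close>.\<close>

lemma ngrow_grid:
  assumes kap: "0 \<le> kap" and K: "3 * kap + 2 * C \<le> K * kap" and n: "1 \<le> n"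
  shows "pw p (M * (K * n)) (\<lambda>w. \<exists>m\<in>{K * n..M * (K * n)}. ngrow B (take m w) < 3 * kap * m)
    \<le> (\<Sum>i\<in>{K..M * K}. pw p (i * n) (\<lambda>w. ngrow B w < 4 * kap * real (i * n)))"
proof -
  let ?T = "M * (K * n)"
  have "pw p ?T (\<lambda>w. \<exists>m\<in>{K * n..?T}. ngrow B (take m w) < 3 * kap * m)
      \<le> pw p ?T (\<lambda>w. \<exists>i\<in>{K..M * K}. ngrow B (take (i * n) w) < 4 * kap * real (i * n))"
  proof (rule pw_mono)
    fix w :: "'a list" assume w: "length w = ?T" "\<exists>m\<in>{K * n..?T}. ngrow B (take m w) < 3 * kap * m"
    then obtain m where m: "K * n \<le> m" "m \<le> ?T" "ngrow B (take m w) < 3 * kap * m" by auto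
    define i where "i = m div n"
    define s where "s = m mod n"
    have ms: "m = i * n + s" "s \<le> n" using n by (simp_all add: i_def s_def less_imp_le)
    have i: "K \<le> i" "i \<le> M * K"
    proof -
      show "K \<le> i" using div_le_mono[OF m(1), of n] n by (simp add: i_def)
      show "i \<le> M * K" using div_le_mono[OF m(2), of n] n unfolding i_def by (simp add: mult.assoc[symmetric])
    qed
    have tk: "take m w = take (i * n) w @ take s (drop (i * n) w)" unfolding ms by (simp add: take_add)
    have "ngrow B (take (i * n) w) - 2 * C * s \<le> ngrow B (take m w)"
    proof -
      have "ngrow B (take (i * n) w) - 2 * C * length (take s (drop (i * n) w)) \<le> ngrow B (take m w)"
        unfolding tk by (rule ngrow_append_ge[OF bounded_by])
      moreover have "2 * C * length (take s (drop (i * n) w)) \<le> 2 * C * s"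
        using bdd_nonneg[OF bounded_by] by (intro mult_left_mono) auto
      ultimately show ?thesis by linarith
    qed
    with m(3) have "ngrow B (take (i * n) w) < 3 * kap * (i * n) + (3 * kap + 2 * C) * s"
      unfolding ms by (simp add: algebra_simps)
    also have "(3 * kap + 2 * C) * s \<le> (real i * kap) * n"
    proof (rule mult_mono)
      have "real K * kap \<le> real i * kap" using i kap by (intro mult_right_mono) auto
      with K show "3 * kap + 2 * C \<le> real i * kap" by linarith
    qed (use ms kap in auto)
    finally show "\<exists>i\<in>{K..M * K}. ngrow B (take (i * n) w) < 4 * kap * real (i * n)"
      using i by (intro bexI[of _ i]) (auto simp: algebra_simps)
  qed
  also have "\<dots> \<le> (\<Sum>i\<in>{K..M * K}. pw p ?T (\<lambda>w. ngrow B (take (i * n) w) < 4 * kap * real (i * n)))"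
    by (rule pw_Bex) simp
  also have "\<dots> = (\<Sum>i\<in>{K..M * K}. pw p (i * n) (\<lambda>w. ngrow B w < 4 * kap * real (i * n)))"
  proof (intro sum.cong refl pw_prefix')
    fix i assume "i \<in> {K..M * K}"
    then have "i * n \<le> (M * K) * n" by (intro mult_right_mono) auto
    then show "i * n \<le> ?T" by (simp add: mult.assoc)
  qed
  finally show ?thesis .
qed

end

lemma full_support_lower_bound:
  fixes p :: "'a::finite pmf"
  assumes "set_pmf p = UNIV"
  obtains pm where "0 < pm" "\<And>j. pm \<le> pmf p j" "pm \<le> 1"
proof (rule that)
  have "Min (range (pmf p)) \<in> range (pmf p)" by (rule Min_in) auto
  then show "0 < Min (range (pmf p))" using assms by (auto simp: pmf_positive)
  show *: "Min (range (pmf p)) \<le> pmf p j" for j by (rule Min_le) auto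
  show "Min (range (pmf p)) \<le> 1" by (rule order_trans[OF * pmf_le_1])
qed

text \<open>A direction that is unbalanced with probability above 1 - pm / 4 would be moved by every
  letter by less than any fixed amount once \<open>N\<close> is large, while compactness gives a
  displacement \<open>r\<close> valid for all directions.\<close>

lemma irreducible_growth:
  fixes A :: "'a::finite \<Rightarrow> mat2"
  assumes full: "set_pmf p = UNIV" and bounded_by: "bounded_by A C" and gap: "0 < gap p A"
    and irr: "\<And>x. x \<noteq> 0 \<Longrightarrow> \<exists>j. wedge x (A j *v x) \<noteq> 0"
  obtains N k where "1 \<le> N" "0 < k" "\<And>x. x \<noteq> 0 \<Longrightarrow> k * real N \<le> ew p N (\<lambda>w. vgrow A w x)"
proof -
  have C0: "0 \<le> C" by (rule bdd_nonneg[OF bounded_by])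
  \<comment> \<open>Of the five units one pays for the lower tail and one for the passage from the
    grid to all times; three remain, as \<open>persistence\<close> requires.\<close>
  define kap where "kap = gap p A / 5"
  have kap: "0 < kap" using gap by (simp add: kap_def)
  obtain pm where pm: "0 < pm" "\<And>j. pm \<le> pmf p j" and pm1: "pm \<le> 1"
    by (rule full_support_lower_bound[OF full]) blast
  obtain M :: nat and \<eta> and N0 :: nat where M: "1 \<le> M" "0 < \<eta>"
    and grow: "\<And>(p :: 'a pmf) B N x. bounded_by B C \<Longrightarrow> N0 \<le> N \<Longrightarrow>
      (\<And>x. x \<noteq> 0 \<Longrightarrow> pw p N (\<lambda>u. \<not> balanced B kap u x) \<le> 1 - pm / 4) \<Longrightarrow>
      pw p (M * N) (\<lambda>w. \<exists>m\<in>{N..M * N}. ngrow B (take m w) < 3 * kap * m) \<le> \<eta> \<Longrightarrow>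
      x \<noteq> 0 \<Longrightarrow> kap / 2 * real (M * N) \<le> ew p (M * N) (\<lambda>w. vgrow B w x)"
    by (rule growth[OF C0 kap, of "1 - pm / 4"]) (use pm pm1 in auto)
  \<comment> \<open>The total displacement is continuous and nowhere zero on the unit circle, hence
    has a positive minimum; for each direction some letter achieves at least the average share of
    it.\<close>
  obtain r where r: "0 < r" "\<And>x. x \<noteq> 0 \<Longrightarrow> \<exists>j. r \<le> pdist x (A j *v x)"
  proof -
    define f where "f x = (\<Sum>j\<in>UNIV. \<bar>wedge x (A j *v x)\<bar>)" for x
    have cont: "continuous_on (sphere 0 1) f"
      unfolding f_def wedge_def
      by (intro continuous_intros linear_continuous_on matrix_vector_mul_bounded_linear)
    obtain x0 where x0: "x0 \<in> sphere 0 1" "\<And>x. x \<in> sphere 0 1 \<Longrightarrow> f x0 \<le> f x"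
      using continuous_attains_inf[OF _ _ cont] by (auto simp: compact_sphere)
    have "x0 \<noteq> 0" using x0(1) by auto
    then obtain i where i: "wedge x0 (A i *v x0) \<noteq> 0" using irr by blast
    have "\<bar>wedge x0 (A i *v x0)\<bar> \<le> f x0" unfolding f_def by (rule member_le_sum) auto
    then have f0: "0 < f x0" using i by linarith
    define r where "r = f x0 / (CARD('a) * exp C)"
    show thesis
    proof (rule that[of r])
      show "0 < r" using f0 by (simp add: r_def)
      fix x :: "real^2" assume x: "x \<noteq> 0"
      define y where "y = (1 / norm x) *\<^sub>R x"
      have y: "norm y = 1" using x by (simp add: y_def)
      have Ay: "A j *v y = (1 / norm x) *\<^sub>R (A j *v x)" for j
        by (simp add: y_def matrix_vector_mult_scaleR)
      have pd: "pdist x (A j *v x) = pdist y (A j *v y)" for j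
        unfolding Ay using x by (simp add: pdist_def y_def abs_mult field_simps)
      have "\<exists>j. f x0 / CARD('a) \<le> \<bar>wedge y (A j *v y)\<bar>"
      proof (rule ccontr)
        assume "\<not> ?thesis"
        then have "f y < (\<Sum>j\<in>(UNIV :: 'a set). f x0 / CARD('a))"
          unfolding f_def by (intro sum_strict_mono) (auto simp: not_le)
        then have "f y < f x0" by simp
        with x0(2)[of y] y show False by simp
      qed
      then obtain j where j: "f x0 / CARD('a) \<le> \<bar>wedge y (A j *v y)\<bar>" ..
      have y0: "y \<noteq> 0" using y by auto
      have "r = f x0 / CARD('a) / exp C" by (simp add: r_def)
      also have "\<dots> \<le> \<bar>wedge y (A j *v y)\<bar> / norm (A j *v y)"
        using j bdd_upper[OF bounded_by, of j y] bdd_nz1[OF bounded_by y0, of j] y f0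
        by (intro frac_le) auto
      finally show "\<exists>j. r \<le> pdist x (A j *v x)"
        unfolding pd using y by (intro exI[of _ j]) (simp add: pdist_def)
    qed
  qed
  obtain K :: nat where K: "3 + 2 * C / kap + 1 \<le> K" using real_arch_simple by blast
  have K1: "1 \<le> K" "3 * kap + 2 * C \<le> K * kap"
  proof -
    have "0 \<le> 2 * C / kap" using C0 kap by simp
    with K have "1 \<le> real K" by linarith
    then show "1 \<le> K" by simp
    have "3 + 2 * C / kap \<le> K" using K by linarith
    then show "3 * kap + 2 * C \<le> K * kap" using kap by (simp add: field_simps)
  qed
  define \<eta>' where "\<eta>' = \<eta> / real (M * K + 1)"
  have eta': "0 < \<eta>'" using M by (simp add: \<eta>'_def zero_less_divide_iff del: of_nat_add of_nat_mult of_nat_Suc)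
  obtain N1 where N1: "\<And>n. N1 \<le> n \<Longrightarrow> pw p n (\<lambda>w. ngrow A w < n * (gap p A - kap)) \<le> \<eta>'"
    by (rule subadditive_lower_tail[of "ngrow A" "2 * C" "gap p A" p kap \<eta>'])
       (use ngrow_append[OF bounded_by] ngrow_abs_le[OF bounded_by] C0 gap_le[OF bounded_by] gap_approx[OF bounded_by] kap eta' in auto)
  \<comment> \<open>From this size on 2 exp (2 C - kap N) is below \<open>r\<close>.\<close>
  obtain n2 :: nat where n2: "ln (2 * exp (2 * C) / r) / kap + 1 \<le> n2" using real_arch_simple by blast
  define n where "n = max (max N0 N1) (max n2 1)"
  define N where "N = K * n"
  have n: "N0 \<le> n" "N1 \<le> n" "n2 \<le> n" "1 \<le> n" by (auto simp: n_def)
  have nN: "n \<le> N" using K1 by (simp add: N_def)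
  have bad: "pw p N (\<lambda>u. \<not> balanced A kap u x) \<le> 1 - pm / 4" if x: "x \<noteq> 0" for x
  proof (rule ccontr)
    assume *: "\<not> ?thesis"
    obtain j where j: "r \<le> pdist x (A j *v x)" using r(2)[OF x] by blast
    have "1 - pmf p j / 4 < pw p N (\<lambda>u. \<not> balanced A kap u x)" using * pm(2)[of j] by linarith
    moreover have "1 \<le> N" using n nN by simp
    ultimately have "pdist x (A j *v x) \<le> 2 * exp (2 * C - kap * N)"
      using unbalanced_almost_fixed[OF bounded_by x] by blast
    with j have "r \<le> 2 * exp (2 * C) / exp (kap * N)" by (simp add: exp_diff)
    then have "exp (kap * N) \<le> 2 * exp (2 * C) / r" using r(1) by (simp add: field_simps)
    then have "kap * N \<le> ln (2 * exp (2 * C) / r)"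
      using r(1) by (subst ln_ge_iff) auto
    then have "N \<le> ln (2 * exp (2 * C) / r) / kap" using kap by (simp add: field_simps)
    moreover have "real n2 \<le> N" using n nN by simp
    ultimately show False using n2 by linarith
  qed
  have H: "pw p (M * N) (\<lambda>w. \<exists>m\<in>{N..M * N}. ngrow A (take m w) < 3 * kap * m) \<le> \<eta>"
  proof -
    have "pw p (M * N) (\<lambda>w. \<exists>m\<in>{N..M * N}. ngrow A (take m w) < 3 * kap * m)
      \<le> (\<Sum>i\<in>{K..M * K}. pw p (i * n) (\<lambda>w. ngrow A w < 4 * kap * real (i * n)))"
      unfolding N_def by (rule ngrow_grid[OF bounded_by _ K1(2) n(4)]) (use kap in simp)
    also have "\<dots> \<le> (\<Sum>i\<in>{K..M * K}. \<eta>')"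
    proof (rule sum_mono)
      fix i assume "i \<in> {K..M * K}"
      then have "1 * n \<le> i * n" using K1 by (intro mult_right_mono) auto
      then have "n \<le> i * n" by (simp only: mult_1)
      with n(2) have "N1 \<le> i * n" by (rule le_trans)
      from N1[OF this] show "pw p (i * n) (\<lambda>w. ngrow A w < 4 * kap * real (i * n)) \<le> \<eta>'"
        by (simp add: kap_def algebra_simps)
    qed
    also have "\<dots> = card {K..M * K} * \<eta>'" by simp
    also have "\<dots> \<le> real (M * K + 1) * \<eta>'"
    proof (rule mult_right_mono)
      have "card {K..M * K} \<le> M * K + 1" by simp
      then show "real (card {K..M * K}) \<le> real (M * K + 1)" by (rule of_nat_mono)
    qed (use eta' in simp)
    also have "\<dots> = \<eta>" by (simp add: \<eta>'_def del: of_nat_add of_nat_mult of_nat_Suc)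

    finally show ?thesis by simp
  qed
  show thesis
  proof (rule that[of "M * N" "kap / 2"])
    show "1 \<le> M * N" using M nN n by (metis le_trans mult_le_mono nat_mult_1)
    show "kap / 2 * real (M * N) \<le> ew p (M * N) (\<lambda>w. vgrow A w x)" if "x \<noteq> 0" for x
      by (rule grow[OF bounded_by _ bad H that]) (use n nN in auto)
  qed (use kap in simp)
qed

section \<open>Perturbation, and deviation estimates uniform over a neighbourhood\<close>

lemma ln_diff_abs_le:
  fixes a b t :: real
  assumes "0 < t" "t \<le> a" "t \<le> b"
  shows "\<bar>ln a - ln b\<bar> \<le> \<bar>a - b\<bar> / t"
proof -
  have *: "ln a - ln b \<le> \<bar>a - b\<bar> / t" if "0 < t" "t \<le> a" "t \<le> b" for a b t :: real
  proof -
    have "ln a - ln b \<le> (a - b) / b" using that by (intro ln_diff_le) auto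
    also have "\<dots> \<le> \<bar>a - b\<bar> / b" using that by (intro divide_right_mono) auto
    also have "\<dots> \<le> \<bar>a - b\<bar> / t" using that by (intro divide_left_mono) auto
    finally show ?thesis .
  qed
  from *[of t a b] *[of t b a] assms show ?thesis by (simp add: abs_minus_commute)
qed

lemma wprod_perturb:
  fixes d C :: real
  assumes A: "bounded_by A C" and B: "bounded_by B C" and d: "\<And>j. opnorm (A j - B j) \<le> d"
  shows "norm (wprod A w *v x - wprod B w *v x) \<le> length w * exp (C * length w) * d * norm x"
proof (induction w arbitrary: x)
  case (Cons j w)
  let ?n = "length w"
  have C0: "0 \<le> C" by (rule bdd_nonneg[OF A])
  have d0: "0 \<le> d" by (rule order_trans[OF opnorm_nonneg d[of j]])
  have "norm (wprod A (j # w) *v x - wprod B (j # w) *v x)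
      = norm ((wprod A w *v (A j *v x) - wprod B w *v (A j *v x)) + wprod B w *v (A j *v x - B j *v x))"
    unfolding wprod_Cons_vec by (simp add: matrix_vector_mult_diff_distrib)
  also have "\<dots> \<le> ?n * exp (C * ?n) * d * norm (A j *v x) + exp (C * ?n) * norm (A j *v x - B j *v x)"
    by (intro order_trans[OF norm_triangle_ineq] add_mono Cons.IH bdd_word(1)[OF B])
  also have "\<dots> \<le> ?n * exp (C * ?n) * d * (exp C * norm x) + exp (C * ?n) * (d * norm x)"
  proof (intro add_mono mult_left_mono bdd_upper[OF A])
    show "norm (A j *v x - B j *v x) \<le> d * norm x"
      unfolding matrix_vector_mult_diff_rdistrib[symmetric]
      by (rule order_trans[OF opnorm_ge mult_right_mono[OF d]]) simp
  qed (use d0 in auto)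
  also have "\<dots> \<le> ?n * exp (C * ?n) * d * (exp C * norm x) + exp (C * ?n) * (d * norm x) * exp C"
    using C0 d0 mult_left_mono[of 1 "exp C" "exp (C * ?n) * (d * norm x)"] by simp
  also have "\<dots> = length (j # w) * exp (C * length (j # w)) * d * norm x"
    by (simp add: exp_add algebra_simps)
  finally show ?case .
qed simp

text \<open>The constant is exponential in the length of the word, which is harmless because the
  length is fixed before the neighbourhood: expansion within \<open>N\<close> letters is an open
  condition.\<close>

lemma vgrow_perturb:
  fixes d C :: real
  assumes A: "bounded_by A C" and B: "bounded_by B C" and d: "\<And>j. opnorm (A j - B j) \<le> d" and x: "x \<noteq> 0"
  shows "\<bar>vgrow A w x - vgrow B w x\<bar> \<le> 2 * length w * exp (4 * C * length w) * d"
proof -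
  let ?n = "length w"
  define E where "E = exp (C * ?n)"
  have C0: "0 \<le> C" by (rule bdd_nonneg[OF A])
  have d0: "0 \<le> d" by (rule order_trans[OF opnorm_nonneg d])
  have E: "1 \<le> E" "E ^ k = exp (k * (C * ?n))" for k using C0 by (simp_all add: E_def exp_of_nat_mult)
  have low: "norm v / E \<le> norm (wprod A w *v v)" "norm v / E \<le> norm (wprod B w *v v)" for v
    using bdd_word(2)[OF A, of v w] bdd_word(2)[OF B, of v w] by (simp_all add: E_def field_simps)
  have diff: "norm (wprod A w *v v - wprod B w *v v) \<le> ?n * E * d * norm v" for v
    unfolding E_def by (rule wprod_perturb[OF A B d])
  have "\<bar>ln (norm (wprod A w *v x)) - ln (norm (wprod B w *v x))\<bar>
      \<le> \<bar>norm (wprod A w *v x) - norm (wprod B w *v x)\<bar> / (norm x / E)"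
    by (rule ln_diff_abs_le) (use x low E in auto)
  also have "\<dots> \<le> (?n * E * d * norm x) / (norm x / E)"
    using E x by (intro divide_right_mono order_trans[OF norm_triangle_ineq3 diff]) auto
  also have "\<dots> = ?n * E\<^sup>2 * d" using x by (simp add: power2_eq_square)
  also have "\<dots> \<le> ?n * E ^ 4 * d"
    using E(1) d0 by (intro mult_right_mono mult_left_mono power_increasing) auto
  finally have 1: "\<bar>ln (norm (wprod A w *v x)) - ln (norm (wprod B w *v x))\<bar> \<le> ?n * E ^ 4 * d" .
  let ?e1 = "axis 1 1 :: real^2" and ?e2 = "axis 2 1 :: real^2"
  have det: "det M = wedge (M *v ?e1) (M *v ?e2)" for M :: mat2
    unfolding wedge_matrix by (simp add: wedge_def axis_def)
  have "det (wprod A w) - det (wprod B w)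
      = wedge (wprod A w *v ?e1 - wprod B w *v ?e1) (wprod A w *v ?e2) + wedge (wprod B w *v ?e1) (wprod A w *v ?e2 - wprod B w *v ?e2)"
    unfolding det by (simp add: wedge_def algebra_simps)
  also have "\<bar>\<dots>\<bar> \<le> norm (wprod A w *v ?e1 - wprod B w *v ?e1) * norm (wprod A w *v ?e2)
      + norm (wprod B w *v ?e1) * norm (wprod A w *v ?e2 - wprod B w *v ?e2)"
    by (intro order_trans[OF abs_triangle_ineq] add_mono wedge_le)
  also have "\<dots> \<le> (?n * E * d) * E + E * (?n * E * d)"
    using diff[of ?e1] diff[of ?e2] bdd_word(1)[OF A, of w ?e2] bdd_word(1)[OF B, of w ?e1] E(1) d0
    by (intro add_mono mult_mono) (auto simp: E_def)
  also have "\<dots> = 2 * (?n * E\<^sup>2 * d)" by (simp add: power2_eq_square)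
  finally have dd: "\<bar>det (wprod A w) - det (wprod B w)\<bar> \<le> 2 * (?n * E\<^sup>2 * d)" .
  have dlow: "1 / E\<^sup>2 \<le> \<bar>det (wprod X w)\<bar>" if "bounded_by X C" for X
  proof -
    have "- (2 * (C * ?n)) \<le> ln \<bar>det (wprod X w)\<bar>" using bdd_det(2)[OF that, of w] by linarith
    then have "exp (- (2 * (C * ?n))) \<le> \<bar>det (wprod X w)\<bar>"
      using bdd_det(1)[OF that, of w] by (subst (asm) ln_ge_iff) auto
    then show ?thesis using E(2)[of 2] by (simp add: exp_minus field_simps)
  qed
  have "\<bar>ln \<bar>det (wprod A w)\<bar> - ln \<bar>det (wprod B w)\<bar>\<bar> \<le> \<bar>\<bar>det (wprod A w)\<bar> - \<bar>det (wprod B w)\<bar>\<bar> / (1 / E\<^sup>2)"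
    by (rule ln_diff_abs_le) (use E(1) dlow[OF A] dlow[OF B] in auto)
  also have "\<dots> \<le> (2 * (?n * E\<^sup>2 * d)) / (1 / E\<^sup>2)"
    by (intro divide_right_mono order_trans[OF abs_triangle_ineq3 dd]) auto
  also have "\<dots> = 2 * (?n * E ^ 4 * d)" by (simp add: power2_eq_square power4_eq_xxxx)
  finally have 2: "\<bar>ln \<bar>det (wprod A w)\<bar> - ln \<bar>det (wprod B w)\<bar>\<bar> \<le> 2 * (?n * E ^ 4 * d)" .
  have "\<bar>vgrow A w x - vgrow B w x\<bar> \<le> 2 * (?n * E ^ 4 * d)"
    using 1 2 unfolding vgrow_def by linarith
  then show ?thesis using E(2)[of 4] by (simp add: mult_ac)
qed

text \<open>Gaussian deviations with constants common to a neighbourhood. The centre is existential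
  because \<open>Lplus\<close> can be evaluated only from such an estimate, as in
  \<open>Lplus_of_ldt\<close>.\<close>

definition uniform_ldt :: "'a::finite pmf \<Rightarrow> ('a \<Rightarrow> mat2) \<Rightarrow> bool" where
  "uniform_ldt p A \<longleftrightarrow> (\<exists>\<delta>>0. \<exists>K>0::real. \<forall>B. cdist B A < \<delta> \<longrightarrow>
     (\<exists>L. \<forall>n. \<forall>s\<ge>0. pw p n (\<lambda>w. \<bar>lognorm B w - real n * L\<bar> > s + K) \<le> 4 * exp (- s\<^sup>2 / (K * real n))))"

lemma opnorm_diff_commute: "opnorm (M - N) = opnorm (N - M)" for M N :: mat2
proof -
  have "(\<lambda>v. (N - M) *v v) = (\<lambda>v. - ((M - N) *v v))"
    by (auto simp: matrix_vector_mult_diff_rdistrib)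
  then show ?thesis unfolding opnorm_def by (metis onorm_neg)
qed

lemma uniform_ldt_of_oscillation:
  fixes C D \<delta> :: real
  assumes "0 < \<delta>"
    and B: "\<And>B. cdist B A < \<delta> \<Longrightarrow> bounded_by B C"
    and D: "\<And>B m x y. cdist B A < \<delta> \<Longrightarrow> x \<noteq> 0 \<Longrightarrow> y \<noteq> 0 \<Longrightarrow> \<bar>mean_grow B p m x - mean_grow B p m y\<bar> \<le> D"
  shows "uniform_ldt p A"
proof -
  have AA: "cdist A A < \<delta>" using assms(1) by (simp add: cdist_def opnorm_def onorm_zero)
  have C0: "0 \<le> C" using bdd_nonneg[OF B[OF AA]] .
  have D0: "0 \<le> D" using D[OF AA, of "axis 1 1" "axis 1 1" 0] by (simp add: axis_eq_0_iff)
  define K where "K = 4 * (D + 2 * C + 1)\<^sup>2"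
  have "D + 2 * C + 1 \<le> (D + 2 * C + 1)\<^sup>2" using C0 D0 by (intro self_le_power) auto
  then have K: "2 * D + 1 \<le> K" "0 < K" using C0 D0 unfolding K_def by linarith+
  show ?thesis
    unfolding uniform_ldt_def
  proof (rule exI[of _ \<delta>], rule conjI[OF assms(1)], rule exI[of _ K], rule conjI[OF K(2)], intro allI impI)
    fix B assume b: "cdist B A < \<delta>"
    obtain L :: real where L: "\<And>n s. 0 \<le> s \<Longrightarrow> pw p n (\<lambda>w. \<bar>lognorm B w - n * L\<bar> > s + 2 * D + 1)
       \<le> 4 * exp (- s\<^sup>2 / (4 * real n * (D + 2 * C + 1)\<^sup>2))"
      using ldt_of_oscillation[OF B[OF b] D[OF b]] by blast
    show "\<exists>L. \<forall>n. \<forall>s\<ge>0. pw p n (\<lambda>w. \<bar>lognorm B w - real n * L\<bar> > s + K) \<le> 4 * exp (- s\<^sup>2 / (K * real n))"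
    proof (rule exI[of _ L], intro allI impI)
      fix n and s :: real assume s: "0 \<le> s"
      have "pw p n (\<lambda>w. \<bar>lognorm B w - real n * L\<bar> > s + K)
          \<le> pw p n (\<lambda>w. \<bar>lognorm B w - n * L\<bar> > s + 2 * D + 1)"
        by (rule pw_mono) (use K in auto)
      also have "\<dots> \<le> 4 * exp (- s\<^sup>2 / (4 * real n * (D + 2 * C + 1)\<^sup>2))" by (rule L[OF s])
      also have "4 * real n * (D + 2 * C + 1)\<^sup>2 = K * real n" by (simp add: K_def)
      finally show "pw p n (\<lambda>w. \<bar>lognorm B w - real n * L\<bar> > s + K) \<le> 4 * exp (- s\<^sup>2 / (K * real n))" .
    qed
  qed
qed

text \<open>Nearby cocycles keep half of the expansion of \<open>A\<close> within the same
  \<open>N\<close> letters, so the oscillation bound \<open>D * N\<close> is common to all of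
  them.\<close>

lemma irreducible_uniform_ldt:
  fixes A :: "'a::finite \<Rightarrow> mat2"
  assumes full: "set_pmf p = UNIV" and bounded_by: "bounded_by A C" and gap: "0 < gap p A"
    and irr: "\<And>x. x \<noteq> 0 \<Longrightarrow> \<exists>j. wedge x (A j *v x) \<noteq> 0"
  shows "uniform_ldt p A"
proof -
  obtain N k where N: "1 \<le> N" "0 < k" and k: "\<And>x. x \<noteq> 0 \<Longrightarrow> k * real N \<le> ew p N (\<lambda>w. vgrow A w x)"
    using irreducible_growth[OF assms] by blast
  have C0: "0 \<le> C + 1" using bdd_nonneg[OF bounded_by] by simp
  obtain D where D: "0 < D"
    "\<And>(p :: 'a pmf) B N m x y. bounded_by B (C + 1) \<Longrightarrow> 1 \<le> N \<Longrightarrow>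
      (\<And>x. x \<noteq> 0 \<Longrightarrow> k / 2 * N \<le> ew p N (\<lambda>w. vgrow B w x)) \<Longrightarrow> x \<noteq> 0 \<Longrightarrow> y \<noteq> 0 \<Longrightarrow>
      \<bar>mean_grow B p m x - mean_grow B p m y\<bar> \<le> D * N"
    by (rule oscillation_of_growth[OF C0, of "k / 2"]) (use N in auto)
  define \<delta> where "\<delta> = min (exp (- C) / 2) (k / (4 * exp (4 * (C + 1) * N)))"
  have d: "0 < \<delta>" "\<delta> \<le> exp (- C) / 2" "\<delta> \<le> k / (4 * exp (4 * (C + 1) * N))"
    using N by (auto simp: \<delta>_def)
  have near: "opnorm (A j - B j) \<le> \<delta>" if "cdist B A < \<delta>" for B j
    using opnorm_diff_le_cdist[of B j A] that by (simp add: opnorm_diff_commute)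
  have cbdA: "bounded_by A (C + 1)"
    by (rule bdd_perturb[OF bounded_by]) (simp add: opnorm_def onorm_zero)
  have cbdB: "bounded_by B (C + 1)" if "cdist B A < \<delta>" for B
    by (rule bdd_perturb[OF bounded_by]) (rule order_trans[OF near[OF that] d(2)])
  show ?thesis
  proof (rule uniform_ldt_of_oscillation[OF d(1) cbdB, where D = "D * N"])
    fix B m and x y :: "real^2" assume b: "cdist B A < \<delta>" and xy: "x \<noteq> 0" "y \<noteq> 0"
    show "\<bar>mean_grow B p m x - mean_grow B p m y\<bar> \<le> D * N"
    proof (rule D(2)[OF cbdB[OF b] N(1) _ xy])
      fix x :: "real^2" assume x: "x \<noteq> 0"
      have "ew p N (\<lambda>w. vgrow A w x) \<le> ew p N (\<lambda>w. vgrow B w x + k / 2 * N)"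
      proof (rule ew_mono)
        fix w :: "'a list" assume w: "length w = N"
        have "\<bar>vgrow A w x - vgrow B w x\<bar> \<le> 2 * N * exp (4 * (C + 1) * N) * \<delta>"
          using vgrow_perturb[OF cbdA cbdB[OF b] near[OF b] x, of w] unfolding w .
        also have "\<dots> \<le> 2 * N * exp (4 * (C + 1) * N) * (k / (4 * exp (4 * (C + 1) * N)))"
          by (intro mult_left_mono d) auto
        also have "\<dots> = k / 2 * N" by simp
        finally show "vgrow A w x \<le> vgrow B w x + k / 2 * N" by linarith
      qed
      with k[OF x] show "k / 2 * N \<le> ew p N (\<lambda>w. vgrow B w x)" by (simp add: ew_add_const)
    qed
  qed
qed

lemma summable_exp_sq:
  fixes K \<epsilon> :: real
  assumes "0 < K" "0 < \<epsilon>"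
    and P: "\<And>s. 0 \<le> s \<Longrightarrow> P n s \<le> 4 * exp (- s\<^sup>2 / (K * real n))"
  shows "K \<le> \<epsilon> / 2 * n \<Longrightarrow> P n (\<epsilon> / 2 * n) \<le> 4 * exp (- (\<epsilon>\<^sup>2 / (4 * K)) * n)"
proof -
  assume "K \<le> \<epsilon> / 2 * n"
  then have n: "0 < n" using assms(1) by (cases n) auto
  have "P n (\<epsilon> / 2 * n) \<le> 4 * exp (- (\<epsilon> / 2 * n)\<^sup>2 / (K * real n))" using assms(2) by (intro P) auto
  also have "- (\<epsilon> / 2 * n)\<^sup>2 / (K * real n) = - (\<epsilon>\<^sup>2 / (4 * K)) * n"
    using n assms(1) by (simp add: power2_eq_square field_simps)
  finally show ?thesis .
qed

lemma Lplus_of_ldt: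
  fixes p :: "'a::finite pmf" and K L :: real
  assumes K: "0 < K"
    and L: "\<And>n s. 0 \<le> s \<Longrightarrow> pw p n (\<lambda>w. \<bar>lognorm B w - real n * L\<bar> > s + K) \<le> 4 * exp (- s\<^sup>2 / (K * real n))"
  shows "Lplus p B = L"
    and "0 < \<epsilon> \<Longrightarrow> 2 * K / \<epsilon> \<le> real n \<Longrightarrow>
      pw p n (\<lambda>w. \<bar>lognorm B w - real n * L\<bar> > \<epsilon> * n) \<le> 4 * exp (- (\<epsilon>\<^sup>2 / (4 * K)) * n)"
proof -
  show *: "pw p n (\<lambda>w. \<bar>lognorm B w - real n * L\<bar> > \<epsilon> * n) \<le> 4 * exp (- (\<epsilon>\<^sup>2 / (4 * K)) * n)"
    if e: "0 < \<epsilon>" and n: "2 * K / \<epsilon> \<le> real n" for \<epsilon> n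
  proof -
    have K2: "K \<le> \<epsilon> / 2 * n" using n e by (simp add: field_simps)
    have "pw p n (\<lambda>w. \<bar>lognorm B w - real n * L\<bar> > \<epsilon> * n)
        \<le> pw p n (\<lambda>w. \<bar>lognorm B w - real n * L\<bar> > \<epsilon> / 2 * n + K)"
      by (rule pw_mono) (use K2 in linarith)
    also have "\<dots> \<le> 4 * exp (- (\<epsilon>\<^sup>2 / (4 * K)) * n)"
      by (rule summable_exp_sq[OF K e, where P = "\<lambda>n s. pw p n (\<lambda>w. \<bar>lognorm B w - real n * L\<bar> > s + K)", OF L K2])
    finally show ?thesis .
  qed
  show "Lplus p B = L"
  proof (rule Lplus_eqI)
    fix \<epsilon> :: real assume e: "0 < \<epsilon>"
    obtain n0 :: nat where n0: "2 * K / \<epsilon> \<le> n0" using real_arch_simple by blast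
    show "summable (\<lambda>n. pw p n (\<lambda>w. \<bar>lognorm B w - real n * L\<bar> > \<epsilon> * real n))"
    proof (rule summable_comparison_test'[where N = n0])
      show "summable (\<lambda>n. 4 * exp (- (\<epsilon>\<^sup>2 / (4 * K)) * real n))"
        by (rule summable_exp_decay) (use e K in simp)
      fix n assume "n0 \<le> n"
      then have "real n0 \<le> real n" by simp
      with n0 have "2 * K / \<epsilon> \<le> real n" by linarith
      from *[OF e this] show "norm (pw p n (\<lambda>w. \<bar>lognorm B w - real n * L\<bar> > \<epsilon> * real n)) \<le> 4 * exp (- (\<epsilon>\<^sup>2 / (4 * K)) * real n)"
        by simp
    qed
  qed
qed

lemma dev_prob_eq_pw_scaled:
  assumes "1 \<le> n"
  shows "dev_prob p B n t = pw p n (\<lambda>w. \<bar>lognorm B w - real n * Lplus p B\<bar> > t * n)"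
proof -
  have "\<bar>a / real n - b\<bar> > t \<longleftrightarrow> \<bar>a - real n * b\<bar> > t * n" for a b
  proof -
    have "\<bar>a / real n - b\<bar> = \<bar>a - real n * b\<bar> / n" using assms by (simp add: field_simps abs_divide[symmetric])
    then show ?thesis using assms by (simp add: field_simps)
  qed
  then show ?thesis unfolding dev_prob_eq_pw by simp
qed

lemma exponential_ldt_of_uniform_ldt:
  assumes "uniform_ldt p A"
  shows "\<exists>\<delta>>0. \<exists>c>0. \<exists>\<epsilon>0>0. \<forall>\<epsilon>. 0 < \<epsilon> \<and> \<epsilon> < \<epsilon>0 \<longrightarrow>
     (\<exists>nbar::nat. \<forall>B. GL2_cocycle B \<and> cdist B A < \<delta> \<longrightarrow>
        (\<forall>n\<ge>nbar. dev_prob p B n \<epsilon> < exp (- c * \<epsilon>^2 * real n)))"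
proof -
  obtain \<delta> K where dK: "0 < \<delta>" "0 < K" and u: "\<And>B. cdist B A < \<delta> \<Longrightarrow>
     \<exists>L. \<forall>n. \<forall>s\<ge>0. pw p n (\<lambda>w. \<bar>lognorm B w - real n * L\<bar> > s + K) \<le> 4 * exp (- s\<^sup>2 / (K * real n))"
    using assms unfolding uniform_ldt_def by blast
  show ?thesis
  proof (rule exI[of _ \<delta>], rule conjI[OF dK(1)], rule exI[of _ "1 / (8 * K)"], rule conjI,
      use dK in simp, rule exI[of _ "1::real"], rule conjI[OF zero_less_one], intro allI impI)
    fix \<epsilon> :: real assume e: "0 < \<epsilon> \<and> \<epsilon> < 1"
    \<comment> \<open>The middle summand fits the additive constant \<open>K\<close> into \<epsilon>
      n / 2; the last makes half of the exponent exceed ln 4, so the factor 4 is traded for the rate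
      1 / (8 K).\<close>
    obtain nbar :: nat where nbar: "1 + 2 * K / \<epsilon> + 8 * K * ln 4 / \<epsilon>\<^sup>2 < nbar" using reals_Archimedean2 by blast
    show "\<exists>nbar::nat. \<forall>B. GL2_cocycle B \<and> cdist B A < \<delta> \<longrightarrow>
        (\<forall>n\<ge>nbar. dev_prob p B n \<epsilon> < exp (- (1 / (8 * K)) * \<epsilon>^2 * real n))"
    proof (intro exI[of _ nbar] allI impI)
      fix B n assume B: "GL2_cocycle B \<and> cdist B A < \<delta>" and n: "nbar \<le> n"
      obtain L where L: "\<And>n s. 0 \<le> s \<Longrightarrow>
        pw p n (\<lambda>w. \<bar>lognorm B w - real n * L\<bar> > s + K) \<le> 4 * exp (- s\<^sup>2 / (K * real n))"
        using u B by blast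
      have nn: "0 \<le> 2 * K / \<epsilon>" "0 \<le> 8 * K * ln 4 / \<epsilon>\<^sup>2" using dK e by auto
      have nr: "real nbar \<le> real n" using n by simp
      then have n1: "1 \<le> n" "2 * K / \<epsilon> \<le> n" "8 * K * ln 4 / \<epsilon>\<^sup>2 < n" using nbar nn by linarith+
      have "dev_prob p B n \<epsilon> \<le> 4 * exp (- (\<epsilon>\<^sup>2 / (4 * K)) * n)"
      proof -
        have "Lplus p B = L" by (rule Lplus_of_ldt(1)[OF dK(2)]) (rule L)
        moreover have "pw p n (\<lambda>w. \<bar>lognorm B w - real n * L\<bar> > \<epsilon> * n) \<le> 4 * exp (- (\<epsilon>\<^sup>2 / (4 * K)) * n)"
          by (rule Lplus_of_ldt(2)[OF dK(2)]) (use L e n1 in auto)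
        ultimately show ?thesis by (simp add: dev_prob_eq_pw_scaled[OF n1(1)])
      qed
      also have "\<dots> = exp (ln 4 - \<epsilon>\<^sup>2 / (4 * K) * n)" by (simp add: exp_diff exp_minus field_simps)
      also have "\<dots> < exp (- (1 / (8 * K)) * \<epsilon>^2 * real n)"
      proof -
        have "ln 4 < \<epsilon>\<^sup>2 / (8 * K) * n" using n1(3) e dK by (simp add: field_simps)
        then have "ln 4 - \<epsilon>\<^sup>2 / (4 * K) * n < - (1 / (8 * K)) * \<epsilon>^2 * real n"
          using dK by (simp add: field_simps)
        then show ?thesis by simp
      qed
      finally show "dev_prob p B n \<epsilon> < exp (- (1 / (8 * K)) * \<epsilon>^2 * real n)" .
    qed
  qed
qed

section \<open>Cocycles close to a dominated diagonal one\<close>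

lemma sum_list_deviation:
  fixes p :: "'a::finite pmf" and f :: "'a \<Rightarrow> real"
  assumes D: "0 < D" "\<And>j. \<bar>f j - (\<Sum>i\<in>UNIV. pmf p i * f i)\<bar> \<le> D" and s: "0 \<le> s"
  shows "pw p n (\<lambda>w. \<bar>sum_list (map f w) - real n * (\<Sum>i\<in>UNIV. pmf p i * f i)\<bar> > s) \<le> 2 * exp (- s\<^sup>2 / (4 * real n * D\<^sup>2))"
proof -
  let ?\<mu> = "\<Sum>i\<in>UNIV. pmf p i * f i"
  have add: "addf (\<lambda>j _. f j) (\<lambda>_ u. u) w () = sum_list (map f w)" for w
    by (induction w) auto
  have mean: "ew p n (\<lambda>w. sum_list (map f w)) = real n * ?\<mu>" for n
    by (induction n) (auto simp: ew_add distrib_left distrib_right sum.distrib)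
  have "pw p n (\<lambda>w. \<bar>addf (\<lambda>j _. f j) (\<lambda>_ u. u) w () - ew p n (\<lambda>w. addf (\<lambda>j _. f j) (\<lambda>_ u. u) w ())\<bar> > s)
      \<le> 2 * exp (- s\<^sup>2 / (4 * real n * D\<^sup>2))"
  proof (rule azuma_addf[where S = UNIV])
    fix m j and x :: unit
    have "f j + ew p m (\<lambda>w. addf (\<lambda>j _. f j) (\<lambda>_ u. u) w ()) - ew p (Suc m) (\<lambda>w. addf (\<lambda>j _. f j) (\<lambda>_ u. u) w ()) = f j - ?\<mu>"
      unfolding add mean by (simp add: algebra_simps)
    then show "\<bar>f j + ew p m (\<lambda>w. addf (\<lambda>j _. f j) (\<lambda>_ u. u) w x) - ew p (Suc m) (\<lambda>w. addf (\<lambda>j _. f j) (\<lambda>_ u. u) w x)\<bar> \<le> D"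
      using D(2)[of j] by simp
  qed (use D s in auto)
  then show ?thesis unfolding add mean .
qed

lemma powr_subadd:
  fixes u v b :: real
  assumes "0 \<le> u" "0 \<le> v" "0 < b" "b \<le> 1"
  shows "(u + v) powr b \<le> u powr b + v powr b"
proof (cases "u + v = 0")
  case False
  define s where "s = u + v"
  have s: "0 < s" using assms False by (simp add: s_def)
  have *: "x / s * s powr b \<le> x powr b" if "0 \<le> x" "x \<le> s" for x
  proof -
    have "x / s \<le> (x / s) powr b"
      using powr_mono'[of b 1 "x / s"] that s assms by simp
    then have "x / s * s powr b \<le> (x / s) powr b * s powr b" by (intro mult_right_mono) auto
    also have "\<dots> = x powr b" using that s by (simp add: powr_mult[symmetric])
    finally show ?thesis .
  qed
  have "s powr b = u / s * s powr b + v / s * s powr b"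
  proof -
    have "u / s + v / s = 1" using s by (simp add: s_def add_divide_distrib[symmetric])
    then show ?thesis by (metis distrib_right mult_1)
  qed
  also have "\<dots> \<le> u powr b + v powr b"
    using assms by (intro add_mono *) (auto simp: s_def)
  finally show ?thesis by (simp add: s_def)
qed (use assms in auto)

section \<open>Directions in a wide cone around the dominant axis\<close>

definition flat :: "real \<Rightarrow> real^2 \<Rightarrow> bool" where
  "flat T v \<longleftrightarrow> \<bar>v $ 2\<bar> \<le> T * \<bar>v $ 1\<bar>"

text \<open>A drift function for the motion of directions. The power \<open>b\<close> is chosen so
  that the random ratio of the two diagonal entries has \<open>b\<close>-th moment at most 1,
  although the ratio itself may have a large mean.\<close>

definition slope :: "real \<Rightarrow> real^2 \<Rightarrow> real" where
  "slope b v = (\<bar>v $ 2\<bar> / \<bar>v $ 1\<bar>) powr b"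

definition flat_word :: "('a \<Rightarrow> mat2) \<Rightarrow> real \<Rightarrow> real^2 \<Rightarrow> 'a list \<Rightarrow> bool" where
  "flat_word B T v w \<longleftrightarrow> (\<forall>k\<le>length w. flat T (wprod B (take k w) *v v))"

lemma all_le_Suc_iff: "(\<forall>k\<le>Suc n. P k) \<longleftrightarrow> P 0 \<and> (\<forall>k\<le>n. P (Suc k))"
  by (metis Suc_le_mono not0_implies_Suc zero_le)

lemma flat_word_Cons:
  "flat_word B T v (j # w) \<longleftrightarrow> flat T v \<and> flat_word B T (B j *v v) w"
proof -
  have "flat_word B T v (j # w) \<longleftrightarrow> (\<forall>k\<le>Suc (length w). flat T (wprod B (take k (j # w)) *v v))"
    by (simp add: flat_word_def)
  also have "\<dots> \<longleftrightarrow> flat T v \<and> (\<forall>k\<le>length w. flat T (wprod B (take (Suc k) (j # w)) *v v))"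
    unfolding all_le_Suc_iff by (simp add: wprod_Cons_vec del: wprod.simps(2))
  finally show ?thesis by (simp only: take_Suc_Cons wprod_Cons_vec flat_word_def)
qed

lemma flat_word_take: "flat_word B T v w \<Longrightarrow> flat_word B T v (take k w)"
  by (auto simp: flat_word_def min_def)

context
  fixes p :: "'a::finite pmf" and al be :: "'a \<Rightarrow> real" and B :: "'a \<Rightarrow> mat2" and b e \<rho> T \<theta> :: real
  assumes b: "0 < b" "b \<le> 1" and e: "0 < e" "\<And>j. 4 * e \<le> \<bar>al j\<bar>"
    and contr: "(\<Sum>j\<in>UNIV. pmf p j * ((\<bar>be j\<bar> + e) / (\<bar>al j\<bar> - 2 * e)) powr b) \<le> 1"
    and B11: "\<And>j. \<bar>B j $ 1 $ 1 - al j\<bar> \<le> e" and B22: "\<And>j. \<bar>B j $ 2 $ 2 - be j\<bar> \<le> e"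
    and B21: "\<And>j. \<bar>B j $ 2 $ 1\<bar> \<le> e" and B12: "\<And>j. \<bar>B j $ 1 $ 2\<bar> \<le> \<rho>"
    and T: "0 < T" "0 \<le> \<rho>" "\<rho> * T \<le> \<theta> * e" "\<theta> \<le> 1"
begin

text \<open>The purpose of the relation between \<rho> and \<open>T\<close>: inside the cone the
  upper right entry changes the first coordinate only by a fraction \<theta> of \<open>e\<close>,
  however wide the cone is.\<close>

lemma offdiag_small:
  assumes "flat T v"
  shows "\<bar>B j $ 1 $ 2 * v $ 2\<bar> \<le> \<theta> * e * \<bar>v $ 1\<bar>"
proof -
  have "\<bar>B j $ 1 $ 2 * v $ 2\<bar> \<le> \<rho> * (T * \<bar>v $ 1\<bar>)"
    unfolding abs_mult using assms B12 T by (intro mult_mono) (auto simp: flat_def)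
  also have "\<dots> \<le> \<theta> * e * \<bar>v $ 1\<bar>" using T(3) by (simp add: mult.assoc[symmetric] mult_right_mono)
  finally show ?thesis .
qed

lemma first_coord_ge:
  assumes "flat T v"
  shows "(\<bar>al j\<bar> - 2 * e) * \<bar>v $ 1\<bar> \<le> \<bar>(B j *v v) $ 1\<bar>"
proof -
  have "\<theta> * e * \<bar>v $ 1\<bar> \<le> e * \<bar>v $ 1\<bar>" using T e by (intro mult_right_mono) (auto simp: mult_le_cancel_right1)
  then have o: "\<bar>B j $ 1 $ 2 * v $ 2\<bar> \<le> e * \<bar>v $ 1\<bar>" using offdiag_small[OF assms, of j] by linarith
  have "\<bar>al j\<bar> - e \<le> \<bar>B j $ 1 $ 1\<bar>" using B11[of j] by linarith
  then have "(\<bar>al j\<bar> - e) * \<bar>v $ 1\<bar> \<le> \<bar>B j $ 1 $ 1 * v $ 1\<bar>" unfolding abs_mult by (rule mult_right_mono) simp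
  then show ?thesis using o unfolding matvec2 left_diff_distrib by linarith
qed

lemma first_coord_nz:
  assumes "flat T v" "v $ 1 \<noteq> 0"
  shows "(B j *v v) $ 1 \<noteq> 0"
proof -
  have "0 < (\<bar>al j\<bar> - 2 * e) * \<bar>v $ 1\<bar>" using e(1) e(2)[of j] assms by (intro mult_pos_pos) linarith+
  with first_coord_ge[OF assms(1), of j] show ?thesis by linarith
qed

text \<open>The diagonal part does not increase the mean of the drift function, by
  \<open>contr\<close>; the lower left entry adds a slope of at most 1/2, and powers with exponent
  at most 1 are subadditive.\<close>

lemma slope_step:
  assumes "flat T v" "v $ 1 \<noteq> 0"
  shows "(\<Sum>j\<in>UNIV. pmf p j * slope b (B j *v v)) \<le> slope b v + 1"
proof -
  have "slope b (B j *v v) \<le> ((\<bar>be j\<bar> + e) / (\<bar>al j\<bar> - 2 * e)) powr b * slope b v + 1" for j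
  proof -
    let ?d = "\<bar>al j\<bar> - 2 * e"
    have d: "2 * e \<le> ?d" "0 < ?d" using e(1) e(2)[of j] by linarith+
    have "\<bar>(B j *v v) $ 2\<bar> \<le> \<bar>B j $ 2 $ 1\<bar> * \<bar>v $ 1\<bar> + \<bar>B j $ 2 $ 2\<bar> * \<bar>v $ 2\<bar>"
      unfolding matvec2 by (rule order_trans[OF abs_triangle_ineq]) (simp add: abs_mult)
    also have "\<dots> \<le> e * \<bar>v $ 1\<bar> + (\<bar>be j\<bar> + e) * \<bar>v $ 2\<bar>"
      using B21[of j] B22[of j] by (intro add_mono mult_right_mono) auto
    finally have "\<bar>(B j *v v) $ 2\<bar> / \<bar>(B j *v v) $ 1\<bar> \<le> (e * \<bar>v $ 1\<bar> + (\<bar>be j\<bar> + e) * \<bar>v $ 2\<bar>) / (?d * \<bar>v $ 1\<bar>)"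
      using first_coord_ge[OF assms(1), of j] d assms(2) e(1)
      by (intro frac_le) (auto intro!: add_nonneg_nonneg)
    also have "\<dots> = (\<bar>be j\<bar> + e) / ?d * (\<bar>v $ 2\<bar> / \<bar>v $ 1\<bar>) + e / ?d"
    proof -
      have "(c * x + a * y) / (d * x) = a / d * (y / x) + c / d" if "d \<noteq> 0" "x \<noteq> 0" for a c d x y :: real
        using that by (simp add: field_simps)
      then show ?thesis using d assms(2) by simp
    qed
    finally have "slope b (B j *v v) \<le> ((\<bar>be j\<bar> + e) / ?d * (\<bar>v $ 2\<bar> / \<bar>v $ 1\<bar>) + e / ?d) powr b"
      unfolding slope_def using b by (intro powr_mono2) auto
    also have "\<dots> \<le> ((\<bar>be j\<bar> + e) / ?d * (\<bar>v $ 2\<bar> / \<bar>v $ 1\<bar>)) powr b + (e / ?d) powr b"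
      using b d e(1) by (intro powr_subadd) auto
    also have "(e / ?d) powr b \<le> 1"
      using d e(1) b by (intro powr_le1) (auto simp: field_simps)
    also have "((\<bar>be j\<bar> + e) / ?d * (\<bar>v $ 2\<bar> / \<bar>v $ 1\<bar>)) powr b = ((\<bar>be j\<bar> + e) / ?d) powr b * slope b v"
      unfolding slope_def by (rule powr_mult)
    finally show ?thesis by simp
  qed
  then have "(\<Sum>j\<in>UNIV. pmf p j * slope b (B j *v v))
      \<le> (\<Sum>j\<in>UNIV. pmf p j * (((\<bar>be j\<bar> + e) / (\<bar>al j\<bar> - 2 * e)) powr b * slope b v + 1))"
    by (intro sum_mono mult_left_mono) auto
  also have "\<dots> = (\<Sum>j\<in>UNIV. pmf p j * ((\<bar>be j\<bar> + e) / (\<bar>al j\<bar> - 2 * e)) powr b) * slope b v + 1"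
    by (simp add: distrib_left sum.distrib sum_distrib_right mult.assoc)
  also have "\<dots> \<le> 1 * slope b v + 1" by (intro add_right_mono mult_right_mono contr) (simp add: slope_def)
  finally show ?thesis by simp
qed

text \<open>Doob's maximal inequality for the nonnegative supermartingale given by the slope plus
  the number of remaining letters, proved by induction on the first letter. Outside the cone the
  right-hand side is at least 1.\<close>

lemma flat_word_prob:
  assumes "v $ 1 \<noteq> 0"
  shows "pw p n (\<lambda>w. \<not> flat_word B T v w) \<le> T powr (- b) * (slope b v + n)"
proof (cases "flat T v")
  case False
  then have "T < \<bar>v $ 2\<bar> / \<bar>v $ 1\<bar>" using assms by (simp add: flat_def field_simps)
  then have "T powr b \<le> slope b v" unfolding slope_def using b T by (intro powr_mono2) auto
  then have "1 \<le> T powr (- b) * slope b v" using T by (simp add: powr_minus field_simps)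
  also have "\<dots> \<le> T powr (- b) * (slope b v + n)" by (intro mult_left_mono) auto
  finally show ?thesis by (rule order_trans[OF pw_le_1])
next
  case True
  then show ?thesis using assms
  proof (induction n arbitrary: v)
    case 0
    then show ?case by (simp add: pw_def flat_word_def slope_def)
  next
    case (Suc n)
    have IH: "pw p n (\<lambda>w. \<not> flat_word B T (B j *v v) w) \<le> T powr (- b) * (slope b (B j *v v) + n)" for j
    proof (cases "flat T (B j *v v)")
      case True
      then show ?thesis by (rule Suc.IH) (rule first_coord_nz[OF Suc.prems])
    next
      case False
      then have "T < \<bar>(B j *v v) $ 2\<bar> / \<bar>(B j *v v) $ 1\<bar>"
        using first_coord_nz[OF Suc.prems, of j] by (simp add: flat_def field_simps)
      then have "T powr b \<le> slope b (B j *v v)" unfolding slope_def using b T by (intro powr_mono2) auto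
      then have "1 \<le> T powr (- b) * slope b (B j *v v)" using T by (simp add: powr_minus field_simps)
      also have "\<dots> \<le> T powr (- b) * (slope b (B j *v v) + n)" by (intro mult_left_mono) auto
      finally show ?thesis by (rule order_trans[OF pw_le_1])
    qed
    have "pw p (Suc n) (\<lambda>w. \<not> flat_word B T v w) = (\<Sum>j\<in>UNIV. pmf p j * pw p n (\<lambda>w. \<not> flat_word B T (B j *v v) w))"
      unfolding pw_Suc flat_word_Cons using Suc.prems by simp
    also have "\<dots> \<le> (\<Sum>j\<in>UNIV. pmf p j * (T powr (- b) * (slope b (B j *v v) + n)))"
      by (intro sum_mono mult_left_mono IH) auto
    also have "\<dots> = T powr (- b) * ((\<Sum>j\<in>UNIV. pmf p j * slope b (B j *v v)) + n)"
    proof -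
      have "(\<Sum>j\<in>UNIV. pmf p j * (T powr (- b) * (slope b (B j *v v) + n)))
        = (\<Sum>j\<in>UNIV. T powr (- b) * (pmf p j * slope b (B j *v v)) + pmf p j * (T powr (- b) * n))"
        by (rule sum.cong) (auto simp: algebra_simps)
      then show ?thesis by (simp add: sum.distrib sum_distrib_left[symmetric] distrib_left)
    qed
    also have "\<dots> \<le> T powr (- b) * ((slope b v + 1) + n)"
      by (intro mult_left_mono add_right_mono slope_step Suc.prems) auto
    finally show ?case by (simp add: add_ac)
  qed
qed

text \<open>While the direction stays in the cone each letter multiplies the first coordinate by its
  upper left entry, with error \<theta> \<open>e\<close> against a factor of at least 2
  \<open>e\<close>; so the logarithm is a sum over the letters up to \<theta> / 2 per
  letter.\<close>

lemma first_coord_additive: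
  assumes "flat_word B T v w" "v $ 1 \<noteq> 0"
  shows "(wprod B w *v v) $ 1 \<noteq> 0"
    and "\<bar>ln \<bar>(wprod B w *v v) $ 1\<bar> - ln \<bar>v $ 1\<bar> - sum_list (map (\<lambda>j. ln \<bar>B j $ 1 $ 1\<bar>) w)\<bar> \<le> length w * (\<theta> / 2)"
proof -
  have "(wprod B w *v v) $ 1 \<noteq> 0 \<and> \<bar>ln \<bar>(wprod B w *v v) $ 1\<bar> - ln \<bar>v $ 1\<bar> - sum_list (map (\<lambda>j. ln \<bar>B j $ 1 $ 1\<bar>) w)\<bar> \<le> length w * (\<theta> / 2)"
    using assms
  proof (induction w arbitrary: v)
    case (Cons j w)
    have fl: "flat T v" "flat_word B T (B j *v v) w" using Cons.prems by (auto simp: flat_word_Cons)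
    note nz = first_coord_nz[OF fl(1) Cons.prems(2), of j]
    note IH = Cons.IH[OF fl(2) nz]
    have v1: "0 < \<bar>v $ 1\<bar>" using Cons.prems by simp
    have B11': "3 * e \<le> \<bar>B j $ 1 $ 1\<bar>" using B11[of j] e(2)[of j] by linarith
    have "\<bar>ln \<bar>(B j *v v) $ 1\<bar> - ln \<bar>B j $ 1 $ 1 * v $ 1\<bar>\<bar> \<le> \<bar>\<bar>(B j *v v) $ 1\<bar> - \<bar>B j $ 1 $ 1 * v $ 1\<bar>\<bar> / (2 * e * \<bar>v $ 1\<bar>)"
    proof (rule ln_diff_abs_le)
      show "0 < 2 * e * \<bar>v $ 1\<bar>" using e v1 by simp
      have "2 * e * \<bar>v $ 1\<bar> \<le> (\<bar>al j\<bar> - 2 * e) * \<bar>v $ 1\<bar>" using e(2)[of j] by (intro mult_right_mono) auto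
      with first_coord_ge[OF fl(1), of j] show "2 * e * \<bar>v $ 1\<bar> \<le> \<bar>(B j *v v) $ 1\<bar>" by linarith
      show "2 * e * \<bar>v $ 1\<bar> \<le> \<bar>B j $ 1 $ 1 * v $ 1\<bar>"
        unfolding abs_mult using B11' e(1) by (intro mult_right_mono) auto
    qed
    also have "\<dots> \<le> \<bar>B j $ 1 $ 2 * v $ 2\<bar> / (2 * e * \<bar>v $ 1\<bar>)"
      using e(1) by (intro divide_right_mono) (auto simp: matvec2)
    also have "\<dots> \<le> (\<theta> * e * \<bar>v $ 1\<bar>) / (2 * e * \<bar>v $ 1\<bar>)"
      using e(1) by (intro divide_right_mono offdiag_small fl) auto
    also have "\<dots> = \<theta> / 2" using e(1) v1 by simp
    finally have *: "\<bar>ln \<bar>(B j *v v) $ 1\<bar> - ln \<bar>B j $ 1 $ 1 * v $ 1\<bar>\<bar> \<le> \<theta> / 2" .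
    have ln_prod: "ln \<bar>B j $ 1 $ 1 * v $ 1\<bar> = ln \<bar>B j $ 1 $ 1\<bar> + ln \<bar>v $ 1\<bar>"
      using B11' e(1) v1 by (simp add: abs_mult ln_mult)
    have len: "real (length (j # w)) * (\<theta> / 2) = length w * (\<theta> / 2) + \<theta> / 2" by (simp add: distrib_right)
    have tri: "\<bar>Z - v' - (b' + S)\<bar> \<le> l' + t" if "\<bar>z - y\<bar> \<le> t" "\<bar>Z - z - S\<bar> \<le> l'" "y = b' + v'" for Z z y v' b' S l' t :: real
      using that by linarith
    have "\<bar>ln \<bar>(wprod B w *v (B j *v v)) $ 1\<bar> - ln \<bar>v $ 1\<bar> - (ln \<bar>B j $ 1 $ 1\<bar> + sum_list (map (\<lambda>j. ln \<bar>B j $ 1 $ 1\<bar>) w))\<bar> \<le> real (length (j # w)) * (\<theta> / 2)"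
      unfolding len by (rule tri[OF * conjunct2[OF IH] ln_prod])
    then show ?case using conjunct1[OF IH] unfolding wprod_Cons_vec list.map sum_list.Cons by blast
  qed simp
  then show "(wprod B w *v v) $ 1 \<noteq> 0"
    and "\<bar>ln \<bar>(wprod B w *v v) $ 1\<bar> - ln \<bar>v $ 1\<bar> - sum_list (map (\<lambda>j. ln \<bar>B j $ 1 $ 1\<bar>) w)\<bar> \<le> length w * (\<theta> / 2)"
    by auto
qed

text \<open>Both starting vectors have first coordinate 1 and span area 1, so
  \<open>opnorm_two_points\<close> bounds the norm by their images, which lie in the cone. The 3 is
  the sum of the bounds 2 and 1 for their norms.\<close>

lemma flat_word_opnorm:
  assumes w: "flat_word B T (axis 1 1) w" "flat_word B T (vector [1, 1]) w"
  shows "opnorm (wprod B w) \<le> 3 * (1 + T) * exp (sum_list (map (\<lambda>j. ln \<bar>B j $ 1 $ 1\<bar>) w) + length w * (\<theta> / 2))"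
    and "exp (sum_list (map (\<lambda>j. ln \<bar>B j $ 1 $ 1\<bar>) w) - length w * (\<theta> / 2)) \<le> opnorm (wprod B w)"
proof -
  let ?e1 = "axis 1 1 :: real^2" and ?e12 = "vector [1, 1] :: real^2"
  define P where "P = sum_list (map (\<lambda>j. ln \<bar>B j $ 1 $ 1\<bar>) w)"
  define h where "h = length w * (\<theta> / 2)"
  have first: "(wprod B w *v v) $ 1 \<noteq> 0" "\<bar>ln \<bar>(wprod B w *v v) $ 1\<bar> - P\<bar> \<le> h" if "flat_word B T v w" "v $ 1 = 1" for v
    using first_coord_additive[OF that(1)] that(2) by (simp_all add: P_def h_def)
  have up: "norm (wprod B w *v v) \<le> (1 + T) * exp (P + h)" if "flat_word B T v w" "v $ 1 = 1" for v
  proof -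
    define z where "z = wprod B w *v v"
    have z: "z $ 1 \<noteq> 0" "ln \<bar>z $ 1\<bar> \<le> P + h" using first[OF that] by (auto simp: z_def abs_le_iff)
    then have z1: "\<bar>z $ 1\<bar> \<le> exp (P + h)" by (metis exp_le_cancel_iff exp_ln zero_less_abs_iff)
    have "flat T z" using that(1)[unfolded flat_word_def, rule_format, of "length w"] by (simp add: z_def)
    moreover have "norm z \<le> \<bar>z $ 1\<bar> + \<bar>z $ 2\<bar>" using norm_le_l1_cart[of z] by (simp add: sum_2)
    ultimately have "norm z \<le> (1 + T) * \<bar>z $ 1\<bar>" by (simp add: flat_def distrib_right)
    also have "\<dots> \<le> (1 + T) * exp (P + h)" using T z1 by (intro mult_left_mono) auto
    finally show ?thesis by (simp add: z_def)
  qed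
  have v1: "?e1 $ 1 = 1" "?e12 $ 1 = 1" by (simp_all add: axis_def)
  have "opnorm (wprod B w) * \<bar>wedge ?e1 ?e12\<bar> \<le> norm (wprod B w *v ?e1) * norm ?e12 + norm (wprod B w *v ?e12) * norm ?e1"
    by (rule opnorm_two_points)
  also have "\<dots> \<le> ((1 + T) * exp (P + h)) * 2 + ((1 + T) * exp (P + h)) * 1"
    using T norm_le_l1_cart[of ?e12] up[OF w(1) v1(1)] up[OF w(2) v1(2)]
    by (intro add_mono mult_mono) (auto simp: sum_2)
  finally show "opnorm (wprod B w) \<le> 3 * (1 + T) * exp (P + h)"
    by (simp add: wedge_def axis_def algebra_simps)
  have "exp (P - h) \<le> exp (ln \<bar>(wprod B w *v ?e1) $ 1\<bar>)" using first(2)[OF w(1) v1(1)] by (auto simp: abs_le_iff)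
  also have "\<dots> = \<bar>(wprod B w *v ?e1) $ 1\<bar>" using first(1)[OF w(1) v1(1)] by simp
  also have "\<dots> \<le> opnorm (wprod B w)"
    using order_trans[OF component_le_norm_cart opnorm_ge[of "wprod B w" ?e1]] by simp
  finally show "exp (P - h) \<le> opnorm (wprod B w)" .
qed

end

section \<open>Expansion for nearly diagonal cocycles\<close>

lemma exp_decay_limit:
  fixes a c d :: real
  assumes "0 < c"
  shows "(\<lambda>n. (a * real n + d) * exp (- c * real n)) \<longlonglongrightarrow> 0"
proof -
  have n: "norm (exp (- c)) < 1" using assms by simp
  have "(\<lambda>n. a * (real n * exp (- c) ^ n) + d * exp (- c) ^ n) \<longlonglongrightarrow> a * 0 + d * 0"
    by (intro tendsto_add tendsto_mult tendsto_const powser_times_n_limit_0 LIMSEQ_power_zero n)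
  then show ?thesis by (simp add: exp_of_nat_mult[symmetric] algebra_simps)
qed

lemma eventually_exp_decay:
  fixes a c d t :: real
  assumes "0 < c" "0 < t"
  shows "eventually (\<lambda>n. (a * real n + d) * exp (- c * real n) < t) sequentially"
  using order_tendstoD(2)[OF exp_decay_limit[OF assms(1)] assms(2)] .

text \<open>The upper right entry has a bound of its own because it is what displaces the second
  axis: \<open>d\<close> stays fixed while \<rho> may be arbitrarily small.\<close>

definition near_diag :: "('a \<Rightarrow> real) \<Rightarrow> ('a \<Rightarrow> real) \<Rightarrow> real \<Rightarrow> real \<Rightarrow> ('a \<Rightarrow> mat2) \<Rightarrow> bool" where
  "near_diag al be d \<rho> B \<longleftrightarrow> (\<forall>j. \<bar>B j $ 1 $ 1 - al j\<bar> \<le> d \<and> \<bar>B j $ 2 $ 2 - be j\<bar> \<le> d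
     \<and> \<bar>B j $ 2 $ 1\<bar> \<le> d \<and> \<bar>B j $ 1 $ 2\<bar> \<le> \<rho>)"

lemma near_diagD:
  assumes "near_diag al be d \<rho> B"
  shows "\<bar>B j $ 1 $ 1 - al j\<bar> \<le> d" "\<bar>B j $ 2 $ 2 - be j\<bar> \<le> d" "\<bar>B j $ 2 $ 1\<bar> \<le> d" "\<bar>B j $ 1 $ 2\<bar> \<le> \<rho>"
  using assms by (auto simp: near_diag_def)

context
  fixes p :: "'a::finite pmf" and al be :: "'a \<Rightarrow> real"
  assumes full: "set_pmf p = UNIV"
    and nz: "\<And>j. al j \<noteq> 0" "\<And>j. be j \<noteq> 0"
    and dom: "(\<Sum>j\<in>UNIV. pmf p j * ln \<bar>be j\<bar>) < (\<Sum>j\<in>UNIV. pmf p j * ln \<bar>al j\<bar>)"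
begin

text \<open>Dominance says that ln |be / al| has negative mean, so some power of the ratio has
  moment below 1; continuity in \<open>e\<close> leaves room for the perturbation.\<close>

lemma slope_contraction_constants:
  obtains b e where "0 < b" "b \<le> 1" "0 < e" "e \<le> 1" "\<And>j. 4 * e \<le> \<bar>al j\<bar>"
    "(\<Sum>j\<in>UNIV. pmf p j * ((\<bar>be j\<bar> + e) / (\<bar>al j\<bar> - 2 * e)) powr b) \<le> 1"
proof -
  define y where "y j = ln \<bar>be j\<bar> - ln \<bar>al j\<bar>" for j
  obtain b where b: "0 < b" "b \<le> 1" "ew p 1 (\<lambda>w. exp (b * y (hd w))) < 1"
  proof (rule ew_exp_less_1[of 1 "\<lambda>w. y (hd w)" "\<Sum>j\<in>UNIV. \<bar>y j\<bar>" p])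
    show "\<bar>y (hd w)\<bar> \<le> (\<Sum>j\<in>UNIV. \<bar>y j\<bar>)" for w by (rule member_le_sum) auto
    show "ew p 1 (\<lambda>w. y (hd w)) < 0"
      using dom by (simp add: y_def right_diff_distrib sum_subtractf)
  qed
  have "(\<Sum>j\<in>UNIV. pmf p j * ((\<bar>be j\<bar> + 0) / (\<bar>al j\<bar> - 2 * 0)) powr b) < 1"
  proof -
    have "exp (b * y j) = (\<bar>be j\<bar> / \<bar>al j\<bar>) powr b" for j
      using nz[of j] by (simp add: powr_def y_def ln_div)
    then show ?thesis using b(3) by simp
  qed
  moreover have "((\<lambda>e. \<Sum>j\<in>UNIV. pmf p j * ((\<bar>be j\<bar> + e) / (\<bar>al j\<bar> - 2 * e)) powr b)
      \<longlongrightarrow> (\<Sum>j\<in>UNIV. pmf p j * ((\<bar>be j\<bar> + 0) / (\<bar>al j\<bar> - 2 * 0)) powr b)) (at_right 0)"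
    by (intro tendsto_intros) (use nz in auto)
  ultimately have ev: "eventually (\<lambda>e. (\<Sum>j\<in>UNIV. pmf p j * ((\<bar>be j\<bar> + e) / (\<bar>al j\<bar> - 2 * e)) powr b) < 1) (at_right 0)"
    by (rule order_tendstoD(2)[rotated])
  define m where "m = min 1 (Min (range (\<lambda>j. \<bar>al j\<bar> / 4)))"
  have "Min (range (\<lambda>j. \<bar>al j\<bar> / 4)) \<in> range (\<lambda>j. \<bar>al j\<bar> / 4)" by (rule Min_in) auto
  then have "0 < Min (range (\<lambda>j. \<bar>al j\<bar> / 4))" using nz by auto
  then have m0: "0 < m" by (simp add: m_def)
  have m4: "4 * m \<le> \<bar>al j\<bar>" for j
  proof -
    have "Min (range (\<lambda>j. \<bar>al j\<bar> / 4)) \<le> \<bar>al j\<bar> / 4" by (rule Min_le) auto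
    then have "m \<le> \<bar>al j\<bar> / 4" unfolding m_def by linarith
    then show ?thesis by simp
  qed
  have "eventually (\<lambda>e. 0 < e \<and> e < m) (at_right 0)" using m0 by (auto simp: eventually_at_right_field)
  with ev have "eventually (\<lambda>e. (\<Sum>j\<in>UNIV. pmf p j * ((\<bar>be j\<bar> + e) / (\<bar>al j\<bar> - 2 * e)) powr b) < 1 \<and> 0 < e \<and> e < m) (at_right 0)"
    by eventually_elim auto
  then obtain e where e: "(\<Sum>j\<in>UNIV. pmf p j * ((\<bar>be j\<bar> + e) / (\<bar>al j\<bar> - 2 * e)) powr b) < 1" "0 < e" "e < m"
    using eventually_happens trivial_limit_at_right_real by blast
  have "4 * e \<le> \<bar>al j\<bar>" for j using m4[of j] e by linarith
  moreover have "e \<le> 1" using e unfolding m_def by linarith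
  ultimately show thesis using that[of b e] b e by simp
qed

lemma near_diag_log_constants:
  fixes \<theta> e :: real
  assumes "0 < \<theta>" "\<theta> \<le> 1" "0 < e" "\<And>j. 4 * e \<le> \<bar>al j\<bar>"
  obtains d C where "0 < d" "d \<le> e" "d \<le> 1"
    "\<And>B \<rho> j. near_diag al be d \<rho> B \<Longrightarrow> \<bar>ln \<bar>B j $ 1 $ 1\<bar> - ln \<bar>al j\<bar>\<bar> \<le> \<theta> / 2"
    "\<And>B \<rho> j. near_diag al be d \<rho> B \<Longrightarrow> \<rho> \<le> d \<Longrightarrow> \<bar>ln \<bar>det (B j)\<bar> - ln \<bar>al j * be j\<bar>\<bar> \<le> \<theta>"
    "\<And>B \<rho>. near_diag al be d \<rho> B \<Longrightarrow> \<rho> \<le> d \<Longrightarrow> bounded_by B C"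
proof -
  define A :: "'a \<Rightarrow> mat2" where "A j = (\<chi> i k. if i = k then (if i = 1 then al j else be j) else 0)" for j
  have "GL2_cocycle A"
    unfolding GL2_cocycle_def using nz by (simp add: invertible_det_nz A_def det_2)
  then obtain C where C: "bounded_by A C" by (rule bdd_exists)
  define A1 where "A1 = (\<Sum>j\<in>UNIV. \<bar>al j\<bar> + \<bar>be j\<bar>)"
  have A1: "\<bar>al j\<bar> \<le> A1" "\<bar>be j\<bar> \<le> A1" for j
  proof -
    have "\<bar>al j\<bar> + \<bar>be j\<bar> \<le> A1" unfolding A1_def by (rule member_le_sum) auto
    then show "\<bar>al j\<bar> \<le> A1" "\<bar>be j\<bar> \<le> A1" by linarith+
  qed
  have A10: "0 \<le> A1" using A1(1)[of undefined] by linarith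
  define \<nu> where "\<nu> = Min (range (\<lambda>j. \<bar>al j * be j\<bar>))"
  have "\<nu> \<in> range (\<lambda>j. \<bar>al j * be j\<bar>)" unfolding \<nu>_def by (rule Min_in) auto
  then have nu0: "0 < \<nu>" using nz by auto
  have nu: "\<nu> \<le> \<bar>al j * be j\<bar>" for j unfolding \<nu>_def by (rule Min_le) auto
  \<comment> \<open>The entry \<open>e * \<theta>\<close> controls the logarithm of the upper left
    entry, exp (-C) / 8 becomes the operator norm allowance of \<open>bdd_perturb\<close> after the
    factor 4 for entrywise bounds, and the last term controls the determinant.\<close>
  define d where "d = min (min e (e * \<theta>)) (min 1 (min (exp (- C) / 8) (\<theta> * \<nu> / (4 * A1 + 6))))"
  have "0 < \<theta> * \<nu> / (4 * A1 + 6)" using assms nu0 A10 by (intro divide_pos_pos) auto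
  then have d: "0 < d" using assms by (simp add: d_def)
  have d: "0 < d" "d \<le> e" "d \<le> e * \<theta>" "d \<le> 1" "d \<le> exp (- C) / 8" "d \<le> \<theta> * \<nu> / (4 * A1 + 6)"
    by (rule d) (unfold d_def, linarith+)
  have d6: "d * (2 * A1 + 3) \<le> \<theta> * \<nu> / 2" using d(6) A10 by (simp add: field_simps)
  show thesis
  proof (rule that[of d "C + 1"])
    fix B :: "'a \<Rightarrow> mat2" and \<rho> j assume n: "near_diag al be d \<rho> B"
    note nd = near_diagD[OF n]
    have "\<bar>ln \<bar>B j $ 1 $ 1\<bar> - ln \<bar>al j\<bar>\<bar> \<le> \<bar>\<bar>B j $ 1 $ 1\<bar> - \<bar>al j\<bar>\<bar> / (3 * e)"
      by (rule ln_diff_abs_le) (use nd(1)[of j] assms(3) assms(4)[of j] d in linarith)+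
    also have "\<dots> \<le> (e * \<theta>) / (3 * e)" using nd(1)[of j] d assms(3) by (intro divide_right_mono) linarith+
    also have "\<dots> \<le> \<theta> / 2" using assms(1,3) by simp
    finally show "\<bar>ln \<bar>B j $ 1 $ 1\<bar> - ln \<bar>al j\<bar>\<bar> \<le> \<theta> / 2" .
  next
    fix B :: "'a \<Rightarrow> mat2" and \<rho> j assume n: "near_diag al be d \<rho> B" and r: "\<rho> \<le> d"
    note nd = near_diagD[OF n, of j]
    have "det (B j) - al j * be j = (B j $ 1 $ 1 - al j) * B j $ 2 $ 2 + al j * (B j $ 2 $ 2 - be j) - B j $ 1 $ 2 * B j $ 2 $ 1"
      by (simp add: det_2 algebra_simps)
    also have "\<bar>\<dots>\<bar> \<le> \<bar>(B j $ 1 $ 1 - al j) * B j $ 2 $ 2\<bar> + \<bar>al j * (B j $ 2 $ 2 - be j)\<bar> + \<bar>B j $ 1 $ 2 * B j $ 2 $ 1\<bar>"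
      by linarith
    also have "\<dots> \<le> d * (A1 + 1) + A1 * d + 1 * d"
      unfolding abs_mult using nd r d A1[of j] A10 by (intro add_mono mult_mono) linarith+
    also have "\<dots> \<le> d * (2 * A1 + 3)" using d(1) by (simp add: algebra_simps)
    also have "\<dots> \<le> \<theta> * \<nu> / 2" by (rule d6)
    finally have dd: "\<bar>det (B j) - al j * be j\<bar> \<le> \<theta> * \<nu> / 2" .
    have tn: "\<theta> * \<nu> \<le> \<nu>" using assms(1,2) nu0 by (simp add: mult_le_cancel_right1)
    have "\<bar>ln \<bar>det (B j)\<bar> - ln \<bar>al j * be j\<bar>\<bar> \<le> \<bar>\<bar>det (B j)\<bar> - \<bar>al j * be j\<bar>\<bar> / (\<nu> / 2)"
      by (rule ln_diff_abs_le) (use dd tn nu[of j] nu0 in linarith)+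
    also have "\<dots> \<le> (\<theta> * \<nu> / 2) / (\<nu> / 2)" using dd nu0 by (intro divide_right_mono) linarith+
    also have "\<dots> = \<theta>" using nu0 by simp
    finally show "\<bar>ln \<bar>det (B j)\<bar> - ln \<bar>al j * be j\<bar>\<bar> \<le> \<theta>" .
  next
    fix B :: "'a \<Rightarrow> mat2" and \<rho> assume n: "near_diag al be d \<rho> B" and r: "\<rho> \<le> d"
    show "bounded_by B (C + 1)"
    proof (rule bdd_perturb[OF C])
      fix j
      have "opnorm (A j - B j) \<le> 4 * d"
      proof (rule opnorm_le_entries)
        fix i k :: 2
        show "\<bar>(A j - B j) $ i $ k\<bar> \<le> d"
          using exhaust_2[of i] exhaust_2[of k] near_diagD[OF n, of j] r by (auto simp: A_def abs_minus_commute)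
      qed
      with d(5) show "opnorm (A j - B j) \<le> exp (- C) / 2" by simp
    qed
  qed (use d in auto)
qed

text \<open>Directions near the second axis are displaced by at least \<open>\<rho> / K0\<close>, so about
  \<open>(4 / kap) * ln (1 / \<rho>)\<close> letters are enough to leave that axis.\<close>
lemma near_diag_growth:
  fixes K0 :: real
  assumes K0: "0 < K0"
  obtains d C kap :: real and M N3 :: nat where "0 < d" "0 < kap" "1 \<le> M" "0 \<le> C"
    "\<And>B \<rho>. near_diag al be d \<rho> B \<Longrightarrow> \<rho> \<le> d \<Longrightarrow> bounded_by B C"
    "\<And>B \<rho> N x. near_diag al be d \<rho> B \<Longrightarrow> \<rho> \<le> d \<Longrightarrow> N3 \<le> N \<Longrightarrow> exp (- kap / 4 * real N) \<le> \<rho> \<Longrightarrow>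
       \<rho> \<le> exp (kap / 4) * exp (- kap / 4 * real N) \<Longrightarrow>
       (\<And>x. x \<noteq> 0 \<Longrightarrow> \<bar>x $ 1\<bar> \<le> \<bar>x $ 2\<bar> \<Longrightarrow> \<exists>j. \<rho> / K0 * (norm x)\<^sup>2 \<le> \<bar>wedge x (B j *v x)\<bar>) \<Longrightarrow>
       x \<noteq> 0 \<Longrightarrow> kap / 2 * real (M * N) \<le> ew p (M * N) (\<lambda>w. vgrow B w x)"
proof -
  \<comment> \<open>The mean growth per letter of \<open>ngrow\<close> on flat words of the diagonal
    cocycle; it takes the place of \<open>gap\<close> and is split into five units again.\<close>
  define gd where "gd = (\<Sum>j\<in>UNIV. pmf p j * ((ln \<bar>al j\<bar> - ln \<bar>be j\<bar>) / 2))"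
  have gd: "0 < gd"
    using dom by (simp add: gd_def right_diff_distrib sum_subtractf flip: sum_divide_distrib)
  define kap where "kap = gd / 5"
  have kap: "0 < kap" "gd = 5 * kap" using gd by (simp_all add: kap_def)
  \<comment> \<open>In the norm comparison below a cone of width at most exp (kap N / 4) and the
    additivity error exp (N kap / 3) must together stay below exp (kap N); 5/12 of kap is left for
    the constant 12.\<close>
  define \<theta> where "\<theta> = min 1 (kap / 3)"
  have th: "0 < \<theta>" "\<theta> \<le> 1" "\<theta> \<le> kap / 3" using kap by (auto simp: \<theta>_def)
  obtain b e where b: "0 < b" "b \<le> 1" and e: "0 < e" "e \<le> 1" "\<And>j. 4 * e \<le> \<bar>al j\<bar>"
    and contr: "(\<Sum>j\<in>UNIV. pmf p j * ((\<bar>be j\<bar> + e) / (\<bar>al j\<bar> - 2 * e)) powr b) \<le> 1"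
    by (rule slope_contraction_constants) blast
  obtain d C where d: "0 < d" "d \<le> e" "d \<le> 1"
    and l11: "\<And>B \<rho> j. near_diag al be d \<rho> B \<Longrightarrow> \<bar>ln \<bar>B j $ 1 $ 1\<bar> - ln \<bar>al j\<bar>\<bar> \<le> \<theta> / 2"
    and ldet: "\<And>B \<rho> j. near_diag al be d \<rho> B \<Longrightarrow> \<rho> \<le> d \<Longrightarrow> \<bar>ln \<bar>det (B j)\<bar> - ln \<bar>al j * be j\<bar>\<bar> \<le> \<theta>"
    and cb: "\<And>B \<rho>. near_diag al be d \<rho> B \<Longrightarrow> \<rho> \<le> d \<Longrightarrow> bounded_by B C"
    by (rule near_diag_log_constants[OF th(1,2) e(1,3)]) blast
  have C0: "0 \<le> C"
  proof (rule bdd_nonneg)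
    show "bounded_by (\<lambda>j. \<chi> i k. if i = k then (if i = 1 then al j else be j) else 0) C"
      by (rule cb[of 0]) (use d in \<open>auto simp: near_diag_def\<close>)
  qed
  obtain pm where pm: "0 < pm" "\<And>j. pm \<le> pmf p j" and pm1: "pm \<le> 1"
    by (rule full_support_lower_bound[OF full]) blast
  obtain M :: nat and \<eta> and N0 :: nat where M: "1 \<le> M" "0 < \<eta>"
    and grow: "\<And>(p :: 'a pmf) B N x. bounded_by B C \<Longrightarrow> N0 \<le> N \<Longrightarrow>
      (\<And>x. x \<noteq> 0 \<Longrightarrow> pw p N (\<lambda>u. \<not> balanced B kap u x) \<le> 1 - pm / 4) \<Longrightarrow>
      pw p (M * N) (\<lambda>w. \<exists>m\<in>{N..M * N}. ngrow B (take m w) < 3 * kap * m) \<le> \<eta> \<Longrightarrow>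
      x \<noteq> 0 \<Longrightarrow> kap / 2 * real (M * N) \<le> ew p (M * N) (\<lambda>w. vgrow B w x)"
    by (rule growth[OF C0 kap(1), of "1 - pm / 4"]) (use pm pm1 in auto)
  define \<xi> where "\<xi> j = (ln \<bar>al j\<bar> - ln \<bar>be j\<bar>) / 2" for j
  define D where "D = 1 + (\<Sum>j\<in>UNIV. \<bar>\<xi> j - gd\<bar>)"
  have D: "0 < D" "\<bar>\<xi> j - gd\<bar> \<le> D" for j
  proof -
    have "\<bar>\<xi> j - gd\<bar> \<le> (\<Sum>j\<in>UNIV. \<bar>\<xi> j - gd\<bar>)" by (rule member_le_sum) auto
    then show "0 < D" "\<bar>\<xi> j - gd\<bar> \<le> D" unfolding D_def by linarith+
  qed
  define K1 where "K1 = (exp (kap / 4) / (\<theta> * e)) powr b"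
  define cc where "cc = b * (kap / 4)"
  define c2 where "c2 = kap\<^sup>2 / (4 * D\<^sup>2)"
  have cc: "0 < cc" "0 < c2" using b kap D by (auto simp: cc_def c2_def)
  \<comment> \<open>In order: leaving the cone within \<open>M * N\<close> letters, the deviation of
    the sums, contraction of flat directions, contraction of steep directions, and the constant in
    the norm comparison.\<close>
  have "eventually (\<lambda>N. (K1 * M * real N + 0) * exp (- cc * real N) < \<eta> / 2
      \<and> (2 * M * real N + 2) * exp (- c2 * real N) < \<eta> / 2
      \<and> (3 * K1 * real N + 2 * K1) * exp (- cc * real N) < 1 / 2
      \<and> (0 * real N + 2 * exp (3 * C) * K0) * exp (- (3 / 4 * kap) * real N) < 1
      \<and> (0 * real N + 12) * exp (- (5 / 12 * kap) * real N) < 1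
      \<and> N0 \<le> N \<and> 1 \<le> N) sequentially"
    using M cc kap
    by (intro eventually_conj eventually_exp_decay eventually_ge_at_top) auto
  then obtain N3 where N3: "\<And>N. N3 \<le> N \<Longrightarrow> (K1 * M * real N) * exp (- cc * real N) < \<eta> / 2
      \<and> (2 * M * real N + 2) * exp (- c2 * real N) < \<eta> / 2
      \<and> (3 * K1 * real N + 2 * K1) * exp (- cc * real N) < 1 / 2
      \<and> (2 * exp (3 * C) * K0) * exp (- (3 / 4 * kap) * real N) < 1
      \<and> 12 * exp (- (5 / 12 * kap) * real N) < 1
      \<and> N0 \<le> N \<and> 1 \<le> N"
    by (auto simp: eventually_sequentially)
  show thesis
  proof (rule that[OF d(1) kap(1) M(1) C0 cb])
    fix B :: "'a \<Rightarrow> mat2" and \<rho> and N and x :: "real^2"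
    assume nd: "near_diag al be d \<rho> B" and rd: "\<rho> \<le> d" and N: "N3 \<le> N"
      and rlow: "exp (- kap / 4 * real N) \<le> \<rho>" and rup: "\<rho> \<le> exp (kap / 4) * exp (- kap / 4 * real N)"
      and ND: "\<And>x. x \<noteq> 0 \<Longrightarrow> \<bar>x $ 1\<bar> \<le> \<bar>x $ 2\<bar> \<Longrightarrow> \<exists>j. \<rho> / K0 * (norm x)\<^sup>2 \<le> \<bar>wedge x (B j *v x)\<bar>"
      and x: "x \<noteq> 0"
    note bounded_by = cb[OF nd rd]
    have NN: "K1 * M * real N * exp (- cc * real N) < \<eta> / 2"
      "(2 * M * real N + 2) * exp (- c2 * real N) < \<eta> / 2"
      "(3 * K1 * real N + 2 * K1) * exp (- cc * real N) < 1 / 2"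
      "2 * exp (3 * C) * K0 * exp (- (3 / 4 * kap) * real N) < 1"
      "12 * exp (- (5 / 12 * kap) * real N) < 1"
      "N0 \<le> N" "1 \<le> N" using N3[OF N] by auto
    have rho: "0 < \<rho>" using rlow exp_gt_zero less_le_trans by blast
    \<comment> \<open>The widest cone that \<theta> permits. Since \<rho> is comparable to exp (-kap
      N / 4), its width is exponential in \<open>N\<close> and so is the smallness of the escape
      probability.\<close>
    define T where "T = \<theta> * e / \<rho>"
    have T: "0 < T" "\<rho> * T \<le> \<theta> * e" using th e rho by (auto simp: T_def)
    have Tb: "T powr (- b) \<le> K1 * exp (- cc * real N)"
    proof -
      have "T powr (- b) = (\<rho> / (\<theta> * e)) powr b"
        using th e rho by (simp add: T_def powr_minus powr_divide field_simps)
      also have "\<dots> \<le> (exp (kap / 4) / (\<theta> * e) * exp (- kap / 4 * real N)) powr b"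
      proof (rule powr_mono2)
        have "\<rho> / (\<theta> * e) \<le> (exp (kap / 4) * exp (- kap / 4 * real N)) / (\<theta> * e)"
          by (rule divide_right_mono[OF rup]) (use th e in simp)
        then show "\<rho> / (\<theta> * e) \<le> exp (kap / 4) / (\<theta> * e) * exp (- kap / 4 * real N)" by simp
      qed (use b rho th e in auto)
      also have "\<dots> = K1 * exp (- kap / 4 * real N) powr b" unfolding K1_def by (rule powr_mult)
      also have "exp (- kap / 4 * real N) powr b = exp (- cc * real N)"
        by (simp add: powr_def cc_def)
      finally show ?thesis .
    qed
    have B': "\<And>j. \<bar>B j $ 1 $ 1 - al j\<bar> \<le> e" "\<And>j. \<bar>B j $ 2 $ 2 - be j\<bar> \<le> e" "\<And>j. \<bar>B j $ 2 $ 1\<bar> \<le> e" "\<And>j. \<bar>B j $ 1 $ 2\<bar> \<le> \<rho>"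
      using near_diagD[OF nd] d(2) order_trans by blast+
    note flat_prob = flat_word_prob[OF b e(1,3) contr B' T(1) less_imp_le[OF rho] T(2) th(2)]
    note opnorm_flat = flat_word_opnorm[OF b e(1,3) contr B' T(1) less_imp_le[OF rho] T(2) th(2)]
    note additive = first_coord_additive[OF b e(1,3) contr B' T(1) less_imp_le[OF rho] T(2) th(2)]
    let ?e1 = "axis 1 1 :: real^2" and ?e12 = "vector [1, 1] :: real^2"
    \<comment> \<open>On flat words the first coordinate bounds the norm from below, so
      \<open>ngrow\<close> is at least a sum of independent variables of mean 5 kap, up to small
      errors.\<close>
    have H: "pw p (M * N) (\<lambda>w. \<exists>m\<in>{N..M * N}. ngrow B (take m w) < 3 * kap * m) \<le> \<eta>"
    proof -
      let ?S = "\<lambda>w. sum_list (map \<xi> w)"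
      have det_sum: "?S w - length w * \<theta> \<le> sum_list (map (\<lambda>j. ln \<bar>B j $ 1 $ 1\<bar>) w) - ln \<bar>det (wprod B w)\<bar> / 2" for w
      proof (induction w)
        case (Cons j w)
        have "det (B j) \<noteq> 0" using bdd_det(1)[OF bounded_by, of "[j]"] by simp
        then have "ln \<bar>det (wprod B (j # w))\<bar> = ln \<bar>det (wprod B w)\<bar> + ln \<bar>det (B j)\<bar>"
          using bdd_det(1)[OF bounded_by, of w] by (simp add: det_mul abs_mult ln_mult)
        moreover have "ln \<bar>al j * be j\<bar> = ln \<bar>al j\<bar> + ln \<bar>be j\<bar>" using nz by (simp add: abs_mult ln_mult)
        moreover have "real (length (j # w)) * \<theta> = length w * \<theta> + \<theta>" by (simp add: distrib_right)
        moreover have "(a - c) / 2 + S - (u + t) \<le> (a' + Y) - (Z + z) / 2"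
          if "S - u \<le> Y - Z / 2" "\<bar>a' - a\<bar> \<le> t / 2" "\<bar>z - (a + c)\<bar> \<le> t" for a c S u t Y Z a' z :: real
        proof -
          have "a - t / 2 \<le> a'" "z \<le> a + c + t" using that by linarith+
          with that(1) show ?thesis by (simp add: field_simps)
        qed
        note this[OF Cons l11[OF nd, of j] ldet[OF nd rd, of j, unfolded \<open>ln \<bar>al j * be j\<bar> = _\<close>]]
        ultimately show ?case
          unfolding \<xi>_def list.map sum_list.Cons by (simp only:)
      qed simp
      have "pw p (M * N) (\<lambda>w. \<exists>m\<in>{N..M * N}. ngrow B (take m w) < 3 * kap * m)
          \<le> pw p (M * N) (\<lambda>w. \<not> flat_word B T ?e1 w \<or> (\<exists>m\<in>{N..M * N}. \<bar>?S (take m w) - m * gd\<bar> > kap * m))"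
      proof (rule pw_mono, rule ccontr)
        fix w assume w: "length w = M * N" "\<exists>m\<in>{N..M * N}. ngrow B (take m w) < 3 * kap * m"
          and n: "\<not> (\<not> flat_word B T ?e1 w \<or> (\<exists>m\<in>{N..M * N}. \<bar>?S (take m w) - m * gd\<bar> > kap * m))"
        then obtain m where m: "m \<in> {N..M * N}" "ngrow B (take m w) < 3 * kap * m" by blast
        have fl: "flat_word B T ?e1 (take m w)" using n by (intro flat_word_take) blast
        have S: "4 * kap * m \<le> ?S (take m w)"
        proof -
          have "\<bar>?S (take m w) - m * gd\<bar> \<le> kap * m" using n m(1) by (meson not_le)
          then show ?thesis using kap(2) by (simp add: algebra_simps abs_le_iff)
        qed
        have len: "length (take m w) = m" using m w by simp
        define z where "z = (wprod B (take m w) *v ?e1) $ 1"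
        have z: "z \<noteq> 0" "\<bar>ln \<bar>z\<bar> - sum_list (map (\<lambda>j. ln \<bar>B j $ 1 $ 1\<bar>) (take m w))\<bar> \<le> m * (\<theta> / 2)"
          using additive[OF fl] unfolding len by (simp_all add: z_def axis_def)
        have "\<bar>z\<bar> \<le> opnorm (wprod B (take m w))"
          using order_trans[OF component_le_norm_cart opnorm_ge[of "wprod B (take m w)" ?e1]] by (simp add: z_def)
        then have "ln \<bar>z\<bar> \<le> ln (opnorm (wprod B (take m w)))" using z(1) by (subst ln_le_cancel_iff) auto
        moreover have "4 * kap * m - m * \<theta> - m * (\<theta> / 2) \<le> o' - dd" 
          if "z' \<le> o'" "\<bar>z' - Y\<bar> \<le> m * (\<theta> / 2)" "Sx - m * \<theta> \<le> Y - dd" "4 * kap * m \<le> Sx" for z' o' Y Sx dd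
          using that by linarith
        note this[OF _ z(2) det_sum[of "take m w", unfolded len] S]
        ultimately have "4 * kap * m - m * \<theta> - m * (\<theta> / 2) \<le> ngrow B (take m w)" unfolding ngrow_def by blast
        moreover have "m * \<theta> \<le> m * (kap / 3)" by (intro mult_left_mono th) auto
        moreover have "0 \<le> kap * m" using kap by simp
        ultimately show False using m(2) by (simp add: algebra_simps)
      qed
      also have "\<dots> \<le> pw p (M * N) (\<lambda>w. \<not> flat_word B T ?e1 w) + pw p (M * N) (\<lambda>w. \<exists>m\<in>{N..M * N}. \<bar>?S (take m w) - m * gd\<bar> > kap * m)"
        by (rule pw_disj)
      also have "pw p (M * N) (\<lambda>w. \<not> flat_word B T ?e1 w) \<le> T powr (- b) * (0 + real (M * N))"
        using flat_prob[of ?e1 "M * N"] by (simp add: slope_def axis_def)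
      also have "\<dots> \<le> K1 * exp (- cc * real N) * (0 + real (M * N))" by (intro mult_right_mono Tb) auto
      also have "\<dots> \<le> \<eta> / 2" using NN(1) by (simp add: mult_ac)
      also have "pw p (M * N) (\<lambda>w. \<exists>m\<in>{N..M * N}. \<bar>?S (take m w) - m * gd\<bar> > kap * m)
          \<le> (\<Sum>m\<in>{N..M * N}. pw p (M * N) (\<lambda>w. \<bar>?S (take m w) - m * gd\<bar> > kap * m))"
        by (rule pw_Bex) simp
      also have "\<dots> \<le> (\<Sum>m\<in>{N..M * N}. 2 * exp (- c2 * N))"
      proof (rule sum_mono)
        fix m assume m: "m \<in> {N..M * N}"
        then have "pw p (M * N) (\<lambda>w. \<bar>?S (take m w) - m * gd\<bar> > kap * m) = pw p m (\<lambda>w. \<bar>?S w - m * gd\<bar> > kap * m)"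
          by (intro pw_prefix') auto
        also have "\<dots> \<le> 2 * exp (- (kap * m)\<^sup>2 / (4 * real m * D\<^sup>2))"
          using sum_list_deviation[of D \<xi> p "kap * m" m] D kap by (simp add: gd_def \<xi>_def)
        also have "- (kap * m)\<^sup>2 / (4 * real m * D\<^sup>2) = - c2 * m"
          using m NN(7) by (simp add: c2_def power2_eq_square field_simps)
        also have "2 * exp (- c2 * m) \<le> 2 * exp (- c2 * N)" using m cc by simp
        finally show "pw p (M * N) (\<lambda>w. \<bar>?S (take m w) - m * gd\<bar> > kap * m) \<le> 2 * exp (- c2 * N)" .
      qed
      also have "\<dots> = real (card {N..M * N}) * (2 * exp (- c2 * N))" by simp
      also have "\<dots> \<le> real (M * N + 1) * (2 * exp (- c2 * N))"
        by (intro mult_right_mono of_nat_mono) auto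
      also have "\<dots> \<le> \<eta> / 2" using NN(2) by (simp add: algebra_simps)
      finally show ?thesis by simp
    qed
    have bad: "pw p N (\<lambda>u. \<not> balanced B kap u x) \<le> 1 - pm / 4" if x: "x \<noteq> 0" for x
    proof (cases "\<bar>x $ 1\<bar> \<le> \<bar>x $ 2\<bar>")
      \<comment> \<open>A steep direction is displaced by at least \<rho> / K0, of order exp (-kap N
        / 4), which is far more than the exp (-kap N) allowed for a direction that is almost always
        contracted.\<close>
      case True
      show ?thesis
      proof (rule ccontr)
        assume *: "\<not> ?thesis"
        obtain j where j: "\<rho> / K0 * (norm x)\<^sup>2 \<le> \<bar>wedge x (B j *v x)\<bar>" using ND[OF x True] by blast
        have "1 - pmf p j / 4 < pw p N (\<lambda>u. \<not> balanced B kap u x)" using * pm(2)[of j] by linarith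
        then have "pdist x (B j *v x) \<le> 2 * exp (2 * C - kap * N)"
          using unbalanced_almost_fixed[OF bounded_by x NN(7)] by blast
        then have "\<bar>wedge x (B j *v x)\<bar> \<le> 2 * exp (2 * C - kap * N) * (norm x * norm (B j *v x))"
          using x bdd_nz1[OF bounded_by x, of j] by (simp add: pdist_def field_simps)
        also have "\<dots> \<le> 2 * exp (2 * C - kap * N) * (norm x * (exp C * norm x))"
          by (intro mult_left_mono bdd_upper[OF bounded_by]) auto
        finally have "\<rho> / K0 * (norm x)\<^sup>2 \<le> (2 * exp (2 * C - kap * N) * exp C) * (norm x)\<^sup>2"
          using j by (simp add: power2_eq_square mult_ac)
        then have "\<rho> / K0 \<le> 2 * exp (2 * C - kap * N) * exp C" by (rule mult_right_le_imp_le) (use x in simp)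
        then have "\<rho> \<le> 2 * exp (2 * C - kap * N) * exp C * K0" using K0 by (simp add: field_simps)
        with rlow have "exp (- kap / 4 * real N) \<le> 2 * exp (2 * C - kap * N) * exp C * K0" by linarith
        also have "\<dots> = (2 * exp (3 * C) * K0 * exp (- (3 / 4 * kap) * real N)) * exp (- kap / 4 * real N)"
        proof -
          have "exp (2 * C - kap * N) * exp C = exp (3 * C) * exp (- (3 / 4 * kap) * real N) * exp (- kap / 4 * real N)"
            unfolding exp_add[symmetric] by (rule arg_cong[where f = exp]) (simp add: field_simps)
          then show ?thesis by simp
        qed
        finally show False using NN(4) by simp
      qed
    next
      \<comment> \<open>A direction of slope at most 1 is likely to stay in the cone, and then grows
        like the norm of the product. The other two starting vectors are those that control this
        norm.\<close>
      case False
      then have x1: "x $ 1 \<noteq> 0" "\<bar>x $ 2\<bar> \<le> \<bar>x $ 1\<bar>" by auto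
      have slope: "slope b x \<le> 1" "slope b ?e1 = 0" "slope b ?e12 = 1"
        using x1 b by (auto simp: slope_def axis_def intro!: powr_le1)
      have nz1: "?e1 $ 1 \<noteq> 0" "?e12 $ 1 \<noteq> 0" by (auto simp: axis_def)
      have "pw p N (\<lambda>u. \<not> balanced B kap u x)
          \<le> pw p N (\<lambda>w. \<not> flat_word B T x w \<or> (\<not> flat_word B T ?e1 w \<or> \<not> flat_word B T ?e12 w))"
      proof (rule pw_mono, rule ccontr)
        fix w assume w: "length w = N" and bal: "\<not> balanced B kap w x"
          and n: "\<not> (\<not> flat_word B T x w \<or> (\<not> flat_word B T ?e1 w \<or> \<not> flat_word B T ?e12 w))"
        define P where "P = sum_list (map (\<lambda>j. ln \<bar>B j $ 1 $ 1\<bar>) w)"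
        define h where "h = N * (\<theta> / 2)"
        have op: "opnorm (wprod B w) \<le> 3 * (1 + T) * exp (P + h)"
          using opnorm_flat(1)[of w] n w unfolding P_def h_def by blast
        have "\<bar>x $ 1\<bar> * exp (P - h) \<le> norm (wprod B w *v x)"
        proof -
          define z where "z = (wprod B w *v x) $ 1"
          have z: "z \<noteq> 0" "\<bar>ln \<bar>z\<bar> - ln \<bar>x $ 1\<bar> - P\<bar> \<le> h"
            using additive[OF _ x1(1), of w] n w by (simp_all add: z_def P_def h_def)
          have "\<bar>x $ 1\<bar> * exp (P - h) = exp (ln \<bar>x $ 1\<bar> + P - h)" using x1(1) by (simp add: exp_add exp_diff)
          also have "\<dots> \<le> exp (ln \<bar>z\<bar>)" using z(2) by simp
          also have "\<dots> = \<bar>z\<bar>" using z(1) by simp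
          also have "\<dots> \<le> norm (wprod B w *v x)" unfolding z_def by (rule component_le_norm_cart)
          finally show ?thesis .
        qed
        then have low: "\<bar>x $ 1\<bar> \<le> norm (wprod B w *v x) * exp (h - P)"
          by (simp add: exp_diff field_simps)
        have "norm x \<le> 2 * \<bar>x $ 1\<bar>" using norm_le_l1_cart[of x] x1(2) by (simp add: sum_2)
        with low have nx: "norm x \<le> 2 * (norm (wprod B w *v x) * exp (h - P))" by linarith
        have "opnorm (wprod B w) * norm x \<le> (3 * (1 + T) * exp (P + h)) * (2 * (norm (wprod B w *v x) * exp (h - P)))"
          using T by (intro mult_mono op nx) auto
        also have "\<dots> = 6 * (1 + T) * (exp (P + h) * exp (h - P)) * norm (wprod B w *v x)" by simp
        also have "exp (P + h) * exp (h - P) = exp (N * \<theta>)"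
          unfolding exp_add[symmetric] by (simp add: h_def)
        also have "6 * (1 + T) * exp (N * \<theta>) * norm (wprod B w *v x) \<le> exp (kap * N) * norm (wprod B w *v x)"
        proof (intro mult_right_mono)
          have "T \<le> 1 / \<rho>"
            using th e rho mult_mono[of \<theta> 1 e 1] by (simp add: T_def divide_right_mono)
          also have "\<dots> \<le> 1 / exp (- kap / 4 * real N)" using rlow rho by (intro divide_left_mono) auto
          also have "\<dots> = exp (kap / 4 * N)" by (simp add: exp_minus field_simps)
          finally have "1 + T \<le> 2 * exp (kap / 4 * N)" using kap by (smt (verit) one_le_exp_iff mult_nonneg_nonneg of_nat_0_le_iff divide_nonneg_nonneg)
          moreover have "N * \<theta> \<le> N * (kap / 3)" by (intro mult_left_mono th) auto
          then have "exp (N * \<theta>) \<le> exp (N * (kap / 3))" unfolding exp_le_cancel_iff .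
          ultimately have "6 * (1 + T) * exp (N * \<theta>) \<le> 6 * (2 * exp (kap / 4 * N)) * exp (N * (kap / 3))"
            using T by (intro mult_mono) auto
          also have "\<dots> = (12 * exp (- (5 / 12 * kap) * real N)) * exp (kap * N)"
          proof -
            have "exp (kap / 4 * N) * exp (N * (kap / 3)) = exp (- (5 / 12 * kap) * real N) * exp (kap * N)"
              unfolding exp_add[symmetric] by (rule arg_cong[where f = exp]) (simp add: field_simps)
            then show ?thesis by simp
          qed
          also have "\<dots> \<le> 1 * exp (kap * N)" using NN(5) by (intro mult_right_mono) auto
          finally show "6 * (1 + T) * exp (N * \<theta>) \<le> exp (kap * N)" by simp
        qed simp
        finally show False using bal w by (simp add: balanced_def)
      qed
      also have "\<dots> \<le> T powr (- b) * (1 + N) + (T powr (- b) * (0 + N) + T powr (- b) * (1 + N))"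
        using slope
        by (intro order_trans[OF pw_disj] add_mono order_trans[OF flat_prob] mult_left_mono x1 nz1) auto
      also have "\<dots> = T powr (- b) * (3 * N + 2)" by (simp add: algebra_simps)
      also have "\<dots> \<le> K1 * exp (- cc * real N) * (3 * N + 2)" by (intro mult_right_mono Tb) auto
      also have "\<dots> \<le> 1 / 2" using NN(3) by (simp add: algebra_simps)
      also have "\<dots> \<le> 1 - pm / 4" using pm1 by simp
      finally show ?thesis .
    qed
    show "kap / 2 * real (M * N) \<le> ew p (M * N) (\<lambda>w. vgrow B w x)"
      by (rule grow[OF bounded_by NN(6) bad H x])
  qed
qed

end

section \<open>Conjugation and the shear normal form\<close>

text \<open>The inverse is a separate argument, so that the hypotheses are the two equations
  \<open>Q ** Q' = mat 1\<close> and \<open>Q' ** Q = mat 1\<close>.\<close>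

definition conj_cocycle :: "mat2 \<Rightarrow> ('a \<Rightarrow> mat2) \<Rightarrow> mat2 \<Rightarrow> 'a \<Rightarrow> mat2" where
  "conj_cocycle Q' B Q = (\<lambda>j. Q' ** B j ** Q)"

lemma wprod_conj:
  assumes "Q ** Q' = mat 1" "Q' ** Q = mat 1"
  shows "wprod (conj_cocycle Q' B Q) w = Q' ** wprod B w ** Q"
proof (induction w)
  case (Cons j w)
  have "wprod (conj_cocycle Q' B Q) (j # w) = Q' ** wprod B w ** (Q ** Q') ** B j ** Q"
    unfolding wprod.simps Cons by (simp add: conj_cocycle_def matrix_mul_assoc)
  then show ?case by (simp add: assms matrix_mul_assoc)
qed (simp add: assms)

text \<open>Only the two ends of the product see the conjugation, so the error does not depend on
  the length of the word and deviation estimates transfer with shifted thresholds.\<close>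

lemma ln_opnorm_conj:
  assumes Q: "Q ** Q' = mat 1" "Q' ** Q = mat 1" and K: "opnorm Q \<le> K" "opnorm Q' \<le> K" "1 \<le> K"
    and d: "det (wprod B w) \<noteq> 0"
  shows "\<bar>ln (opnorm (wprod (conj_cocycle Q' B Q) w)) - lognorm B w\<bar> \<le> 2 * ln K"
proof -
  let ?M = "wprod B w" and ?M' = "Q' ** wprod B w ** Q"
  have dQ: "det Q * det Q' = 1" using Q(1) by (metis det_I det_mul)
  then have d': "det ?M' \<noteq> 0" using d by (auto simp: det_mul)
  have le: "opnorm (X ** Y ** Z) \<le> K * K * opnorm Y" if "opnorm X \<le> K" "opnorm Z \<le> K" for X Y Z :: mat2
  proof -
    have "opnorm (X ** Y ** Z) \<le> opnorm X * opnorm Y * opnorm Z"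
      by (rule order_trans[OF opnorm_mult mult_right_mono[OF opnorm_mult]]) simp
    also have "\<dots> \<le> K * opnorm Y * K" using that K(3) by (intro mult_mono) auto
    finally show ?thesis by (simp add: mult_ac)
  qed
  have M: "?M = Q ** ?M' ** Q'"
  proof -
    have "Q ** ?M' ** Q' = (Q ** Q') ** ?M ** (Q ** Q')" by (simp add: matrix_mul_assoc)
    then show ?thesis using Q by simp
  qed
  have lnle: "ln (opnorm Y) \<le> 2 * ln K + ln (opnorm X)" if "opnorm Y \<le> K * K * opnorm X" "det X \<noteq> 0" "det Y \<noteq> 0" for X Y :: mat2
  proof -
    have "ln (opnorm Y) \<le> ln (K * K * opnorm X)" using that opnorm_pos by (subst ln_le_cancel_iff) (use K in auto)
    also have "\<dots> = 2 * ln K + ln (opnorm X)" using opnorm_pos[OF that(2)] K by (simp add: ln_mult)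
    finally show ?thesis .
  qed
  have "ln (opnorm ?M') \<le> 2 * ln K + ln (opnorm ?M)" by (rule lnle[OF le[OF K(2,1)] d d'])
  moreover have "ln (opnorm ?M) \<le> 2 * ln K + ln (opnorm ?M')"
    by (rule lnle[OF _ d' d]) (subst M, rule le[OF K(1,2)])
  ultimately show ?thesis unfolding wprod_conj[OF Q] by linarith
qed

definition mat22 :: "real \<Rightarrow> real \<Rightarrow> real \<Rightarrow> real \<Rightarrow> mat2" where
  "mat22 a b c d = vector [vector [a, b], vector [c, d]]"

lemma mat22_nth [simp]:
  "mat22 a b c d $ 1 $ 1 = a" "mat22 a b c d $ 1 $ 2 = b"
  "mat22 a b c d $ 2 $ 1 = c" "mat22 a b c d $ 2 $ 2 = d"
  by (simp_all add: mat22_def)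

lemma mat2_eqI:
  fixes M N :: mat2
  assumes "M $ 1 $ 1 = N $ 1 $ 1" "M $ 1 $ 2 = N $ 1 $ 2" "M $ 2 $ 1 = N $ 2 $ 1" "M $ 2 $ 2 = N $ 2 $ 2"
  shows "M = N"
  using assms by (simp add: vec_eq_iff forall_2)

lemma mat2_mult: "(M ** N) $ i $ k = M $ i $ 1 * N $ 1 $ k + M $ i $ 2 * N $ 2 $ k" for M N :: mat2
  by (simp add: matrix_matrix_mult_def sum_2)

text \<open>Total displacement of the direction of \<open>x\<close>, homogeneous of degree 2; on
  nonzero vectors it vanishes exactly at common eigenvectors.\<close>

definition wedge_sum :: "('a::finite \<Rightarrow> mat2) \<Rightarrow> real^2 \<Rightarrow> real" where
  "wedge_sum B x = (\<Sum>j\<in>UNIV. \<bar>wedge x (B j *v x)\<bar>)"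

lemma continuous_on_wedge_sum: "continuous_on S (wedge_sum B)"
  unfolding wedge_sum_def wedge_def
  by (intro continuous_intros linear_continuous_on matrix_vector_mul_bounded_linear)

lemma wedge_sum_scaleR: "wedge_sum B (c *\<^sub>R x) = c\<^sup>2 * wedge_sum B x"
proof -
  have "\<bar>c * (c * t)\<bar> = c\<^sup>2 * \<bar>t\<bar>" for t :: real
    by (simp add: abs_mult power2_eq_square mult.assoc[symmetric])
  then show ?thesis
    by (simp add: wedge_sum_def matrix_vector_mult_scaleR sum_distrib_left)
qed

lemma wedge_sum_nonneg: "0 \<le> wedge_sum B x"
  by (simp add: wedge_sum_def sum_nonneg)

lemma wedge_le_wedge_sum: "\<bar>wedge x (B j *v x)\<bar> \<le> wedge_sum B x"
  unfolding wedge_sum_def by (rule member_le_sum) auto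

lemma wedge_sum_attained:
  obtains j where "wedge_sum B x / CARD('a) \<le> \<bar>wedge x (B (j :: 'a::finite) *v x)\<bar>"
proof (rule ccontr)
  assume "\<not> thesis"
  then have "\<bar>wedge x (B j *v x)\<bar> < wedge_sum B x / CARD('a)" for j using that by (meson not_le)
  then have "wedge_sum B x < (\<Sum>j\<in>(UNIV :: 'a set). wedge_sum B x / CARD('a))"
    unfolding wedge_sum_def[of B x] by (intro sum_strict_mono) (auto simp: wedge_sum_def)
  then show False by simp
qed

text \<open>The factor 2 leaves room for the shear: with shear parameter at most 1 in modulus it
  maps the cone where the second coordinate dominates into this one.\<close>

definition steep_cone :: "(real^2) set" where
  "steep_cone = {x. \<bar>x $ 1\<bar> \<le> 2 * \<bar>x $ 2\<bar> \<and> norm x = 1}"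

lemma compact_cone: "compact steep_cone"
proof -
  have eq: "steep_cone = sphere 0 1 \<inter> {x. \<bar>x $ 1\<bar> \<le> 2 * \<bar>x $ 2\<bar>}" by (auto simp: steep_cone_def)
  have "closed {x :: real^2. \<bar>x $ 1\<bar> \<le> 2 * \<bar>x $ 2\<bar>}"
    by (intro closed_Collect_le continuous_intros)
  then show ?thesis unfolding eq by (intro compact_Int_closed compact_sphere)
qed

lemma wedge_sum_cone_min:
  obtains z where "z \<in> steep_cone" "\<And>x. x \<in> steep_cone \<Longrightarrow> wedge_sum B z \<le> wedge_sum B x"
proof -
  have "axis 2 1 \<in> steep_cone" by (simp add: steep_cone_def) (simp add: axis_def)
  then have "steep_cone \<noteq> {}" by blast
  then show thesis
    using continuous_attains_inf[OF compact_cone _ continuous_on_wedge_sum] that by metis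
qed

text \<open>The shear moves the direction near the second axis that is moved least by the cocycle onto that axis.\<close>
lemma shear_normal_form:
  fixes al be :: "'a::finite \<Rightarrow> real" and d :: real
  assumes d: "0 < d" and ne: "al i \<noteq> be i"
  obtains d0 where "0 < d0"
    "\<And>B. near_diag al be d0 d0 B \<Longrightarrow> \<exists>S S' \<rho>. S ** S' = mat 1 \<and> S' ** S = mat 1 \<and> opnorm S \<le> 4 \<and> opnorm S' \<le> 4 \<and>
       0 \<le> \<rho> \<and> \<rho> \<le> d \<and> near_diag al be d \<rho> (conj_cocycle S' B S) \<and>
       (\<forall>x. x \<noteq> 0 \<longrightarrow> \<bar>x $ 1\<bar> \<le> \<bar>x $ 2\<bar> \<longrightarrow>
          (\<exists>j. \<rho> / (15 * CARD('a)) * (norm x)\<^sup>2 \<le> \<bar>wedge x (conj_cocycle S' B S j *v x)\<bar>)) \<and>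
       (\<forall>r0. (\<forall>x\<in>steep_cone. r0 \<le> wedge_sum B x) \<longrightarrow> r0 \<le> \<rho>)"
proof -
  define n where "n = real CARD('a)"
  have n: "1 \<le> n" by (simp add: n_def Suc_le_eq)
  define g where "g = \<bar>al i - be i\<bar>"
  have g: "0 < g" using ne by (simp add: g_def)
  \<comment> \<open>The first entry keeps the conjugate within \<open>d\<close> of the diagonal, the
    second ensures that \<rho> = 5 r is at most \<open>d\<close>, and the third bounds the shear
    parameter by 1.\<close>
  define d0 where "d0 = min (d / 3) (min (d / (5 * n)) (g / (7 + 5 * (n + 2))))"
  have d0: "0 < d0" "3 * d0 \<le> d" "5 * n * d0 \<le> d" "(7 + 5 * (n + 2)) * d0 \<le> g"
  proof -
    show "0 < d0" using d g n by (simp add: d0_def add_pos_pos)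
    have "d0 \<le> d / 3" "d0 \<le> d / (5 * n)" "d0 \<le> g / (7 + 5 * (n + 2))" unfolding d0_def by linarith+
    then show "3 * d0 \<le> d" "5 * n * d0 \<le> d" "(7 + 5 * (n + 2)) * d0 \<le> g"
      using n by (simp_all add: field_simps)
  qed
  show thesis
  proof (rule that[OF d0(1)])
    fix B :: "'a \<Rightarrow> mat2" assume nd: "near_diag al be d0 d0 B"
    note nd' = near_diagD[OF nd]
    obtain z where z: "z \<in> steep_cone" and zmin: "\<And>x. x \<in> steep_cone \<Longrightarrow> wedge_sum B z \<le> wedge_sum B x"
      by (rule wedge_sum_cone_min) blast
    define r where "r = wedge_sum B z"
    have z1: "norm z = 1" "\<bar>z $ 1\<bar> \<le> 2 * \<bar>z $ 2\<bar>" using z by (auto simp: steep_cone_def)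
    have zz: "(z $ 1)\<^sup>2 + (z $ 2)\<^sup>2 = 1" using norm2_sq[of z] z1 by simp
    have "(z $ 1)\<^sup>2 \<le> (2 * z $ 2)\<^sup>2" using z1(2) by (subst abs_le_square_iff[symmetric]) (simp add: abs_mult)
    then have z2: "1 \<le> 5 * (z $ 2)\<^sup>2" using zz by (simp add: power_mult_distrib)
    then have z2nz: "z $ 2 \<noteq> 0" by auto
    have rn: "r \<le> n * d0"
    proof -
      have "r \<le> wedge_sum B (axis 2 1)" unfolding r_def by (rule zmin) (simp add: steep_cone_def, simp add: axis_def)
      also have "\<dots> \<le> (\<Sum>j\<in>(UNIV :: 'a set). d0)"
        unfolding wedge_sum_def using nd'(4) by (intro sum_mono) (simp add: wedge_def matvec2 axis_def)
      finally show ?thesis by (simp add: n_def)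
    qed
    define \<sigma> where "\<sigma> = z $ 1 / z $ 2"
    have sigma: "\<bar>\<sigma>\<bar> \<le> 1"
    proof -
      \<comment> \<open>The minimiser is displaced no more than the second axis, whose displacement
        is at most n d0, whereas the letter \<open>i\<close> turns any direction away from both axes
        by an amount proportional to the difference \<open>g\<close> of its eigenvalues. Hence
        \<open>z\<close> is close to the second axis.\<close>
      have w: "wedge z (B i *v z) = z $ 1 * z $ 2 * (B i $ 2 $ 2 - B i $ 1 $ 1) + B i $ 2 $ 1 * (z $ 1)\<^sup>2 - B i $ 1 $ 2 * (z $ 2)\<^sup>2"
        by (simp add: wedge_def matvec2 power2_eq_square algebra_simps)
      have "\<bar>B i $ 2 $ 1 * (z $ 1)\<^sup>2\<bar> \<le> d0 * 1" "\<bar>B i $ 1 $ 2 * (z $ 2)\<^sup>2\<bar> \<le> d0 * 1"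
        unfolding abs_mult using nd'(3)[of i] nd'(4)[of i] zz zero_le_power2[of "z $ 1"] zero_le_power2[of "z $ 2"]
        by (intro mult_mono; simp; linarith)+
      moreover have "\<bar>wedge z (B i *v z)\<bar> \<le> n * d0" using wedge_le_wedge_sum[of z B i] rn by (simp add: r_def)
      ultimately have "\<bar>z $ 1 * z $ 2 * (B i $ 2 $ 2 - B i $ 1 $ 1)\<bar> \<le> n * d0 + d0 + d0" unfolding w by linarith
      then have up: "\<bar>z $ 1 * z $ 2\<bar> * \<bar>B i $ 2 $ 2 - B i $ 1 $ 1\<bar> \<le> (n + 2) * d0" by (simp add: abs_mult distrib_right)
      have "g - 2 * d0 \<le> \<bar>B i $ 2 $ 2 - B i $ 1 $ 1\<bar>" using nd'(1)[of i] nd'(2)[of i] unfolding g_def by linarith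
      then have "\<bar>z $ 1 * z $ 2\<bar> * (g - 2 * d0) \<le> \<bar>z $ 1 * z $ 2\<bar> * \<bar>B i $ 2 $ 2 - B i $ 1 $ 1\<bar>" by (intro mult_left_mono) auto
      then have "\<bar>z $ 1 * z $ 2\<bar> * (g - 2 * d0) \<le> (n + 2) * d0" using up by (rule order_trans)
      moreover have "z $ 1 * z $ 2 = \<sigma> * (z $ 2)\<^sup>2" using z2nz by (simp add: \<sigma>_def power2_eq_square)
      then have "\<bar>z $ 1 * z $ 2\<bar> = \<bar>\<sigma>\<bar> * (z $ 2)\<^sup>2" by (simp add: abs_mult)
      ultimately have s: "\<bar>\<sigma>\<bar> * (z $ 2)\<^sup>2 * (g - 2 * d0) \<le> (n + 2) * d0" by (simp only:)
      have gd: "5 * (n + 2) * d0 \<le> g - 2 * d0" "0 < g - 2 * d0" 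
      proof -
        have "5 * (n + 2) * d0 + 7 * d0 \<le> g" using d0(4) by (simp add: distrib_right)
        moreover have "0 \<le> 5 * (n + 2) * d0" using d0(1) n by simp
        ultimately show "5 * (n + 2) * d0 \<le> g - 2 * d0" "0 < g - 2 * d0" using d0(1) by linarith+
      qed
      have "\<bar>\<sigma>\<bar> * (g - 2 * d0) \<le> \<bar>\<sigma>\<bar> * (5 * (z $ 2)\<^sup>2) * (g - 2 * d0)"
        using z2 gd by (intro mult_right_mono) (auto simp: mult_le_cancel_left1)
      also have "\<dots> = 5 * (\<bar>\<sigma>\<bar> * (z $ 2)\<^sup>2 * (g - 2 * d0))" by simp
      also have "\<dots> \<le> 5 * ((n + 2) * d0)" by (intro mult_left_mono s) simp
      also have "\<dots> \<le> 1 * (g - 2 * d0)" using gd(1) by (simp only: mult.assoc mult_1)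
      finally show ?thesis using gd(2) by (simp only: mult_le_cancel_right_pos)
    qed
    define S where "S = mat22 1 \<sigma> 0 1"
    define S' where "S' = mat22 1 (- \<sigma>) 0 1"
    define B' where "B' = conj_cocycle S' B S"
    have SS: "S ** S' = mat 1" "S' ** S = mat 1"
      by (rule mat2_eqI; simp add: S_def S'_def mat2_mult mat_def)+
    have opS: "opnorm S \<le> 4 * 1" "opnorm S' \<le> 4 * 1"
    proof (rule_tac [!] opnorm_le_entries)
      fix i k :: 2
      show "\<bar>S $ i $ k\<bar> \<le> 1" "\<bar>S' $ i $ k\<bar> \<le> 1"
        using sigma exhaust_2[of i] exhaust_2[of k] by (auto simp: S_def S'_def)
    qed
    have B': "B' j $ 1 $ 1 = B j $ 1 $ 1 - \<sigma> * B j $ 2 $ 1"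
      "B' j $ 2 $ 1 = B j $ 2 $ 1" "B' j $ 2 $ 2 = B j $ 2 $ 1 * \<sigma> + B j $ 2 $ 2" for j
      by (simp_all add: B'_def conj_cocycle_def S_def S'_def mat2_mult algebra_simps)
    have B'12: "B' j $ 1 $ 2 * (z $ 2)\<^sup>2 = - wedge z (B j *v z)" for j
      using z2nz by (simp add: B'_def conj_cocycle_def S_def S'_def mat2_mult wedge_def matvec2 \<sigma>_def power2_eq_square field_simps)
    have wB': "wedge x (B' j *v x) = wedge (S *v x) (B j *v (S *v x))" for j x
    proof -
      have "S' *v (S *v x) = x" using SS by (simp add: matrix_vector_mul_assoc)
      then have "wedge x (B' j *v x) = wedge (S' *v (S *v x)) (S' *v (B j *v (S *v x)))"
        by (simp add: B'_def conj_cocycle_def matrix_vector_mul_assoc matrix_mul_assoc)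
      also have "\<dots> = det S' * wedge (S *v x) (B j *v (S *v x))" by (rule wedge_matrix)
      also have "det S' = 1" by (simp add: S'_def det_2)
      finally show ?thesis by simp
    qed
    \<comment> \<open>In the steep cone the squared second coordinate of a unit vector is at least
      1/5, so the new upper right entry is at most 5 r. The further factor 3 in the constant 15
      compares the squared norms before and after the shear.\<close>
    define \<rho> where "\<rho> = 5 * r"
    have r0: "0 \<le> r" unfolding r_def by (rule wedge_sum_nonneg)
    have sB: "\<bar>\<sigma> * B j $ 2 $ 1\<bar> \<le> 1 * d0" for j
      unfolding abs_mult using sigma nd'(3)[of j] by (intro mult_mono) auto
    have near: "near_diag al be d \<rho> B'"
      unfolding near_diag_def
    proof (intro allI conjI)
      fix j
      show "\<bar>B' j $ 1 $ 1 - al j\<bar> \<le> d" using nd'(1)[of j] sB[of j] d0(2) d0(1) unfolding B' by linarith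
      show "\<bar>B' j $ 2 $ 2 - be j\<bar> \<le> d" using nd'(2)[of j] sB[of j] d0(2) d0(1) unfolding B' by (simp add: mult.commute)
      show "\<bar>B' j $ 2 $ 1\<bar> \<le> d" using nd'(3)[of j] d0(2) d0(1) unfolding B' by linarith
      have "\<bar>B' j $ 1 $ 2\<bar> * 1 \<le> \<bar>B' j $ 1 $ 2\<bar> * (5 * (z $ 2)\<^sup>2)" by (intro mult_left_mono z2) auto
      also have "\<dots> = 5 * \<bar>B' j $ 1 $ 2 * (z $ 2)\<^sup>2\<bar>" by (simp add: abs_mult)
      also have "\<dots> \<le> 5 * r" unfolding B'12 r_def using wedge_le_wedge_sum[of z B j] by simp
      finally show "\<bar>B' j $ 1 $ 2\<bar> \<le> \<rho>" by (simp add: \<rho>_def)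
    qed
    have ND: "\<exists>j. \<rho> / (15 * CARD('a)) * (norm x)\<^sup>2 \<le> \<bar>wedge x (B' j *v x)\<bar>"
      if x: "x \<noteq> 0" "\<bar>x $ 1\<bar> \<le> \<bar>x $ 2\<bar>" for x
    proof -
      define y where "y = S *v x"
      have y: "y $ 1 = x $ 1 + \<sigma> * x $ 2" "y $ 2 = x $ 2" by (simp_all add: y_def S_def matvec2)
      have x2: "x $ 2 \<noteq> 0" using x by (auto simp: vec_eq_iff forall_2)
      have sx: "\<bar>\<sigma> * x $ 2\<bar> \<le> \<bar>x $ 2\<bar>" unfolding abs_mult using mult_right_mono[OF sigma, of "\<bar>x $ 2\<bar>"] by simp
      have ny: "0 < norm y" using x2 y by (auto simp: vec_eq_iff forall_2)
      define y' where "y' = (1 / norm y) *\<^sub>R y"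
      have "\<bar>y $ 1\<bar> \<le> 2 * \<bar>y $ 2\<bar>" using sx x(2) unfolding y by linarith
      then have y': "y' \<in> steep_cone" using ny by (simp add: steep_cone_def y'_def abs_mult field_simps)
      have yy: "y = norm y *\<^sub>R y'" using ny by (simp add: y'_def)
      have "r * (norm y)\<^sup>2 \<le> wedge_sum B y' * (norm y)\<^sup>2"
        unfolding r_def by (intro mult_right_mono zmin y') simp
      also have "\<dots> = wedge_sum B y"
        using wedge_sum_scaleR[of B "norm y" y'] unfolding yy[symmetric] by (simp only: mult.commute)
      finally have rB: "r * (norm y)\<^sup>2 \<le> wedge_sum B y" .
      obtain j where j: "wedge_sum B y / CARD('a) \<le> \<bar>wedge y (B j *v y)\<bar>" by (rule wedge_sum_attained)
      have "(norm x)\<^sup>2 \<le> 3 * (norm y)\<^sup>2"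
      proof -
        have "(x $ 1)\<^sup>2 \<le> (x $ 2)\<^sup>2" using x(2) by (simp add: abs_le_square_iff)
        then have "(norm x)\<^sup>2 \<le> 3 * (x $ 2)\<^sup>2" unfolding norm2_sq[of x] using zero_le_power2[of "x $ 2"] by linarith
        also have "\<dots> \<le> 3 * (norm y)\<^sup>2" unfolding norm2_sq[of y] y(2) by simp
        finally show ?thesis .
      qed
      then have "\<rho> / (15 * CARD('a)) * (norm x)\<^sup>2 \<le> \<rho> / (15 * CARD('a)) * (3 * (norm y)\<^sup>2)"
        using r0 by (intro mult_left_mono) (auto simp: \<rho>_def)
      also have "\<dots> = r * (norm y)\<^sup>2 / CARD('a)" by (simp add: \<rho>_def)
      also have "\<dots> \<le> wedge_sum B y / CARD('a)" by (intro divide_right_mono rB) simp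
      also note j
      finally show ?thesis unfolding wB' y_def[symmetric] by blast
    qed
    \<comment> \<open>Keeps \<rho> above any lower bound for the displacement of \<open>B\<close>;
      the non-diagonalizable case rests on it.\<close>
    have low: "r0 \<le> \<rho>" if "\<forall>x\<in>steep_cone. r0 \<le> wedge_sum B x" for r0
      using that z r0 unfolding \<rho>_def r_def by force
    have "\<rho> \<le> d" using rn d0(3) by (simp add: \<rho>_def)
    then show "\<exists>S S' \<rho>. S ** S' = mat 1 \<and> S' ** S = mat 1 \<and> opnorm S \<le> 4 \<and> opnorm S' \<le> 4 \<and>
       0 \<le> \<rho> \<and> \<rho> \<le> d \<and> near_diag al be d \<rho> (conj_cocycle S' B S) \<and>
       (\<forall>x. x \<noteq> 0 \<longrightarrow> \<bar>x $ 1\<bar> \<le> \<bar>x $ 2\<bar> \<longrightarrow>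
          (\<exists>j. \<rho> / (15 * CARD('a)) * (norm x)\<^sup>2 \<le> \<bar>wedge x (conj_cocycle S' B S j *v x)\<bar>)) \<and>
       (\<forall>r0. (\<forall>x\<in>steep_cone. r0 \<le> wedge_sum B x) \<longrightarrow> r0 \<le> \<rho>)"
      using SS opS near ND low r0 unfolding B'_def
      by (intro exI[of _ S] exI[of _ S'] exI[of _ \<rho>] conjI allI impI) (auto simp: \<rho>_def)
  qed
qed

lemma near_diag_mono: "near_diag al be d \<rho> B \<Longrightarrow> d \<le> d' \<Longrightarrow> near_diag al be d' \<rho> B"
  unfolding near_diag_def by (meson order_trans)

section \<open>The long-time and the short-time estimate\<close>

lemma pmf_mean_abs_le:
  fixes f :: "'a::finite \<Rightarrow> real"
  assumes "\<And>j. \<bar>f j\<bar> \<le> Y"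
  shows "\<bar>\<Sum>j\<in>UNIV. pmf p j * f j\<bar> \<le> Y"
proof -
  have "\<bar>\<Sum>j\<in>UNIV. pmf p j * f j\<bar> \<le> (\<Sum>j\<in>UNIV. pmf p j * Y)"
    by (rule order_trans[OF sum_abs]) (intro sum_mono, simp add: abs_mult mult_left_mono assms)
  then show ?thesis by simp
qed

context
  fixes p :: "'a::finite pmf" and al be :: "'a \<Rightarrow> real"
  assumes full: "set_pmf p = UNIV"
    and nz: "\<And>j. al j \<noteq> 0" "\<And>j. be j \<noteq> 0"
    and dom: "(\<Sum>j\<in>UNIV. pmf p j * ln \<bar>be j\<bar>) < (\<Sum>j\<in>UNIV. pmf p j * ln \<bar>al j\<bar>)"
begin

text \<open>The first estimate uses \<open>near_diag_growth\<close> with \<open>N\<close> of order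
  -ln \<rho>, so the oscillation is of order 1 - ln \<rho> and enters squared in Azuma's inequality.
  The second combines the probability of leaving the cone of width \<open>T\<close> with the
  deviations of a sum of independent variables, and makes sense even for \<rho> = 0.\<close>

lemma near_diag_ldt_normal_form:
  obtains d K b e :: real where "0 < d" "1 \<le> K" "0 < b" "0 < e"
    "\<And>B \<rho> w. near_diag al be d \<rho> B \<Longrightarrow> 0 \<le> \<rho> \<Longrightarrow> \<rho> \<le> d \<Longrightarrow> \<rho> \<le> 1 \<and> det (wprod B w) \<noteq> 0"
    "\<And>B \<rho>. near_diag al be d \<rho> B \<Longrightarrow> 0 < \<rho> \<Longrightarrow> \<rho> \<le> d \<Longrightarrow>
      (\<And>x. x \<noteq> 0 \<Longrightarrow> \<bar>x $ 1\<bar> \<le> \<bar>x $ 2\<bar> \<Longrightarrow> \<exists>j. \<rho> / (15 * CARD('a)) * (norm x)\<^sup>2 \<le> \<bar>wedge x (B j *v x)\<bar>) \<Longrightarrow>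
      \<exists>L. \<forall>n. \<forall>s\<ge>0. pw p n (\<lambda>w. \<bar>lognorm B w - real n * L\<bar> > s + K * (1 - ln \<rho>))
         \<le> 4 * exp (- s\<^sup>2 / (K * (1 - ln \<rho>)\<^sup>2 * real n))"
    "\<And>B \<rho> n T \<theta> s. near_diag al be d \<rho> B \<Longrightarrow> 0 \<le> \<rho> \<Longrightarrow> \<rho> \<le> d \<Longrightarrow> 1 \<le> T \<Longrightarrow> 0 \<le> \<theta> \<Longrightarrow> \<theta> \<le> 1 \<Longrightarrow> \<rho> * T \<le> \<theta> * e \<Longrightarrow> 0 \<le> s \<Longrightarrow>
      pw p n (\<lambda>w. \<bar>lognorm B w - real n * (\<Sum>j\<in>UNIV. pmf p j * ln \<bar>B j $ 1 $ 1\<bar>)\<bar> > s + ln T + real n * \<theta> + K)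
       \<le> K * (real n + 1) * T powr (- b) + 2 * exp (- s\<^sup>2 / (K * real n))"
proof -
  have K0: "0 < real (15 * CARD('a))" by simp
  obtain d1 C kap :: real and M N3 :: nat where d1: "0 < d1" and kap: "0 < kap" and M: "1 \<le> M" and C0: "0 \<le> C"
    and cb: "\<And>B \<rho>. near_diag al be d1 \<rho> B \<Longrightarrow> \<rho> \<le> d1 \<Longrightarrow> bounded_by B C"
    and grow: "\<And>B \<rho> N x. near_diag al be d1 \<rho> B \<Longrightarrow> \<rho> \<le> d1 \<Longrightarrow> N3 \<le> N \<Longrightarrow> exp (- kap / 4 * real N) \<le> \<rho> \<Longrightarrow>
       \<rho> \<le> exp (kap / 4) * exp (- kap / 4 * real N) \<Longrightarrow>
       (\<And>x. x \<noteq> 0 \<Longrightarrow> \<bar>x $ 1\<bar> \<le> \<bar>x $ 2\<bar> \<Longrightarrow> \<exists>j. \<rho> / real (15 * CARD('a)) * (norm x)\<^sup>2 \<le> \<bar>wedge x (B j *v x)\<bar>) \<Longrightarrow>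
       x \<noteq> 0 \<Longrightarrow> kap / 2 * real (M * N) \<le> ew p (M * N) (\<lambda>w. vgrow B w x)"
    by (rule near_diag_growth[OF full nz dom K0]) blast
  obtain D0 where D0: "0 < D0" and osc: "\<And>(p :: 'a pmf) B N m x y. bounded_by B C \<Longrightarrow> 1 \<le> N \<Longrightarrow>
      (\<And>x. x \<noteq> 0 \<Longrightarrow> kap / 2 * N \<le> ew p N (\<lambda>w. vgrow B w x)) \<Longrightarrow> x \<noteq> 0 \<Longrightarrow> y \<noteq> 0 \<Longrightarrow>
      \<bar>mean_grow B p m x - mean_grow B p m y\<bar> \<le> D0 * N"
    by (rule oscillation_of_growth[OF C0, of "kap / 2"]) (use kap in auto)
  obtain b e where b: "0 < b" "b \<le> 1" and e: "0 < e" "e \<le> 1" "\<And>j. 4 * e \<le> \<bar>al j\<bar>"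
    and contr: "(\<Sum>j\<in>UNIV. pmf p j * ((\<bar>be j\<bar> + e) / (\<bar>al j\<bar> - 2 * e)) powr b) \<le> 1"
    by (rule slope_contraction_constants[OF full nz dom]) blast
  obtain d2 C2 where d2: "0 < d2" "d2 \<le> e" "d2 \<le> 1"
    and l11: "\<And>B \<rho> j. near_diag al be d2 \<rho> B \<Longrightarrow> \<bar>ln \<bar>B j $ 1 $ 1\<bar> - ln \<bar>al j\<bar>\<bar> \<le> 1 / 2"
    by (rule near_diag_log_constants[OF full nz dom zero_less_one order_refl e(1,3)]) blast
  define N4 where "N4 = max N3 1"
  \<comment> \<open>The last bound forces -ln \<rho> to be so large that the \<open>N\<close>
    computed from \<rho> is at least \<open>N3\<close> and 1.\<close>
  define d where "d = min (min d1 d2) (exp (- kap / 4 * N4))"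
  have d: "0 < d" "d \<le> d1" "d \<le> d2" "d \<le> 1" "d \<le> exp (- kap / 4 * N4)"
    using d1 d2 by (auto simp: d_def)
  define c1 where "c1 = D0 * M * (4 / kap + 1)"
  have c1: "0 < c1" using D0 M kap by (simp add: c1_def add_pos_pos)
  define Y where "Y = (\<Sum>j\<in>UNIV. \<bar>ln \<bar>al j\<bar>\<bar>) + 1"
  have Y0: "1 \<le> Y" unfolding Y_def by (simp add: sum_nonneg)
  define K where "K = 4 * (c1 + 2 * C + 1)\<^sup>2 + 2 * c1 + 2 + ln 6 + 4 * (2 * Y)\<^sup>2"
  have sq: "0 \<le> (c1 + 2 * C + 1)\<^sup>2" "0 \<le> (2 * Y)\<^sup>2" "0 \<le> ln (6::real)" by auto
  have K: "4 * (c1 + 2 * C + 1)\<^sup>2 \<le> K" "2 * c1 + 1 \<le> K" "ln 6 \<le> K" "2 \<le> K" "4 * (2 * Y)\<^sup>2 \<le> K" "1 \<le> K"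
    using c1 sq unfolding K_def by linarith+
  show thesis
  proof (rule that[OF d(1) K(6) b(1) e(1)])
    fix B :: "'a \<Rightarrow> mat2" and \<rho> w assume n: "near_diag al be d \<rho> B" "0 \<le> \<rho>" "\<rho> \<le> d"
    show "\<rho> \<le> 1 \<and> det (wprod B w) \<noteq> 0"
      using bdd_det(1)[OF cb[OF near_diag_mono[OF n(1) d(2)]]] n d by simp
  next
    fix B :: "'a \<Rightarrow> mat2" and \<rho> assume n: "near_diag al be d \<rho> B" "0 < \<rho>" "\<rho> \<le> d"
      and ND: "\<And>x. x \<noteq> 0 \<Longrightarrow> \<bar>x $ 1\<bar> \<le> \<bar>x $ 2\<bar> \<Longrightarrow> \<exists>j. \<rho> / (15 * CARD('a)) * (norm x)\<^sup>2 \<le> \<bar>wedge x (B j *v x)\<bar>"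
    have n1: "near_diag al be d1 \<rho> B" by (rule near_diag_mono[OF n(1) d(2)])
    have rd1: "\<rho> \<le> d1" using n d by linarith
    note bounded_by = cb[OF n1 rd1]
    define l where "l = 1 - ln \<rho>"
    have l1: "1 \<le> l" using n d by (simp add: l_def)
    \<comment> \<open>Rounding up brings exp (-kap N / 4) just below \<rho>; the loss is at most one
      letter, that is a factor exp (kap / 4).\<close>
    define N where "N = nat \<lceil>4 / kap * (- ln \<rho>)\<rceil>"
    have lr: "kap / 4 * N4 \<le> - ln \<rho>"
    proof -
      have "\<rho> \<le> exp (- kap / 4 * N4)" using n d by linarith
      then have "ln \<rho> \<le> - kap / 4 * N4" using n(2) by (intro ln_le_of_le_exp)
      then show ?thesis by simp
    qed
    then have N4: "real N4 \<le> 4 / kap * (- ln \<rho>)" using kap by (simp add: field_simps)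
    then have "0 \<le> 4 / kap * (- ln \<rho>)" by (rule order_trans[OF of_nat_0_le_iff])
    then have N: "4 / kap * (- ln \<rho>) \<le> N" "N \<le> 4 / kap * (- ln \<rho>) + 1"
    proof -
      have *: "q \<le> nat \<lceil>q\<rceil>" "nat \<lceil>q\<rceil> \<le> q + 1" if "0 \<le> q" for q :: real
        using that le_of_int_ceiling[of q] of_int_ceiling_le_add_one[of q] by auto
      show "4 / kap * (- ln \<rho>) \<le> N" "N \<le> 4 / kap * (- ln \<rho>) + 1"
        unfolding N_def using *[OF \<open>0 \<le> 4 / kap * (- ln \<rho>)\<close>] by auto
    qed
    have "real N4 \<le> N" using N4 N by linarith
    then have NN: "N3 \<le> N" "1 \<le> N" by (auto simp: N4_def)
    have r1: "exp (- kap / 4 * real N) \<le> \<rho>"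
    proof -
      have "- kap / 4 * real N \<le> ln \<rho>" using N(1) kap by (simp add: field_simps)
      then show ?thesis using n(2) by (metis exp_le_cancel_iff exp_ln)
    qed
    have r2: "\<rho> \<le> exp (kap / 4) * exp (- kap / 4 * real N)"
    proof -
      have "ln \<rho> \<le> kap / 4 + (- kap / 4 * real N)" using N(2) kap by (simp add: field_simps)
      then show ?thesis using n(2) by (metis exp_add exp_le_cancel_iff exp_ln)
    qed
    have D: "\<bar>mean_grow B p m x - mean_grow B p m y\<bar> \<le> c1 * l" if "x \<noteq> 0" "y \<noteq> 0" for m x y
    proof -
      have "1 \<le> M * N" using M NN by (metis le_trans mult_le_mono nat_mult_1)
      then have "\<bar>mean_grow B p m x - mean_grow B p m y\<bar> \<le> D0 * real (M * N)"
        by (rule osc[OF bounded_by _ grow[OF n1 rd1 NN(1) r1 r2 ND] that])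
      also have "\<dots> = D0 * M * N" by simp
      also have "\<dots> \<le> D0 * M * ((4 / kap + 1) * l)"
      proof (intro mult_left_mono)
        have "N \<le> 4 / kap * (l - 1) + 1" using N(2) by (simp add: l_def)
        also have "\<dots> \<le> 4 / kap * l + l" using l1 kap by (intro add_mono mult_left_mono) auto
        finally show "N \<le> (4 / kap + 1) * l" by (simp add: distrib_right)
      qed (use D0 in auto)
      finally show ?thesis by (simp add: c1_def mult.assoc)
    qed
    obtain L :: real where L: "\<And>n s. 0 \<le> s \<Longrightarrow> pw p n (\<lambda>w. \<bar>lognorm B w - n * L\<bar> > s + 2 * (c1 * l) + 1)
       \<le> 4 * exp (- s\<^sup>2 / (4 * real n * (c1 * l + 2 * C + 1)\<^sup>2))"
      using ldt_of_oscillation[OF bounded_by D] by blast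
    show "\<exists>L. \<forall>n. \<forall>s\<ge>0. pw p n (\<lambda>w. \<bar>lognorm B w - real n * L\<bar> > s + K * (1 - ln \<rho>))
         \<le> 4 * exp (- s\<^sup>2 / (K * (1 - ln \<rho>)\<^sup>2 * real n))"
      unfolding l_def[symmetric]
    proof (rule exI[of _ L], intro allI impI)
      fix n :: nat and s :: real assume s: "0 \<le> s"
      have "(2 * c1 + 1) * l \<le> K * l" using K l1 by (intro mult_right_mono) auto
      then have "2 * (c1 * l) + 1 \<le> K * l" using l1 by (simp add: distrib_right)
      then have "pw p n (\<lambda>w. \<bar>lognorm B w - real n * L\<bar> > s + K * l)
          \<le> pw p n (\<lambda>w. \<bar>lognorm B w - n * L\<bar> > s + 2 * (c1 * l) + 1)"
        by (intro pw_mono) auto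
      also have "\<dots> \<le> 4 * exp (- s\<^sup>2 / (4 * real n * (c1 * l + 2 * C + 1)\<^sup>2))" by (rule L[OF s])
      also have "\<dots> \<le> 4 * exp (- s\<^sup>2 / (K * l\<^sup>2 * real n))"
      proof (cases "n = 0")
        case False
        have "(2 * C + 1) * 1 \<le> (2 * C + 1) * l" using C0 l1 by (intro mult_left_mono) auto
        then have "c1 * l + 2 * C + 1 \<le> (c1 + 2 * C + 1) * l" by (simp add: distrib_right)
        moreover have p: "0 < c1 * l + 2 * C + 1" using c1 l1 C0 by (simp add: add_pos_nonneg)
        ultimately have "4 * n * (c1 * l + 2 * C + 1)\<^sup>2 \<le> 4 * n * ((c1 + 2 * C + 1) * l)\<^sup>2"
          by (intro mult_left_mono power_mono) auto
        also have "\<dots> = 4 * (c1 + 2 * C + 1)\<^sup>2 * (l\<^sup>2 * n)" by (simp add: power_mult_distrib)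
        also have "\<dots> \<le> K * (l\<^sup>2 * n)" by (intro mult_right_mono K) auto
        finally have "4 * n * (c1 * l + 2 * C + 1)\<^sup>2 \<le> K * l\<^sup>2 * n" by (simp add: mult.assoc)
        then have "s\<^sup>2 / (K * l\<^sup>2 * real n) \<le> s\<^sup>2 / (4 * real n * (c1 * l + 2 * C + 1)\<^sup>2)"
          using p False K(6) l1 by (intro divide_left_mono mult_pos_pos) auto
        then show ?thesis by simp
      qed simp
      finally show "pw p n (\<lambda>w. \<bar>lognorm B w - real n * L\<bar> > s + K * l) \<le> 4 * exp (- s\<^sup>2 / (K * l\<^sup>2 * real n))" .
    qed
  next
    fix B :: "'a \<Rightarrow> mat2" and \<rho> T \<theta> s :: real and n :: nat
    assume nd: "near_diag al be d \<rho> B" "0 \<le> \<rho>" "\<rho> \<le> d" and T: "1 \<le> T" and th: "0 \<le> \<theta>" "\<theta> \<le> 1" and rT: "\<rho> * T \<le> \<theta> * e" and s: "0 \<le> s"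
    have de: "d \<le> e" using d d2 by linarith
    have B': "\<And>j. \<bar>B j $ 1 $ 1 - al j\<bar> \<le> e" "\<And>j. \<bar>B j $ 2 $ 2 - be j\<bar> \<le> e" "\<And>j. \<bar>B j $ 2 $ 1\<bar> \<le> e" "\<And>j. \<bar>B j $ 1 $ 2\<bar> \<le> \<rho>"
      using near_diagD[OF near_diag_mono[OF nd(1) de]] by auto
    have T0: "0 < T" using T by simp
    have bounded_by: "bounded_by B C" by (rule cb[OF near_diag_mono[OF nd(1) d(2)]]) (use nd d in linarith)
    note opn = flat_word_opnorm[OF b e(1,3) contr B' T0 nd(2) rT th(2)]
    note flat_prob = flat_word_prob[OF b e(1,3) contr B' T0 nd(2) rT th(2)]
    let ?e1 = "axis 1 1 :: real^2" and ?e12 = "vector [1, 1] :: real^2"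
    define f where "f j = ln \<bar>B j $ 1 $ 1\<bar>" for j
    define \<mu> where "\<mu> = (\<Sum>j\<in>UNIV. pmf p j * f j)"
    have fY: "\<bar>f j\<bar> \<le> Y" for j
    proof -
      have "\<bar>ln \<bar>al j\<bar>\<bar> \<le> (\<Sum>j\<in>UNIV. \<bar>ln \<bar>al j\<bar>\<bar>)" by (rule member_le_sum) auto
      moreover have "\<bar>f j - ln \<bar>al j\<bar>\<bar> \<le> 1 / 2" unfolding f_def by (rule l11[OF near_diag_mono[OF nd(1) d(3)]])
      moreover have "\<bar>f j\<bar> \<le> \<bar>ln \<bar>al j\<bar>\<bar> + \<bar>f j - ln \<bar>al j\<bar>\<bar>" using abs_triangle_ineq[of "ln \<bar>al j\<bar>" "f j - ln \<bar>al j\<bar>"] by simp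
      ultimately show ?thesis unfolding Y_def by simp
    qed
    have dev: "\<bar>f j - \<mu>\<bar> \<le> 2 * Y" for j
      using fY[of j] pmf_mean_abs_le[of f Y p, OF fY] unfolding \<mu>_def by linarith
    have "pw p n (\<lambda>w. \<bar>lognorm B w - real n * \<mu>\<bar> > s + ln T + real n * \<theta> + K)
        \<le> pw p n (\<lambda>w. (\<not> flat_word B T ?e1 w \<or> \<not> flat_word B T ?e12 w) \<or> \<bar>sum_list (map f w) - real n * \<mu>\<bar> > s)"
    proof (rule pw_mono, rule ccontr)
      fix w assume w: "length w = n" and big: "\<bar>lognorm B w - real n * \<mu>\<bar> > s + ln T + real n * \<theta> + K"
        and nn: "\<not> ((\<not> flat_word B T ?e1 w \<or> \<not> flat_word B T ?e12 w) \<or> \<bar>sum_list (map f w) - real n * \<mu>\<bar> > s)"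
      then have fl: "flat_word B T ?e1 w" "flat_word B T ?e12 w" by auto
      define P where "P = sum_list (map f w)"
      define h where "h = n * (\<theta> / 2)"
      have P: "\<bar>P - real n * \<mu>\<bar> \<le> s" using nn by (simp add: P_def)
      have op0: "0 < opnorm (wprod B w)" by (rule opnorm_pos[OF bdd_det(1)[OF bounded_by]])
      have "opnorm (wprod B w) \<le> 3 * (1 + T) * exp (P + h)" using opn(1)[OF fl] w by (simp add: P_def h_def f_def[abs_def])
      also have "\<dots> \<le> 6 * T * exp (P + h)" using T by (intro mult_right_mono) auto
      also have "\<dots> = exp (ln 6 + ln T + (P + h))" using T0 by (simp add: exp_add)
      finally have u: "lognorm B w \<le> ln 6 + ln T + (P + h)" by (rule ln_le_of_le_exp[OF op0])
      have "exp (P - h) \<le> opnorm (wprod B w)" using opn(2)[OF fl] w by (simp add: P_def h_def f_def[abs_def])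
      then have l: "P - h \<le> lognorm B w" using op0 by (simp add: ln_ge_iff)
      have "0 \<le> ln T" using T by simp
      moreover have "h \<le> real n * \<theta>" using th by (simp add: h_def mult_left_mono)
      ultimately show False using u l P big K(3) sq(3) by linarith
    qed
    also have "\<dots> \<le> (T powr (- b) * (0 + n) + T powr (- b) * (1 + n)) + 2 * exp (- s\<^sup>2 / (4 * real n * (2 * Y)\<^sup>2))"
    proof (intro order_trans[OF pw_disj] add_mono)
      show "pw p n (\<lambda>w. \<not> flat_word B T ?e1 w) \<le> T powr (- b) * (0 + n)"
        using flat_prob[of ?e1 n] by (simp add: slope_def axis_def)
      show "pw p n (\<lambda>w. \<not> flat_word B T ?e12 w) \<le> T powr (- b) * (1 + n)"
        using flat_prob[of ?e12 n] by (simp add: slope_def)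
      show "pw p n (\<lambda>w. \<bar>sum_list (map f w) - real n * \<mu>\<bar> > s) \<le> 2 * exp (- s\<^sup>2 / (4 * real n * (2 * Y)\<^sup>2))"
        unfolding \<mu>_def by (rule sum_list_deviation) (use Y0 dev s in \<open>auto simp: \<mu>_def\<close>)
    qed
    also have "T powr (- b) * (0 + n) + T powr (- b) * (1 + n) \<le> K * (real n + 1) * T powr (- b)"
    proof -
      have "T powr (- b) * (0 + n) + T powr (- b) * (1 + n) \<le> 2 * ((real n + 1) * T powr (- b))"
        by (simp add: algebra_simps)
      also have "\<dots> \<le> K * ((real n + 1) * T powr (- b))" by (intro mult_right_mono K) auto
      finally show ?thesis by (simp add: mult.assoc)
    qed
    also have "2 * exp (- s\<^sup>2 / (4 * real n * (2 * Y)\<^sup>2)) \<le> 2 * exp (- s\<^sup>2 / (K * real n))"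
    proof (cases "n = 0")
      case False
      have "4 * (2 * Y)\<^sup>2 * real n \<le> K * real n" by (intro mult_right_mono K) auto
      then have "s\<^sup>2 / (K * real n) \<le> s\<^sup>2 / (4 * real n * (2 * Y)\<^sup>2)"
        using Y0 False K by (intro divide_left_mono) (auto simp: mult_ac)
      then show ?thesis by simp
    qed simp
    finally show "pw p n (\<lambda>w. \<bar>lognorm B w - real n * (\<Sum>j\<in>UNIV. pmf p j * ln \<bar>B j $ 1 $ 1\<bar>)\<bar> > s + ln T + real n * \<theta> + K)
       \<le> K * (real n + 1) * T powr (- b) + 2 * exp (- s\<^sup>2 / (K * real n))"
      by (simp add: \<mu>_def f_def)
  qed
qed

end

section \<open>Triangular and diagonalizable cocycles\<close>

lemma wedge_eq_0_imp_scaleR: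
  fixes x y :: "real^2"
  assumes "x \<noteq> 0" "wedge x y = 0"
  obtains c where "y = c *\<^sub>R x"
proof -
  obtain z where z: "wedge x z = (norm x)\<^sup>2" by (rule wedge_exists)
  have "(norm x)\<^sup>2 *\<^sub>R y = wedge y z *\<^sub>R x"
    using wedge_Cramer[of x z y] assms(2) z by simp
  then have "y = (wedge y z / (norm x)\<^sup>2) *\<^sub>R x"
    using assms(1) by (metis (no_types, lifting) divide_inverse_commute norm_eq_zero power_eq_0_iff scaleR_one scaleR_scaleR left_inverse)
  then show thesis by (rule that)
qed

definition columns_mat :: "real^2 \<Rightarrow> real^2 \<Rightarrow> mat2" where
  "columns_mat u v = mat22 (u $ 1) (v $ 1) (u $ 2) (v $ 2)"

lemma det_columns_mat: "det (columns_mat u v) = wedge u v"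
  by (simp add: columns_mat_def det_2 wedge_def)

lemma columns_mat_axis: "columns_mat u v *v axis 1 1 = u" "columns_mat u v *v axis 2 1 = v"
  by (simp_all add: columns_mat_def vec_eq_iff forall_2 matvec2) (simp_all add: axis_def)

lemma entry_eq_axis: "M $ i $ k = (M *v axis k 1) $ i" for M :: mat2
  using exhaust_2[of k] by (auto simp: matvec2 axis_def)

lemma diagonalizable_of_eigenvectors:
  assumes ind: "wedge u v \<noteq> 0"
    and u: "\<And>j. wedge u (A j *v u) = 0" and v: "\<And>j. wedge v (A j *v v) = 0"
  shows "diagonalizable_cocycle A"
proof -
  define Q where "Q = columns_mat u v"
  have inv: "invertible Q" using ind by (simp add: invertible_det_nz Q_def det_columns_mat)
  note Q = matrix_inv_mult[OF inv]
  have uv: "u \<noteq> 0" "v \<noteq> 0" using ind by (auto simp: wedge_def)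
  have col: "(matrix_inv Q ** A j ** Q) $ i $ k = 0"
    if y: "Q *v axis k 1 = y" "wedge y (A j *v y) = 0" "y \<noteq> 0" "i \<noteq> k" for i k y j
  proof -
    obtain c where c: "A j *v y = c *\<^sub>R y" by (rule wedge_eq_0_imp_scaleR[OF y(3,2)])
    have "(matrix_inv Q ** A j ** Q) *v axis k 1 = matrix_inv Q *v (A j *v (Q *v axis k 1))"
      by (simp add: matrix_vector_mul_assoc matrix_mul_assoc)
    also have "\<dots> = c *\<^sub>R (matrix_inv Q *v (Q *v axis k 1))"
      unfolding y(1) c by (simp add: matrix_vector_mult_scaleR)
    also have "\<dots> = c *\<^sub>R axis k 1" using Q by (simp add: matrix_vector_mul_assoc)
    finally have "((matrix_inv Q ** A j ** Q) *v axis k 1) $ i = 0" using y(4) by (simp add: axis_def)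
    then show ?thesis by (simp only: entry_eq_axis)
  qed
  have "(matrix_inv Q ** A j ** Q) $ i $ k = 0" if "i \<noteq> k" for i k j
  proof (cases "k = 1")
    case True
    then show ?thesis by (intro col[of k u]) (use that uv u in \<open>auto simp: Q_def columns_mat_axis\<close>)
  next
    case False
    then have "k = 2" using exhaust_2 by blast
    then show ?thesis by (intro col[of k v]) (use that uv v in \<open>auto simp: Q_def columns_mat_axis\<close>)
  qed
  with inv show ?thesis unfolding diagonalizable_cocycle_def by blast
qed

lemma conj_nbhd:
  fixes A :: "'a::finite \<Rightarrow> mat2" and \<eta> :: real
  assumes "0 < \<eta>"
  obtains \<delta> where "0 < \<delta>" "\<And>B j. cdist B A < \<delta> \<Longrightarrow> opnorm (conj_cocycle Q' B Q j - conj_cocycle Q' A Q j) \<le> \<eta>"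
proof -
  define c where "c = opnorm Q' * opnorm Q + 1"
  have c: "0 < c" "opnorm Q' * opnorm Q \<le> c" by (auto simp: c_def add_nonneg_pos)
  show thesis
  proof (rule that[of "\<eta> / c"])
    show "0 < \<eta> / c" using assms c by simp
    fix B :: "'a \<Rightarrow> mat2" and j assume B: "cdist B A < \<eta> / c"
    have "conj_cocycle Q' B Q j - conj_cocycle Q' A Q j = Q' ** (B j - A j) ** Q"
      by (rule mat2_eqI) (simp_all add: conj_cocycle_def mat2_mult algebra_simps)
    also have "opnorm \<dots> \<le> opnorm Q' * opnorm (B j - A j) * opnorm Q"
      by (rule order_trans[OF opnorm_mult mult_right_mono[OF opnorm_mult]]) simp
    also have "\<dots> = (opnorm Q' * opnorm Q) * opnorm (B j - A j)" by simp
    also have "\<dots> \<le> c * (\<eta> / c)"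
      using opnorm_diff_le_cdist[of B j A] B c assms by (intro mult_mono) auto
    finally show "opnorm (conj_cocycle Q' B Q j - conj_cocycle Q' A Q j) \<le> \<eta>" using c by simp
  qed
qed

section \<open>Transposed cocycles\<close>

lemma wprod_transpose: "wprod (\<lambda>j. transpose (B j)) w = transpose (wprod B (rev w))"
  by (induction w) (auto simp: wprod_append matrix_transpose_mul)

lemma cdist_transpose: "cdist (\<lambda>j. transpose (A j)) (\<lambda>j. transpose (B j)) = cdist A B"
proof -
  have "transpose M - transpose N = transpose (M - N)" for M N :: mat2
    by (simp add: transpose_def vec_eq_iff)
  then show ?thesis by (simp add: cdist_def opnorm_transpose)
qed

text \<open>Transposition keeps operator norms and distances and reverses words, and reversal does
  not change the law of a word.\<close>

lemma uniform_ldt_transpose: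
  assumes "uniform_ldt p (\<lambda>j. transpose (A j))"
  shows "uniform_ldt p A"
proof -
  obtain \<delta> K where dK: "0 < \<delta>" "0 < K" and u: "\<And>B. cdist B (\<lambda>j. transpose (A j)) < \<delta> \<Longrightarrow>
     \<exists>L. \<forall>n. \<forall>s\<ge>0. pw p n (\<lambda>w. \<bar>lognorm B w - real n * L\<bar> > s + K) \<le> 4 * exp (- s\<^sup>2 / (K * real n))"
    using assms unfolding uniform_ldt_def by blast
  have rev: "pw p n (\<lambda>w. \<bar>ln (opnorm (wprod (\<lambda>j. transpose (B j)) w)) - real n * L\<bar> > t) = pw p n (\<lambda>w. \<bar>lognorm B w - real n * L\<bar> > t)" for B n L t
    unfolding wprod_transpose opnorm_transpose pw_def by (rule ew_rev)
  show ?thesis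
    unfolding uniform_ldt_def
  proof (rule exI[of _ \<delta>], rule conjI[OF dK(1)], rule exI[of _ K], rule conjI[OF dK(2)], intro allI impI)
    fix B assume "cdist B A < \<delta>"
    then show "\<exists>L. \<forall>n. \<forall>s\<ge>0. pw p n (\<lambda>w. \<bar>lognorm B w - real n * L\<bar> > s + K) \<le> 4 * exp (- s\<^sup>2 / (K * real n))"
      using u[of "\<lambda>j. transpose (B j)"] unfolding cdist_transpose rev by blast
  qed
qed

definition perp :: "real^2 \<Rightarrow> real^2" where
  "perp v = vector [- v $ 2, v $ 1]"

lemma perp_simps [simp]: "perp v $ 1 = - v $ 2" "perp v $ 2 = v $ 1"
  by (simp_all add: perp_def)

lemma wedge_perp: "wedge v (perp v) = (norm v)\<^sup>2"
  unfolding norm2_sq by (simp add: wedge_def power2_eq_square)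

text \<open>A line is invariant under \<open>M\<close> if and only if its orthogonal complement is
  invariant under the transpose.\<close>

lemma wedge_perp_transpose: "wedge (perp v) (transpose M *v perp v) = - wedge v (M *v v)"
  by (simp add: wedge_def matvec2 transpose_def algebra_simps)

text \<open>Coordinates in which a common eigenvector \<open>v\<close> is the first basis vector; the scaling \<open>t\<close> of
  the second one makes the off-diagonal entries small.\<close>
lemma triangular_coordinates:
  assumes v: "v \<noteq> 0" and ev: "\<And>j. A j *v v = a j *\<^sub>R v" and a: "\<And>j. a j \<noteq> 0" and t: "t \<noteq> 0"
  obtains Q Q' c where "Q ** Q' = mat 1" "Q' ** Q = mat 1" "Q *v axis 1 1 = v"
    "\<And>j. conj_cocycle Q' A Q j = mat22 (a j) (t * c j) 0 (det (A j) / a j)"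
    "\<And>j. c j = wedge (A j *v perp v) (perp v) / (norm v)\<^sup>2"
proof -
  define Q where "Q = columns_mat v (t *\<^sub>R perp v)"
  have dQ: "det Q = t * (norm v)\<^sup>2" by (simp add: Q_def det_columns_mat wedge_perp)
  have dQ0: "det Q \<noteq> 0" using v t by (simp add: dQ)
  note inv = matrix_inv_mult[OF invertible_det_nz[THEN iffD2, OF dQ0]]
  define Q' where "Q' = matrix_inv Q"
  define c where "c j = wedge (A j *v perp v) (perp v) / (norm v)\<^sup>2" for j
  have Q: "Q *v axis 1 1 = v" "Q *v axis 2 1 = t *\<^sub>R perp v" by (simp_all add: Q_def columns_mat_axis)
  have Qinv: "Q ** Q' = mat 1" "Q' ** Q = mat 1" using inv by (simp_all add: Q'_def)
  have v2: "(norm v)\<^sup>2 \<noteq> 0" using v by simp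
  have Q'v: "Q' *v v = axis 1 1" using Qinv(2) unfolding Q(1)[symmetric] by (simp add: matrix_vector_mul_assoc)
  show thesis
  proof (rule that[OF Qinv Q(1) _ c_def])
    fix j
    let ?M = "conj_cocycle Q' A Q j"
    have M: "?M *v x = Q' *v (A j *v (Q *v x))" for x
      by (simp add: conj_cocycle_def matrix_vector_mul_assoc matrix_mul_assoc)
    have c1: "?M *v axis 1 1 = a j *\<^sub>R axis 1 1"
      unfolding M Q ev by (simp add: matrix_vector_mult_scaleR Q'v)
    have dM: "det ?M = det (A j)"
    proof -
      have "det Q' * det Q = 1" using Qinv(2) by (metis det_I det_mul)
      then show ?thesis by (simp add: conj_cocycle_def det_mul)
    qed
    have e11: "?M $ 1 $ 1 = a j" and e21: "?M $ 2 $ 1 = 0"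
      unfolding entry_eq_axis[of _ _ 1] c1 by (simp_all add: axis_def)
    have e22: "?M $ 2 $ 2 = det (A j) / a j"
      using dM e11 e21 a[of j] by (simp add: det_2 field_simps)
    have "?M $ 1 $ 2 = wedge (?M *v axis 2 1) (axis 2 1)"
      unfolding entry_eq_axis[of _ _ 2] by (simp add: wedge_def axis_def)
    also have "\<dots> = wedge (Q *v (?M *v axis 2 1)) (Q *v axis 2 1) / det Q"
      unfolding wedge_matrix using dQ0 by simp
    also have "Q *v (?M *v axis 2 1) = A j *v (Q *v axis 2 1)"
      unfolding M using Qinv(1) by (simp add: matrix_vector_mul_assoc matrix_mul_assoc)
    also have "wedge (A j *v (Q *v axis 2 1)) (Q *v axis 2 1) / det Q = t * c j"
      unfolding Q dQ c_def using t v2 by (simp add: matrix_vector_mult_scaleR)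
    finally have e12: "?M $ 1 $ 2 = t * c j" .
    show "?M = mat22 (a j) (t * c j) 0 (det (A j) / a j)"
      by (rule mat2_eqI) (simp_all add: e11 e12 e21 e22)
  qed
qed

text \<open>The weight \<open>Kc\<close> of the second coordinate absorbs the off-diagonal entries \<open>c\<close>.\<close>
lemma triangular_exp_moment:
  fixes al be c :: "'a::finite \<Rightarrow> real" and \<tau> Kc U :: real
  defines "A \<equiv> \<lambda>j. mat22 (al j) (c j) 0 (be j)"
  assumes nz: "\<And>j. al j \<noteq> 0" "\<And>j. be j \<noteq> 0"
    and eq: "(\<Sum>j\<in>UNIV. pmf p j * ln \<bar>al j\<bar>) = (\<Sum>j\<in>UNIV. pmf p j * ln \<bar>be j\<bar>)"
    and U: "\<And>j. \<bar>ln \<bar>al j\<bar> - ln \<bar>be j\<bar>\<bar> \<le> U" and tau: "0 < \<tau>" "2 * \<tau> \<le> 1" "\<tau> * U \<le> 1"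
    and Kc: "1 \<le> Kc" "(\<Sum>j\<in>UNIV. pmf p j * (\<bar>al j * be j\<bar> powr (-\<tau>) * \<bar>c j\<bar> powr (2 * \<tau>))) \<le> \<tau>\<^sup>2 * Kc"
  shows "ew p n (\<lambda>w. \<bar>det (wprod A w)\<bar> powr (-\<tau>) * (\<bar>(wprod A w *v x) $ 1\<bar> powr (2 * \<tau>) + Kc * \<bar>(wprod A w *v x) $ 2\<bar> powr (2 * \<tau>)))
     \<le> (1 + \<tau>\<^sup>2 * (U\<^sup>2 + 1)) ^ n * (\<bar>x $ 1\<bar> powr (2 * \<tau>) + Kc * \<bar>x $ 2\<bar> powr (2 * \<tau>))"
proof (induction n arbitrary: x)
  case 0
  then show ?case by simp
next
  case (Suc n)
  define \<Theta> where "\<Theta> = 1 + \<tau>\<^sup>2 * (U\<^sup>2 + 1)"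
  define V where "V y = \<bar>y $ 1\<bar> powr (2 * \<tau>) + Kc * \<bar>y $ 2\<bar> powr (2 * \<tau>)" for y :: "real^2"
  have T0: "0 \<le> \<Theta>" by (simp add: \<Theta>_def)
  have det: "det (A j) = al j * be j" for j by (simp add: A_def det_2)
  have IH: "ew p n (\<lambda>w. \<bar>det (wprod A w)\<bar> powr (-\<tau>) * V (wprod A w *v x)) \<le> \<Theta> ^ n * V x" for x
    using Suc.IH[of x] by (simp add: V_def \<Theta>_def)
  \<comment> \<open>The linear term vanishes because the two diagonal exponents agree; the two signs
    of \<open>r\<close> belong to the two coordinates.\<close>
  have mgf: "(\<Sum>j\<in>UNIV. pmf p j * exp (r * (ln \<bar>al j\<bar> - ln \<bar>be j\<bar>))) \<le> 1 + \<tau>\<^sup>2 * U\<^sup>2" if "\<bar>r\<bar> = \<tau>" for r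
  proof -
    have "(\<Sum>j\<in>UNIV. pmf p j * exp (r * (ln \<bar>al j\<bar> - ln \<bar>be j\<bar>)))
        \<le> (\<Sum>j\<in>UNIV. pmf p j * (1 + r * (ln \<bar>al j\<bar> - ln \<bar>be j\<bar>) + \<tau>\<^sup>2 * U\<^sup>2))"
    proof (intro sum_mono mult_left_mono)
      fix j
      let ?u = "r * (ln \<bar>al j\<bar> - ln \<bar>be j\<bar>)"
      have "\<bar>?u\<bar> \<le> \<tau> * U" unfolding abs_mult that using U[of j] tau by (intro mult_left_mono) auto
      then have "\<bar>?u\<bar> \<le> 1" "?u\<^sup>2 \<le> (\<tau> * U)\<^sup>2" using tau(3) by (linarith, metis abs_ge_zero power2_abs power_mono)
      then show "exp ?u \<le> 1 + ?u + \<tau>\<^sup>2 * U\<^sup>2" using exp_le_quadratic[of ?u] by (simp add: power_mult_distrib)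
    qed auto
    also have "\<dots> = 1 + r * ((\<Sum>j\<in>UNIV. pmf p j * ln \<bar>al j\<bar>) - (\<Sum>j\<in>UNIV. pmf p j * ln \<bar>be j\<bar>)) + \<tau>\<^sup>2 * U\<^sup>2"
    proof -
      have "(\<Sum>j\<in>UNIV. pmf p j * (1 + r * (ln \<bar>al j\<bar> - ln \<bar>be j\<bar>) + \<tau>\<^sup>2 * U\<^sup>2))
        = (\<Sum>j\<in>UNIV. pmf p j * (1 + \<tau>\<^sup>2 * U\<^sup>2) + (r * (pmf p j * ln \<bar>al j\<bar>) - r * (pmf p j * ln \<bar>be j\<bar>)))"
        by (rule sum.cong) (auto simp: algebra_simps)
      then show ?thesis by (simp add: sum.distrib sum_subtractf sum_distrib_left[symmetric] right_diff_distrib)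
    qed
    finally show ?thesis using eq by simp
  qed
  have pw1: "\<bar>al j * be j\<bar> powr (-\<tau>) * \<bar>al j\<bar> powr (2 * \<tau>) = exp (\<tau> * (ln \<bar>al j\<bar> - ln \<bar>be j\<bar>))"
    and pw2: "\<bar>al j * be j\<bar> powr (-\<tau>) * \<bar>be j\<bar> powr (2 * \<tau>) = exp (-\<tau> * (ln \<bar>al j\<bar> - ln \<bar>be j\<bar>))" for j
    using nz[of j] by (auto simp: powr_def abs_mult ln_mult algebra_simps simp flip: exp_add)
  have one: "(\<Sum>j\<in>UNIV. pmf p j * (\<bar>al j * be j\<bar> powr (-\<tau>) * V (A j *v x))) \<le> \<Theta> * V x"
  proof -
    let ?x1 = "\<bar>x $ 1\<bar> powr (2 * \<tau>)" and ?x2 = "\<bar>x $ 2\<bar> powr (2 * \<tau>)"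
    have "\<bar>al j * be j\<bar> powr (-\<tau>) * V (A j *v x) \<le> exp (\<tau> * (ln \<bar>al j\<bar> - ln \<bar>be j\<bar>)) * ?x1
        + ((\<bar>al j * be j\<bar> powr (-\<tau>) * \<bar>c j\<bar> powr (2 * \<tau>)) * ?x2 + exp (-\<tau> * (ln \<bar>al j\<bar> - ln \<bar>be j\<bar>)) * (Kc * ?x2))" for j
    proof -
      have "\<bar>(A j *v x) $ 1\<bar> powr (2 * \<tau>) \<le> (\<bar>al j * x $ 1\<bar> + \<bar>c j * x $ 2\<bar>) powr (2 * \<tau>)"
        using tau by (intro powr_mono2) (auto simp: A_def matvec2 abs_triangle_ineq)
      also have "\<dots> \<le> \<bar>al j * x $ 1\<bar> powr (2 * \<tau>) + \<bar>c j * x $ 2\<bar> powr (2 * \<tau>)"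
        using tau by (intro powr_subadd) auto
      finally have "V (A j *v x) \<le> \<bar>al j\<bar> powr (2 * \<tau>) * ?x1 + \<bar>c j\<bar> powr (2 * \<tau>) * ?x2 + Kc * (\<bar>be j\<bar> powr (2 * \<tau>) * ?x2)"
        by (simp add: V_def A_def matvec2 abs_mult powr_mult)
      then have "\<bar>al j * be j\<bar> powr (-\<tau>) * V (A j *v x) \<le> \<bar>al j * be j\<bar> powr (-\<tau>) * (\<bar>al j\<bar> powr (2 * \<tau>) * ?x1 + \<bar>c j\<bar> powr (2 * \<tau>) * ?x2 + Kc * (\<bar>be j\<bar> powr (2 * \<tau>) * ?x2))"
        by (intro mult_left_mono) auto
      also have "\<dots> = (\<bar>al j * be j\<bar> powr (-\<tau>) * \<bar>al j\<bar> powr (2 * \<tau>)) * ?x1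
        + ((\<bar>al j * be j\<bar> powr (-\<tau>) * \<bar>c j\<bar> powr (2 * \<tau>)) * ?x2 + (\<bar>al j * be j\<bar> powr (-\<tau>) * \<bar>be j\<bar> powr (2 * \<tau>)) * (Kc * ?x2))"
        by (simp add: distrib_left mult_ac)
      finally show ?thesis unfolding pw1 pw2 .
    qed
    then have "(\<Sum>j\<in>UNIV. pmf p j * (\<bar>al j * be j\<bar> powr (-\<tau>) * V (A j *v x)))
        \<le> (\<Sum>j\<in>UNIV. pmf p j * (exp (\<tau> * (ln \<bar>al j\<bar> - ln \<bar>be j\<bar>)) * ?x1
        + ((\<bar>al j * be j\<bar> powr (-\<tau>) * \<bar>c j\<bar> powr (2 * \<tau>)) * ?x2 + exp (-\<tau> * (ln \<bar>al j\<bar> - ln \<bar>be j\<bar>)) * (Kc * ?x2))))"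
      by (intro sum_mono mult_left_mono) auto
    also have "\<dots> = (\<Sum>j\<in>UNIV. pmf p j * exp (\<tau> * (ln \<bar>al j\<bar> - ln \<bar>be j\<bar>))) * ?x1
        + ((\<Sum>j\<in>UNIV. pmf p j * (\<bar>al j * be j\<bar> powr (-\<tau>) * \<bar>c j\<bar> powr (2 * \<tau>))) * ?x2
          + (\<Sum>j\<in>UNIV. pmf p j * exp (-\<tau> * (ln \<bar>al j\<bar> - ln \<bar>be j\<bar>))) * (Kc * ?x2))"
      by (simp add: distrib_left sum.distrib sum_distrib_right mult.assoc)
    also have "\<dots> \<le> (1 + \<tau>\<^sup>2 * U\<^sup>2) * ?x1 + ((\<tau>\<^sup>2 * Kc) * ?x2 + (1 + \<tau>\<^sup>2 * U\<^sup>2) * (Kc * ?x2))"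
      using mgf[of \<tau>] mgf[of "-\<tau>"] tau Kc by (intro add_mono mult_right_mono) auto
    also have "\<dots> \<le> \<Theta> * V x"
    proof -
      have "0 \<le> \<tau>\<^sup>2 * ?x1" by simp
      then show ?thesis unfolding \<Theta>_def V_def by (simp add: algebra_simps)
    qed
    finally show ?thesis .
  qed
  have "ew p (Suc n) (\<lambda>w. \<bar>det (wprod A w)\<bar> powr (-\<tau>) * V (wprod A w *v x))
      = (\<Sum>j\<in>UNIV. pmf p j * (\<bar>al j * be j\<bar> powr (-\<tau>) * ew p n (\<lambda>w. \<bar>det (wprod A w)\<bar> powr (-\<tau>) * V (wprod A w *v (A j *v x)))))"
    by (simp add: ew_cmult[symmetric] det_mul det abs_mult powr_mult mult_ac matrix_vector_mul_assoc)
  also have "\<dots> \<le> (\<Sum>j\<in>UNIV. pmf p j * (\<bar>al j * be j\<bar> powr (-\<tau>) * (\<Theta> ^ n * V (A j *v x))))"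
    by (intro sum_mono mult_left_mono IH) auto
  also have "\<dots> = \<Theta> ^ n * (\<Sum>j\<in>UNIV. pmf p j * (\<bar>al j * be j\<bar> powr (-\<tau>) * V (A j *v x)))"
    by (simp add: sum_distrib_left mult_ac)
  also have "\<dots> \<le> \<Theta> ^ n * (\<Theta> * V x)" by (intro mult_left_mono one zero_le_power T0)
  also have "\<dots> = \<Theta> ^ Suc n * V x" by simp
  finally show ?case by (simp only: V_def \<Theta>_def)
qed

lemma exp_ew_le: "exp (ew p n Y) \<le> ew p n (\<lambda>w. exp (Y w))"
proof -
  define m where "m = ew p n Y"
  have "exp m = ew p n (\<lambda>w. exp m * (1 + (Y w - m)))"
    by (simp only: ew_cmult ew_add ew_diff ew_const m_def) simp
  also have "\<dots> \<le> ew p n (\<lambda>w. exp m * exp (Y w - m))"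
    by (intro ew_mono mult_left_mono exp_ge_add_one_self) auto
  also have "\<dots> = ew p n (\<lambda>w. exp (Y w))" by (simp flip: exp_add)
  finally show ?thesis by (simp add: m_def)
qed

text \<open>The moment of exp (2 \<tau> \<open>ngrow\<close>) grows per letter at most by the factor
  1 + \<tau>^2 (U^2 + 1), with no first-order term. Jensen's inequality turns this into 2 \<tau> gap
  at most \<tau>^2 (U^2 + 1); dividing by \<tau> and taking it small forces the gap to
  vanish.\<close>

lemma gap_zero_of_equal_exponents:
  fixes A :: "'a::finite \<Rightarrow> mat2"
  assumes bounded_by: "bounded_by A C" and v: "v \<noteq> 0" and ev: "\<And>j. A j *v v = a j *\<^sub>R v"
    and eq: "(\<Sum>j\<in>UNIV. pmf p j * ln \<bar>a j\<bar>) = (\<Sum>j\<in>UNIV. pmf p j * ln \<bar>det (A j) / a j\<bar>)"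
  shows "gap p A = 0"
proof -
  have a: "a j \<noteq> 0" for j using bdd_nz1[OF bounded_by v, of j] ev[of j] by auto
  have dA: "det (A j) \<noteq> 0" for j using bdd_det(1)[OF bounded_by, of "[j]"] by simp
  obtain Q Q' c where Q: "Q ** Q' = mat 1" "Q' ** Q = mat 1"
    and tri: "\<And>j. conj_cocycle Q' A Q j = mat22 (a j) (1 * c j) 0 (det (A j) / a j)"
    by (rule triangular_coordinates[where A = A and a = a and t = 1, OF v ev a]) auto
  define be where "be j = det (A j) / a j" for j
  have be: "be j \<noteq> 0" for j using a dA by (simp add: be_def)
  define A' where "A' = (\<lambda>j. mat22 (a j) (c j) 0 (be j))"
  have A': "conj_cocycle Q' A Q = A'" using tri by (simp add: fun_eq_iff A'_def be_def)
  define Kq where "Kq = max 1 (max (opnorm Q) (opnorm Q'))"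
  have Kq: "opnorm Q \<le> Kq" "opnorm Q' \<le> Kq" "1 \<le> Kq" by (auto simp: Kq_def)
  define U where "U = (\<Sum>j\<in>UNIV. \<bar>ln \<bar>a j\<bar> - ln \<bar>be j\<bar>\<bar>)"
  have U: "\<bar>ln \<bar>a j\<bar> - ln \<bar>be j\<bar>\<bar> \<le> U" for j unfolding U_def by (rule member_le_sum) auto
  have U0: "0 \<le> U" using U[of undefined] by linarith
  have dQ: "det Q' * det Q = 1" using Q(2) by (metis det_I det_mul)
  have dA': "det (wprod A' w) = det (wprod A w)" for w
    unfolding A'[symmetric] wprod_conj[OF Q] det_mul using dQ by (metis mult.assoc mult.commute mult_1)
  have bound: "2 * gap p A \<le> \<tau> * (U\<^sup>2 + 1)" if tau: "0 < \<tau>" "2 * \<tau> \<le> 1" "\<tau> * U \<le> 1" for \<tau>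
  proof -
    define S where "S = (\<Sum>j\<in>UNIV. pmf p j * (\<bar>a j * be j\<bar> powr (-\<tau>) * \<bar>c j\<bar> powr (2 * \<tau>)))"
    have S0: "0 \<le> S" unfolding S_def by (intro sum_nonneg) auto
    \<comment> \<open>The weight grows as \<tau> shrinks, so that the off-diagonal entries too
      contribute only to second order in \<tau>; it affects the final bound through a constant
      independent of \<open>n\<close>.\<close>
    define Kc where "Kc = 1 + S / \<tau>\<^sup>2"
    have Kc: "1 \<le> Kc" "S \<le> \<tau>\<^sup>2 * Kc" using S0 tau by (simp_all add: Kc_def field_simps)
    define \<Theta> where "\<Theta> = 1 + \<tau>\<^sup>2 * (U\<^sup>2 + 1)"
    have T0: "0 < \<Theta>" unfolding \<Theta>_def by (intro add_pos_nonneg) auto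
    have mom: "ew p n (\<lambda>w. \<bar>det (wprod A' w)\<bar> powr (-\<tau>) * (\<bar>(wprod A' w *v x) $ 1\<bar> powr (2 * \<tau>) + Kc * \<bar>(wprod A' w *v x) $ 2\<bar> powr (2 * \<tau>)))
       \<le> \<Theta> ^ n * (\<bar>x $ 1\<bar> powr (2 * \<tau>) + Kc * \<bar>x $ 2\<bar> powr (2 * \<tau>))" for n x
      unfolding A'_def \<Theta>_def
      by (rule triangular_exp_moment) (use a be eq U tau Kc in \<open>auto simp: be_def S_def\<close>)
    let ?e1 = "axis 1 1 :: real^2" and ?e2 = "axis 2 1 :: real^2"
    have exph: "exp (2 * \<tau> * ngrow A' w) \<le> \<bar>det (wprod A' w)\<bar> powr (-\<tau>) * (\<bar>(wprod A' w *v ?e1) $ 1\<bar> powr (2 * \<tau>) + Kc * \<bar>(wprod A' w *v ?e1) $ 2\<bar> powr (2 * \<tau>))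
        + \<bar>det (wprod A' w)\<bar> powr (-\<tau>) * (\<bar>(wprod A' w *v ?e2) $ 1\<bar> powr (2 * \<tau>) + Kc * \<bar>(wprod A' w *v ?e2) $ 2\<bar> powr (2 * \<tau>))" for w
    proof -
      let ?M = "wprod A' w"
      have d: "det ?M \<noteq> 0" unfolding dA' by (rule bdd_det(1)[OF bounded_by])
      have nrm: "norm y powr (2 * \<tau>) \<le> \<bar>y $ 1\<bar> powr (2 * \<tau>) + Kc * \<bar>y $ 2\<bar> powr (2 * \<tau>)" for y :: "real^2"
      proof -
        have "norm y powr (2 * \<tau>) \<le> (\<bar>y $ 1\<bar> + \<bar>y $ 2\<bar>) powr (2 * \<tau>)"
          using norm_le_l1_cart[of y] tau by (intro powr_mono2) (auto simp: sum_2)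
        also have "\<dots> \<le> \<bar>y $ 1\<bar> powr (2 * \<tau>) + 1 * \<bar>y $ 2\<bar> powr (2 * \<tau>)"
          using tau by (simp add: powr_subadd)
        also have "\<dots> \<le> \<bar>y $ 1\<bar> powr (2 * \<tau>) + Kc * \<bar>y $ 2\<bar> powr (2 * \<tau>)"
          by (intro add_left_mono mult_right_mono Kc) auto
        finally show ?thesis .
      qed
      have "exp (2 * \<tau> * ngrow A' w) = \<bar>det ?M\<bar> powr (-\<tau>) * opnorm ?M powr (2 * \<tau>)"
        using d opnorm_pos[OF d] by (simp add: ngrow_def powr_def algebra_simps flip: exp_add)
      also have "opnorm ?M powr (2 * \<tau>) \<le> (norm (?M *v ?e1) + norm (?M *v ?e2)) powr (2 * \<tau>)"
      proof (rule powr_mono2)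
        have "wedge ?e1 ?e2 = 1" by (simp add: wedge_def axis_def)
        then show "opnorm ?M \<le> norm (?M *v ?e1) + norm (?M *v ?e2)"
          using opnorm_two_points[of ?M ?e1 ?e2] by simp
      qed (use tau in auto)
      also have "\<dots> \<le> norm (?M *v ?e1) powr (2 * \<tau>) + norm (?M *v ?e2) powr (2 * \<tau>)"
        using tau by (intro powr_subadd) auto
      also have "\<dots> \<le> (\<bar>(?M *v ?e1) $ 1\<bar> powr (2 * \<tau>) + Kc * \<bar>(?M *v ?e1) $ 2\<bar> powr (2 * \<tau>))
          + (\<bar>(?M *v ?e2) $ 1\<bar> powr (2 * \<tau>) + Kc * \<bar>(?M *v ?e2) $ 2\<bar> powr (2 * \<tau>))"
        by (intro add_mono nrm)
      finally show ?thesis by (simp add: distrib_left mult_left_mono)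
    qed
    have main: "2 * \<tau> * (n * gap p A) \<le> 4 * \<tau> * ln Kq + n * ln \<Theta> + ln (1 + Kc)" for n :: nat
    proof -
      have "ew p n (ngrow A) \<le> ew p n (\<lambda>w. ngrow A' w + 2 * ln Kq)"
      proof (rule ew_mono)
        fix w
        have "\<bar>lognorm A' w - lognorm A w\<bar> \<le> 2 * ln Kq"
          unfolding A'[symmetric] by (rule ln_opnorm_conj[OF Q Kq bdd_det(1)[OF bounded_by]])
        then show "ngrow A w \<le> ngrow A' w + 2 * ln Kq" unfolding ngrow_def dA' by linarith
      qed
      then have 1: "n * gap p A \<le> ew p n (ngrow A') + 2 * ln Kq"
        using gap_le[OF bounded_by, of n p] by (simp add: ew_add_const)
      have "exp (2 * \<tau> * ew p n (ngrow A')) \<le> ew p n (\<lambda>w. exp (2 * \<tau> * ngrow A' w))"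
        using exp_ew_le[of p n "\<lambda>w. 2 * \<tau> * ngrow A' w"] by (simp only: ew_cmult)
      also have "\<dots> \<le> \<Theta> ^ n * (\<bar>?e1 $ 1\<bar> powr (2 * \<tau>) + Kc * \<bar>?e1 $ 2\<bar> powr (2 * \<tau>)) + \<Theta> ^ n * (\<bar>?e2 $ 1\<bar> powr (2 * \<tau>) + Kc * \<bar>?e2 $ 2\<bar> powr (2 * \<tau>))"
        by (rule order_trans[OF ew_mono[OF exph]]) (unfold ew_add, intro add_mono mom)
      also have "\<dots> = exp (n * ln \<Theta> + ln (1 + Kc))"
        using T0 Kc by (simp add: axis_def exp_add exp_of_nat_mult distrib_left)
      finally have "2 * \<tau> * ew p n (ngrow A') \<le> n * ln \<Theta> + ln (1 + Kc)" by simp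
      moreover have "2 * \<tau> * (n * gap p A) \<le> 2 * \<tau> * (ew p n (ngrow A') + 2 * ln Kq)"
        using tau 1 by (intro mult_left_mono) auto
      ultimately show ?thesis by (simp add: algebra_simps)
    qed
    \<comment> \<open>Letting \<open>n\<close> tend to infinity in \<open>main\<close> removes the
      constants from the conjugation and from \<open>Kc\<close>.\<close>
    have "2 * \<tau> * gap p A \<le> ln \<Theta>"
    proof (rule ccontr)
      assume "\<not> ?thesis"
      then have p: "0 < 2 * \<tau> * gap p A - ln \<Theta>" by simp
      obtain n :: nat where "(4 * \<tau> * ln Kq + ln (1 + Kc)) / (2 * \<tau> * gap p A - ln \<Theta>) < n"
        using reals_Archimedean2 by blast
      then have "4 * \<tau> * ln Kq + ln (1 + Kc) < n * (2 * \<tau> * gap p A - ln \<Theta>)" using p by (simp add: field_simps)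
      with main[of n] show False by (simp add: algebra_simps)
    qed
    also have "ln \<Theta> \<le> \<tau>\<^sup>2 * (U\<^sup>2 + 1)" unfolding \<Theta>_def by (rule ln_add_one_self_le_self) auto
    finally have "\<tau> * (2 * gap p A) \<le> \<tau> * (\<tau> * (U\<^sup>2 + 1))" by (simp add: power2_eq_square mult_ac)
    then show ?thesis using tau(1) by simp
  qed
  have "gap p A \<le> 0"
  proof (rule ccontr)
    assume "\<not> ?thesis"
    then have g: "0 < gap p A" by simp
    have pos: "0 < U\<^sup>2 + 1" "0 < U + 1" using U0 by (auto intro: add_nonneg_pos)
    define \<tau> where "\<tau> = min (1 / 2) (min (1 / (U + 1)) (gap p A / (U\<^sup>2 + 1)))"
    have t: "0 < \<tau>" "\<tau> \<le> 1 / 2" "\<tau> \<le> 1 / (U + 1)" "\<tau> \<le> gap p A / (U\<^sup>2 + 1)"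
      using g pos unfolding \<tau>_def by (simp, linarith+)
    have "\<tau> * (U + 1) \<le> 1" using t(3) pos by (simp add: field_simps)
    then have "\<tau> * U \<le> 1" using t(1) by (simp add: distrib_left)
    then have "2 * gap p A \<le> \<tau> * (U\<^sup>2 + 1)" using t by (intro bound) auto
    also have "\<dots> \<le> gap p A" using t(4) pos by (simp add: field_simps)
    finally show False using g by simp
  qed
  with gap_nonneg[OF bounded_by, of p] show ?thesis by simp
qed

section \<open>Neighbourhoods of diagonal and triangular cocycles\<close>

lemma pw_conj_deviation:
  fixes c t K :: real
  assumes Q: "Q ** Q' = mat 1" "Q' ** Q = mat 1" and K: "opnorm Q \<le> K" "opnorm Q' \<le> K" "1 \<le> K"
    and d: "\<And>w. det (wprod B w) \<noteq> 0"
  shows "pw p n (\<lambda>w. \<bar>lognorm B w - c\<bar> > t + 2 * ln K) \<le> pw p n (\<lambda>w. \<bar>ln (opnorm (wprod (conj_cocycle Q' B Q) w)) - c\<bar> > t)"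
proof (rule pw_mono)
  fix w assume "t + 2 * ln K < \<bar>lognorm B w - c\<bar>"
  with ln_opnorm_conj[OF Q K d[of w]] show "t < \<bar>ln (opnorm (wprod (conj_cocycle Q' B Q) w)) - c\<bar>" by linarith
qed

lemma det_wprod_conj:
  assumes "Q ** Q' = mat 1" "Q' ** Q = mat 1"
  shows "det (wprod (conj_cocycle Q' B Q) w) = det (wprod B w)"
proof -
  have "det Q' * det Q = 1" using assms(2) by (metis det_I det_mul)
  then show ?thesis unfolding wprod_conj[OF assms] det_mul by (metis mult.assoc mult.commute mult_1)
qed

text \<open>The shear has norm at most 4, which costs 2 ln 4 in the thresholds. The centre \<mu> of
  the short-time estimate is not yet related to \<open>L\<close>. The clause on
  \<open>steep_cone\<close> lets \<rho> be bounded below where no second eigenvector exists.\<close>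

lemma near_diag_ldt:
  fixes p :: "'a::finite pmf" and al be :: "'a \<Rightarrow> real"
  assumes full: "set_pmf p = UNIV"
    and nz: "\<And>j. al j \<noteq> 0" "\<And>j. be j \<noteq> 0"
    and dom: "(\<Sum>j\<in>UNIV. pmf p j * ln \<bar>be j\<bar>) < (\<Sum>j\<in>UNIV. pmf p j * ln \<bar>al j\<bar>)"
  obtains d0 K K1 b e :: real where "0 < d0" "1 \<le> K" "1 \<le> K1" "0 < b" "0 < e"
    "\<And>B. near_diag al be d0 d0 B \<Longrightarrow> \<exists>\<rho> \<mu>. 0 \<le> \<rho> \<and> \<rho> \<le> 1 \<and> (\<forall>w. det (wprod B w) \<noteq> 0) \<and>
       (\<forall>r0. (\<forall>x\<in>steep_cone. r0 \<le> wedge_sum B x) \<longrightarrow> r0 \<le> \<rho>) \<and>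
       (0 < \<rho> \<longrightarrow> (\<exists>L. \<forall>n. \<forall>s\<ge>0. pw p n (\<lambda>w. \<bar>lognorm B w - real n * L\<bar> > s + K1 * (1 - ln \<rho>))
         \<le> 4 * exp (- s\<^sup>2 / (K * (1 - ln \<rho>)\<^sup>2 * real n)))) \<and>
       (\<forall>n T \<theta> s. 1 \<le> T \<longrightarrow> 0 \<le> \<theta> \<longrightarrow> \<theta> \<le> 1 \<longrightarrow> \<rho> * T \<le> \<theta> * e \<longrightarrow> 0 \<le> s \<longrightarrow>
          pw p n (\<lambda>w. \<bar>lognorm B w - real n * \<mu>\<bar> > s + ln T + real n * \<theta> + K1)
            \<le> K * (real n + 1) * T powr (- b) + 2 * exp (- s\<^sup>2 / (K * real n)))"
proof -
  obtain d K b e :: real where dK: "0 < d" "1 \<le> K" "0 < b" "0 < e"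
    and r1: "\<And>B \<rho> w. near_diag al be d \<rho> B \<Longrightarrow> 0 \<le> \<rho> \<Longrightarrow> \<rho> \<le> d \<Longrightarrow> \<rho> \<le> 1 \<and> det (wprod B w) \<noteq> 0"
    and reg1: "\<And>B \<rho>. near_diag al be d \<rho> B \<Longrightarrow> 0 < \<rho> \<Longrightarrow> \<rho> \<le> d \<Longrightarrow>
      (\<And>x. x \<noteq> 0 \<Longrightarrow> \<bar>x $ 1\<bar> \<le> \<bar>x $ 2\<bar> \<Longrightarrow> \<exists>j. \<rho> / (15 * CARD('a)) * (norm x)\<^sup>2 \<le> \<bar>wedge x (B j *v x)\<bar>) \<Longrightarrow>
      \<exists>L. \<forall>n. \<forall>s\<ge>0. pw p n (\<lambda>w. \<bar>lognorm B w - real n * L\<bar> > s + K * (1 - ln \<rho>))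
         \<le> 4 * exp (- s\<^sup>2 / (K * (1 - ln \<rho>)\<^sup>2 * real n))"
    and reg2: "\<And>B \<rho> n T \<theta> s. near_diag al be d \<rho> B \<Longrightarrow> 0 \<le> \<rho> \<Longrightarrow> \<rho> \<le> d \<Longrightarrow> 1 \<le> T \<Longrightarrow> 0 \<le> \<theta> \<Longrightarrow> \<theta> \<le> 1 \<Longrightarrow> \<rho> * T \<le> \<theta> * e \<Longrightarrow> 0 \<le> s \<Longrightarrow>
      pw p n (\<lambda>w. \<bar>lognorm B w - real n * (\<Sum>j\<in>UNIV. pmf p j * ln \<bar>B j $ 1 $ 1\<bar>)\<bar> > s + ln T + real n * \<theta> + K)
       \<le> K * (real n + 1) * T powr (- b) + 2 * exp (- s\<^sup>2 / (K * real n))"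
    using near_diag_ldt_normal_form[OF full nz dom] by blast
  \<comment> \<open>Some letter must have different diagonal entries for the shear to be controlled;
    otherwise the two exponents would coincide.\<close>
  obtain i where i: "al i \<noteq> be i"
  proof (rule ccontr)
    assume "\<not> thesis"
    then have "al = be" using that by blast
    with dom show False by simp
  qed
  obtain d0 where d0: "0 < d0"
    and shear: "\<And>B. near_diag al be d0 d0 B \<Longrightarrow> \<exists>S S' \<rho>. S ** S' = mat 1 \<and> S' ** S = mat 1 \<and> opnorm S \<le> 4 \<and> opnorm S' \<le> 4 \<and>
       0 \<le> \<rho> \<and> \<rho> \<le> d \<and> near_diag al be d \<rho> (conj_cocycle S' B S) \<and>
       (\<forall>x. x \<noteq> 0 \<longrightarrow> \<bar>x $ 1\<bar> \<le> \<bar>x $ 2\<bar> \<longrightarrow>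
          (\<exists>j. \<rho> / (15 * CARD('a)) * (norm x)\<^sup>2 \<le> \<bar>wedge x (conj_cocycle S' B S j *v x)\<bar>)) \<and>
       (\<forall>r0. (\<forall>x\<in>steep_cone. r0 \<le> wedge_sum B x) \<longrightarrow> r0 \<le> \<rho>)"
    using shear_normal_form[where al = al and be = be and i = i, OF dK(1) i] by blast
  define K1 where "K1 = K + 2 * ln 4"
  have K1: "1 \<le> K1" using dK by (simp add: K1_def add_increasing2)
  show thesis
  proof (rule that[OF d0 dK(2) K1 dK(3,4)])
    fix B :: "'a \<Rightarrow> mat2" assume nd: "near_diag al be d0 d0 B"
    obtain S S' \<rho> where S: "S ** S' = mat 1" "S' ** S = mat 1" "opnorm S \<le> 4" "opnorm S' \<le> 4"
      and rho: "0 \<le> \<rho>" "\<rho> \<le> d" and nd': "near_diag al be d \<rho> (conj_cocycle S' B S)"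
      and ND: "\<And>x. x \<noteq> 0 \<Longrightarrow> \<bar>x $ 1\<bar> \<le> \<bar>x $ 2\<bar> \<Longrightarrow>
          (\<exists>j. \<rho> / (15 * CARD('a)) * (norm x)\<^sup>2 \<le> \<bar>wedge x (conj_cocycle S' B S j *v x)\<bar>)"
      and low: "\<forall>r0. (\<forall>x\<in>steep_cone. r0 \<le> wedge_sum B x) \<longrightarrow> r0 \<le> \<rho>"
      using shear[OF nd] by blast
    define B' where "B' = conj_cocycle S' B S"
    define \<mu> where "\<mu> = (\<Sum>j\<in>UNIV. pmf p j * ln \<bar>B' j $ 1 $ 1\<bar>)"
    have rho1: "\<rho> \<le> 1" using r1[OF nd' rho] by blast
    have det: "det (wprod B w) \<noteq> 0" for w using r1[OF nd' rho, of w] unfolding det_wprod_conj[OF S(1,2)] by blast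
    note tr = pw_conj_deviation[OF S one_le_numeral det, of p]
    have l1: "1 \<le> 1 - ln \<rho>" if "0 < \<rho>" using rho1 that by simp
    have a: "\<exists>L. \<forall>n. \<forall>s\<ge>0. pw p n (\<lambda>w. \<bar>lognorm B w - real n * L\<bar> > s + K1 * (1 - ln \<rho>))
         \<le> 4 * exp (- s\<^sup>2 / (K * (1 - ln \<rho>)\<^sup>2 * real n))" if r: "0 < \<rho>"
    proof -
      obtain L where L: "\<And>n s. 0 \<le> s \<Longrightarrow> pw p n (\<lambda>w. \<bar>lognorm B' w - real n * L\<bar> > s + K * (1 - ln \<rho>))
         \<le> 4 * exp (- s\<^sup>2 / (K * (1 - ln \<rho>)\<^sup>2 * real n))"
        using reg1[OF nd' r rho(2) ND] unfolding B'_def by blast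
      show ?thesis
      proof (rule exI[of _ L], intro allI impI)
        fix n and s :: real assume s: "0 \<le> s"
        have "2 * ln 4 * 1 \<le> 2 * ln 4 * (1 - ln \<rho>)" using l1[OF r] by (intro mult_left_mono) auto
        then have "pw p n (\<lambda>w. \<bar>lognorm B w - real n * L\<bar> > s + K1 * (1 - ln \<rho>))
            \<le> pw p n (\<lambda>w. \<bar>lognorm B w - real n * L\<bar> > (s + K * (1 - ln \<rho>)) + 2 * ln 4)"
          by (intro pw_mono) (auto simp: K1_def algebra_simps)
        also have "\<dots> \<le> pw p n (\<lambda>w. \<bar>lognorm B' w - real n * L\<bar> > s + K * (1 - ln \<rho>))"
          unfolding B'_def by (rule tr)
        also note L[OF s]
        finally show "pw p n (\<lambda>w. \<bar>lognorm B w - real n * L\<bar> > s + K1 * (1 - ln \<rho>))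
         \<le> 4 * exp (- s\<^sup>2 / (K * (1 - ln \<rho>)\<^sup>2 * real n))" .
      qed
    qed
    have c: "pw p n (\<lambda>w. \<bar>lognorm B w - real n * \<mu>\<bar> > s + ln T + real n * \<theta> + K1)
            \<le> K * (real n + 1) * T powr (- b) + 2 * exp (- s\<^sup>2 / (K * real n))"
      if "1 \<le> T" "0 \<le> \<theta>" "\<theta> \<le> 1" "\<rho> * T \<le> \<theta> * e" "0 \<le> s" for n T \<theta> s
    proof -
      have "pw p n (\<lambda>w. \<bar>lognorm B w - real n * \<mu>\<bar> > s + ln T + real n * \<theta> + K1)
          = pw p n (\<lambda>w. \<bar>lognorm B w - real n * \<mu>\<bar> > (s + ln T + real n * \<theta> + K) + 2 * ln 4)"
        by (simp add: K1_def add_ac)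
      also have "\<dots> \<le> pw p n (\<lambda>w. \<bar>lognorm B' w - real n * \<mu>\<bar> > s + ln T + real n * \<theta> + K)"
        unfolding B'_def by (rule tr)
      also have "\<dots> \<le> K * (real n + 1) * T powr (- b) + 2 * exp (- s\<^sup>2 / (K * real n))"
        using reg2[OF nd' rho that] unfolding \<mu>_def B'_def .
      finally show ?thesis .
    qed
    show "\<exists>\<rho> \<mu>. 0 \<le> \<rho> \<and> \<rho> \<le> 1 \<and> (\<forall>w. det (wprod B w) \<noteq> 0) \<and>
       (\<forall>r0. (\<forall>x\<in>steep_cone. r0 \<le> wedge_sum B x) \<longrightarrow> r0 \<le> \<rho>) \<and>
       (0 < \<rho> \<longrightarrow> (\<exists>L. \<forall>n. \<forall>s\<ge>0. pw p n (\<lambda>w. \<bar>lognorm B w - real n * L\<bar> > s + K1 * (1 - ln \<rho>))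
         \<le> 4 * exp (- s\<^sup>2 / (K * (1 - ln \<rho>)\<^sup>2 * real n)))) \<and>
       (\<forall>n T \<theta> s. 1 \<le> T \<longrightarrow> 0 \<le> \<theta> \<longrightarrow> \<theta> \<le> 1 \<longrightarrow> \<rho> * T \<le> \<theta> * e \<longrightarrow> 0 \<le> s \<longrightarrow>
          pw p n (\<lambda>w. \<bar>lognorm B w - real n * \<mu>\<bar> > s + ln T + real n * \<theta> + K1)
            \<le> K * (real n + 1) * T powr (- b) + 2 * exp (- s\<^sup>2 / (K * real n)))"
      by (rule exI[of _ \<rho>], rule exI[of _ \<mu>]) (intro conjI allI impI rho rho1 det low[rule_format] a c; blast)
  qed
qed

lemma near_diag_of_close:
  fixes A :: "'a \<Rightarrow> mat2"
  assumes "near_diag al be (d / 2) (d / 2) A" "\<And>j. opnorm (B j - A j) \<le> d / 2"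
  shows "near_diag al be d d B"
  unfolding near_diag_def
proof (intro allI conjI)
  fix j
  have c: "\<bar>B j $ i $ k - A j $ i $ k\<bar> \<le> d / 2" for i k
    using order_trans[OF entry_le_opnorm[of "B j - A j" i k] assms(2)[of j]] by simp
  note n = near_diagD[OF assms(1), of j]
  show "\<bar>B j $ 1 $ 1 - al j\<bar> \<le> d" using n(1) c[of 1 1] by linarith
  show "\<bar>B j $ 2 $ 2 - be j\<bar> \<le> d" using n(2) c[of 2 2] by linarith
  show "\<bar>B j $ 2 $ 1\<bar> \<le> d" using n(3) c[of 2 1] by linarith
  show "\<bar>B j $ 1 $ 2\<bar> \<le> d" using n(4) c[of 1 2] by linarith
qed

lemma wedge_sum_perturb:
  fixes A B :: "'a::finite \<Rightarrow> mat2" and \<eta> :: real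
  assumes "\<And>j. opnorm (B j - A j) \<le> \<eta>" "norm x = 1"
  shows "wedge_sum A x - CARD('a) * \<eta> \<le> wedge_sum B x"
proof -
  have "wedge_sum A x \<le> (\<Sum>j\<in>(UNIV :: 'a set). \<bar>wedge x (B j *v x)\<bar> + \<eta>)"
    unfolding wedge_sum_def
  proof (rule sum_mono)
    fix j
    have "wedge x (A j *v x) = wedge x (B j *v x) - wedge x ((B j - A j) *v x)"
      by (simp add: wedge_def matrix_vector_mult_diff_rdistrib algebra_simps)
    moreover have "\<bar>wedge x ((B j - A j) *v x)\<bar> \<le> \<eta>"
      using wedge_le[of x "(B j - A j) *v x"] opnorm_ge[of "B j - A j" x] assms by (simp add: order_trans)
    ultimately show "\<bar>wedge x (A j *v x)\<bar> \<le> \<bar>wedge x (B j *v x)\<bar> + \<eta>" by linarith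
  qed
  then show ?thesis by (simp add: sum.distrib wedge_sum_def)
qed

text \<open>A zero of the displacement in the steep cone would be a second common eigenvector,
  independent of \<open>v\<close>, and would diagonalize \<open>A\<close>. So the minimum
  \<open>m\<close> is positive, nearby cocycles keep \<rho> at least m / 2, and the long-time
  estimate has uniform constants.\<close>

lemma dominated_triangular_uniform_ldt:
  fixes A :: "'a::finite \<Rightarrow> mat2"
  assumes full: "set_pmf p = UNIV" and bounded_by: "bounded_by A C"
    and v: "v \<noteq> 0" and ev: "\<And>j. A j *v v = a j *\<^sub>R v"
    and dom: "(\<Sum>j\<in>UNIV. pmf p j * ln \<bar>det (A j) / a j\<bar>) < (\<Sum>j\<in>UNIV. pmf p j * ln \<bar>a j\<bar>)"
    and nd: "\<not> diagonalizable_cocycle A"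
  shows "uniform_ldt p A"
proof -
  have a: "a j \<noteq> 0" for j using bdd_nz1[OF bounded_by v, of j] ev[of j] by auto
  have dA: "det (A j) \<noteq> 0" for j using bdd_det(1)[OF bounded_by, of "[j]"] by simp
  define be where "be j = det (A j) / a j" for j
  have be: "be j \<noteq> 0" for j using a dA by (simp add: be_def)
  obtain d0 K K1 b e :: real where d0: "0 < d0" and K: "1 \<le> K" "1 \<le> K1"
    and ldt: "\<And>B. near_diag a be d0 d0 B \<Longrightarrow> \<exists>\<rho> \<mu>. 0 \<le> \<rho> \<and> \<rho> \<le> 1 \<and> (\<forall>w. det (wprod B w) \<noteq> 0) \<and>
       (\<forall>r0. (\<forall>x\<in>steep_cone. r0 \<le> wedge_sum B x) \<longrightarrow> r0 \<le> \<rho>) \<and>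
       (0 < \<rho> \<longrightarrow> (\<exists>L. \<forall>n. \<forall>s\<ge>0. pw p n (\<lambda>w. \<bar>lognorm B w - real n * L\<bar> > s + K1 * (1 - ln \<rho>))
         \<le> 4 * exp (- s\<^sup>2 / (K * (1 - ln \<rho>)\<^sup>2 * real n)))) \<and>
       (\<forall>n T \<theta> s. 1 \<le> T \<longrightarrow> 0 \<le> \<theta> \<longrightarrow> \<theta> \<le> 1 \<longrightarrow> \<rho> * T \<le> \<theta> * e \<longrightarrow> 0 \<le> s \<longrightarrow>
          pw p n (\<lambda>w. \<bar>lognorm B w - real n * \<mu>\<bar> > s + ln T + real n * \<theta> + K1)
            \<le> K * (real n + 1) * T powr (- b) + 2 * exp (- s\<^sup>2 / (K * real n)))"
    using near_diag_ldt[of p a be, OF full a be dom[folded be_def]] by metis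
  define c where "c j = wedge (A j *v perp v) (perp v) / (norm v)\<^sup>2" for j
  define S where "S = (\<Sum>j\<in>UNIV. \<bar>c j\<bar>)"
  have cS: "\<bar>c j\<bar> \<le> S" for j unfolding S_def by (rule member_le_sum) auto
  have S0: "0 \<le> S" unfolding S_def by (intro sum_nonneg) auto
  define t where "t = d0 / (2 * (S + 1))"
  have t: "0 < t" "t * S \<le> d0 / 2"
  proof -
    show "0 < t" using d0 S0 by (simp add: t_def)
    have "t * (S + 1) = d0 / 2" using S0 by (simp add: t_def field_simps)
    then show "t * S \<le> d0 / 2" using \<open>0 < t\<close> by (simp add: distrib_left)
  qed
  obtain Q Q' c' where Q: "Q ** Q' = mat 1" "Q' ** Q = mat 1" and Qv: "Q *v axis 1 1 = v"
    and tri: "\<And>j. conj_cocycle Q' A Q j = mat22 (a j) (t * c' j) 0 (det (A j) / a j)"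
    and c': "\<And>j. c' j = wedge (A j *v perp v) (perp v) / (norm v)\<^sup>2"
    by (rule triangular_coordinates[where A = A and a = a and t = t, OF v ev a]) (use t in auto)
  have cc: "c' j = c j" for j by (simp add: c' c_def)
  define A' where "A' = conj_cocycle Q' A Q"
  have A': "near_diag a be (d0 / 2) (d0 / 2) A'"
    unfolding near_diag_def A'_def tri cc
  proof (intro allI conjI)
    fix j
    have "\<bar>t * c j\<bar> \<le> t * S" unfolding abs_mult using t cS[of j] by (intro mult_mono) auto
    then show "\<bar>mat22 (a j) (t * c j) 0 (det (A j) / a j) $ 1 $ 2\<bar> \<le> d0 / 2" using t by simp
  qed (use d0 in \<open>auto simp: be_def\<close>)
  have dQ: "det Q \<noteq> 0"
  proof
    assume "det Q = 0"
    moreover have "det Q * det Q' = 1" using Q(1) by (metis det_I det_mul)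
    ultimately show False by simp
  qed
  obtain z where z: "z \<in> steep_cone" "\<And>x. x \<in> steep_cone \<Longrightarrow> wedge_sum A' z \<le> wedge_sum A' x"
    by (rule wedge_sum_cone_min) blast
  define m where "m = wedge_sum A' z"
  have m0: "0 < m"
  proof (rule ccontr)
    assume "\<not> 0 < m"
    then have m: "wedge_sum A' z = 0" using wedge_sum_nonneg[of A' z] by (simp add: m_def)
    have z2: "z $ 2 \<noteq> 0"
    proof
      assume "z $ 2 = 0"
      then have "z $ 1 = 0" "norm z = 1" using z(1) by (auto simp: steep_cone_def)
      with \<open>z $ 2 = 0\<close> have "z = 0" by (simp add: vec_eq_iff forall_2)
      with \<open>norm z = 1\<close> show False by simp
    qed
    have "wedge z (A' j *v z) = 0" for j using wedge_le_wedge_sum[of z A' j] m by simp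
    moreover have "wedge (Q *v z) (A j *v (Q *v z)) = det Q * wedge z (A' j *v z)" for j
    proof -
      have "Q *v (A' j *v z) = A j *v (Q *v z)"
        using Q(1) by (simp add: A'_def conj_cocycle_def matrix_vector_mul_assoc matrix_mul_assoc)
      then show ?thesis by (metis wedge_matrix)
    qed
    ultimately have "wedge (Q *v z) (A j *v (Q *v z)) = 0" for j by simp
    moreover have "wedge v (Q *v z) \<noteq> 0"
      unfolding Qv[symmetric] wedge_matrix using dQ z2 by (simp add: wedge_def axis_def)
    moreover have "wedge v (A j *v v) = 0" for j by (simp add: ev)
    ultimately have "diagonalizable_cocycle A" by (intro diagonalizable_of_eigenvectors[of v "Q *v z"])
    with nd show False ..
  qed
  define n where "n = real CARD('a)"
  have n: "0 < n" by (simp add: n_def)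
  define r0 where "r0 = m / 2"
  have r0: "0 < r0" using m0 by (simp add: r0_def)
  obtain \<delta> where \<delta>: "0 < \<delta>" and close: "\<And>B j. cdist B A < \<delta> \<Longrightarrow> opnorm (conj_cocycle Q' B Q j - conj_cocycle Q' A Q j) \<le> min (d0 / 2) (m / (2 * n))"
    by (rule conj_nbhd[of "min (d0 / 2) (m / (2 * n))"]) (use d0 m0 n in auto)
  define Kq where "Kq = max 1 (max (opnorm Q) (opnorm Q'))"
  have Kq: "opnorm Q \<le> Kq" "opnorm Q' \<le> Kq" "1 \<le> Kq" by (auto simp: Kq_def)
  define l0 where "l0 = 1 - ln r0"
  define Kf where "Kf = K1 * max l0 1 + K * (max l0 1)\<^sup>2 + 2 * ln Kq + 1"
  have Kf: "K1 * max l0 1 + 2 * ln Kq \<le> Kf" "K * (max l0 1)\<^sup>2 \<le> Kf" "0 < Kf"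
  proof -
    have "0 \<le> K1 * max l0 1" "0 \<le> K * (max l0 1)\<^sup>2" "0 \<le> ln Kq" using K Kq by auto
    then show "K1 * max l0 1 + 2 * ln Kq \<le> Kf" "K * (max l0 1)\<^sup>2 \<le> Kf" "0 < Kf" unfolding Kf_def by linarith+
  qed
  show ?thesis
    unfolding uniform_ldt_def
  proof (rule exI[of _ \<delta>], rule conjI[OF \<delta>], rule exI[of _ Kf], rule conjI[OF Kf(3)], intro allI impI)
    fix B assume B: "cdist B A < \<delta>"
    define B' where "B' = conj_cocycle Q' B Q"
    have cl: "opnorm (B' j - A' j) \<le> d0 / 2" "opnorm (B' j - A' j) \<le> m / (2 * n)" for j
      using close[OF B, of j] by (simp_all add: B'_def A'_def)
    have "near_diag a be d0 d0 B'" by (rule near_diag_of_close[OF A' cl(1)])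
    from ldt[OF this] obtain \<rho> where rho: "0 \<le> \<rho>" "\<rho> \<le> 1" and det: "\<And>w. det (wprod B' w) \<noteq> 0"
      and low: "\<And>r0. (\<forall>x\<in>steep_cone. r0 \<le> wedge_sum B' x) \<Longrightarrow> r0 \<le> \<rho>"
      and reg: "0 < \<rho> \<Longrightarrow> (\<exists>L. \<forall>n. \<forall>s\<ge>0. pw p n (\<lambda>w. \<bar>lognorm B' w - real n * L\<bar> > s + K1 * (1 - ln \<rho>))
         \<le> 4 * exp (- s\<^sup>2 / (K * (1 - ln \<rho>)\<^sup>2 * real n)))"
      by blast
    have "r0 \<le> \<rho>"
    proof (rule low, rule ballI)
      fix x assume x: "x \<in> steep_cone"
      then have nx: "norm x = 1" by (simp add: steep_cone_def)
      have "wedge_sum A' x - CARD('a) * (m / (2 * n)) \<le> wedge_sum B' x"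
        by (rule wedge_sum_perturb[OF cl(2) nx])
      then have "wedge_sum A' x - n * (m / (2 * n)) \<le> wedge_sum B' x" by (simp only: n_def)
      moreover have "m \<le> wedge_sum A' x" unfolding m_def by (rule z(2)[OF x])
      ultimately show "r0 \<le> wedge_sum B' x" using n by (simp add: r0_def)
    qed
    then have r: "0 < \<rho>" "r0 \<le> \<rho>" using r0 by auto
    define l where "l = 1 - ln \<rho>"
    have l: "1 \<le> l" "l \<le> max l0 1"
    proof -
      show "1 \<le> l" using rho r by (simp add: l_def)
      have "ln r0 \<le> ln \<rho>" using r r0 by simp
      then show "l \<le> max l0 1" by (simp add: l_def l0_def)
    qed
    obtain L where L: "\<And>n s. 0 \<le> s \<Longrightarrow> pw p n (\<lambda>w. \<bar>lognorm B' w - real n * L\<bar> > s + K1 * l)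
         \<le> 4 * exp (- s\<^sup>2 / (K * l\<^sup>2 * real n))"
      using reg[OF r(1)] unfolding l_def by blast
    show "\<exists>L. \<forall>n. \<forall>s\<ge>0. pw p n (\<lambda>w. \<bar>lognorm B w - real n * L\<bar> > s + Kf) \<le> 4 * exp (- s\<^sup>2 / (Kf * real n))"
    proof (rule exI[of _ L], intro allI impI)
      fix n and s :: real assume s: "0 \<le> s"
      have detB: "det (wprod B w) \<noteq> 0" for w using det[of w] unfolding B'_def det_wprod_conj[OF Q] .
      have "K1 * l \<le> K1 * max l0 1" using K l by (intro mult_left_mono) auto
      then have "pw p n (\<lambda>w. \<bar>lognorm B w - real n * L\<bar> > s + Kf)
          \<le> pw p n (\<lambda>w. \<bar>lognorm B w - real n * L\<bar> > (s + K1 * l) + 2 * ln Kq)"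
        using Kf(1) by (intro pw_mono) linarith
      also have "\<dots> \<le> pw p n (\<lambda>w. \<bar>lognorm B' w - real n * L\<bar> > s + K1 * l)"
        unfolding B'_def by (rule pw_conj_deviation[OF Q Kq detB])
      also have "\<dots> \<le> 4 * exp (- s\<^sup>2 / (K * l\<^sup>2 * real n))" by (rule L[OF s])
      also have "\<dots> \<le> 4 * exp (- s\<^sup>2 / (Kf * real n))"
      proof (cases "n = 0")
        case False
        have "K * l\<^sup>2 \<le> K * (max l0 1)\<^sup>2" using K l by (intro mult_left_mono power_mono) auto
        then have "K * l\<^sup>2 * n \<le> Kf * n" using Kf(2) by (intro mult_right_mono) auto
        then have "s\<^sup>2 / (Kf * real n) \<le> s\<^sup>2 / (K * l\<^sup>2 * real n)"
          using False K l Kf(3) by (intro divide_left_mono mult_pos_pos) auto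
        then show ?thesis by simp
      qed simp
      finally show "pw p n (\<lambda>w. \<bar>lognorm B w - real n * L\<bar> > s + Kf) \<le> 4 * exp (- s\<^sup>2 / (Kf * real n))" .
    qed
  qed
qed

lemma common_eigenvector:
  fixes A :: "'a \<Rightarrow> mat2"
  assumes "v \<noteq> 0" "\<And>j. wedge v (A j *v v) = 0"
  obtains a where "\<And>j. A j *v v = a j *\<^sub>R v"
proof -
  have "\<forall>j. \<exists>c. A j *v v = c *\<^sub>R v" using wedge_eq_0_imp_scaleR[OF assms(1)] assms(2) by metis
  then obtain a where "\<And>j. A j *v v = a j *\<^sub>R v" by metis
  then show thesis by (rule that)
qed

text \<open>The determinant is computed in the basis \<open>v\<close>, \<open>perp v\<close>, where
  the component of \<open>M *v perp v\<close> along \<open>perp v\<close> is read off from the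
  transpose. Transposing thus exchanges the two diagonal exponents.\<close>

lemma eigenvalue_perp_transpose:
  fixes M :: mat2
  assumes v: "v \<noteq> 0" and ev: "M *v v = a *\<^sub>R v" and ew: "transpose M *v perp v = b *\<^sub>R perp v"
  shows "det M = a * b"
proof -
  have wp: "wedge v y = perp v \<bullet> y" for y by (simp add: wedge_def inner_vec_def sum_2)
  have "det M * (norm v)\<^sup>2 = wedge (M *v v) (M *v perp v)" unfolding wedge_matrix wedge_perp ..
  also have "\<dots> = a * (perp v \<bullet> (M *v perp v))" unfolding ev by (simp add: wp)
  also have "perp v \<bullet> (M *v perp v) = (transpose M *v perp v) \<bullet> perp v"
    by (metis dot_lmul_matrix transpose_matrix_vector transpose_transpose)
  also have "\<dots> = b * (norm v)\<^sup>2"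
    unfolding ew using wp[of "perp v"] by (simp add: wedge_perp)
  finally show ?thesis using v by simp
qed

lemma bdd_transpose:
  assumes "bounded_by (A :: 'a::finite \<Rightarrow> mat2) C"
  obtains C' where "bounded_by (\<lambda>j. transpose (A j)) C'"
proof (rule bdd_exists)
  show "GL2_cocycle (\<lambda>j. transpose (A j))"
    unfolding GL2_cocycle_def invertible_det_nz det_transpose
    using bdd_det(1)[OF assms, of "[_]"] by simp
qed (rule that)

text \<open>With a common eigenvector there are three orders of the diagonal exponents. Equality
  contradicts the positive gap; if the invariant line carries the smaller exponent, the line
  orthogonal to it carries the larger one for the transposed cocycle.\<close>

lemma nondiagonalizable_uniform_ldt:
  fixes A :: "'a::finite \<Rightarrow> mat2"
  assumes full: "set_pmf p = UNIV" and bounded_by: "bounded_by A C" and gap: "0 < gap p A"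
    and nd: "\<not> diagonalizable_cocycle A"
  shows "uniform_ldt p A"
proof (cases "\<exists>v. v \<noteq> 0 \<and> (\<forall>j. wedge v (A j *v v) = 0)")
  case False
  then show ?thesis by (intro irreducible_uniform_ldt[OF full bounded_by gap]) blast
next
  case True
  then obtain v where v: "v \<noteq> 0" "\<And>j. wedge v (A j *v v) = 0" by blast
  obtain a where ev: "\<And>j. A j *v v = a j *\<^sub>R v" by (rule common_eigenvector[where A = A and v = v, OF v]) blast
  have a: "a j \<noteq> 0" for j using bdd_nz1[OF bounded_by v(1), of j] ev[of j] by auto
  have dA: "det (A j) \<noteq> 0" for j using bdd_det(1)[OF bounded_by, of "[j]"] by simp
  consider "(\<Sum>j\<in>UNIV. pmf p j * ln \<bar>det (A j) / a j\<bar>) < (\<Sum>j\<in>UNIV. pmf p j * ln \<bar>a j\<bar>)"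
    | "(\<Sum>j\<in>UNIV. pmf p j * ln \<bar>a j\<bar>) = (\<Sum>j\<in>UNIV. pmf p j * ln \<bar>det (A j) / a j\<bar>)"
    | "(\<Sum>j\<in>UNIV. pmf p j * ln \<bar>a j\<bar>) < (\<Sum>j\<in>UNIV. pmf p j * ln \<bar>det (A j) / a j\<bar>)"
    by linarith
  then show ?thesis
  proof cases
    case 1
    then show ?thesis by (rule dominated_triangular_uniform_ldt[OF full bounded_by v(1) ev _ nd])
  next
    case 2
    with gap_zero_of_equal_exponents[OF bounded_by v(1) ev, of p] gap show ?thesis by simp
  next
    case 3
    let ?T = "\<lambda>j. transpose (A j)"
    have pv: "perp v \<noteq> 0"
    proof
      assume "perp v = 0"
      then have "wedge v (perp v) = 0" by (simp only: wedge_def zero_index mult_zero_right diff_zero)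
      then show False using v(1) by (simp add: wedge_perp)
    qed
    have wT: "wedge (perp v) (?T j *v perp v) = 0" for j using v(2)[of j] unfolding wedge_perp_transpose by simp
    obtain b where eb: "\<And>j. ?T j *v perp v = b j *\<^sub>R perp v" by (rule common_eigenvector[where A = ?T and v = "perp v", OF pv wT]) blast
    have db: "det (A j) = a j * b j" for j by (rule eigenvalue_perp_transpose[OF v(1) ev eb])
    obtain C' where C': "bounded_by ?T C'" by (rule bdd_transpose[OF bounded_by])
    have b: "b j \<noteq> 0" for j using db[of j] dA[of j] by auto
    \<comment> \<open>If \<open>Q\<close> diagonalizes the transposes, then the transposed inverse
      of \<open>Q\<close> provides two independent common eigenvectors of \<open>A\<close>.\<close>
    have ndT: "\<not> diagonalizable_cocycle ?T"
    proof
      assume "diagonalizable_cocycle ?T"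
      then have "\<exists>Q::mat2. invertible Q \<and> (\<forall>j i k. i \<noteq> k \<longrightarrow> (matrix_inv Q ** ?T j ** Q) $ i $ k = 0)"
        by (simp only: diagonalizable_cocycle_def)
      then obtain Q :: mat2 where Q: "invertible Q" and off: "\<And>j i k. i \<noteq> k \<Longrightarrow> (matrix_inv Q ** ?T j ** Q) $ i $ k = 0"
        by blast
      note Qi = matrix_inv_mult[OF Q]
      define R where "R = transpose (matrix_inv Q)"
      have R: "R ** transpose Q = mat 1" "transpose Q ** R = mat 1"
        unfolding R_def using Qi by (metis matrix_transpose_mul transpose_mat)+
      have off': "(transpose Q ** A j ** R) $ i $ k = 0" if "i \<noteq> k" for i k j
      proof -
        have "transpose Q ** A j ** R = transpose (matrix_inv Q ** ?T j ** Q)"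
          by (simp add: R_def matrix_transpose_mul matrix_mul_assoc)
        then show ?thesis using off[of k i j] that by (simp add: transpose_def)
      qed
      have eig: "wedge (R *v axis k 1) (A j *v (R *v axis k 1)) = 0" for j k
      proof -
        let ?D = "transpose Q ** A j ** R"
        have "A j *v (R *v axis k 1) = R *v (?D *v axis k 1)"
          using R(1) by (simp add: matrix_vector_mul_assoc matrix_mul_assoc)
        then have "wedge (R *v axis k 1) (A j *v (R *v axis k 1)) = det R * wedge (axis k 1) (?D *v axis k 1)"
          by (simp only: wedge_matrix)
        also have "wedge (axis k 1) (?D *v axis k 1) = 0"
          using off'[of 1 2 j] off'[of 2 1 j] exhaust_2[of k]
          unfolding wedge_def entry_eq_axis[symmetric] by (auto simp: axis_def)
        finally show ?thesis by simp
      qed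
      have "det R \<noteq> 0" using R(1) by (metis det_I det_mul mult_zero_left zero_neq_one)
      then have "wedge (R *v axis 1 1) (R *v axis 2 1) \<noteq> 0"
        unfolding wedge_matrix by (simp add: wedge_def axis_def)
      then have "diagonalizable_cocycle A" by (rule diagonalizable_of_eigenvectors) (rule eig)+
      with nd show False ..
    qed
    have "uniform_ldt p ?T"
    proof (rule dominated_triangular_uniform_ldt[OF full C' pv eb _ ndT])
      have "det (A j) / b j = a j" "det (A j) / a j = b j" for j using db[of j] a[of j] b[of j] by auto
      then show "(\<Sum>j\<in>UNIV. pmf p j * ln \<bar>det (?T j) / b j\<bar>) < (\<Sum>j\<in>UNIV. pmf p j * ln \<bar>b j\<bar>)"
        using 3 by (simp add: det_transpose)
    qed
    then show ?thesis by (rule uniform_ldt_transpose)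
  qed
qed

section \<open>Joining the two regimes\<close>

lemma summable_stretched_exp: "summable (\<lambda>n::nat. exp (- (real n powr (1/16))))"
proof (rule summable_comparison_test_bigo)
  show "summable (\<lambda>n::nat. norm (1 / real n ^ 2))"
    using inverse_power_summable[of 2, where 'a = real] by (simp add: field_simps)
  show "(\<lambda>n::nat. exp (- (real n powr (1/16)))) \<in> O(\<lambda>n. 1 / real n ^ 2)" by real_asymp
qed

text \<open>Serves the case \<rho> = 0, where the short-time estimate holds at all large lengths and
  its own centre is the exponent.\<close>

lemma Lplus_of_stretched_exp:
  fixes p :: "'a::finite pmf"
  assumes "\<And>n. n0 \<le> n \<Longrightarrow> pw p n (\<lambda>w. \<bar>lognorm B w - real n * L\<bar> > real n powr (7/8) / 2) < exp (- (real n powr (1/16)))"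
  shows "Lplus p B = L"
proof (rule Lplus_eqI)
  fix \<epsilon> :: real assume e: "0 < \<epsilon>"
  have "eventually (\<lambda>n::nat. real n powr (7/8) / 2 \<le> \<epsilon> * real n) sequentially" using e by real_asymp
  then obtain n1 where n1: "\<And>n. n1 \<le> n \<Longrightarrow> real n powr (7/8) / 2 \<le> \<epsilon> * real n"
    by (auto simp: eventually_sequentially)
  show "summable (\<lambda>n. pw p n (\<lambda>w. \<bar>lognorm B w - real n * L\<bar> > \<epsilon> * real n))"
  proof (rule summable_comparison_test'[OF summable_stretched_exp, where N = "max n0 n1"])
    fix n assume n: "max n0 n1 \<le> n"
    have "pw p n (\<lambda>w. \<bar>lognorm B w - real n * L\<bar> > \<epsilon> * real n)
        \<le> pw p n (\<lambda>w. \<bar>lognorm B w - real n * L\<bar> > real n powr (7/8) / 2)"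
      by (rule pw_mono) (use n1[of n] n in auto)
    also have "\<dots> \<le> exp (- (real n powr (1/16)))" using assms[of n] n by simp
    finally show "norm (pw p n (\<lambda>w. \<bar>lognorm B w - real n * L\<bar> > \<epsilon> * real n)) \<le> exp (- (real n powr (1/16)))"
      by simp
  qed
qed

text \<open>With \<open>l = 1 - ln \<rho>\<close>, the first estimate is useful for \<open>n \<ge> l\<^sup>4\<close> and the second one for
  \<open>n \<le> 16 * l\<^sup>4\<close>; comparing the two at \<open>n \<approx> l\<^sup>4\<close> shows that \<open>\<mu>\<close> is close to the exponent \<open>L\<close>.\<close>
lemma combine_regimes:
  fixes K K1 b e :: real
  assumes K: "1 \<le> K" "1 \<le> K1" and b: "0 < b" and e: "0 < e"
  obtains n0 :: nat where
    "\<And>(p :: 'a::finite pmf) B \<rho> \<mu> n. 0 \<le> \<rho> \<Longrightarrow> \<rho> \<le> 1 \<Longrightarrow>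
       (0 < \<rho> \<Longrightarrow> \<exists>L. \<forall>n. \<forall>s\<ge>0. pw p n (\<lambda>w. \<bar>lognorm B w - real n * L\<bar> > s + K1 * (1 - ln \<rho>))
         \<le> 4 * exp (- s\<^sup>2 / (K * (1 - ln \<rho>)\<^sup>2 * real n))) \<Longrightarrow>
       (\<And>n T \<theta> s. 1 \<le> T \<Longrightarrow> 0 \<le> \<theta> \<Longrightarrow> \<theta> \<le> 1 \<Longrightarrow> \<rho> * T \<le> \<theta> * e \<Longrightarrow> 0 \<le> s \<Longrightarrow>
          pw p n (\<lambda>w. \<bar>lognorm B w - real n * \<mu>\<bar> > s + ln T + real n * \<theta> + K1)
            \<le> K * (real n + 1) * T powr (- b) + 2 * exp (- s\<^sup>2 / (K * real n))) \<Longrightarrow>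
       n0 \<le> n \<Longrightarrow>
       pw p n (\<lambda>w. \<bar>lognorm B w - real n * Lplus p B\<bar> > 3 / 2 * real n powr (7/8)) < exp (- (real n powr (1/16)))"
proof -
  \<comment> \<open>Deviations of n^(7/8) / 3 enter squared, whence the 9. With l at most n^(1/4)
    the long-time exponent is of order n^(7/4 - 1/2 - 1) = n^(1/4); the short-time one is n^(3/4).
    Cone widths exp (n^(1/8)) and \<theta> = 1 / n complete the choice, and all errors fall below
    exp (-n^(1/16)).\<close>
  define c where "c = 1 / (9 * K)"
  have c: "0 < c" using K by (simp add: c_def)
  have K0: "0 < K" "0 < K1" using K by auto
  have "eventually (\<lambda>n::nat. real n powr (7/8) / 3 + K1 * real n powr (1/4) \<le> real n powr (7/8) / 2) sequentially"
    using K0 by real_asymp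
  moreover have "eventually (\<lambda>n::nat. 4 * exp (- c * (real n powr (1/4))) < exp (- (real n powr (1/16)))) sequentially"
    using c by real_asymp
  moreover have "eventually (\<lambda>n::nat. exp (1 - real n powr (1/4) / 2) * exp (real n powr (1/8)) \<le> 1 / real n * e) sequentially"
    using e by real_asymp
  moreover have "eventually (\<lambda>n::nat. real n powr (7/8) / 3 + real n powr (1/8) + 1 + K1 \<le> real n powr (7/8) / 2) sequentially"
    using K0 by real_asymp
  moreover have "eventually (\<lambda>n::nat. K * (real n + 1) * exp (- b * real n powr (1/8)) + 2 * exp (- c * (real n powr (3/4))) < exp (- (real n powr (1/16)))) sequentially"
    using c b K0 by real_asymp
  moreover have "eventually (\<lambda>n::nat. exp (- (real n powr (1/16))) < 1/2) sequentially" by real_asymp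
  moreover have "eventually (\<lambda>n::nat. 1 \<le> n) sequentially" by (rule eventually_ge_at_top)
  ultimately have "eventually (\<lambda>n::nat. real n powr (7/8) / 3 + K1 * real n powr (1/4) \<le> real n powr (7/8) / 2
    \<and> 4 * exp (- c * (real n powr (1/4))) < exp (- (real n powr (1/16)))
    \<and> exp (1 - real n powr (1/4) / 2) * exp (real n powr (1/8)) \<le> 1 / real n * e
    \<and> real n powr (7/8) / 3 + real n powr (1/8) + 1 + K1 \<le> real n powr (7/8) / 2
    \<and> K * (real n + 1) * exp (- b * real n powr (1/8)) + 2 * exp (- c * (real n powr (3/4))) < exp (- (real n powr (1/16)))
    \<and> exp (- (real n powr (1/16))) < 1/2 \<and> 1 \<le> n) sequentially"
    by eventually_elim blast
  then obtain n0 where n0: "\<And>n. n0 \<le> n \<Longrightarrow> real n powr (7/8) / 3 + K1 * real n powr (1/4) \<le> real n powr (7/8) / 2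
    \<and> 4 * exp (- c * (real n powr (1/4))) < exp (- (real n powr (1/16)))
    \<and> exp (1 - real n powr (1/4) / 2) * exp (real n powr (1/8)) \<le> 1 / real n * e
    \<and> real n powr (7/8) / 3 + real n powr (1/8) + 1 + K1 \<le> real n powr (7/8) / 2
    \<and> K * (real n + 1) * exp (- b * real n powr (1/8)) + 2 * exp (- c * (real n powr (3/4))) < exp (- (real n powr (1/16)))
    \<and> exp (- (real n powr (1/16))) < 1/2 \<and> 1 \<le> n"
    by (auto simp: eventually_sequentially)
  show thesis
  proof (rule that[of n0])
    fix p :: "'a pmf" and B \<rho> \<mu> n
    assume rho: "0 \<le> \<rho>" "\<rho> \<le> 1"
      and reg1: "0 < \<rho> \<Longrightarrow> \<exists>L. \<forall>n. \<forall>s\<ge>0. pw p n (\<lambda>w. \<bar>lognorm B w - real n * L\<bar> > s + K1 * (1 - ln \<rho>))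
         \<le> 4 * exp (- s\<^sup>2 / (K * (1 - ln \<rho>)\<^sup>2 * real n))"
      and reg2: "\<And>n T \<theta> s. 1 \<le> T \<Longrightarrow> 0 \<le> \<theta> \<Longrightarrow> \<theta> \<le> 1 \<Longrightarrow> \<rho> * T \<le> \<theta> * e \<Longrightarrow> 0 \<le> s \<Longrightarrow>
          pw p n (\<lambda>w. \<bar>lognorm B w - real n * \<mu>\<bar> > s + ln T + real n * \<theta> + K1)
            \<le> K * (real n + 1) * T powr (- b) + 2 * exp (- s\<^sup>2 / (K * real n))"
      and n: "n0 \<le> n"
    define far where "far n M t \<longleftrightarrow> pw p n (\<lambda>w. \<bar>lognorm B w - real n * M\<bar> > t) < exp (- (real n powr (1/16)))" for n M t
    \<comment> \<open>The smallness of \<rho> says that n^(1/4) is at most 2 l. The factor 2 creates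
      the overlap with the other regime, where n^(1/4) is at least l.\<close>
    have two: "far n \<mu> (real n powr (7/8) / 2)" if n: "n0 \<le> n" and small: "\<rho> \<le> exp (1 - real n powr (1/4) / 2)" for n
    proof -
      note N = n0[OF n]
      have n1: "1 \<le> real n" using N by simp
      have "pw p n (\<lambda>w. \<bar>lognorm B w - real n * \<mu>\<bar> > real n powr (7/8) / 2)
          \<le> pw p n (\<lambda>w. \<bar>lognorm B w - real n * \<mu>\<bar> > real n powr (7/8) / 3 + ln (exp (real n powr (1/8))) + real n * (1 / real n) + K1)"
        by (rule pw_mono) (use N n1 in auto)
      also have "\<dots> \<le> K * (real n + 1) * exp (real n powr (1/8)) powr (- b) + 2 * exp (- (real n powr (7/8) / 3)\<^sup>2 / (K * real n))"
      proof (rule reg2)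
        have "\<rho> * exp (real n powr (1/8)) \<le> exp (1 - real n powr (1/4) / 2) * exp (real n powr (1/8))"
          by (intro mult_right_mono small) auto
        then show "\<rho> * exp (real n powr (1/8)) \<le> 1 / real n * e" using N by linarith
      qed (use n1 in auto)
      also have "exp (real n powr (1/8)) powr (- b) = exp (- b * real n powr (1/8))" by (simp add: powr_def)
      also have "- (real n powr (7/8) / 3)\<^sup>2 / (K * real n) = - c * (real n powr (3/4))"
      proof -
        have "(real n powr (7/8))\<^sup>2 = real n powr (7/4)" by (simp add: power2_eq_square powr_add[symmetric])
        also have "\<dots> = real n powr (3/4) * real n powr 1" by (simp only: powr_add[symmetric]) simp
        finally have "(real n powr (7/8))\<^sup>2 = real n powr (3/4) * real n" by simp
        then show ?thesis using n1 K0 by (simp add: c_def power_divide field_simps)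
      qed
      finally show ?thesis unfolding far_def using N by linarith
    qed
    have final: "pw p n (\<lambda>w. \<bar>lognorm B w - real n * Lplus p B\<bar> > 3 / 2 * real n powr (7/8)) < exp (- (real n powr (1/16)))"
      if "far n M t" "t + real n * \<bar>M - Lplus p B\<bar> \<le> 3 / 2 * real n powr (7/8)" for M t
    proof -
      have "pw p n (\<lambda>w. \<bar>lognorm B w - real n * Lplus p B\<bar> > 3 / 2 * real n powr (7/8))
        \<le> pw p n (\<lambda>w. \<bar>lognorm B w - real n * M\<bar> > t)"
      proof (rule pw_mono)
        fix w assume *: "\<bar>lognorm B w - real n * Lplus p B\<bar> > 3 / 2 * real n powr (7/8)"
        have "real n * M - real n * Lplus p B = real n * (M - Lplus p B)" by (simp add: right_diff_distrib)
        then have "\<bar>real n * M - real n * Lplus p B\<bar> = real n * \<bar>M - Lplus p B\<bar>" by (simp add: abs_mult)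
        with * that(2) show "\<bar>lognorm B w - real n * M\<bar> > t" by linarith
      qed
      with that(1) show ?thesis unfolding far_def by linarith
    qed
    show "pw p n (\<lambda>w. \<bar>lognorm B w - real n * Lplus p B\<bar> > 3 / 2 * real n powr (7/8)) < exp (- (real n powr (1/16)))"
    proof (cases "\<rho> = 0")
      case True
      then have all: "far n \<mu> (real n powr (7/8) / 2)" if "n0 \<le> n" for n by (intro two that) simp
      have "Lplus p B = \<mu>" by (rule Lplus_of_stretched_exp[of n0]) (use all in \<open>auto simp: far_def\<close>)
      then show ?thesis by (intro final[OF all[OF n]]) simp
    next
      case False
      then have r0: "0 < \<rho>" using rho by simp
      define l where "l = 1 - ln \<rho>"
      have l: "1 \<le> l" using rho r0 by (simp add: l_def)
      obtain L where L: "\<And>n s. 0 \<le> s \<Longrightarrow> pw p n (\<lambda>w. \<bar>lognorm B w - real n * L\<bar> > s + K1 * l)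
         \<le> 4 * exp (- s\<^sup>2 / (K * l\<^sup>2 * real n))"
        using reg1[OF r0] unfolding l_def by blast
      have one: "far n L (real n powr (7/8) / 2)" if n: "n0 \<le> n" and ln: "l \<le> real n powr (1/4)" for n
      proof -
        note N = n0[OF n]
        have n1: "1 \<le> real n" using N by simp
        have "K1 * l \<le> K1 * real n powr (1/4)" using K0 ln by (intro mult_left_mono) auto
        then have "pw p n (\<lambda>w. \<bar>lognorm B w - real n * L\<bar> > real n powr (7/8) / 2)
            \<le> pw p n (\<lambda>w. \<bar>lognorm B w - real n * L\<bar> > real n powr (7/8) / 3 + K1 * l)"
          by (intro pw_mono) (use N in linarith)
        also have "\<dots> \<le> 4 * exp (- (real n powr (7/8) / 3)\<^sup>2 / (K * l\<^sup>2 * real n))" by (rule L) simp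
        also have "\<dots> \<le> 4 * exp (- c * (real n powr (1/4)))"
        proof -
          have sq: "(real n powr (7/8))\<^sup>2 = real n powr (1/4) * ((real n powr (1/4))\<^sup>2 * real n)"
          proof -
            have "(real n powr (7/8))\<^sup>2 = real n powr (7/4)" by (simp add: power2_eq_square powr_add[symmetric])
            also have "\<dots> = real n powr (1/4) * ((real n powr (1/4)) * (real n powr (1/4)) * real n powr 1)"
              by (simp only: powr_add[symmetric]) simp
            finally show ?thesis using n1 by (simp add: power2_eq_square)
          qed
          have "K * l\<^sup>2 * real n \<le> K * (real n powr (1/4))\<^sup>2 * real n"
            using K0 l ln by (intro mult_right_mono mult_left_mono power_mono) auto
          then have "(real n powr (7/8) / 3)\<^sup>2 / (K * (real n powr (1/4))\<^sup>2 * real n) \<le> (real n powr (7/8) / 3)\<^sup>2 / (K * l\<^sup>2 * real n)"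
            using K0 l n1 by (intro divide_left_mono mult_pos_pos) auto
          moreover have "(real n powr (7/8) / 3)\<^sup>2 / (K * (real n powr (1/4))\<^sup>2 * real n) = c * (real n powr (1/4))"
            unfolding power_divide sq using n1 K0 by (simp add: c_def field_simps)
          ultimately show ?thesis by simp
        qed
        finally show ?thesis unfolding far_def using N by linarith
      qed
      have Lp: "Lplus p B = L"
      proof (rule Lplus_of_ldt(1))
        define Kf where "Kf = K1 * l + K * l\<^sup>2"
        have pos: "0 < K1 * l" "0 < K * l\<^sup>2" using K0 l by auto
        then show Kf0: "0 < Kf" by (simp add: Kf_def)
        fix n and s :: real assume s: "0 \<le> s"
        have "pw p n (\<lambda>w. \<bar>lognorm B w - real n * L\<bar> > s + Kf)
            \<le> pw p n (\<lambda>w. \<bar>lognorm B w - real n * L\<bar> > s + K1 * l)"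
          using pos by (intro pw_mono) (simp add: Kf_def)
        also have "\<dots> \<le> 4 * exp (- s\<^sup>2 / (K * l\<^sup>2 * real n))" by (rule L[OF s])
        also have "\<dots> \<le> 4 * exp (- s\<^sup>2 / (Kf * real n))"
        proof (cases "n = 0")
          case False
          have "K * l\<^sup>2 * n \<le> Kf * n" using pos by (intro mult_right_mono) (auto simp: Kf_def)
          then have "s\<^sup>2 / (Kf * real n) \<le> s\<^sup>2 / (K * l\<^sup>2 * real n)"
            using False K0 l Kf0 by (intro divide_left_mono mult_pos_pos) auto
          then show ?thesis by simp
        qed simp
        finally show "pw p n (\<lambda>w. \<bar>lognorm B w - real n * L\<bar> > s + Kf) \<le> 4 * exp (- s\<^sup>2 / (Kf * real n))" .
      qed
      show ?thesis
      proof (cases "l \<le> real n powr (1/4)")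
        case True
        show ?thesis by (rule final[OF one[OF n True]]) (simp add: Lp)
      next
        case False
        \<comment> \<open>The first integer at or above l^4: its fourth root lies between l and 2 l,
          so both estimates hold at length \<open>N\<close>.\<close>
        define N where "N = nat \<lceil>l ^ 4\<rceil>"
        have l4: "1 \<le> l ^ 4" using l by (rule one_le_power)
        have N: "l ^ 4 \<le> real N" "real N \<le> l ^ 4 + 1"
          unfolding N_def using l4 le_of_int_ceiling[of "l ^ 4"] of_int_ceiling_le_add_one[of "l ^ 4"] by auto
        have root: "(x ^ 4) powr (1/4) = x" if "0 < x" for x :: real
        proof -
          have "(x ^ 4) powr (1/4) = (x powr 4) powr (1/4)" using that by simp
          also have "\<dots> = x powr 1" by (subst powr_powr) simp
          finally show ?thesis using that by simp
        qed
        have Nl: "l \<le> real N powr (1/4)"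
          using powr_mono2[of "1/4" "l ^ 4" "real N"] N(1) l root[of l] by simp
        have "real N \<le> (2 * l) ^ 4" using N(2) l4 by (simp add: power_mult_distrib)
        then have N2: "real N powr (1/4) \<le> 2 * l"
          using powr_mono2[of "1/4" "real N" "(2 * l) ^ 4"] l root[of "2 * l"] by simp
        have small: "\<rho> \<le> exp (1 - real m powr (1/4) / 2)" if "real m powr (1/4) \<le> 2 * l" for m :: nat
        proof -
          have "ln \<rho> \<le> 1 - real m powr (1/4) / 2" using that by (simp add: l_def)
          then show ?thesis using r0 by (metis exp_le_cancel_iff exp_ln)
        qed
        have nN: "n \<le> N"
        proof -
          have "0 < real n" using n0[OF n] by simp
          then have "(real n powr (1/4)) ^ 4 = (real n powr (1/4)) powr 4" by simp
          also have "\<dots> = real n powr 1" by (subst powr_powr) simp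
          finally have "real n = (real n powr (1/4)) ^ 4" by simp
          also have "\<dots> \<le> l ^ 4" using False by (intro power_mono) auto
          finally show ?thesis using N(1) by simp
        qed
        then have N0: "n0 \<le> N" using n by simp
        have N1: "1 \<le> real N" using n0[OF N0] by simp
        have n1: "1 \<le> real n" using n0[OF n] by simp
        have fL: "far N L (real N powr (7/8) / 2)" by (rule one[OF N0 Nl])
        have fM: "far N \<mu> (real N powr (7/8) / 2)" by (rule two[OF N0 small[OF N2]])
        \<comment> \<open>Both deviation events have probability below 1/2, so one word is close to
          both centres, which bounds the distance of the centres.\<close>
        have "0 < pw p N (\<lambda>w. \<bar>lognorm B w - real N * L\<bar> \<le> real N powr (7/8) / 2 \<and> \<bar>lognorm B w - real N * \<mu>\<bar> \<le> real N powr (7/8) / 2)"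
        proof -
          have "pw p N (\<lambda>w. \<not> (\<bar>lognorm B w - real N * L\<bar> \<le> real N powr (7/8) / 2 \<and> \<bar>lognorm B w - real N * \<mu>\<bar> \<le> real N powr (7/8) / 2))
              = pw p N (\<lambda>w. \<bar>lognorm B w - real N * L\<bar> > real N powr (7/8) / 2 \<or> \<bar>lognorm B w - real N * \<mu>\<bar> > real N powr (7/8) / 2)"
            by (rule pw_cong) auto
          also have "\<dots> < 1 / 2 + 1 / 2"
            using pw_disj[of p N "\<lambda>w. \<bar>lognorm B w - real N * L\<bar> > real N powr (7/8) / 2" "\<lambda>w. \<bar>lognorm B w - real N * \<mu>\<bar> > real N powr (7/8) / 2"]
              fL fM n0[OF N0] unfolding far_def by linarith
          finally show ?thesis unfolding pw_not by linarith
        qed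
        then obtain w where w: "\<bar>lognorm B w - real N * L\<bar> \<le> real N powr (7/8) / 2" "\<bar>lognorm B w - real N * \<mu>\<bar> \<le> real N powr (7/8) / 2"
          by (rule pw_pos_imp_ex) blast
        have "real N * \<bar>\<mu> - L\<bar> = \<bar>real N * \<mu> - real N * L\<bar>" by (simp add: abs_mult right_diff_distrib[symmetric])
        also have "\<dots> \<le> real N powr (7/8)" using w by linarith
        also have "real N powr (7/8) = real N * real N powr (- (1/8))"
          using N1 by (simp add: powr_mult_base)
        finally have "\<bar>\<mu> - L\<bar> \<le> real N powr (- (1/8))" using N1 by simp
        \<comment> \<open>The distance of the centres shrinks with the length at which they are
          compared; since \<open>N\<close> is at least \<open>n\<close>, the comparison is more than
          good enough at length \<open>n\<close>.\<close>
        also have "\<dots> \<le> real n powr (- (1/8))" using nN n1 by (intro powr_mono2') auto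
        finally have "real n * \<bar>\<mu> - L\<bar> \<le> real n * real n powr (- (1/8))" by (intro mult_left_mono) auto
        also have "\<dots> = real n powr (7/8)" using n1 by (simp add: powr_mult_base)
        finally have diff: "real n * \<bar>\<mu> - L\<bar> \<le> real n powr (7/8)" .
        have "far n \<mu> (real n powr (7/8) / 2)"
          by (rule two[OF n small]) (use False l in linarith)
        then show ?thesis by (rule final) (use diff in \<open>simp add: Lp\<close>)
      qed
    qed
  qed
qed

text \<open>Equality of the two diagonal exponents is excluded by the positive gap, so the axes can
  be ordered with the dominant one first. The exponent 1/16 in the threshold comes from 3/2 n^(7/8)
  being eventually below n^(15/16).\<close>

lemma diagonalizable_ldt:
  fixes A :: "'a::finite \<Rightarrow> mat2"
  assumes full: "set_pmf p = UNIV" and bounded_by: "bounded_by A C" and gap: "0 < gap p A"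
    and diag: "diagonalizable_cocycle A"
  obtains \<delta> n0 where "0 < \<delta>"
    "\<And>B n. cdist B A < \<delta> \<Longrightarrow> n0 \<le> n \<Longrightarrow>
       dev_prob p B n (real n powr (- (1/16))) < exp (- (real n powr (1/16)))"
proof -
  obtain Q :: mat2 where Q: "invertible Q" and off: "\<And>j i k. i \<noteq> k \<Longrightarrow> (matrix_inv Q ** A j ** Q) $ i $ k = 0"
    using diag unfolding diagonalizable_cocycle_def by blast
  note Qi = matrix_inv_mult[OF Q]
  define Q' where "Q' = matrix_inv Q"
  have QQ: "Q ** Q' = mat 1" "Q' ** Q = mat 1" using Qi by (simp_all add: Q'_def)
  define f where "f k j = (Q' ** A j ** Q) $ k $ k" for k j
  have D: "Q' ** A j ** Q = mat22 (f 1 j) 0 0 (f 2 j)" for j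
    by (rule mat2_eqI) (simp_all add: f_def off Q'_def)
  have dQ: "det Q' * det Q = 1" using QQ(2) by (metis det_I det_mul)
  have dA: "det (A j) = f 1 j * f 2 j" for j
  proof -
    have "det (Q' ** A j ** Q) = det (A j)" unfolding det_mul using dQ by (metis mult.assoc mult.commute mult_1)
    then show ?thesis unfolding D by (simp add: det_2)
  qed
  have dA0: "det (A j) \<noteq> 0" for j using bdd_det(1)[OF bounded_by, of "[j]"] by simp
  have f0: "f 1 j \<noteq> 0" "f 2 j \<noteq> 0" for j using dA[of j] dA0[of j] by auto
  define v where "v = Q *v axis 1 1"
  have dQ0: "det Q \<noteq> 0" using dQ by auto
  have v0: "v \<noteq> 0"
  proof
    assume "v = 0"
    then have "wedge v (Q *v axis 2 1) = 0" by (simp add: wedge_def)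
    moreover have "wedge v (Q *v axis 2 1) = det Q" unfolding v_def wedge_matrix by (simp add: wedge_def axis_def)
    ultimately show False using dQ0 by simp
  qed
  have ev: "A j *v v = f 1 j *\<^sub>R v" for j
  proof -
    have "A j *v v = Q *v ((Q' ** A j ** Q) *v axis 1 1)"
      using QQ(1) by (simp add: v_def matrix_vector_mul_assoc matrix_mul_assoc)
    also have "(Q' ** A j ** Q) *v axis 1 1 = f 1 j *\<^sub>R axis 1 1"
      unfolding D by (simp add: vec_eq_iff forall_2 matvec2) (simp add: axis_def)
    finally show ?thesis by (simp add: v_def matrix_vector_mult_scaleR)
  qed
  have neq: "(\<Sum>j\<in>UNIV. pmf p j * ln \<bar>f 1 j\<bar>) \<noteq> (\<Sum>j\<in>UNIV. pmf p j * ln \<bar>f 2 j\<bar>)"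
  proof
    have "det (A j) / f 1 j = f 2 j" for j using f0[of j] by (simp add: dA)
    moreover assume "(\<Sum>j\<in>UNIV. pmf p j * ln \<bar>f 1 j\<bar>) = (\<Sum>j\<in>UNIV. pmf p j * ln \<bar>f 2 j\<bar>)"
    ultimately have "gap p A = 0" by (intro gap_zero_of_equal_exponents[OF bounded_by v0 ev]) simp
    with gap show False by simp
  qed
  have ord1: "\<exists>R R' al be. R ** R' = mat 1 \<and> R' ** R = mat 1 \<and> (\<forall>j. conj_cocycle R' A R j = mat22 (al j) 0 0 (be j)) \<and>
      (\<forall>j. al j \<noteq> 0 \<and> be j \<noteq> 0) \<and> (\<Sum>j\<in>UNIV. pmf p j * ln \<bar>be j\<bar>) < (\<Sum>j\<in>UNIV. pmf p j * ln \<bar>al j\<bar>)"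
    if "(\<Sum>j\<in>UNIV. pmf p j * ln \<bar>f 2 j\<bar>) < (\<Sum>j\<in>UNIV. pmf p j * ln \<bar>f 1 j\<bar>)"
    by (rule exI[of _ Q], rule exI[of _ Q'], rule exI[of _ "f 1"], rule exI[of _ "f 2"])
       (use that QQ f0 D in \<open>auto simp: conj_cocycle_def\<close>)
  have ord2: "\<exists>R R' al be. R ** R' = mat 1 \<and> R' ** R = mat 1 \<and> (\<forall>j. conj_cocycle R' A R j = mat22 (al j) 0 0 (be j)) \<and>
      (\<forall>j. al j \<noteq> 0 \<and> be j \<noteq> 0) \<and> (\<Sum>j\<in>UNIV. pmf p j * ln \<bar>be j\<bar>) < (\<Sum>j\<in>UNIV. pmf p j * ln \<bar>al j\<bar>)"
    if lt: "(\<Sum>j\<in>UNIV. pmf p j * ln \<bar>f 1 j\<bar>) < (\<Sum>j\<in>UNIV. pmf p j * ln \<bar>f 2 j\<bar>)"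
  proof -
    \<comment> \<open>Exchanging the basis vectors puts the dominant axis first.\<close>
    define P where "P = mat22 0 1 1 0"
    have P: "P ** P = mat 1" by (rule mat2_eqI) (simp_all add: P_def mat2_mult mat_def)
    have "(Q ** P) ** (P ** Q') = Q ** (P ** P) ** Q'" by (simp add: matrix_mul_assoc)
    then have 1: "(Q ** P) ** (P ** Q') = mat 1" using P QQ by simp
    have "(P ** Q') ** (Q ** P) = P ** (Q' ** Q) ** P" by (simp add: matrix_mul_assoc)
    then have 2: "(P ** Q') ** (Q ** P) = mat 1" using P QQ by simp
    have 3: "conj_cocycle (P ** Q') A (Q ** P) j = mat22 (f 2 j) 0 0 (f 1 j)" for j
    proof -
      have "conj_cocycle (P ** Q') A (Q ** P) j = P ** (Q' ** A j ** Q) ** P"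
        by (simp add: conj_cocycle_def matrix_mul_assoc)
      also have "\<dots> = mat22 (f 2 j) 0 0 (f 1 j)"
        unfolding D by (rule mat2_eqI) (simp_all add: P_def mat2_mult)
      finally show ?thesis .
    qed
    show ?thesis
      by (rule exI[of _ "Q ** P"], rule exI[of _ "P ** Q'"], rule exI[of _ "f 2"], rule exI[of _ "f 1"])
         (use 1 2 3 lt f0 in auto)
  qed
  have "\<exists>R R' al be. R ** R' = mat 1 \<and> R' ** R = mat 1 \<and> (\<forall>j. conj_cocycle R' A R j = mat22 (al j) 0 0 (be j)) \<and>
      (\<forall>j. al j \<noteq> 0 \<and> be j \<noteq> 0) \<and> (\<Sum>j\<in>UNIV. pmf p j * ln \<bar>be j\<bar>) < (\<Sum>j\<in>UNIV. pmf p j * ln \<bar>al j\<bar>)"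
    using neq ord2 ord1 by (rule linorder_neqE)
  then obtain R R' al be where R: "R ** R' = mat 1" "R' ** R = mat 1"
    and A': "\<And>j. conj_cocycle R' A R j = mat22 (al j) 0 0 (be j)" and nz: "\<And>j. al j \<noteq> 0" "\<And>j. be j \<noteq> 0"
    and dom: "(\<Sum>j\<in>UNIV. pmf p j * ln \<bar>be j\<bar>) < (\<Sum>j\<in>UNIV. pmf p j * ln \<bar>al j\<bar>)"
    by blast
  obtain d0 K K1 b e :: real where d0: "0 < d0" and K: "1 \<le> K" "1 \<le> K1" and be: "0 < b" "0 < e"
    and ldt: "\<And>B. near_diag al be d0 d0 B \<Longrightarrow> \<exists>\<rho> \<mu>. 0 \<le> \<rho> \<and> \<rho> \<le> 1 \<and> (\<forall>w. det (wprod B w) \<noteq> 0) \<and>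
       (\<forall>r0. (\<forall>x\<in>steep_cone. r0 \<le> wedge_sum B x) \<longrightarrow> r0 \<le> \<rho>) \<and>
       (0 < \<rho> \<longrightarrow> (\<exists>L. \<forall>n. \<forall>s\<ge>0. pw p n (\<lambda>w. \<bar>lognorm B w - real n * L\<bar> > s + K1 * (1 - ln \<rho>))
         \<le> 4 * exp (- s\<^sup>2 / (K * (1 - ln \<rho>)\<^sup>2 * real n)))) \<and>
       (\<forall>n T \<theta> s. 1 \<le> T \<longrightarrow> 0 \<le> \<theta> \<longrightarrow> \<theta> \<le> 1 \<longrightarrow> \<rho> * T \<le> \<theta> * e \<longrightarrow> 0 \<le> s \<longrightarrow>
          pw p n (\<lambda>w. \<bar>lognorm B w - real n * \<mu>\<bar> > s + ln T + real n * \<theta> + K1)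
            \<le> K * (real n + 1) * T powr (- b) + 2 * exp (- s\<^sup>2 / (K * real n)))"
    using near_diag_ldt[where p = p and al = al and be = be, OF full nz dom] by metis
  define Kq where "Kq = max 1 (max (opnorm R) (opnorm R'))"
  have Kq: "opnorm R \<le> Kq" "opnorm R' \<le> Kq" "1 \<le> Kq" by (auto simp: Kq_def)
  define K2 where "K2 = K1 + 2 * ln Kq"
  have K2: "1 \<le> K2" using K Kq by (simp add: K2_def add_increasing2)
  obtain n0 :: nat where n0: "\<And>(p :: 'a pmf) B \<rho> \<mu> n. 0 \<le> \<rho> \<Longrightarrow> \<rho> \<le> 1 \<Longrightarrow>
       (0 < \<rho> \<Longrightarrow> \<exists>L. \<forall>n. \<forall>s\<ge>0. pw p n (\<lambda>w. \<bar>lognorm B w - real n * L\<bar> > s + K2 * (1 - ln \<rho>))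
         \<le> 4 * exp (- s\<^sup>2 / (K * (1 - ln \<rho>)\<^sup>2 * real n))) \<Longrightarrow>
       (\<And>n T \<theta> s. 1 \<le> T \<Longrightarrow> 0 \<le> \<theta> \<Longrightarrow> \<theta> \<le> 1 \<Longrightarrow> \<rho> * T \<le> \<theta> * e \<Longrightarrow> 0 \<le> s \<Longrightarrow>
          pw p n (\<lambda>w. \<bar>lognorm B w - real n * \<mu>\<bar> > s + ln T + real n * \<theta> + K2)
            \<le> K * (real n + 1) * T powr (- b) + 2 * exp (- s\<^sup>2 / (K * real n))) \<Longrightarrow>
       n0 \<le> n \<Longrightarrow>
       pw p n (\<lambda>w. \<bar>lognorm B w - real n * Lplus p B\<bar> > 3 / 2 * real n powr (7/8)) < exp (- (real n powr (1/16)))"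
    by (rule combine_regimes[OF K(1) K2 be]) blast
  have "eventually (\<lambda>n::nat. 3/2 * real n powr (7/8) \<le> real n powr (15/16)) sequentially" by real_asymp
  then obtain n1 where n1: "\<And>n. n1 \<le> n \<Longrightarrow> 3/2 * real n powr (7/8) \<le> real n powr (15/16)"
    by (auto simp: eventually_sequentially)
  obtain \<delta> where \<delta>: "0 < \<delta>" and close: "\<And>B j. cdist B A < \<delta> \<Longrightarrow> opnorm (conj_cocycle R' B R j - conj_cocycle R' A R j) \<le> d0 / 2"
    by (rule conj_nbhd[of "d0 / 2"]) (use d0 in auto)
  show thesis
  proof (rule that[OF \<delta>, of "max (max n0 n1) 1"])
    fix B and n :: nat assume B: "cdist B A < \<delta>" and n: "max (max n0 n1) 1 \<le> n"
    define B' where "B' = conj_cocycle R' B R"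
    have "near_diag al be d0 d0 B'"
    proof (rule near_diag_of_close)
      show "near_diag al be (d0 / 2) (d0 / 2) (conj_cocycle R' A R)"
        unfolding near_diag_def A' using d0 by simp
      show "opnorm (B' j - conj_cocycle R' A R j) \<le> d0 / 2" for j unfolding B'_def by (rule close[OF B])
    qed
    from ldt[OF this] obtain \<rho> \<mu> where rho: "0 \<le> \<rho>" "\<rho> \<le> 1" and det: "\<And>w. det (wprod B' w) \<noteq> 0"
      and reg1: "0 < \<rho> \<Longrightarrow> (\<exists>L. \<forall>n. \<forall>s\<ge>0. pw p n (\<lambda>w. \<bar>lognorm B' w - real n * L\<bar> > s + K1 * (1 - ln \<rho>))
         \<le> 4 * exp (- s\<^sup>2 / (K * (1 - ln \<rho>)\<^sup>2 * real n)))"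
      and reg2: "\<And>n T \<theta> s. 1 \<le> T \<Longrightarrow> 0 \<le> \<theta> \<Longrightarrow> \<theta> \<le> 1 \<Longrightarrow> \<rho> * T \<le> \<theta> * e \<Longrightarrow> 0 \<le> s \<Longrightarrow>
          pw p n (\<lambda>w. \<bar>lognorm B' w - real n * \<mu>\<bar> > s + ln T + real n * \<theta> + K1)
            \<le> K * (real n + 1) * T powr (- b) + 2 * exp (- s\<^sup>2 / (K * real n))"
      by blast
    have detB: "det (wprod B w) \<noteq> 0" for w using det[of w] unfolding B'_def det_wprod_conj[OF R] .
    note tr = pw_conj_deviation[OF R Kq detB, of p, folded B'_def]
    have "pw p n (\<lambda>w. \<bar>lognorm B w - real n * Lplus p B\<bar> > 3 / 2 * real n powr (7/8)) < exp (- (real n powr (1/16)))"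
    proof (rule n0[OF rho])
      assume r: "0 < \<rho>"
      obtain L where L: "\<And>n s. 0 \<le> s \<Longrightarrow> pw p n (\<lambda>w. \<bar>lognorm B' w - real n * L\<bar> > s + K1 * (1 - ln \<rho>))
         \<le> 4 * exp (- s\<^sup>2 / (K * (1 - ln \<rho>)\<^sup>2 * real n))" using reg1[OF r] by blast
      show "\<exists>L. \<forall>n. \<forall>s\<ge>0. pw p n (\<lambda>w. \<bar>lognorm B w - real n * L\<bar> > s + K2 * (1 - ln \<rho>))
         \<le> 4 * exp (- s\<^sup>2 / (K * (1 - ln \<rho>)\<^sup>2 * real n))"
      proof (rule exI[of _ L], intro allI impI)
        fix n and s :: real assume s: "0 \<le> s"
        have "2 * ln Kq * 1 \<le> 2 * ln Kq * (1 - ln \<rho>)" using Kq rho r by (intro mult_left_mono) auto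
        then have "pw p n (\<lambda>w. \<bar>lognorm B w - real n * L\<bar> > s + K2 * (1 - ln \<rho>))
            \<le> pw p n (\<lambda>w. \<bar>lognorm B w - real n * L\<bar> > (s + K1 * (1 - ln \<rho>)) + 2 * ln Kq)"
          by (intro pw_mono) (auto simp: K2_def algebra_simps)
        also note tr
        also note L[OF s]
        finally show "pw p n (\<lambda>w. \<bar>lognorm B w - real n * L\<bar> > s + K2 * (1 - ln \<rho>))
         \<le> 4 * exp (- s\<^sup>2 / (K * (1 - ln \<rho>)\<^sup>2 * real n))" .
      qed
    next
      fix n and T \<theta> s :: real assume *: "1 \<le> T" "0 \<le> \<theta>" "\<theta> \<le> 1" "\<rho> * T \<le> \<theta> * e" "0 \<le> s"
      have "pw p n (\<lambda>w. \<bar>lognorm B w - real n * \<mu>\<bar> > s + ln T + real n * \<theta> + K2)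
          = pw p n (\<lambda>w. \<bar>lognorm B w - real n * \<mu>\<bar> > (s + ln T + real n * \<theta> + K1) + 2 * ln Kq)"
        by (simp add: K2_def add_ac)
      also note tr
      also note reg2[OF *]
      finally show "pw p n (\<lambda>w. \<bar>lognorm B w - real n * \<mu>\<bar> > s + ln T + real n * \<theta> + K2)
            \<le> K * (real n + 1) * T powr (- b) + 2 * exp (- s\<^sup>2 / (K * real n))" .
    qed (use n in auto)
    moreover have "3/2 * real n powr (7/8) \<le> real n powr (- (1/16)) * real n"
    proof -
      have "real n powr (- (1/16)) * real n = real n powr (15/16)"
        using n powr_mult_base[of "real n" "- (1/16)"] by (simp add: mult.commute)
      then show ?thesis using n1[of n] n by simp
    qed
    then have "pw p n (\<lambda>w. \<bar>lognorm B w - real n * Lplus p B\<bar> > real n powr (- (1/16)) * real n)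
        \<le> pw p n (\<lambda>w. \<bar>lognorm B w - real n * Lplus p B\<bar> > 3 / 2 * real n powr (7/8))"
      by (intro pw_mono) linarith
    moreover have "dev_prob p B n (real n powr (- (1/16))) = pw p n (\<lambda>w. \<bar>lognorm B w - real n * Lplus p B\<bar> > real n powr (- (1/16)) * real n)"
      by (rule dev_prob_eq_pw_scaled) (use n in simp)
    ultimately show "dev_prob p B n (real n powr (- (1/16))) < exp (- (real n powr (1/16)))" by linarith
  qed
qed

theorem theorem1p5:
  fixes p :: "'a::finite pmf" and A :: "'a \<Rightarrow> mat2"
  assumes full_support: "set_pmf p = UNIV"
    and GL: "GL2_cocycle A"
    and gap: "Lplus p A > Lminus p A"
  shows "(diagonalizable_cocycle A \<longrightarrow>
            (\<exists>\<delta>>0. \<exists>nbar::nat. \<exists>a>0. \<exists>b>0. \<forall>B. GL2_cocycle B \<and> cdist B A < \<delta> \<longrightarrow>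
               (\<forall>n\<ge>nbar. dev_prob p B n (real n powr (-a)) < exp (- (real n powr b)))))
       \<and> (\<not> diagonalizable_cocycle A \<longrightarrow>
            (\<exists>\<delta>>0. \<exists>c>0. \<exists>\<epsilon>0>0. \<forall>\<epsilon>. 0 < \<epsilon> \<and> \<epsilon> < \<epsilon>0 \<longrightarrow>
               (\<exists>nbar::nat. \<forall>B. GL2_cocycle B \<and> cdist B A < \<delta> \<longrightarrow>
                 (\<forall>n\<ge>nbar. dev_prob p B n \<epsilon> < exp (- c * \<epsilon>^2 * real n)))))"
proof (intro conjI impI)
  obtain C where bounded_by: "bounded_by A C" by (rule bdd_exists[OF GL])
  \<comment> \<open>The strict inequality of the exponents enters through the positivity of
    \<open>gap\<close>.\<close>
  have "gap p A \<noteq> 0" using exponents_eq_of_gap_zero[OF bounded_by, of p] gap by auto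
  with gap_nonneg[OF bounded_by, of p] have pos: "0 < gap p A" by simp
  {
    assume diag: "diagonalizable_cocycle A"
    obtain \<delta> n0 where d: "0 < \<delta>" and ldt: "\<And>B n. cdist B A < \<delta> \<Longrightarrow> n0 \<le> n \<Longrightarrow>
        dev_prob p B n (real n powr (- (1/16))) < exp (- (real n powr (1/16)))"
      by (rule diagonalizable_ldt[OF full_support bounded_by pos diag]) blast
    show "\<exists>\<delta>>0. \<exists>nbar::nat. \<exists>a>0. \<exists>b>0. \<forall>B. GL2_cocycle B \<and> cdist B A < \<delta> \<longrightarrow>
        (\<forall>n\<ge>nbar. dev_prob p B n (real n powr (-a)) < exp (- (real n powr b)))"
    proof (rule exI[of _ \<delta>], rule conjI[OF d], rule exI[of _ n0], rule exI[of _ "1/16"], rule conjI,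
        simp, rule exI[of _ "1/16"], rule conjI, simp, intro allI impI)
      fix B n assume "GL2_cocycle B \<and> cdist B A < \<delta>" "n0 \<le> n"
      then show "dev_prob p B n (real n powr (- (1/16))) < exp (- (real n powr (1/16)))"
        by (intro ldt) auto
    qed
  next
    assume "\<not> diagonalizable_cocycle A"
    then show "\<exists>\<delta>>0. \<exists>c>0. \<exists>\<epsilon>0>0. \<forall>\<epsilon>. 0 < \<epsilon> \<and> \<epsilon> < \<epsilon>0 \<longrightarrow>
        (\<exists>nbar::nat. \<forall>B. GL2_cocycle B \<and> cdist B A < \<delta> \<longrightarrow>
           (\<forall>n\<ge>nbar. dev_prob p B n \<epsilon> < exp (- c * \<epsilon>^2 * real n)))"
      by (intro exponential_ldt_of_uniform_ldt nondiagonalizable_uniform_ldt[OF full_support bounded_by pos])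
  }
qed

end
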